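(* Fix $d\ge1$. As $p$ ranges over odd primes and $k$ is a field of characteristic $p$, \[ e_{HK}\bigl(k[[x_0,\dots,x_d]]/(x_0^2+\cdots+x_d^2)\bigr)=1+\frac{\mathcal{A}_d}{d!}+O(p^{-2}), \] i.e. there is a constant $C$ depending only on $d$ such that for every prime $p>2$ and every field $k$ of characteristic $p$ the left-hand side differs from $1+\mathcal{A}_d/d!$ by at most $Cp^{-2}$ in absolute value.
   Context: For a local ring $(R,\mathfrak m)$ of prime characteristic $p>0$, the Hilbert--Kunz multiplicity is $e_{HK}(R)=\lim_{e\to\infty}\lambda(R/\mathfrak m^{[p^e]})/p^{e\dim R}$, where $\lambda$ is length and $\mathfrak m^{[p^e]}$ is the ideal generated by all $p^e$-th powers of elements of $\mathfrak m$. The Euler (zigzag) numbers $\mathcal{A}_d$ are defined by $\sec x+\tan x=\sum_{d\ge0}\frac{\mathcal{A}_d}{d!}x^d$. *)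

theory Defs
  imports
    "HOL-Algebra.Algebra"
    "HOL-Library.Extended_Nat"
    "HOL-Computational_Algebra.Formal_Power_Series"
begin

section \<open>Length and Krull dimension\<close>

text \<open>Both are suprema of numbers of strict inclusions in finite chains, with value
  \<open>\<infinity>\<close> if the chains are unbounded.\<close>

definition strict_chain :: "('a set \<Rightarrow> bool) \<Rightarrow> nat \<Rightarrow> (nat \<Rightarrow> 'a set) \<Rightarrow> bool"
  where "strict_chain P n C \<longleftrightarrow> (\<forall>i\<le>n. P (C i)) \<and> (\<forall>i<n. C i \<subset> C (Suc i))"

definition module_length :: "('a, 'b) ring_scheme \<Rightarrow> ('a, 'c, 'd) module_scheme \<Rightarrow> enat"
  where "module_length R M = (SUP n \<in> {n. \<exists>C. strict_chain (\<lambda>N. submodule N R M) n C}. enat n)"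

definition krull_dim :: "('a, 'b) ring_scheme \<Rightarrow> enat"
  where "krull_dim R = (SUP n \<in> {n. \<exists>C. strict_chain (\<lambda>P. primeideal P R) n C}. enat n)"

definition quotient_module :: "('a, 'b) ring_scheme \<Rightarrow> 'a set \<Rightarrow> ('a, 'a set) module"
  where "quotient_module R I =
    \<lparr>carrier = carrier (R Quot I), monoid.mult = (\<otimes>\<^bsub>R Quot I\<^esub>),
     one = \<one>\<^bsub>R Quot I\<^esub>, ring.zero = \<zero>\<^bsub>R Quot I\<^esub>, add = (\<oplus>\<^bsub>R Quot I\<^esub>),
     smult = (\<lambda>r A. (I +>\<^bsub>R\<^esub> r) \<otimes>\<^bsub>R Quot I\<^esub> A)\<rparr>"

section \<open>Hilbert--Kunz multiplicity\<close>

text \<open>The additive order of \<open>1\<close>; \<^const>\<open>group.ord\<close> is \<open>0\<close> for elements of infinite order.\<close>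

definition ring_char :: "('a, 'b) ring_scheme \<Rightarrow> nat"
  where "ring_char R = group.ord (add_monoid R) \<one>\<^bsub>R\<^esub>"

text \<open>Meaningful only for local rings.\<close>

definition the_max_ideal :: "('a, 'b) ring_scheme \<Rightarrow> 'a set"
  where "the_max_ideal R = (THE m. maximalideal m R)"

text \<open>For an ideal \<open>I\<close>, the ideal generated by all \<open>q\<close>-th powers of elements of \<open>I\<close>.\<close>

definition frobenius_power :: "('a, 'b) ring_scheme \<Rightarrow> 'a set \<Rightarrow> nat \<Rightarrow> 'a set"
  where "frobenius_power R I q = Idl\<^bsub>R\<^esub> ((\<lambda>a. a [^]\<^bsub>R\<^esub> q) ` I)"

text \<open>Meaningful for Noetherian local rings of prime characteristic; there all the lengths and
  the dimension are finite and the limit exists.\<close>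

definition hilbert_kunz_multiplicity :: "('a, 'b) ring_scheme \<Rightarrow> real"
  where "hilbert_kunz_multiplicity R =
    lim (\<lambda>e::nat.
      real (the_enat (module_length R
        (quotient_module R (frobenius_power R (the_max_ideal R) (ring_char R ^ e)))))
      / real (ring_char R ^ (e * the_enat (krull_dim R))))"

section \<open>Power series rings and the diagonal quadric\<close>

text \<open>As in \<^theory>\<open>HOL-Algebra.Indexed_Polynomials\<close>, a monomial is a multiset of variables.
  A power series in the variables \<open>V\<close> is an arbitrary assignment of coefficients to the
  monomials in \<open>V\<close>; coefficients of monomials involving other variables are \<open>0\<close>.\<close>

definition power_series_ring ::
    "('a, 'b) ring_scheme \<Rightarrow> 'c set \<Rightarrow> ('c multiset \<Rightarrow> 'a) ring"
  where "power_series_ring R V =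
    \<lparr>carrier = {f. (\<forall>m. f m \<in> carrier R) \<and> (\<forall>m. \<not> set_mset m \<subseteq> V \<longrightarrow> f m = \<zero>\<^bsub>R\<^esub>)},
     monoid.mult = (\<lambda>f g m. \<Oplus>\<^bsub>R\<^esub>u \<in> {u. u \<subseteq># m}. f u \<otimes>\<^bsub>R\<^esub> g (m - u)),
     one = ring.indexed_const R \<one>\<^bsub>R\<^esub>,
     ring.zero = ring.indexed_const R \<zero>\<^bsub>R\<^esub>,
     add = ring.indexed_padd R\<rparr>"

definition diagonal_quadric_form :: "('a, 'b) ring_scheme \<Rightarrow> nat \<Rightarrow> nat multiset \<Rightarrow> 'a"
  where "diagonal_quadric_form k d =
    (\<Oplus>\<^bsub>power_series_ring k {..d}\<^esub>i \<in> {..d}.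
       ring.indexed_var k i [^]\<^bsub>power_series_ring k {..d}\<^esub> (2::nat))"

text \<open>\<open>k[[x\<^sub>0,\<dots>,x\<^sub>d]]/(x\<^sub>0\<^sup>2 + \<dots> + x\<^sub>d\<^sup>2)\<close>\<close>

definition diagonal_quadric_ring ::
    "('a, 'b) ring_scheme \<Rightarrow> nat \<Rightarrow> (nat multiset \<Rightarrow> 'a) set ring"
  where "diagonal_quadric_ring k d =
    power_series_ring k {..d} Quot
      (Idl\<^bsub>power_series_ring k {..d}\<^esub> {diagonal_quadric_form k d})"

section \<open>Zigzag numbers\<close>

text \<open>\<open>sec x + tan x = \<Sum>\<^sub>d \<A>\<^sub>d / d! x\<^sup>d\<close> as formal power series.\<close>

definition zigzag_number :: "nat \<Rightarrow> real"
  where "zigzag_number d = fact d * fps_nth (inverse (fps_cos 1) + fps_tan 1) d"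

section \<open>The estimate with a given constant\<close>

text \<open>A single \<open>C\<close> must serve all odd primes \<open>p\<close> and all fields of characteristic \<open>p\<close> whose
  underlying set is contained in the type \<open>'a\<close>.\<close>

definition quadric_estimate :: "'a itself \<Rightarrow> nat \<Rightarrow> real \<Rightarrow> bool"
  where "quadric_estimate (_ :: 'a itself) d C \<longleftrightarrow>
    (\<forall>p::nat. Factorial_Ring.prime p \<and> p > 2 \<longrightarrow>
      (\<forall>k :: 'a ring. field k \<and> ring_char k = p \<longrightarrow>
        \<bar>hilbert_kunz_multiplicity (diagonal_quadric_ring k d) - (1 + zigzag_number d / fact d)\<bar>
          \<le> C / real p ^ 2))"

text \<open>HOL cannot quantify over types inside a formula, so \<open>\<exists>C. quadric_estimate TYPE('a) d C\<close>
  would let \<open>C\<close> depend on \<open>'a\<close>. To have \<open>C\<close> depend on \<open>d\<close> alone, one asserts that a constant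
  exists for the fields living on the fixed type \<^typ>\<open>nat\<close>, and that every such constant is
  also valid for the fields living on any other type \<open>'a\<close>.\<close>

end

theory Submission
  imports Defs "HOL-Library.Poly_Mapping" "HOL-Number_Theory.Residues" "HOL-Library.Function_Algebras"
begin

text \<open>The length of \<open>k[[x]]/(x\<^sub>0\<^sup>q, \<dots>, x\<^sub>d\<^sup>q, \<Sum> x\<^sub>i\<^sup>2)\<close> is the number of Jordan blocks of
  multiplication by \<open>\<Sum> x\<^sub>i\<^sup>2\<close> on \<open>k[x]/(x\<^sub>i\<^sup>q)\<close>. It can be computed over \<open>\<int>/p\<close>, because additive
  maps from \<open>k\<close> to \<open>\<int>/p\<close> and back transport initial monomials. As \<open>x\<^sup>2\<close> acts on \<open>k[x]/x\<^sup>q\<close> with one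
  block of size \<open>(q + 1)/2\<close> and one of size \<open>(q - 1)/2\<close>, one has to count the blocks of
  the \<open>(d + 1)\<close>-st power of the sum of these two in the ring of nilpotent Jordan blocks, as in the
  work of Han and Monsky.

  For \<open>q = p\<close> this reduces to a discrete boustrophedon transform, which the midpoint rule compares with the
  polynomials whose values at \<open>1\<close> are \<open>\<A>\<^sub>s / s!\<close>; the error is \<open>O(p\<^sup>-\<^sup>2)\<close>. The count for \<open>p q\<close> differs
  from \<open>p\<^sup>d\<close> times the count for \<open>q\<close> by a second-order difference of block counts, so the passage to the
  limit costs another \<open>O(p\<^sup>-\<^sup>2)\<close>.

  That the quadric has dimension \<open>d\<close> is shown from below by the boundary monoids of Coquand and Lombardi,
  and from above by comparing the number of monomials of bounded degree with the lengths that the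
  Artin--Rees lemma forces along a chain of primes.\<close>

section \<open>Jordan blocks of tensor products\<close>

text \<open>The field may be infinite and may live on any type, so lengths are not counted by
  cardinalities over \<open>k\<close>. An ideal containing all series that vanish on a finite box of
  monomials has colength equal to the number of box monomials that are not initial for it. For the
  ideal of the form and the q-th powers these initial monomials are the same over \<open>k\<close>
  and over Z/p, because the form has coefficients 0 and 1. Over Z/p all groups are finite, and a
  number of Jordan blocks is the logarithm to base \<open>p\<close> of the order of a kernel. The
  passage from \<open>q\<close> to \<open>p * q\<close> is governed by \<open>eta\<close>, the class
  of the two blocks for \<open>p * q\<close> minus the class of the two blocks for \<open>q\<close>
  stretched by \<open>p\<close>. It annihilates the classes of blocks of size divisible by
  \<open>p\<close>, so no cross terms arise, and a product of two copies is a signed sum of at most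
  p^2 second differences. This gains a factor q^2 over the trivial bound, but it requires
  \<open>d \<ge> 2\<close>; for \<open>d = 1\<close> the count is found to be 2 q - 1. The limit
  depends only on \<open>p\<close> and \<open>d\<close>. Therefore a constant that is valid for the
  fields on \<open>nat\<close> is valid on every type.\<close>

lemma card_additive_image:
  fixes h :: "'a::ab_group_add \<Rightarrow> 'b::ab_group_add"
  assumes "finite G" and sub: "\<And>x y. x \<in> G \<Longrightarrow> y \<in> G \<Longrightarrow> x - y \<in> G"
    and add: "\<And>x y. x \<in> G \<Longrightarrow> y \<in> G \<Longrightarrow> h (x - y) = h x - h y"
  shows "card G = card {x \<in> G. h x = 0} * card (h ` G)"
proof -
  have fib: "card {x \<in> G. h x = z} = card {x \<in> G. h x = 0}" if z: "z \<in> h ` G" for z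
  proof -
    obtain y where y: "y \<in> G" "z = h y" using z by auto
    have 0: "0 \<in> G" using sub[OF y(1) y(1)] by simp
    have neg: "- x \<in> G" if "x \<in> G" for x using sub[OF 0 that] by simp
    have plus: "a + b \<in> G" if "a \<in> G" "b \<in> G" for a b using sub[OF that(1) neg[OF that(2)]] by simp
    have "bij_betw (\<lambda>x. x - y) {x \<in> G. h x = z} {x \<in> G. h x = 0}"
    proof (rule bij_betwI[where g="\<lambda>x. x + y"])
      show "(\<lambda>x. x - y) \<in> {x \<in> G. h x = z} \<rightarrow> {x \<in> G. h x = 0}"
        using y sub add by auto
      show "(\<lambda>x. x + y) \<in> {x \<in> G. h x = 0} \<rightarrow> {x \<in> G. h x = z}"
      proof
        fix x assume x: "x \<in> {x \<in> G. h x = 0}"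
        have "h (x + y - y) = h (x + y) - h y" using add[OF plus y(1)] x y by blast
        then show "x + y \<in> {x \<in> G. h x = z}" using x y plus by simp
      qed
    qed auto
    then show ?thesis by (rule bij_betw_same_card)
  qed
  have "card G = (\<Sum>z\<in>h ` G. card {x \<in> G. h x = z})"
    using sum.image_gen[OF assms(1), of "\<lambda>_. 1::nat" h] by simp
  also have "\<dots> = (\<Sum>z\<in>h ` G. card {x \<in> G. h x = 0})"
    by (rule sum.cong) (use fib in auto)
  finally show ?thesis by simp
qed

section \<open>Multi-indices in a box and the shift operator\<close>

declare One_nat_def [simp del]

text \<open>The transpose of multiplication by the power sum x_1^s + ... + x_n^s. Because values are
  pulled from larger indices, the truncation x_i^a = 0 is encoded in the support of \<open>f\<close>
  alone.\<close>

fun shift_sum :: "nat \<Rightarrow> (nat list \<Rightarrow> 'r::comm_ring_1) \<Rightarrow> nat list \<Rightarrow> 'r" where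
  "shift_sum s f [] = 0"
| "shift_sum s f (j # l) = f ((j + s) # l) + shift_sum s (\<lambda>l. f (j # l)) l"

definition box :: "nat list \<Rightarrow> nat list set" where
  "box as = {l. list_all2 (<) l as}"

lemma box_Nil [simp]: "l \<in> box [] \<longleftrightarrow> l = []"
  by (simp add: box_def)

lemma box_Cons: "l \<in> box (a # as) \<longleftrightarrow> (\<exists>j l'. l = j # l' \<and> j < a \<and> l' \<in> box as)"
  by (cases l) (auto simp: box_def)

lemma box_Cons_Cons [simp]: "j # l \<in> box (a # as) \<longleftrightarrow> j < a \<and> l \<in> box as"
  by (simp add: box_def)

lemma Nil_box_Cons [simp]: "[] \<notin> box (a # as)"
  by (simp add: box_def)

lemma box_length: "l \<in> box as \<Longrightarrow> length l = length as"
  by (auto simp: box_def dest: list_all2_lengthD)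

lemma box_Cons_image: "box (a # as) = (\<lambda>(j, l). j # l) ` ({..<a} \<times> box as)"
  by (auto simp: box_Cons)

lemma finite_box [simp]: "finite (box as)"
proof (induction as)
  case Nil
  have "box [] = {[]}" by auto
  then show ?case by simp
qed (simp add: box_Cons_image)

lemma card_box: "card (box as) = prod_list as"
proof (induction as)
  case Nil
  have "box [] = {[]}" by auto
  then show ?case by simp
next
  case (Cons a as)
  have "inj_on (\<lambda>(j, l). j # l) ({..<a} \<times> box as)" by (auto simp: inj_on_def)
  then show ?case using Cons by (simp add: box_Cons_image card_image)
qed

lemma shift_sum_diff: "shift_sum s (\<lambda>l. f l - g l) l = shift_sum s f l - shift_sum s g l"
  by (induction s f l arbitrary: g rule: shift_sum.induct) auto

lemma shift_sum_add: "shift_sum s (\<lambda>l. f l + g l) l = shift_sum s f l + shift_sum s g l"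
  by (induction s f l arbitrary: g rule: shift_sum.induct) auto

lemma shift_sum_mult: "shift_sum s (\<lambda>l. c * f l) l = c * shift_sum s f l"
  by (induction s f l rule: shift_sum.induct) (auto simp: algebra_simps)

lemma shift_sum_minus: "shift_sum s (\<lambda>l. - f l) l = - shift_sum s f l"
  by (induction s f l rule: shift_sum.induct) auto

lemma shift_sum_zero [simp]: "shift_sum s (\<lambda>l. 0) l = 0"
  by (induction l) auto

lemma shift_sum_pow_diff:
  "(shift_sum s ^^ n) (\<lambda>l. f l - g l) = (\<lambda>l. (shift_sum s ^^ n) f l - (shift_sum s ^^ n) g l)"
  by (induction n) (auto simp: shift_sum_diff)

lemma shift_sum_pow_mult:
  "(shift_sum s ^^ n) (\<lambda>l. c * f l) = (\<lambda>l. c * (shift_sum s ^^ n) f l)"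
  by (induction n) (auto simp: shift_sum_mult)

lemma shift_sum_pow_add:
  "(shift_sum s ^^ n) (\<lambda>l. f l + g l) = (\<lambda>l. (shift_sum s ^^ n) f l + (shift_sum s ^^ n) g l)"
  by (induction n) (auto simp: shift_sum_add)

lemma shift_sum_pow_zero: "(shift_sum s ^^ n) (\<lambda>l. 0) = (\<lambda>l. 0)"
proof (induction n)
  case (Suc n)
  show ?case unfolding funpow.simps comp_apply Suc by auto
qed simp

text \<open>\<open>A\<close> is a copy of the additive group \<open>\<int>/p\<close>. A function supported in \<open>box as\<close> is an element of
  the tensor product of Jordan blocks of sizes \<open>as\<close>, on which \<open>shift_sum 1\<close> is the nilpotent operator.\<close>

locale prime_values =
  fixes p :: nat and A :: "'r::comm_ring_1 set"
  assumes p: "Factorial_Ring.prime p"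
    and card_A: "card A = p"
    and A_diff: "\<And>x y. x \<in> A \<Longrightarrow> y \<in> A \<Longrightarrow> x - y \<in> A"
    and p_mult: "\<And>x. x \<in> A \<Longrightarrow> of_nat p * x = 0"
begin

lemma p_gt_0: "p > 0" and p_gt_1: "p > 1"
  using p prime_gt_0_nat prime_gt_1_nat by auto

lemma finite_A [simp]: "finite A"
  using card_A p_gt_0 card.infinite by fastforce

lemma A_zero [simp]: "0 \<in> A"
proof -
  have "A \<noteq> {}" using card_A p_gt_0 by auto
  then show ?thesis using A_diff by (metis ex_in_conv diff_self)
qed

lemma A_minus: "x \<in> A \<Longrightarrow> - x \<in> A"
  using A_diff[OF A_zero] by fastforce

lemma A_add: "x \<in> A \<Longrightarrow> y \<in> A \<Longrightarrow> x + y \<in> A"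
  using A_diff[OF _ A_minus] by fastforce

lemma A_of_nat_mult: "x \<in> A \<Longrightarrow> of_nat m * x \<in> A"
  by (induction m) (auto simp: algebra_simps A_add)

lemma A_minus1_pow: "x \<in> A \<Longrightarrow> (-1) ^ j * x \<in> A"
  by (induction j) (auto simp: A_minus)

lemma p_dvd_mult: "x \<in> A \<Longrightarrow> p dvd m \<Longrightarrow> of_nat m * x = 0"
proof -
  assume "x \<in> A" "p dvd m"
  then obtain k where "m = k * p" by (metis dvdE mult.commute)
  then show ?thesis using p_mult[OF \<open>x \<in> A\<close>] by (simp add: mult.assoc)
qed

lemma inverse_mod:
  assumes "\<not> p dvd m"
  obtains m' where "\<And>x. x \<in> A \<Longrightarrow> of_nat m * (of_nat m' * x) = x"
proof -
  have "coprime m p" using prime_imp_coprime[OF p assms] by (simp add: coprime_commute)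
  then obtain m' where "[m * m' = 1] (mod p)" using cong_solve_coprime_nat[of m p] by (auto simp: One_nat_def)
  then have *: "(m * m') mod p = 1" using p_gt_1 by (simp add: cong_def)
  have "of_nat m * (of_nat m' * x) = x" if "x \<in> A" for x
  proof -
    have "m * m' = p * ((m * m') div p) + 1" using * by (metis mult_div_mod_eq)
    then have "(of_nat (m * m') :: 'r) = of_nat (p * ((m * m') div p)) + 1"
      by (metis of_nat_1 of_nat_add)
    then have "of_nat (m * m') * x = of_nat (p * ((m * m') div p)) * x + x"
      by (simp add: algebra_simps)
    then show ?thesis using p_dvd_mult[OF that, of "p * ((m * m') div p)"] by (simp add: mult.assoc)
  qed
  then show ?thesis using that by blast
qed

definition F :: "nat list \<Rightarrow> (nat list \<Rightarrow> 'r) set" where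
  "F as = {f. (\<forall>l. f l \<in> A) \<and> (\<forall>l. l \<notin> box as \<longrightarrow> f l = 0)}"

definition K :: "nat \<Rightarrow> nat list \<Rightarrow> (nat list \<Rightarrow> 'r) set" where
  "K n as = {f \<in> F as. \<forall>l. (shift_sum 1 ^^ n) f l = 0}"

lemma F_diff: "f \<in> F as \<Longrightarrow> g \<in> F as \<Longrightarrow> (\<lambda>l. f l - g l) \<in> F as"
  by (auto simp: F_def A_diff)

lemma F_add: "f \<in> F as \<Longrightarrow> g \<in> F as \<Longrightarrow> (\<lambda>l. f l + g l) \<in> F as"
  by (auto simp: F_def A_add)

lemma F_zero: "(\<lambda>l. 0) \<in> F as"
  by (auto simp: F_def)

lemma F_of_nat_mult: "f \<in> F as \<Longrightarrow> (\<lambda>l. of_nat m * f l) \<in> F as"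
  by (auto simp: F_def A_of_nat_mult)

lemma F_Cons_iff: "f \<in> F (a # as) \<longleftrightarrow>
    (\<forall>j. (\<lambda>l. f (j # l)) \<in> F as) \<and> (\<forall>j\<ge>a. \<forall>l. f (j # l) = 0) \<and> f [] = 0"
  (is "?L \<longleftrightarrow> ?R")
proof
  show "?L \<Longrightarrow> ?R" by (auto simp: F_def)
  assume R: ?R
  have "f l \<in> A" for l using R by (cases l) (auto simp: F_def)
  moreover have "f l = 0" if "l \<notin> box (a # as)" for l
    using R that by (cases l) (auto simp: F_def not_less)
  ultimately show ?L by (auto simp: F_def)
qed

lemma F_slice: "f \<in> F (a # as) \<Longrightarrow> (\<lambda>l. f (j # l)) \<in> F as"
  by (simp add: F_Cons_iff)

lemma finite_card_F: "finite (F as) \<and> card (F as) = p ^ prod_list as"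
proof -
  have bij: "bij_betw (\<lambda>f. restrict f (box as)) (F as) (box as \<rightarrow>\<^sub>E A)"
  proof (rule bij_betwI[where g="\<lambda>g l. if l \<in> box as then g l else 0"])
    show "(\<lambda>f. restrict f (box as)) \<in> F as \<rightarrow> (box as \<rightarrow>\<^sub>E A)"
      unfolding F_def by (intro Pi_I) (simp only: restrict_PiE_iff mem_Collect_eq, blast)
    show "(\<lambda>g l. if l \<in> box as then g l else 0) \<in> (box as \<rightarrow>\<^sub>E A) \<rightarrow> F as"
      unfolding F_def by (auto simp only: Pi_iff PiE_iff A_zero mem_Collect_eq split: if_splits)
    show "(\<lambda>l. if l \<in> box as then restrict f (box as) l else 0) = f" if "f \<in> F as" for f
      using that unfolding F_def fun_eq_iff by simp
    show "restrict (\<lambda>l. if l \<in> box as then g l else 0) (box as) = g" if "g \<in> box as \<rightarrow>\<^sub>E A" for g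
      using PiE_arb[OF that] by (simp add: fun_eq_iff)
  qed
  have "finite (box as \<rightarrow>\<^sub>E A)" by (simp add: finite_PiE)
  moreover have "card (box as \<rightarrow>\<^sub>E A) = p ^ prod_list as"
    by (simp add: card_PiE card_A card_box)
  ultimately show ?thesis
    using bij_betw_finite[OF bij] bij_betw_same_card[OF bij] by simp
qed

lemma finite_F [simp]: "finite (F as)" and card_F: "card (F as) = p ^ prod_list as"
  using finite_card_F by auto

lemma F_shift_sum: "f \<in> F as \<Longrightarrow> shift_sum s f \<in> F as"
proof (induction as arbitrary: f)
  case Nil
  have "shift_sum s f l = 0" for l
  proof (cases l)
    case (Cons j l')
    have "(\<lambda>l. f (j # l)) = (\<lambda>l. 0)" using Nil by (auto simp: F_def)
    then show ?thesis using Cons Nil by (simp add: F_def)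
  qed simp
  then have "shift_sum s f = (\<lambda>l. 0)" by auto
  then show ?case by (simp add: F_zero)
next
  case (Cons a as)
  have zero: "(\<lambda>l. f (j # l)) = (\<lambda>l. 0)" if "j \<ge> a" for j
    using Cons.prems that by (auto simp: F_Cons_iff)
  show ?case unfolding F_Cons_iff
  proof (intro conjI allI impI)
    fix j
    have "(\<lambda>l. f ((j + s) # l) + shift_sum s (\<lambda>l. f (j # l)) l) \<in> F as"
      using F_add[OF F_slice[OF Cons.prems] Cons.IH[OF F_slice[OF Cons.prems]]] .
    then show "(\<lambda>l. shift_sum s f (j # l)) \<in> F as" by simp
  next
    fix j l assume "j \<ge> a"
    then have "f ((j + s) # l) = 0" using fun_cong[OF zero[of "j + s"], of l] by simp
    then show "shift_sum s f (j # l) = 0" using \<open>j \<ge> a\<close> by (simp add: zero)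
  qed simp
qed

lemma F_shift_sum_pow: "f \<in> F as \<Longrightarrow> (shift_sum s ^^ n) f \<in> F as"
  by (induction n) (auto simp: F_shift_sum)

lemma K_subset: "K n as \<subseteq> F as" by (auto simp: K_def)

lemma finite_K [simp]: "finite (K n as)" using finite_subset[OF K_subset] by simp

lemma K_diff: "f \<in> K n as \<Longrightarrow> g \<in> K n as \<Longrightarrow> (\<lambda>l. f l - g l) \<in> K n as"
  by (auto simp: K_def F_diff shift_sum_pow_diff)

lemma K_zero: "(\<lambda>l. 0) \<in> K n as"
  by (simp add: K_def F_zero shift_sum_pow_zero)

lemma card_K_pos: "card (K n as) > 0"
  using K_zero[of n as] card_gt_0_iff by fastforce

lemma K_1_iff: "f \<in> K 1 as \<longleftrightarrow> f \<in> F as \<and> (\<forall>l. shift_sum 1 f l = 0)"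
  by (simp add: K_def One_nat_def)

text \<open>Vanishing of the shift sum at \<open>j # l\<close> makes slice \<open>j + 1\<close> the
  negative of the shift sum of slice \<open>j\<close>, so slice 0 determines all others.\<close>

lemma K_slice:
  assumes "f \<in> K 1 (a # as)"
  shows "(\<lambda>l. f (j # l)) = (\<lambda>l. (-1) ^ j * (shift_sum 1 ^^ j) (\<lambda>l. f (0 # l)) l)"
proof (induction j)
  case (Suc j)
  have "f (Suc j # l) = - shift_sum 1 (\<lambda>l. f (j # l)) l" for l
  proof -
    have "shift_sum 1 f (j # l) = 0" using assms K_1_iff[of f "a # as"] by blast
    then have "f ((j + 1) # l) + shift_sum 1 (\<lambda>l. f (j # l)) l = 0" by (simp only: shift_sum.simps)
    then show ?thesis by (simp only: eq_neg_iff_add_eq_0 Suc_eq_plus1)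
  qed
  then have "(\<lambda>l. f (Suc j # l)) = (\<lambda>l. - shift_sum 1 (\<lambda>l. f (j # l)) l)" by blast
  also have "\<dots> = (\<lambda>l. (-1) ^ Suc j * (shift_sum 1 ^^ Suc j) (\<lambda>l. f (0 # l)) l)"
    unfolding Suc shift_sum_mult by simp
  finally show ?case .
qed simp

text \<open>A kernel element is rebuilt from its slice 0, and the only condition on that slice is
  that slice \<open>a\<close> vanishes, that is, that the \<open>a\<close>-th power of the operator
  on the remaining factors kills it. One tensor factor is thus traded for a power of the
  operator.\<close>

lemma card_K_Cons: "card (K 1 (a # as)) = card (K a as)"
proof -
  define G where "G g = (\<lambda>l. case l of [] \<Rightarrow> 0 | j # l \<Rightarrow> (-1) ^ j * (shift_sum 1 ^^ j) g l)"
    for g :: "nat list \<Rightarrow> 'r"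
  have "bij_betw (\<lambda>f l. f (0 # l)) (K 1 (a # as)) (K a as)"
  proof (rule bij_betwI[where g=G])
    show "(\<lambda>f l. f (0 # l)) \<in> K 1 (a # as) \<rightarrow> K a as"
    proof
      fix f assume f: "f \<in> K 1 (a # as)"
      have "f (a # l) = 0" for l using f by (auto simp: K_1_iff F_Cons_iff)
      then have "(shift_sum 1 ^^ a) (\<lambda>l. f (0 # l)) l = 0" for l
        using fun_cong[OF K_slice[OF f, of a], of l] by (simp add: minus_one_power_iff split: if_splits)
      then show "(\<lambda>l. f (0 # l)) \<in> K a as"
        using f by (auto simp: K_def F_slice)
    qed
    show "G \<in> K a as \<rightarrow> K 1 (a # as)"
    proof
      fix g assume g: "g \<in> K a as"
      have gF: "g \<in> F as" using g by (simp add: K_def)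
      have van: "(shift_sum 1 ^^ j) g = (\<lambda>l. 0)" if "j \<ge> a" for j
      proof -
        have "(shift_sum 1 ^^ j) g = (shift_sum 1 ^^ (j - a)) ((shift_sum 1 ^^ a) g)"
          using that funpow_add[of "j - a" a "shift_sum 1 :: (nat list \<Rightarrow> 'r) \<Rightarrow> _"] by simp
        also have "(shift_sum 1 ^^ a) g = (\<lambda>l. 0)" using g by (auto simp: K_def)
        finally show ?thesis by (simp add: shift_sum_pow_zero)
      qed
      have "G g \<in> F (a # as)"
        unfolding F_Cons_iff
      proof (intro conjI allI impI)
        fix j
        have "(shift_sum 1 ^^ j) g \<in> F as" using F_shift_sum_pow gF by blast
        then show "(\<lambda>l. G g (j # l)) \<in> F as" by (auto simp: G_def F_def A_minus1_pow)
      next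
        fix j l assume "j \<ge> a"
        then show "G g (j # l) = 0" using van[of j] by (simp add: G_def)
      qed (simp add: G_def)
      moreover have "shift_sum 1 (G g) l = 0" for l
        by (cases l) (simp_all add: G_def shift_sum_mult flip: Suc_eq_plus1)
      ultimately show "G g \<in> K 1 (a # as)" by (simp add: K_1_iff)
    qed
    show "G (\<lambda>l. f (0 # l)) = f" if "f \<in> K 1 (a # as)" for f
    proof
      fix l show "G (\<lambda>l. f (0 # l)) l = f l"
      proof (cases l)
        case Nil
        then show ?thesis using that by (simp add: G_def K_1_iff F_Cons_iff)
      next
        case (Cons j l')
        then show ?thesis using fun_cong[OF K_slice[OF that, of j], of l'] by (simp add: G_def)
      qed
    qed
    show "(\<lambda>l. G g (0 # l)) = g" for g by (simp add: G_def)
  qed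
  then show ?thesis by (rule bij_betw_same_card)
qed

lemma card_K_le: "card (K 1 (a # as)) \<le> p ^ prod_list as"
  using card_mono[OF finite_F K_subset[of a as]] unfolding card_K_Cons card_F .

lemma card_K_0: "card (K 0 as) = 1"
proof -
  have "K 0 as = {\<lambda>l. 0}" by (auto simp: K_def F_zero)
  then show ?thesis by simp
qed

end

section \<open>Tensoring with a block of size two\<close>

context prime_values
begin

lemma shift_sum_pow_slice1:
  assumes "f \<in> F (2 # as)"
  shows "(\<lambda>l. (shift_sum 1 ^^ n) f (1 # l)) = (shift_sum 1 ^^ n) (\<lambda>l. f (1 # l))"
proof (induction n)
  case (Suc n)
  have "(shift_sum 1 ^^ n) f \<in> F (2 # as)" by (rule F_shift_sum_pow) (rule assms)
  then have z: "(shift_sum 1 ^^ n) f (2 # l) = 0" for l unfolding F_Cons_iff by simp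
  have "(shift_sum 1 ^^ Suc n) f (1 # l) = (shift_sum 1 ^^ Suc n) (\<lambda>l. f (1 # l)) l" for l
    using z by (simp add: Suc)
  then show ?case by blast
qed simp

text \<open>The operator of a block of size two squares to zero, so only two terms of the binomial
  expansion survive.\<close>

lemma shift_sum_pow_slice0:
  assumes "f \<in> F (2 # as)"
  shows "(\<lambda>l. (shift_sum 1 ^^ n) f (0 # l)) =
    (\<lambda>l. (shift_sum 1 ^^ n) (\<lambda>l. f (0 # l)) l + of_nat n * (shift_sum 1 ^^ (n - 1)) (\<lambda>l. f (1 # l)) l)"
proof (induction n)
  case (Suc n)
  have s1: "(shift_sum 1 ^^ n) f (1 # l) = (shift_sum 1 ^^ n) (\<lambda>l. f (1 # l)) l" for l
    using fun_cong[OF shift_sum_pow_slice1[OF assms, of n]] .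
  have "shift_sum 1 (\<lambda>l. of_nat n * (shift_sum 1 ^^ (n - 1)) (\<lambda>l. f (1 # l)) l) l =
      of_nat n * (shift_sum 1 ^^ n) (\<lambda>l. f (1 # l)) l" for l
    by (cases n) (simp_all add: shift_sum_mult)
  then have "(shift_sum 1 ^^ Suc n) f (0 # l) = (shift_sum 1 ^^ Suc n) (\<lambda>l. f (0 # l)) l
     + of_nat (Suc n) * (shift_sum 1 ^^ (Suc n - 1)) (\<lambda>l. f (1 # l)) l" for l
    by (simp add: Suc s1 shift_sum_add algebra_simps)
  then show ?case by blast
qed simp

lemma K_2_iff:
  assumes "f \<in> F (2 # as)"
  shows "f \<in> K m (2 # as) \<longleftrightarrow>
    (\<forall>l. (shift_sum 1 ^^ m) (\<lambda>l. f (0 # l)) l + of_nat m * (shift_sum 1 ^^ (m - 1)) (\<lambda>l. f (1 # l)) l = 0) \<and>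
    (\<forall>l. (shift_sum 1 ^^ m) (\<lambda>l. f (1 # l)) l = 0)"
proof -
  let ?g = "(shift_sum 1 ^^ m) f"
  have g: "?g \<in> F (2 # as)" by (rule F_shift_sum_pow) (rule assms)
  have "f \<in> K m (2 # as) \<longleftrightarrow> (\<forall>l. ?g l = 0)" using assms by (simp add: K_def)
  also have "\<dots> \<longleftrightarrow> (\<forall>l. ?g (0 # l) = 0) \<and> (\<forall>l. ?g (1 # l) = 0)"
  proof (intro iffI conjI allI)
    fix l assume *: "(\<forall>l. ?g (0 # l) = 0) \<and> (\<forall>l. ?g (1 # l) = 0)"
    show "?g l = 0"
    proof (cases l)
      case Nil
      then show ?thesis using g unfolding F_Cons_iff by blast
    next
      case (Cons j l')
      consider "j = 0" | "j = 1" | "j \<ge> 2" by linarith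
      then show ?thesis
        using Cons * g unfolding F_Cons_iff by cases auto
    qed
  qed auto
  finally show ?thesis
    using shift_sum_pow_slice0[OF assms, of m] shift_sum_pow_slice1[OF assms, of m]
    by (simp add: fun_eq_iff)
qed

lemma card_K_2_pairs:
  "card (K m (2 # as)) = card {(u, v). u \<in> F as \<and> v \<in> F as \<and>
    (\<forall>l. (shift_sum 1 ^^ m) u l + of_nat m * (shift_sum 1 ^^ (m - 1)) v l = 0) \<and>
    (\<forall>l. (shift_sum 1 ^^ m) v l = 0)}" (is "_ = card ?P")
proof -
  define G where "G = (\<lambda>(u :: nat list \<Rightarrow> 'r, v :: nat list \<Rightarrow> 'r) l.
    case l of [] \<Rightarrow> 0 | j # l \<Rightarrow> if j = 0 then u l else if j = 1 then v l else 0)"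
  have GF: "G (u, v) \<in> F (2 # as)" if "u \<in> F as" "v \<in> F as" for u v
  proof -
    have "(\<lambda>l. if j = 0 then u l else if j = 1 then v l else 0) \<in> F as" for j :: nat
      using that F_zero by (cases "j = 0"; cases "j = 1") simp_all
    then show ?thesis unfolding F_Cons_iff by (simp add: G_def)
  qed
  have "bij_betw (\<lambda>f. (\<lambda>l. f (0 # l), \<lambda>l. f (1 # l))) (K m (2 # as)) ?P"
  proof (rule bij_betwI[where g=G])
    show "(\<lambda>f. (\<lambda>l. f (0 # l), \<lambda>l. f (1 # l))) \<in> K m (2 # as) \<rightarrow> ?P"
    proof
      fix f assume f: "f \<in> K m (2 # as)"
      then have fF: "f \<in> F (2 # as)" by (simp add: K_def)
      show "(\<lambda>l. f (0 # l), \<lambda>l. f (1 # l)) \<in> ?P"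
        using f K_2_iff[OF fF, of m] F_slice[OF fF] by simp
    qed
    show "G \<in> ?P \<rightarrow> K m (2 # as)"
    proof
      fix x assume "x \<in> ?P"
      then obtain u v where x: "x = (u, v)" and uv: "u \<in> F as" "v \<in> F as"
        "\<forall>l. (shift_sum 1 ^^ m) u l + of_nat m * (shift_sum 1 ^^ (m - 1)) v l = 0"
        "\<forall>l. (shift_sum 1 ^^ m) v l = 0" by blast
      have "(\<lambda>l. G x (0 # l)) = u" "(\<lambda>l. G x (1 # l)) = v" by (simp_all add: x G_def)
      then show "G x \<in> K m (2 # as)" using K_2_iff[of "G x" as m] GF[OF uv(1,2)] uv(3,4) by (simp add: x)
    qed
    show "G (\<lambda>l. f (0 # l), \<lambda>l. f (1 # l)) = f" if "f \<in> K m (2 # as)" for f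
    proof
      fix l
      have "f \<in> F (2 # as)" using that by (simp add: K_def)
      then show "G (\<lambda>l. f (0 # l), \<lambda>l. f (1 # l)) l = f l"
        unfolding F_Cons_iff G_def by (auto split: list.split)
    qed
    show "(\<lambda>l. G x (0 # l), \<lambda>l. G x (1 # l)) = x" for x
      by (cases x) (simp add: G_def)
  qed
  then show ?thesis by (rule bij_betw_same_card)
qed

text \<open>The cross term carries the factor \<open>m\<close>, which is zero on \<open>A\<close>;
  the two slices are then constrained independently.\<close>

lemma card_K_2_dvd:
  assumes "p dvd m"
  shows "card (K m (2 # as)) = card (K m as) * card (K m as)"
proof -
  have "of_nat m * (shift_sum 1 ^^ (m - 1)) v l = 0" if "v \<in> F as" for v l
  proof -
    have "(shift_sum 1 ^^ (m - 1)) v \<in> F as" by (rule F_shift_sum_pow) (rule that)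
    then show ?thesis using p_dvd_mult[OF _ assms] by (simp add: F_def)
  qed
  then have "{(u, v). u \<in> F as \<and> v \<in> F as \<and>
    (\<forall>l. (shift_sum 1 ^^ m) u l + of_nat m * (shift_sum 1 ^^ (m - 1)) v l = 0) \<and>
    (\<forall>l. (shift_sum 1 ^^ m) v l = 0)} = K m as \<times> K m as"
    by (auto simp: K_def)
  then show ?thesis unfolding card_K_2_pairs by (simp add: card_cartesian_product)
qed

text \<open>The substitution \<open>w = \<Lambda> u + m v\<close>, \<open>\<Lambda>\<close> being the shift sum, diagonalises the two conditions.\<close>

lemma card_K_2_not_dvd:
  assumes "\<not> p dvd m"
  shows "card (K m (2 # as)) = card (K (m + 1) as) * card (K (m - 1) as)"
proof -
  have m: "m > 0" using assms by (intro gr0I) auto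
  obtain m' where m': "\<And>x. x \<in> A \<Longrightarrow> of_nat m * (of_nat m' * x) = x"
    using inverse_mod[OF assms] by blast
  let ?S = "shift_sum 1 :: (nat list \<Rightarrow> 'r) \<Rightarrow> nat list \<Rightarrow> 'r"
  have S: "?S ((?S ^^ k) u) = (?S ^^ (k + 1)) u" for k u by (simp flip: Suc_eq_plus1)
  have S': "(?S ^^ k) (?S u) = (?S ^^ (k + 1)) u" for k u by (simp add: funpow_swap1 flip: Suc_eq_plus1)
  let ?P = "{(u, v). u \<in> F as \<and> v \<in> F as \<and>
    (\<forall>l. (?S ^^ m) u l + of_nat m * (?S ^^ (m - 1)) v l = 0) \<and> (\<forall>l. (?S ^^ m) v l = 0)}"
  let ?h = "\<lambda>(u, v). (u, \<lambda>l. ?S u l + of_nat m * v l)"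
  let ?g = "\<lambda>(u, w). (u, \<lambda>l. of_nat m' * (w l - ?S u l))"
  have inF: "f l \<in> A" if "f \<in> F as" for f l using that by (simp add: F_def)
  have "bij_betw ?h ?P (K (m + 1) as \<times> K (m - 1) as)"
  proof (rule bij_betwI[where g="?g"])
    show "?h \<in> ?P \<rightarrow> K (m + 1) as \<times> K (m - 1) as"
    proof
      fix x assume "x \<in> ?P"
      then obtain u v where x: "x = (u, v)" and uv: "u \<in> F as" "v \<in> F as"
        and 1: "(\<lambda>l. (?S ^^ m) u l + of_nat m * (?S ^^ (m - 1)) v l) = (\<lambda>l. 0)"
        and 2: "(?S ^^ m) v = (\<lambda>l. 0)" by (auto simp: fun_eq_iff)
      have "?S (\<lambda>l. (?S ^^ m) u l + of_nat m * (?S ^^ (m - 1)) v l) l = 0" for l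
        unfolding 1 by simp
      then have "(?S ^^ (m + 1)) u l + of_nat m * (?S ^^ m) v l = 0" for l
        using m unfolding shift_sum_add shift_sum_mult S by simp
      then have "u \<in> K (m + 1) as" using uv 2 by (simp add: K_def)
      moreover have "(?S ^^ (m - 1)) (\<lambda>l. ?S u l + of_nat m * v l) l = 0" for l
        using fun_cong[OF 1, of l] m unfolding shift_sum_pow_add shift_sum_pow_mult S' by simp
      then have "(\<lambda>l. ?S u l + of_nat m * v l) \<in> K (m - 1) as"
        using F_add[OF F_shift_sum[OF uv(1)] F_of_nat_mult[OF uv(2)]] by (simp add: K_def)
      ultimately show "?h x \<in> K (m + 1) as \<times> K (m - 1) as" by (simp add: x)
    qed
    show "?g \<in> K (m + 1) as \<times> K (m - 1) as \<rightarrow> ?P"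
    proof
      fix x assume "x \<in> K (m + 1) as \<times> K (m - 1) as"
      then obtain u w where x: "x = (u, w)" and uw: "u \<in> F as" "w \<in> F as"
        and 1: "(?S ^^ (m + 1)) u = (\<lambda>l. 0)" and 2: "(?S ^^ (m - 1)) w = (\<lambda>l. 0)"
        unfolding K_def by blast
      let ?v = "\<lambda>l. of_nat m' * (w l - ?S u l)"
      have v: "?v \<in> F as" using F_of_nat_mult[OF F_diff[OF uw(2) F_shift_sum[OF uw(1)]]] .
      have mA: "(?S ^^ m) u l \<in> A" for l by (rule inF) (rule F_shift_sum_pow[OF uw(1)])
      have "(?S ^^ (m - 1)) ?v = (\<lambda>l. of_nat m' * (0 - (?S ^^ m) u l))"
        using m unfolding shift_sum_pow_mult shift_sum_pow_diff 2 S' by simp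
      then have "(?S ^^ m) u l + of_nat m * (?S ^^ (m - 1)) ?v l = 0" for l
        using m'[OF A_minus[OF mA[of l]]] by simp
      moreover have "(?S ^^ m) w = (\<lambda>l. 0)"
        using m S[of "m - 1" w] unfolding 2 by (auto simp: fun_eq_iff)
      then have "(?S ^^ m) ?v l = 0" for l
        unfolding shift_sum_pow_mult shift_sum_pow_diff S' 1 by simp
      ultimately show "?g x \<in> ?P" using uw v by (simp add: x)
    qed
    show "?g (?h x) = x" if "x \<in> ?P" for x
    proof -
      obtain u v where x: "x = (u, v)" "v \<in> F as" using \<open>x \<in> ?P\<close> by blast
      have "of_nat m' * (of_nat m * v l) = v l" for l
        using m'[OF inF[OF x(2), of l]] by (simp add: mult.left_commute)
      then show ?thesis by (simp add: x)
    qed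
    show "?h (?g x) = x" if x: "x \<in> K (m + 1) as \<times> K (m - 1) as" for x
    proof -
      obtain u w where x: "x = (u, w)" and uw: "u \<in> F as" "w \<in> F as"
        using x unfolding K_def by blast
      have "of_nat m * (of_nat m' * (w l - ?S u l)) = w l - ?S u l" for l
        by (rule m'[OF inF[OF F_diff[OF uw(2) F_shift_sum[OF uw(1)]]]])
      then show ?thesis by (simp add: x)
    qed
  qed
  from bij_betw_same_card[OF this] show ?thesis
    unfolding card_K_2_pairs by (simp add: card_cartesian_product)
qed

end

text \<open>A permutation of the tensor factors, given as a bijection of multi-indices that commutes
  with all shift sums and matches the two boxes. The type argument fixes the coefficient ring of the
  functions quantified in the second condition.\<close>

definition reindexes :: "(nat list \<Rightarrow> nat list) \<Rightarrow> 'r::comm_ring_1 itself \<Rightarrow> nat list \<Rightarrow> nat list \<Rightarrow> bool" where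
  "reindexes \<sigma> (_ :: 'r itself) as bs \<longleftrightarrow> bij \<sigma> \<and>
    (\<forall>s (f :: nat list \<Rightarrow> 'r) l. shift_sum s (\<lambda>l. f (\<sigma> l)) l = shift_sum s f (\<sigma> l)) \<and>
    (\<forall>l. \<sigma> l \<in> box as \<longleftrightarrow> l \<in> box bs)"

lemma reindexes_trans:
  assumes "reindexes \<sigma> TYPE('r::comm_ring_1) as bs" "reindexes \<sigma>' TYPE('r) bs cs"
  shows "reindexes (\<sigma> \<circ> \<sigma>') TYPE('r) as cs"
proof -
  have 1: "shift_sum s (\<lambda>l. f (\<sigma> l)) l = shift_sum s f (\<sigma> l)" for s and f :: "nat list \<Rightarrow> 'r" and l
    using assms(1) unfolding reindexes_def by blast
  have 2: "shift_sum s (\<lambda>l. f (\<sigma>' l)) l = shift_sum s f (\<sigma>' l)" for s and f :: "nat list \<Rightarrow> 'r" and l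
    using assms(2) unfolding reindexes_def by blast
  have "shift_sum s (\<lambda>l. f ((\<sigma> \<circ> \<sigma>') l)) l = shift_sum s f ((\<sigma> \<circ> \<sigma>') l)" for s and f :: "nat list \<Rightarrow> 'r" and l
    using 2[of s "\<lambda>l. f (\<sigma> l)" l] 1[of s f "\<sigma>' l"] by simp
  then show ?thesis using assms unfolding reindexes_def by (auto intro: bij_comp)
qed

lemma reindexes_Cons:
  assumes "reindexes \<sigma> TYPE('r::comm_ring_1) as bs"
  shows "reindexes (\<lambda>l. case l of [] \<Rightarrow> [] | j # l \<Rightarrow> j # \<sigma> l) TYPE('r) (a # as) (a # bs)"
proof -
  let ?\<sigma> = "\<lambda>l. case l of [] \<Rightarrow> [] | j # l \<Rightarrow> j # \<sigma> l"
  have bij: "bij \<sigma>" and 1: "shift_sum s (\<lambda>l. f (\<sigma> l)) l = shift_sum s f (\<sigma> l)"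
    and 2: "\<sigma> l \<in> box as \<longleftrightarrow> l \<in> box bs" for s and f :: "nat list \<Rightarrow> 'r" and l
    using assms unfolding reindexes_def by blast+
  have "bij ?\<sigma>"
  proof (rule o_bij[where g="\<lambda>l. case l of [] \<Rightarrow> [] | j # l \<Rightarrow> j # inv_into UNIV \<sigma> l"])
    show "(\<lambda>l. case l of [] \<Rightarrow> [] | j # l \<Rightarrow> j # inv_into UNIV \<sigma> l) \<circ> ?\<sigma> = id"
      using bij by (auto simp: fun_eq_iff bij_is_inj split: list.split)
    show "?\<sigma> \<circ> (\<lambda>l. case l of [] \<Rightarrow> [] | j # l \<Rightarrow> j # inv_into UNIV \<sigma> l) = id"
      using bij by (auto simp: fun_eq_iff bij_is_surj surj_f_inv_f split: list.split)
  qed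
  moreover have "shift_sum s (\<lambda>l. f (?\<sigma> l)) l = shift_sum s f (?\<sigma> l)" for s and f :: "nat list \<Rightarrow> 'r" and l
    using 1[of s "\<lambda>l'. f (hd l # l')" "tl l"] by (cases l) simp_all
  moreover have "?\<sigma> l \<in> box (a # as) \<longleftrightarrow> l \<in> box (a # bs)" for l
    using 2 by (cases l) auto
  ultimately show ?thesis unfolding reindexes_def by blast
qed

lemma reindexes_swap:
  "\<exists>\<sigma>. reindexes \<sigma> TYPE('r::comm_ring_1) (a # b # as) (b # a # as)"
proof -
  let ?\<sigma> = "\<lambda>l::nat list. case l of i # j # l' \<Rightarrow> j # i # l' | _ \<Rightarrow> l"
  have "?\<sigma> \<circ> ?\<sigma> = id" by (auto simp: fun_eq_iff split: list.split)
  then have "bij ?\<sigma>" by (rule o_bij) fact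
  moreover have "shift_sum s (\<lambda>l. f (?\<sigma> l)) l = shift_sum s f (?\<sigma> l)" for s and f :: "nat list \<Rightarrow> 'r" and l
    by (auto split: list.split simp: algebra_simps)
  moreover have "?\<sigma> l \<in> box (a # b # as) \<longleftrightarrow> l \<in> box (b # a # as)" for l
    by (auto split: list.split simp: box_Cons)
  ultimately show ?thesis unfolding reindexes_def by blast
qed

lemma reindexes_refl: "reindexes id TYPE('r::comm_ring_1) as as"
  by (simp add: reindexes_def)

lemma reindexes_move:
  "\<exists>\<sigma>. reindexes \<sigma> TYPE('r::comm_ring_1) (a # xs @ ys) (xs @ a # ys)"
proof (induction xs)
  case Nil
  then show ?case using reindexes_refl[where 'r='r] by auto
next
  case (Cons x xs)
  then show ?case
    using reindexes_swap[where 'r='r, of a x "xs @ ys"] reindexes_Cons[where 'r='r]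
      reindexes_trans[where 'r='r] by fastforce
qed

lemma reindexes_mset:
  "mset as = mset bs \<Longrightarrow> \<exists>\<sigma>. reindexes \<sigma> TYPE('r::comm_ring_1) as bs"
proof (induction as arbitrary: bs)
  case Nil
  then show ?case using reindexes_refl[where 'r='r] by auto
next
  case (Cons a as)
  then have "a \<in> set bs" by (metis list.set_intros(1) mset_eq_setD)
  then obtain xs ys where bs: "bs = xs @ a # ys" by (meson split_list)
  then have "mset as = mset (xs @ ys)" using Cons.prems by simp
  then obtain \<sigma> where "reindexes \<sigma> TYPE('r) as (xs @ ys)" using Cons.IH by blast
  then show ?case
    using reindexes_Cons[where 'r='r] reindexes_move[where 'r='r, of a xs ys] reindexes_trans[where 'r='r]
    unfolding bs by blast
qed

context prime_values
begin

lemma card_K_mset: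
  assumes "mset as = mset bs"
  shows "card (K n as) = card (K n bs)"
proof -
  obtain \<sigma> where \<sigma>: "reindexes \<sigma> TYPE('r) as bs" using reindexes_mset[OF assms] by blast
  then have bij: "bij \<sigma>" and 1: "shift_sum s (\<lambda>l. f (\<sigma> l)) l = shift_sum s f (\<sigma> l)"
    and 2: "\<sigma> l \<in> box as \<longleftrightarrow> l \<in> box bs" for s and f :: "nat list \<Rightarrow> 'r" and l
    unfolding reindexes_def by blast+
  have pow: "(shift_sum s ^^ n) (\<lambda>l. f (\<sigma> l)) = (\<lambda>l. (shift_sum s ^^ n) f (\<sigma> l))"
    for s n and f :: "nat list \<Rightarrow> 'r"
    by (induction n) (simp_all add: 1)
  have inv1: "\<sigma> (inv_into UNIV \<sigma> l) = l" and inv2: "inv_into UNIV \<sigma> (\<sigma> l) = l" for l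
    using bij by (simp_all add: bij_is_surj surj_f_inv_f bij_is_inj)
  have "bij_betw (\<lambda>f l. f (\<sigma> l)) (K n as) (K n bs)"
  proof (rule bij_betwI[where g="\<lambda>f l. f (inv_into UNIV \<sigma> l)"])
    show "(\<lambda>f l. f (\<sigma> l)) \<in> K n as \<rightarrow> K n bs"
      by (auto simp: K_def pow F_def 2)
    show "(\<lambda>f l. f (inv_into UNIV \<sigma> l)) \<in> K n bs \<rightarrow> K n as"
    proof
      fix g assume g: "g \<in> K n bs"
      let ?h = "\<lambda>l. g (inv_into UNIV \<sigma> l)"
      have "(shift_sum 1 ^^ n) g = (\<lambda>l. (shift_sum 1 ^^ n) ?h (\<sigma> l))"
        using pow[of n 1 ?h] by (simp add: inv2)
      then have "(shift_sum 1 ^^ n) ?h l = 0" for l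
        using g inv1[of l] unfolding K_def by (metis (mono_tags, lifting) mem_Collect_eq)
      moreover have "?h \<in> F as"
        using g 2[of "inv_into UNIV \<sigma> _"] unfolding K_def F_def by (auto simp: inv1)
      ultimately show "?h \<in> K n as" by (simp add: K_def)
    qed
  qed (simp_all add: inv1 inv2)
  then show ?thesis by (rule bij_betw_same_card)
qed

end

section \<open>Splitting multi-indices by residues modulo s\<close>

fun interleave :: "nat \<Rightarrow> nat list \<Rightarrow> nat list \<Rightarrow> nat list" where
  "interleave s (c # cs) (j # l) = (s * j + c) # interleave s cs l"
| "interleave s _ _ = []"

text \<open>For \<open>c < s\<close>, the number of indices below \<open>a\<close> that are
  congruent to \<open>c\<close> modulo \<open>s\<close>.\<close>

definition residue_count :: "nat \<Rightarrow> nat \<Rightarrow> nat \<Rightarrow> nat" where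
  "residue_count s c a = (a + s - 1 - c) div s"

lemma less_residue_count_iff:
  assumes "c < s"
  shows "j < residue_count s c a \<longleftrightarrow> s * j + c < a"
proof -
  have "j < residue_count s c a \<longleftrightarrow> Suc j \<le> (a + s - 1 - c) div s"
    by (auto simp: residue_count_def)
  also have "\<dots> \<longleftrightarrow> Suc j * s \<le> a + s - 1 - c"
    using assms by (simp add: less_eq_div_iff_mult_less_eq)
  also have "\<dots> \<longleftrightarrow> s * j + c < a" using assms by (auto simp: algebra_simps)
  finally show ?thesis .
qed

lemma shift_sum_cong_length:
  "(\<And>l'. length l' = length l \<Longrightarrow> f l' = g l') \<Longrightarrow> shift_sum s f l = shift_sum s g l"
proof (induction l arbitrary: f g)
  case (Cons j l)
  have "shift_sum s (\<lambda>l. f (j # l)) l = shift_sum s (\<lambda>l. g (j # l)) l"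
    by (rule Cons.IH) (rule Cons.prems, simp)
  moreover have "f ((j + s) # l) = g ((j + s) # l)" by (rule Cons.prems) simp
  ultimately show ?case by simp
qed simp

lemma shift_sum_interleave:
  "length c = length l \<Longrightarrow>
    shift_sum s f (interleave s c l) = shift_sum 1 (\<lambda>l. f (interleave s c l)) l"
proof (induction c l arbitrary: f rule: list_induct2)
  case (Cons x c j l)
  then show ?case using Cons.IH[of "\<lambda>l. f ((s * j + x) # l)"] by (simp add: algebra_simps)
qed simp

definition residue_slice :: "nat \<Rightarrow> nat list \<Rightarrow> (nat list \<Rightarrow> 'r::comm_ring_1) \<Rightarrow> nat list \<Rightarrow> 'r" where
  "residue_slice s c f l = (if length l = length c then f (interleave s c l) else 0)"

lemma residue_slice_shift_sum:
  "residue_slice s c (shift_sum s f) = shift_sum 1 (residue_slice s c f)"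
proof
  fix l
  show "residue_slice s c (shift_sum s f) l = shift_sum 1 (residue_slice s c f) l"
  proof (cases "length l = length c")
    case True
    have "shift_sum 1 (residue_slice s c f) l = shift_sum 1 (\<lambda>l. f (interleave s c l)) l"
      by (rule shift_sum_cong_length) (simp add: residue_slice_def True)
    then show ?thesis using True shift_sum_interleave[of c l s f] by (simp add: residue_slice_def)
  next
    case False
    have "shift_sum 1 (residue_slice s c f) l = shift_sum 1 (\<lambda>l. 0) l"
      by (rule shift_sum_cong_length) (simp add: residue_slice_def False)
    then show ?thesis using False by (simp add: residue_slice_def)
  qed
qed

lemma residue_slice_shift_sum_pow:
  "residue_slice s c ((shift_sum s ^^ n) f) = (shift_sum 1 ^^ n) (residue_slice s c f)"
  by (induction n) (simp_all add: residue_slice_shift_sum)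

lemma interleave_mod_div: "s > 0 \<Longrightarrow> interleave s (map (\<lambda>x. x mod s) l) (map (\<lambda>x. x div s) l) = l"
  by (induction l) auto

lemma interleave_box:
  assumes "length as = length c" "length l = length c" "c \<in> box (replicate (length as) s)"
  shows "interleave s c l \<in> box as \<longleftrightarrow> l \<in> box (map2 (residue_count s) c as)"
    "map (\<lambda>x. x mod s) (interleave s c l) = c" "map (\<lambda>x. x div s) (interleave s c l) = l"
proof -
  have len: "length as = length c" "length c = length l" using assms by auto
  have "(interleave s c l \<in> box as \<longleftrightarrow> l \<in> box (map2 (residue_count s) c as)) \<and>
    map (\<lambda>x. x mod s) (interleave s c l) = c \<and> map (\<lambda>x. x div s) (interleave s c l) = l"
    using len assms(3)
    by (induction as c l rule: list_induct3) (auto simp: box_Cons less_residue_count_iff)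
  then show "interleave s c l \<in> box as \<longleftrightarrow> l \<in> box (map2 (residue_count s) c as)"
    "map (\<lambda>x. x mod s) (interleave s c l) = c" "map (\<lambda>x. x div s) (interleave s c l) = l" by auto
qed

lemma residues_in_box: "s > 0 \<Longrightarrow> map (\<lambda>x. x mod s) l \<in> box (replicate (length l) s)"
  by (induction l) auto

context prime_values
begin

lemma residue_slice_F:
  assumes "f \<in> F as" "c \<in> box (replicate (length as) s)"
  shows "residue_slice s c f \<in> F (map2 (residue_count s) c as)"
proof -
  have len: "length as = length c" using box_length[OF assms(2)] by simp
  then have "residue_slice s c f l = 0" if "l \<notin> box (map2 (residue_count s) c as)" for l
    using interleave_box(1)[OF len _ assms(2), of l] assms(1) that by (simp add: residue_slice_def F_def)
  then show ?thesis using assms(1) by (auto simp: F_def residue_slice_def)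
qed

lemma residue_slices_eq_0:
  assumes "s > 0" "f \<in> F as" "\<And>c. c \<in> box (replicate (length as) s) \<Longrightarrow> residue_slice s c f = (\<lambda>l. 0)"
  shows "f l = 0"
proof (cases "length l = length as")
  case True
  have "residue_slice s (map (\<lambda>x. x mod s) l) f (map (\<lambda>x. x div s) l) = 0"
    using assms(3)[of "map (\<lambda>x. x mod s) l"] residues_in_box[OF assms(1), of l] True by simp
  then show ?thesis using interleave_mod_div[OF assms(1), of l] by (simp add: residue_slice_def)
next
  case False
  then show ?thesis using assms(2) box_length by (auto simp: F_def)
qed

text \<open>\<open>shift_sum s\<close> preserves the residue of every entry modulo \<open>s\<close>,
  and within one residue vector it acts as \<open>shift_sum 1\<close> on the quotients. The kernel
  is a product over the residue vectors. The case \<open>s = p\<close> gives the Frobenius rule, the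
  case \<open>s = 2\<close> the passage from squares of variables to variables.\<close>

lemma card_residues:
  assumes s: "s > 0"
  shows "card {f \<in> F as. \<forall>l. (shift_sum s ^^ n) f l = 0} =
    (\<Prod>c\<in>box (replicate (length as) s). card (K n (map2 (residue_count s) c as)))"
proof -
  let ?C = "box (replicate (length as) s)"
  let ?Y = "{f \<in> F as. \<forall>l. (shift_sum s ^^ n) f l = 0}"
  let ?G = "\<lambda>h l. if l \<in> box as then h (map (\<lambda>x. x mod s) l) (map (\<lambda>x. x div s) l) else 0"
  have iff: "(\<forall>l. (shift_sum s ^^ n) f l = 0) \<longleftrightarrow> (\<forall>c\<in>?C. residue_slice s c f \<in> K n (map2 (residue_count s) c as))"
    if f: "f \<in> F as" for f
  proof -
    have "(\<forall>l. (shift_sum s ^^ n) f l = 0) \<longleftrightarrow> (\<forall>c\<in>?C. residue_slice s c ((shift_sum s ^^ n) f) = (\<lambda>l. 0))"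
      using residue_slices_eq_0[OF s F_shift_sum_pow[OF f]] by (auto simp: residue_slice_def fun_eq_iff)
    also have "\<dots> \<longleftrightarrow> (\<forall>c\<in>?C. residue_slice s c f \<in> K n (map2 (residue_count s) c as))"
      unfolding residue_slice_shift_sum_pow K_def using residue_slice_F[OF f] by (auto simp: fun_eq_iff)
    finally show ?thesis .
  qed
  have "bij_betw (\<lambda>f. \<lambda>c\<in>?C. residue_slice s c f) ?Y (\<Pi>\<^sub>E c\<in>?C. K n (map2 (residue_count s) c as))"
  proof (rule bij_betwI[where g="?G"])
    show "(\<lambda>f. \<lambda>c\<in>?C. residue_slice s c f) \<in> ?Y \<rightarrow> (\<Pi>\<^sub>E c\<in>?C. K n (map2 (residue_count s) c as))"
    proof
      fix f assume "f \<in> ?Y"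
      then have "f \<in> F as" "\<forall>l. (shift_sum s ^^ n) f l = 0" by auto
      then show "(\<lambda>c\<in>?C. residue_slice s c f) \<in> (\<Pi>\<^sub>E c\<in>?C. K n (map2 (residue_count s) c as))"
        using iff by simp
    qed
    have slice: "residue_slice s c (?G h) = h c"
      if h: "h \<in> (\<Pi>\<^sub>E c\<in>?C. K n (map2 (residue_count s) c as))" and c: "c \<in> ?C" for h c
    proof
      fix l
      have hc: "h c l' = 0" if "l' \<notin> box (map2 (residue_count s) c as)" for l'
        using PiE_mem[OF h c] that by (simp add: K_def F_def)
      have len: "length as = length c" using box_length[OF c] by simp
      show "residue_slice s c (?G h) l = h c l"
      proof (cases "length l = length c")
        case True
        then show ?thesis
          using interleave_box[OF len True c] hc by (simp add: residue_slice_def)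
      next
        case False
        then have "l \<notin> box (map2 (residue_count s) c as)" using box_length[of l] len by fastforce
        then show ?thesis using False hc by (simp add: residue_slice_def)
      qed
    qed
    show "?G \<in> (\<Pi>\<^sub>E c\<in>?C. K n (map2 (residue_count s) c as)) \<rightarrow> ?Y"
    proof
      fix h assume h: "h \<in> (\<Pi>\<^sub>E c\<in>?C. K n (map2 (residue_count s) c as))"
      have "?G h l \<in> A" for l
      proof (cases "l \<in> box as")
        case True
        then have "map (\<lambda>x. x mod s) l \<in> ?C" using residues_in_box[OF s, of l] box_length[OF True] by simp
        then show ?thesis using PiE_mem[OF h] True by (auto simp: K_def F_def)
      qed simp
      then have G: "?G h \<in> F as" by (auto simp: F_def)
      moreover have "\<forall>l. (shift_sum s ^^ n) (?G h) l = 0"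
        unfolding iff[OF G] using slice[OF h] PiE_mem[OF h] by simp
      ultimately show "?G h \<in> ?Y" by blast
    qed
    show "(\<lambda>c\<in>?C. residue_slice s c (?G h)) = h" if "h \<in> (\<Pi>\<^sub>E c\<in>?C. K n (map2 (residue_count s) c as))" for h
      using slice[OF that] PiE_arb[OF that] by (auto simp: fun_eq_iff)
    show "?G (\<lambda>c\<in>?C. residue_slice s c f) = f" if "f \<in> ?Y" for f
    proof
      fix l
      show "?G (\<lambda>c\<in>?C. residue_slice s c f) l = f l"
      proof (cases "l \<in> box as")
        case True
        then show ?thesis
          using residues_in_box[OF s, of l] box_length[OF True] interleave_mod_div[OF s, of l]
          by (simp add: residue_slice_def)
      next
        case False
        then show ?thesis using that by (simp add: F_def)
      qed
    qed
  qed
  from bij_betw_same_card[OF this] show ?thesis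
    using card_PiE[of ?C "\<lambda>c. K n (map2 (residue_count s) c as)"] by simp
qed

section \<open>Powers of the shift operator and the Frobenius rule\<close>

lemma pascal_sum:
  fixes Y :: "nat \<Rightarrow> nat \<Rightarrow> 'r"
  shows "(\<Sum>i\<le>n. of_nat (n choose i) * Y (Suc i) (n - i)) + (\<Sum>i\<le>n. of_nat (n choose i) * Y i (Suc n - i))
    = (\<Sum>i\<le>Suc n. of_nat (Suc n choose i) * Y i (Suc n - i))"
proof -
  have "(\<Sum>i\<le>Suc n. of_nat (Suc n choose i) * Y i (Suc n - i)) =
    Y 0 (Suc n) + (\<Sum>i\<le>n. of_nat (Suc n choose Suc i) * Y (Suc i) (n - i))"
    by (subst sum.atMost_Suc_shift) simp
  also have "(\<Sum>i\<le>n. of_nat (Suc n choose Suc i) * Y (Suc i) (n - i)) =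
     (\<Sum>i\<le>n. of_nat (n choose i) * Y (Suc i) (n - i)) + (\<Sum>i\<le>n. of_nat (n choose Suc i) * Y (Suc i) (n - i))"
    by (simp add: algebra_simps sum.distrib)
  also have "Y 0 (Suc n) + (\<dots>) = (\<Sum>i\<le>n. of_nat (n choose i) * Y (Suc i) (n - i)) +
    (Y 0 (Suc n) + (\<Sum>i\<le>n. of_nat (n choose Suc i) * Y (Suc i) (n - i)))" by simp
  also have "Y 0 (Suc n) + (\<Sum>i\<le>n. of_nat (n choose Suc i) * Y (Suc i) (n - i)) =
    (\<Sum>i\<le>Suc n. of_nat (n choose i) * Y i (Suc n - i))"
    by (subst sum.atMost_Suc_shift) simp
  also have "\<dots> = (\<Sum>i\<le>n. of_nat (n choose i) * Y i (Suc n - i))"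
    by (simp add: binomial_eq_0)
  finally show ?thesis by simp
qed

text \<open>Raising the first entry commutes with the shift sum of the tail, so powers of their sum
  expand binomially.\<close>

lemma shift_sum_pow_Cons:
  "(shift_sum 1 ^^ n) f (j # l) =
    (\<Sum>i\<le>n. of_nat (n choose i) * (shift_sum 1 ^^ (n - i)) (\<lambda>l. f ((j + i) # l)) (l :: nat list) :: 'r)"
proof (induction n arbitrary: j l)
  case (Suc n)
  have sm: "shift_sum 1 (\<lambda>l. \<Sum>i\<le>n. Y i l) l = (\<Sum>i\<le>n. shift_sum 1 (Y i) l)" for n and Y :: "nat \<Rightarrow> nat list \<Rightarrow> 'r" and l
    by (induction n) (simp_all add: shift_sum_add)
  have "(shift_sum 1 ^^ Suc n) f (j # l) = (shift_sum 1 ^^ n) f ((j + 1) # l) +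
    shift_sum 1 (\<lambda>l. (shift_sum 1 ^^ n) f (j # l)) l" by simp
  also have "(shift_sum 1 ^^ n) f ((j + 1) # l) =
    (\<Sum>i\<le>n. of_nat (n choose i) * (shift_sum 1 ^^ (n - i)) (\<lambda>l. f ((j + Suc i) # l)) l)"
    unfolding Suc by (simp add: add.assoc One_nat_def)
  also have "shift_sum 1 (\<lambda>l. (shift_sum 1 ^^ n) f (j # l)) l =
    (\<Sum>i\<le>n. of_nat (n choose i) * (shift_sum 1 ^^ (Suc n - i)) (\<lambda>l. f ((j + i) # l)) l)"
    unfolding Suc sm shift_sum_mult by (rule sum.cong) (simp_all add: Suc_diff_le)
  finally show ?case
    using pascal_sum[of n "\<lambda>i m. (shift_sum 1 ^^ m) (\<lambda>l. f ((j + i) # l)) l"] by simp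
qed simp

lemma shift_sum_A: "(\<And>l. f l \<in> A) \<Longrightarrow> shift_sum s f l \<in> A"
  by (induction s f l rule: shift_sum.induct) (auto simp: A_add)

lemma shift_sum_pow_A: "(\<And>l. f l \<in> A) \<Longrightarrow> (shift_sum s ^^ n) f l \<in> A"
  by (induction n arbitrary: l) (auto intro: shift_sum_A)

text \<open>All binomial coefficients except the two outer ones are divisible by \<open>p\<close>
  and kill \<open>A\<close>; the p-th power of the sum of the variables is the sum of their p-th
  powers.\<close>

lemma shift_sum_pow_p:
  assumes "\<And>l. f l \<in> A"
  shows "(shift_sum 1 ^^ p) f l = shift_sum p f l"
  using assms
proof (induction l arbitrary: f)
  case Nil
  then show ?case using p_gt_0 by (cases p) auto
next
  case (Cons j l)
  let ?t = "\<lambda>i. of_nat (p choose i) * (shift_sum 1 ^^ (p - i)) (\<lambda>l. f ((j + i) # l)) l"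
  have "?t i = 0" if "i \<in> {..p} - {0, p}" for i
  proof -
    have "p dvd (p choose i)" using that p by (auto intro: dvd_choose_prime)
    then show ?thesis using p_dvd_mult shift_sum_pow_A[of "\<lambda>l. f ((j + i) # l)"] Cons.prems by blast
  qed
  then have "(\<Sum>i\<le>p. ?t i) = (\<Sum>i\<in>{0, p}. ?t i)" by (intro sum.mono_neutral_right) auto
  also have "\<dots> = (shift_sum 1 ^^ p) (\<lambda>l. f (j # l)) l + f ((j + p) # l)" using p_gt_0 by simp
  finally show ?case
    using Cons.IH[of "\<lambda>l. f (j # l)"] Cons.prems by (simp add: shift_sum_pow_Cons)
qed

text \<open>The power \<open>p * a\<close> of the operator is the power \<open>a\<close> of
  \<open>shift_sum p\<close>. Splitting by residues modulo \<open>p\<close> gives one copy of the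
  box \<open>as\<close> for each of the p^(length as) residue vectors, as every residue class has
  exactly \<open>a\<close> members below \<open>p * a\<close>.\<close>

lemma card_K_frobenius:
  "card (K 1 (p * a # map ((*) p) as)) = card (K 1 (a # as)) ^ (p ^ length as)"
proof -
  have pow: "(shift_sum 1 ^^ (p * n)) f = (shift_sum p ^^ n) f" if "f \<in> F bs" for f n bs
  proof (induction n)
    case (Suc n)
    have "(shift_sum p ^^ n) f l \<in> A" for l using F_shift_sum_pow[OF that] by (simp add: F_def)
    then have "(shift_sum 1 ^^ p) ((shift_sum p ^^ n) f) = shift_sum p ((shift_sum p ^^ n) f)"
      using shift_sum_pow_p by blast
    then show ?case by (simp add: Suc funpow_add)
  qed simp
  have "card (K 1 (p * a # map ((*) p) as)) =
      card {f \<in> F (map ((*) p) as). \<forall>l. (shift_sum p ^^ a) f l = 0}"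
  proof -
    have "K (p * a) (map ((*) p) as) = {f \<in> F (map ((*) p) as). \<forall>l. (shift_sum p ^^ a) f l = 0}"
      unfolding K_def using pow by auto
    then show ?thesis unfolding card_K_Cons by simp
  qed
  also have "\<dots> = (\<Prod>c\<in>box (replicate (length as) p).
      card (K a (map2 (residue_count p) c (map ((*) p) as))))"
    using card_residues[OF p_gt_0, of "map ((*) p) as" a] by simp
  also have "\<dots> = (\<Prod>c\<in>box (replicate (length as) p). card (K a as))"
  proof (rule prod.cong)
    fix c assume "c \<in> box (replicate (length as) p)"
    then have "map2 (residue_count p) c (map ((*) p) as) = as"
    proof (induction as arbitrary: c)
      case (Cons a as)
      then obtain x c' where c: "c = x # c'" "x < p" "c' \<in> box (replicate (length as) p)"
        by (auto simp: box_Cons)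
      have "residue_count p x (p * a) = (p * a + (p - 1 - x)) div p"
        using c(2) by (simp add: residue_count_def)
      also have "\<dots> = a" by (rule div_nat_eqI) (use c(2) in auto)
      finally show ?case using Cons.IH[OF c(3)] by (simp add: c(1))
    qed simp
    then show "card (K a (map2 (residue_count p) c (map ((*) p) as))) = card (K a as)" by simp
  qed simp
  also have "\<dots> = card (K 1 (a # as)) ^ (p ^ length as)"
    by (simp add: card_box card_K_Cons)
  finally show ?thesis .
qed

text \<open>In the next lemma the quotient of the two sides is \<open>card W' / card W\<close>, where \<open>W\<close> and \<open>W'\<close>
  consist of the slices at first index \<open>a\<close> and second index \<open>0\<close>; shifting in the second index shows
  \<open>\<Lambda> W' \<subseteq> W\<close>.\<close>

lemma card_K_second_difference:
  shows "card (K 1 (Suc a # b # cs)) * card (K 1 (a # Suc b # cs))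
      \<le> card (K 1 (Suc a # Suc b # cs)) * card (K 1 (a # b # cs))" (is ?A)
    and "card (K 1 (Suc a # Suc b # cs)) * card (K 1 (a # b # cs))
      \<le> card (K 1 (Suc a # b # cs)) * card (K 1 (a # Suc b # cs)) * card (K 1 cs)" (is ?B)
proof -
  define \<rho> where "\<rho> f = (\<lambda>l. f (a # 0 # l))" for f :: "nat list \<Rightarrow> 'r"
  have slice: "f (a # j # l) = (-1) ^ j * (shift_sum 1 ^^ j) (\<rho> f) l"
    if f: "f \<in> K 1 (Suc a # b # cs)" for f b j l
  proof -
    have "(\<lambda>l. f (a # l)) \<in> K 1 (b # cs)"
    proof -
      have fF: "f \<in> F (Suc a # b # cs)" and s: "shift_sum 1 f (a # l) = 0" for l
        using f unfolding K_1_iff by blast+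
      have "f (Suc a # l) = 0" for l using fF unfolding F_Cons_iff[of f "Suc a"] by simp
      then have "shift_sum 1 (\<lambda>l. f (a # l)) l = 0" for l using s[of l] by (simp flip: Suc_eq_plus1)
      then show ?thesis using F_slice[OF fF] by (simp add: K_1_iff)
    qed
    from fun_cong[OF K_slice[OF this, of j], of l] show ?thesis by (simp add: \<rho>_def)
  qed
  \<comment> \<open>\<open>\<rho>\<close> evaluates the top slice at second index 0, and by
    \<open>slice\<close> this value determines the whole top slice. Hence \<open>card (W b)\<close>
    below is the quotient of the orders for \<open>Suc a\<close> and \<open>a\<close>, and both
    claims become comparisons of \<open>W (Suc b)\<close> with \<open>W b\<close>.\<close>
  have kernel: "{f \<in> K 1 (Suc a # b # cs). \<rho> f = 0} = K 1 (a # b # cs)" for b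
  proof (intro equalityI subsetI)
    fix f assume f: "f \<in> {f \<in> K 1 (Suc a # b # cs). \<rho> f = 0}"
    then have r: "\<rho> f = (\<lambda>l. 0)" and fK: "f \<in> K 1 (Suc a # b # cs)" by (auto simp: fun_eq_iff)
    have "f (a # j # l) = 0" for j l using slice[OF fK, of j l] by (simp add: r shift_sum_pow_zero)
    moreover have "f [a] = 0" using fK by (simp add: K_1_iff F_def)
    ultimately have "f (a # l) = 0" for l by (cases l) auto
    then have "f (j # l) = 0" if "j \<ge> a" for j l
      using that fK unfolding K_1_iff F_Cons_iff[of f "Suc a"] by (cases "j = a") auto
    then show "f \<in> K 1 (a # b # cs)"
      using fK unfolding K_1_iff F_Cons_iff[of f "Suc a"] F_Cons_iff[of f a] by blast
  next
    fix f assume "f \<in> K 1 (a # b # cs)"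
    then have *: "f \<in> F (a # b # cs)" "\<forall>l. shift_sum 1 f l = 0" unfolding K_1_iff by blast+
    then have "\<rho> f = 0" unfolding F_Cons_iff[of f a] by (auto simp: \<rho>_def)
    moreover have "f \<in> F (Suc a # b # cs)" using *(1) unfolding F_Cons_iff[of f a] F_Cons_iff[of f "Suc a"] by simp
    ultimately show "f \<in> {f \<in> K 1 (Suc a # b # cs). \<rho> f = 0}"
      using *(2) by (simp add: K_1_iff)
  qed
  define W where "W b = \<rho> ` K 1 (Suc a # b # cs)" for b
  have img: "card (K 1 (Suc a # b # cs)) = card (K 1 (a # b # cs)) * card (W b)" for b
    using card_additive_image[of "K 1 (Suc a # b # cs)" \<rho>] K_diff[of _ 1 "Suc a # b # cs"]
    unfolding kernel W_def by (simp add: fun_diff_def \<rho>_def)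
  have "K 1 (Suc a # b # cs) \<subseteq> K 1 (Suc a # Suc b # cs)"
  proof
    fix f assume "f \<in> K 1 (Suc a # b # cs)"
    then show "f \<in> K 1 (Suc a # Suc b # cs)"
      unfolding K_1_iff F_Cons_iff[of f] F_Cons_iff[of "\<lambda>l. f (_ # l)"] by simp
  qed
  then have WW: "W b \<subseteq> W (Suc b)" by (auto simp: W_def)
  have fin: "finite (W b)" for b by (simp add: W_def)
  have WF: "W b \<subseteq> F cs" for b
  proof
    fix g assume "g \<in> W b"
    then obtain f where f: "f \<in> K 1 (Suc a # b # cs)" "g = \<rho> f" unfolding W_def by blast
    then show "g \<in> F cs" using F_slice[OF F_slice[of f "Suc a" "b # cs" a], of 0] by (simp add: K_1_iff \<rho>_def)
  qed
  have shiftW: "shift_sum 1 g \<in> W b" if "g \<in> W (Suc b)" for g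
  proof -
    obtain f where f: "f \<in> K 1 (Suc a # Suc b # cs)" "g = \<rho> f"
      using \<open>g \<in> W (Suc b)\<close> unfolding W_def by blast
    \<comment> \<open>Lowering the second index by one preserves the kernel condition. With this
      sign the slice formula at index 1 turns the value of \<open>\<rho>\<close> into the shift sum
      of \<open>g\<close>.\<close>
    define f' where "f' = (\<lambda>l. case l of i # j # l \<Rightarrow> - f (i # Suc j # l) | _ \<Rightarrow> 0)"
    have fF: "f \<in> F (Suc a # Suc b # cs)" and s: "shift_sum 1 f l = 0" for l
      using f(1) unfolding K_1_iff by blast+
    have "f' l \<in> A" for l using fF by (auto simp: f'_def F_def A_minus split: list.split)
    moreover have "f' l = 0" if "l \<notin> box (Suc a # b # cs)" for l
      using fF that by (auto simp: f'_def F_def box_Cons split: list.split)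
    ultimately have "f' \<in> F (Suc a # b # cs)" by (simp add: F_def)
    moreover have "shift_sum 1 f' l = 0" for l
    proof (cases l)
      case (Cons i l')
      show ?thesis
      proof (cases l')
        case (Cons j l'')
        have "shift_sum 1 f (i # Suc j # l'') = 0" by (rule s)
        then have "- shift_sum 1 f (i # Suc j # l'') = 0" by simp
        then show ?thesis unfolding \<open>l = i # l'\<close> Cons
          by (simp add: f'_def shift_sum_minus algebra_simps)
      qed (simp add: \<open>l = i # l'\<close> f'_def)
    qed simp
    ultimately have "f' \<in> K 1 (Suc a # b # cs)" by (simp add: K_1_iff)
    moreover have "shift_sum 1 g = \<rho> f'"
      using slice[OF f(1), of 1] by (auto simp: \<rho>_def f'_def f(2) One_nat_def fun_eq_iff)
    ultimately show ?thesis unfolding W_def by blast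
  qed
  have Wdiff: "(\<lambda>l. g l - h l) \<in> W b" if "g \<in> W b" "h \<in> W b" for g h b
  proof -
    obtain f f' where "f \<in> K 1 (Suc a # b # cs)" "f' \<in> K 1 (Suc a # b # cs)" "g = \<rho> f" "h = \<rho> f'"
      using \<open>g \<in> W b\<close> \<open>h \<in> W b\<close> unfolding W_def by blast
    then have "(\<lambda>l. f l - f' l) \<in> K 1 (Suc a # b # cs)" "(\<lambda>l. g l - h l) = \<rho> (\<lambda>l. f l - f' l)"
      using K_diff by (auto simp: \<rho>_def)
    then show ?thesis unfolding W_def by blast
  qed
  \<comment> \<open>The shift sum maps \<open>W (Suc b)\<close> into \<open>W b\<close>, and its
    kernel there lies in \<open>K 1 cs\<close>; this is where the factor
    \<open>card (K 1 cs)\<close> comes from.\<close>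
  have "card (W (Suc b)) = card {g \<in> W (Suc b). shift_sum 1 g = 0} * card (shift_sum 1 ` W (Suc b))"
    by (rule card_additive_image) (auto simp: fin Wdiff fun_diff_def shift_sum_diff)
  also have "\<dots> \<le> card (K 1 cs) * card (W b)"
  proof (rule mult_le_mono)
    show "card {g \<in> W (Suc b). shift_sum 1 g = 0} \<le> card (K 1 cs)"
    proof (rule card_mono)
      show "{g \<in> W (Suc b). shift_sum 1 g = 0} \<subseteq> K 1 cs"
        using subsetD[OF WF[of "Suc b"]] by (auto simp: K_1_iff fun_eq_iff)
    qed simp
    show "card (shift_sum 1 ` W (Suc b)) \<le> card (W b)"
      by (rule card_mono) (use shiftW fin in auto)
  qed
  finally have "card (W (Suc b)) \<le> card (K 1 cs) * card (W b)" .
  then show ?B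
    using mult_le_mono2[of _ _ "card (K 1 (a # Suc b # cs)) * card (K 1 (a # b # cs))"]
    unfolding img[of "Suc b"] img[of b] by (fastforce simp: algebra_simps)
  show ?A
    using mult_le_mono2[OF card_mono[OF fin WW], of "card (K 1 (a # Suc b # cs)) * card (K 1 (a # b # cs))"]
    unfolding img[of "Suc b"] img[of b] by (simp add: algebra_simps)
qed

end

section \<open>The algebra of tensor products\<close>

text \<open>\<open>D M\<close> stands for the number of Jordan blocks of the tensor product of nilpotent Jordan blocks of
  sizes \<open>a \<in># M\<close> in characteristic \<open>p\<close>. Formal combinations of such products form a ring; as \<open>null\<close> is
  an ideal, identities modulo \<open>null\<close> may be multiplied.\<close>

locale block_count =
  fixes p n :: nat and D :: "nat multiset \<Rightarrow> real"
  assumes p_eq: "p = 2 * n + 1" and n_pos: "n \<ge> 1"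
    and D_single: "a \<ge> 1 \<Longrightarrow> D {#a#} = 1"
    and D_0: "0 \<in># M \<Longrightarrow> D M = 0"
    and D_1: "D (add_mset 1 M) = D M"
    and D_2: "\<not> p dvd m \<Longrightarrow> D (add_mset 2 (add_mset m M)) = D (add_mset (m + 1) M) + D (add_mset (m - 1) M)"
    and D_2_dvd: "p dvd m \<Longrightarrow> D (add_mset 2 (add_mset m M)) = 2 * D (add_mset m M)"
    and D_frobenius: "M \<noteq> {#} \<Longrightarrow> D (image_mset ((*) p) M) = p ^ (size M - 1) * D M"
    and D_second_difference:
      "0 \<le> D (add_mset (a + 1) (add_mset (b + 1) M)) - D (add_mset (a + 1) (add_mset b M))
        - D (add_mset a (add_mset (b + 1) M)) + D (add_mset a (add_mset b M))"
      "D (add_mset (a + 1) (add_mset (b + 1) M)) - D (add_mset (a + 1) (add_mset b M))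
        - D (add_mset a (add_mset (b + 1) M)) + D (add_mset a (add_mset b M)) \<le> D M"
    and D_le: "D (add_mset a M) \<le> prod_mset M"
begin

type_synonym tensors = "nat multiset \<Rightarrow>\<^sub>0 real"

definition tmon :: "nat multiset \<Rightarrow> tensors" where "tmon M = Poly_Mapping.single M 1"

definition del :: "nat \<Rightarrow> tensors" where "del a = tmon {#a#}"

definition L :: "tensors \<Rightarrow> real" where
  "L g = (\<Sum>M\<in>Poly_Mapping.keys g. Poly_Mapping.lookup g M * D M)"

lemma L_superset: "finite S \<Longrightarrow> Poly_Mapping.keys g \<subseteq> S \<Longrightarrow> L g = (\<Sum>M\<in>S. Poly_Mapping.lookup g M * D M)"
  unfolding L_def by (rule sum.mono_neutral_left) (auto simp: in_keys_iff)

lemma L_add: "L (g + h) = L g + L h"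
proof -
  let ?S = "Poly_Mapping.keys g \<union> Poly_Mapping.keys h"
  have "Poly_Mapping.keys (g + h) \<subseteq> ?S" by (rule keys_add)
  then have "L (g + h) = (\<Sum>M\<in>?S. Poly_Mapping.lookup (g + h) M * D M)" by (intro L_superset) auto
  also have "\<dots> = (\<Sum>M\<in>?S. Poly_Mapping.lookup g M * D M) + (\<Sum>M\<in>?S. Poly_Mapping.lookup h M * D M)"
    by (simp add: lookup_add algebra_simps sum.distrib)
  also have "\<dots> = L g + L h" by (subst (1 2) L_superset[of ?S]) auto
  finally show ?thesis .
qed

lemma L_minus: "L (- g) = - L g"
  by (simp add: L_def sum_negf)

lemma L_diff: "L (g - h) = L g - L h"
  using L_add[of g "- h"] by (simp add: L_minus)

lemma L_0 [simp]: "L 0 = 0" by (simp add: L_def)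

lemma L_sum: "L (sum f S) = (\<Sum>i\<in>S. L (f i))"
  by (induction S rule: infinite_finite_induct) (auto simp: L_add)

lemma L_single: "L (Poly_Mapping.single M c) = c * D M"
  by (subst L_superset[of "{M}"]) auto

lemma L_tmon [simp]: "L (tmon M) = D M"
  by (simp add: tmon_def L_single)

lemma tmon_mult: "tmon M * tmon N = tmon (M + N)"
  by (simp add: tmon_def mult_single)

lemma del_mult_tmon: "del a * tmon M = tmon (add_mset a M)"
  by (simp add: del_def tmon_mult)

lemma L_of_nat_mult: "L (of_nat m * g) = real m * L g"
  by (induction m) (auto simp: algebra_simps L_add)

lemma expansion: "g = (\<Sum>M\<in>Poly_Mapping.keys g. Poly_Mapping.single M (Poly_Mapping.lookup g M))"
  by (rule poly_mapping_eqI) (auto simp: lookup_sum lookup_single when_def in_keys_iff sum.delta)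

text \<open>The radical of the bilinear form \<open>L (g * h)\<close>; by linearity it suffices to
  test against monomials.\<close>

definition null :: "tensors set" where "null = {g. \<forall>M. L (g * tmon M) = 0}"

lemma nullI: "(\<And>M. L (g * tmon M) = 0) \<Longrightarrow> g \<in> null"
  by (simp add: null_def)

lemma null_mult: assumes "g \<in> null" shows "g * h \<in> null" "h * g \<in> null"
proof -
  have L0: "L (g * h) = 0" for h
  proof -
    have "L (g * Poly_Mapping.single M c) = 0" for M c
    proof -
      have "g * Poly_Mapping.single M c = Poly_Mapping.single 0 c * (g * tmon M)"
        by (simp add: tmon_def mult_single mult.left_commute)
      moreover have "L (Poly_Mapping.single 0 c * f) = c * L f" for f
      proof -
        have "Poly_Mapping.single 0 c * f = (\<Sum>M\<in>Poly_Mapping.keys f. Poly_Mapping.single M (c * Poly_Mapping.lookup f M))"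
          by (subst expansion[of f]) (simp add: sum_distrib_left mult_single)
        then have "L (Poly_Mapping.single 0 c * f) = (\<Sum>M\<in>Poly_Mapping.keys f. c * (Poly_Mapping.lookup f M * D M))"
          by (simp add: L_sum L_single mult.assoc)
        then show ?thesis by (simp add: L_def sum_distrib_left)
      qed
      ultimately show ?thesis using assms by (simp add: null_def)
    qed
    then show ?thesis by (subst expansion[of h]) (simp add: sum_distrib_left L_sum)
  qed
  then show "g * h \<in> null" by (intro nullI) (simp add: mult.assoc)
  then show "h * g \<in> null" by (simp add: mult.commute)
qed

lemma null_add: "g \<in> null \<Longrightarrow> h \<in> null \<Longrightarrow> g + h \<in> null"
  by (simp add: null_def algebra_simps L_add)

lemma null_minus: "g \<in> null \<Longrightarrow> - g \<in> null"
  by (simp add: null_def L_minus)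

lemma null_diff: "g \<in> null \<Longrightarrow> h \<in> null \<Longrightarrow> g - h \<in> null"
  using null_add[of g "- h"] null_minus[of h] by simp

lemma null_0 [simp]: "0 \<in> null" by (simp add: null_def)

lemma null_sum: "(\<And>i. i \<in> S \<Longrightarrow> f i \<in> null) \<Longrightarrow> sum f S \<in> null"
  by (induction S rule: infinite_finite_induct) (auto simp: null_add)

lemma L_null: "g \<in> null \<Longrightarrow> L g = 0"
proof -
  assume "g \<in> null"
  then have "L (g * tmon {#}) = 0" by (simp add: null_def)
  then show ?thesis by (simp add: tmon_def)
qed

lemma L_eq: "g - h \<in> null \<Longrightarrow> L g = L h"
  using L_null[of "g - h"] by (simp add: L_diff)

lemma null_diff_mult: "g - h \<in> null \<Longrightarrow> g * k - h * k \<in> null"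
  using null_mult(1)[of "g - h" k] by (simp add: algebra_simps)

section \<open>Relations between the classes of single blocks\<close>

lemma del_0: "del 0 \<in> null"
  by (rule nullI) (simp add: del_mult_tmon D_0)

lemma del_1: "del 1 - 1 \<in> null"
  by (rule nullI) (simp add: left_diff_distrib L_diff del_mult_tmon D_1)

lemma del_2: "\<not> p dvd m \<Longrightarrow> del 2 * del m - del (m + 1) - del (m - 1) \<in> null"
  by (rule nullI) (simp add: left_diff_distrib L_diff mult.assoc del_mult_tmon D_2)

lemma del_2_dvd: "p dvd m \<Longrightarrow> del 2 * del m - of_nat 2 * del m \<in> null"
  by (rule nullI) (simp add: left_diff_distrib L_diff mult.assoc del_mult_tmon D_2_dvd L_of_nat_mult
      del: of_nat_numeral)

lemma p_pos: "p > 0" and p_gt_2: "p > 2" using p_eq n_pos by auto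

lemma not_p_dvd: "0 < j \<Longrightarrow> j < p \<Longrightarrow> \<not> p dvd p * b + j"
  by (metis dvd_add_right_iff dvd_triv_left nat_dvd_not_less)

text \<open>Below \<open>p\<close> the classes obey the Chebyshev recursion in \<open>del 2\<close>.
  On \<open>del (p * b)\<close> the class \<open>del 2\<close> acts as the number 2, and there the
  recursion with initial values 0 and 1 has the solution \<open>j\<close>.\<close>

lemma del_mult_del_p:
  assumes "j \<le> p"
  shows "del j * del (p * b) - of_nat j * del (p * b) \<in> null"
  using assms
proof (induction j rule: induct_nat_012)
  case 0
  then show ?case using null_mult[OF del_0] by simp
next
  case 1
  then show ?case using null_diff_mult[OF del_1, of "del (p * b)"] by (simp add: One_nat_def)
next
  case (ge2 j)
  have "\<not> p dvd Suc j" using not_p_dvd[of "Suc j" 0] ge2.prems by simp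
  then have 1: "del 2 * del (Suc j) - del (Suc (Suc j)) - del j \<in> null" using del_2[of "Suc j"] by (simp add: One_nat_def)
  have 2: "del 2 * del (p * b) - of_nat 2 * del (p * b) \<in> null" by (rule del_2_dvd) simp
  have 3: "del j * del (p * b) - of_nat j * del (p * b) \<in> null" using ge2 by simp
  have 4: "del (Suc j) * del (p * b) - of_nat (Suc j) * del (p * b) \<in> null" using ge2 by simp
  have "del (Suc (Suc j)) * del (p * b) - of_nat (Suc (Suc j)) * del (p * b) =
     - ((del 2 * del (Suc j) - del (Suc (Suc j)) - del j) * del (p * b))
     + (del (Suc j) * del (p * b) - of_nat (Suc j) * del (p * b)) * del 2
     + of_nat (Suc j) * (del 2 * del (p * b) - of_nat 2 * del (p * b))
     - (del j * del (p * b) - of_nat j * del (p * b))"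
    by (simp add: algebra_simps)
  also have "\<dots> \<in> null"
    by (intro null_diff null_add null_minus null_mult 1 2 3 4)
  finally show ?case .
qed

definition kap :: "nat \<Rightarrow> tensors" where "kap b = del (p * b + 1) - del (p * b)"

text \<open>Both sides satisfy the same recursion under \<open>del 2\<close> and agree at
  \<open>j = 0\<close> and \<open>j = 1\<close>. The recursion breaks only at multiples of
  \<open>p\<close>, so the range extends exactly to the next multiple.\<close>

lemma del_block:
  assumes "j \<le> p"
  shows "del (p * b + j) - (del (p * b) + del j * kap b) \<in> null"
  using assms
proof (induction j rule: induct_nat_012)
  case 0
  then show ?case using null_minus[OF null_mult(1)[OF del_0, of "kap b"]] by simp
next
  case 1
  have "del (p * b + 1) - (del (p * b) + del 1 * kap b) = - ((del 1 - 1) * kap b)"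
    by (simp add: kap_def algebra_simps)
  then show ?case using null_minus[OF null_mult(1)[OF del_1, of "kap b"]] by (simp add: One_nat_def)
next
  case (ge2 j)
  have "\<not> p dvd Suc j" using not_p_dvd[of "Suc j" 0] ge2.prems by simp
  then have 1: "del 2 * del (Suc j) - del (Suc (Suc j)) - del j \<in> null" using del_2[of "Suc j"] by (simp add: One_nat_def)
  have "\<not> p dvd p * b + Suc j" using not_p_dvd[of "Suc j" b] ge2.prems by simp
  then have 5: "del 2 * del (p * b + Suc j) - del (p * b + Suc (Suc j)) - del (p * b + j) \<in> null"
    using del_2[of "p * b + Suc j"] by (simp add: One_nat_def)
  have 2: "del 2 * del (p * b) - of_nat 2 * del (p * b) \<in> null" by (rule del_2_dvd) simp
  have 3: "del (p * b + j) - (del (p * b) + del j * kap b) \<in> null" using ge2 by simp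
  have 4: "del (p * b + Suc j) - (del (p * b) + del (Suc j) * kap b) \<in> null" using ge2 by simp
  have "del (p * b + Suc (Suc j)) - (del (p * b) + del (Suc (Suc j)) * kap b) =
    - (del 2 * del (p * b + Suc j) - del (p * b + Suc (Suc j)) - del (p * b + j))
    + (del (p * b + Suc j) - (del (p * b) + del (Suc j) * kap b)) * del 2
    - (del (p * b + j) - (del (p * b) + del j * kap b))
    + (del 2 * del (p * b) - of_nat 2 * del (p * b))
    + (del 2 * del (Suc j) - del (Suc (Suc j)) - del j) * kap b"
    by (simp add: algebra_simps)
  also have "\<dots> \<in> null"
    by (intro null_diff null_add null_minus null_mult 1 2 3 4 5)
  finally show ?case .
qed

text \<open>A combination of total dimension zero. As \<open>del (p * b)\<close> turns classes of
  size at most \<open>p\<close> into their dimensions, it annihilates \<open>eps t\<close>, and this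
  decouples \<open>eps\<close> from blocks of size divisible by \<open>p\<close>.\<close>

definition eps :: "nat \<Rightarrow> tensors" where "eps t = del t + del (p - t) - del p"

lemma eps_sym: "t \<le> p \<Longrightarrow> eps (p - t) = eps t"
  by (simp add: eps_def)

lemma eps_mult_del_p:
  assumes "t \<le> p"
  shows "eps t * del (p * b) \<in> null"
proof -
  have "eps t * del (p * b) = (del t * del (p * b) - of_nat t * del (p * b)) +
      (del (p - t) * del (p * b) - of_nat (p - t) * del (p * b)) -
      (del p * del (p * b) - of_nat p * del (p * b))"
    using assms by (simp add: eps_def algebra_simps of_nat_diff)
  also have "\<dots> \<in> null" by (intro null_diff null_add del_mult_del_p) (use assms in auto)
  finally show ?thesis .
qed

lemma eps_0: "eps 0 \<in> null"
  using del_0 by (simp add: eps_def)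

lemma eps_2:
  assumes "0 < t" "t < p"
  shows "del 2 * eps t - eps (t + 1) - eps (t - 1) \<in> null"
proof -
  have 1: "del 2 * del t - del (t + 1) - del (t - 1) \<in> null"
    by (rule del_2) (use not_p_dvd[of t 0] assms in auto)
  have 2: "del 2 * del (p - t) - del (p - t + 1) - del (p - t - 1) \<in> null"
    by (rule del_2) (use not_p_dvd[of "p - t" 0] assms in auto)
  have 3: "del 2 * del p - of_nat 2 * del p \<in> null" by (rule del_2_dvd) simp
  have *: "p - (t + 1) = p - t - 1" "p - (t - 1) = p - t + 1" using assms by auto
  have "del 2 * eps t - eps (t + 1) - eps (t - 1) =
    (del 2 * del t - del (t + 1) - del (t - 1)) + (del 2 * del (p - t) - del (p - t + 1) - del (p - t - 1))
    - (del 2 * del p - of_nat 2 * del p)"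
    unfolding eps_def * by (simp add: algebra_simps)
  also have "\<dots> \<in> null" by (intro null_diff[OF null_add[OF 1 2] 3])
  finally show ?thesis .
qed

text \<open>Modulo \<open>del p\<close>, multiplication by the block of size \<open>p - 1\<close> is
  the reflection of \<open>j\<close> to \<open>p - j\<close>. The coefficient of
  \<open>del p\<close> is forced by dimensions: j (p - 1) = (j - 1) p + (p - j).\<close>

lemma del_mult_del_p_minus_1:
  assumes "1 \<le> j" "j \<le> p"
  shows "del j * del (p - 1) - (of_nat (j - 1) * del p + del (p - j)) \<in> null"
proof -
  have "Suc i \<le> p \<Longrightarrow> del (Suc i) * del (p - 1) - (of_nat i * del p + del (p - Suc i)) \<in> null" for i
  proof (induction i rule: induct_nat_012)
    case 0
    then show ?case using null_diff_mult[OF del_1, of "del (p - 1)"] by (simp add: One_nat_def)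
  next
    case 1
    have "\<not> p dvd p - 1" using not_p_dvd[of "p - 1" 0] p_gt_2 by simp
    from del_2[OF this] show ?case using p_pos by (simp add: numeral_2_eq_2 One_nat_def algebra_simps)
  next
    case (ge2 i)
    have "\<not> p dvd Suc (Suc i)" using not_p_dvd[of "Suc (Suc i)" 0] ge2.prems by simp
    then have 1: "del 2 * del (Suc (Suc i)) - del (Suc (Suc (Suc i))) - del (Suc i) \<in> null"
      using del_2[of "Suc (Suc i)"] by (simp add: One_nat_def)
    have 2: "del 2 * del p - of_nat 2 * del p \<in> null" by (rule del_2_dvd) simp
    have 3: "del (Suc i) * del (p - 1) - (of_nat i * del p + del (p - Suc i)) \<in> null" using ge2 by simp
    have 4: "del (Suc (Suc i)) * del (p - 1) - (of_nat (Suc i) * del p + del (p - Suc (Suc i))) \<in> null"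
      using ge2 by simp
    have "\<not> p dvd p - Suc (Suc i)" using not_p_dvd[of "p - Suc (Suc i)" 0] ge2.prems by simp
    from del_2[OF this] have 5: "del 2 * del (p - Suc (Suc i)) - del (p - Suc i) - del (p - Suc (Suc (Suc i))) \<in> null"
      using ge2.prems by (simp add: Suc_diff_Suc One_nat_def)
    have "del (Suc (Suc (Suc i))) * del (p - 1) - (of_nat (Suc (Suc i)) * del p + del (p - Suc (Suc (Suc i)))) =
      - ((del 2 * del (Suc (Suc i)) - del (Suc (Suc (Suc i))) - del (Suc i)) * del (p - 1))
      + (del (Suc (Suc i)) * del (p - 1) - (of_nat (Suc i) * del p + del (p - Suc (Suc i)))) * del 2
      - (del (Suc i) * del (p - 1) - (of_nat i * del p + del (p - Suc i)))
      + of_nat (Suc i) * (del 2 * del p - of_nat 2 * del p)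
      + (del 2 * del (p - Suc (Suc i)) - del (p - Suc i) - del (p - Suc (Suc (Suc i))))"
      by (simp add: algebra_simps)
    also have "\<dots> \<in> null" by (intro null_diff null_add null_minus null_mult 1 2 3 4 5)
    finally show ?case .
  qed
  from this[of "j - 1"] show ?thesis using assms by simp
qed

definition om :: tensors where "om = del n + del (n + 1)"

lemma om_eq: "om = eps n + del p"
proof -
  have "p - n = n + 1" using p_eq by linarith
  then show ?thesis by (simp add: om_def eps_def)
qed

lemma om_mult_del_p: "om * del p - of_nat p * del p \<in> null"
proof -
  have "om * del p - of_nat p * del p = (del n * del (p * 1) - of_nat n * del (p * 1))
    + (del (n + 1) * del (p * 1) - of_nat (n + 1) * del (p * 1))"
    by (simp add: om_def p_eq algebra_simps)
  also have "\<dots> \<in> null" by (intro null_add del_mult_del_p) (auto simp: p_eq)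
  finally show ?thesis .
qed

lemma om_mult_eps_1: "om * eps 1 - of_nat 2 * eps n \<in> null"
proof -
  have 1: "del n * del (p - 1) - (of_nat (n - 1) * del p + del (p - n)) \<in> null"
    by (rule del_mult_del_p_minus_1) (use n_pos p_eq in auto)
  have 2: "del (n + 1) * del (p - 1) - (of_nat n * del p + del (p - (n + 1))) \<in> null"
    using del_mult_del_p_minus_1[of "n + 1"] p_eq by simp
  have *: "p - n = n + 1" "p - (n + 1) = n" using p_eq by auto
  have **: "(of_nat p :: tensors) = 2 * of_nat n + 1" by (subst p_eq) simp
  have "om * eps 1 - of_nat 2 * eps n = (del 1 - 1) * om
     + (del n * del (p - 1) - (of_nat (n - 1) * del p + del (p - n)))
     + (del (n + 1) * del (p - 1) - (of_nat n * del p + del (p - (n + 1))))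
     - (om * del p - of_nat p * del p)"
    unfolding * ** using n_pos by (simp add: eps_def om_def * algebra_simps of_nat_diff)
  also have "\<dots> \<in> null" by (intro null_diff null_add null_mult del_1 1 2 om_mult_del_p)
  finally show ?thesis .
qed

text \<open>The case \<open>t = 1\<close> is the reflection under \<open>del (p - 1)\<close>; larger
  \<open>t\<close> follow from the recursion of \<open>eps\<close> under \<open>del 2\<close>. The
  sum starts at the middle index \<open>n\<close> and runs downwards, which is the change of
  direction of a boustrophedon.\<close>

lemma om_mult_eps:
  "t \<le> n \<Longrightarrow> om * eps t - of_nat 2 * (\<Sum>i<t. eps (n - i)) \<in> null"
proof (induction t rule: induct_nat_012)
  case 0
  then show ?case using null_mult[OF eps_0] by simp
next
  case 1
  then show ?case using om_mult_eps_1 by (simp add: One_nat_def)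
next
  case (ge2 t)
  let ?S = "\<lambda>t. \<Sum>i<t. eps (n - i)"
  have 1: "del 2 * eps (Suc t) - eps (Suc (Suc t)) - eps t \<in> null"
    using eps_2[of "Suc t"] ge2.prems p_eq by (simp add: One_nat_def)
  have 2: "om * eps t - of_nat 2 * ?S t \<in> null" using ge2 by simp
  have 3: "om * eps (Suc t) - of_nat 2 * ?S (Suc t) \<in> null" using ge2 by simp
  have 4: "(\<Sum>i<Suc t. del 2 * eps (n - i) - eps (n - i + 1) - eps (n - i - 1)) \<in> null"
    by (rule null_sum, rule eps_2) (use ge2.prems p_eq in auto)
  \<comment> \<open>The term that leaves the range is folded back by
    \<open>eps (n + 1) = eps n\<close>, the symmetry about \<open>p / 2\<close>.\<close>
  have "(\<Sum>i<Suc t. eps (n - i + 1)) = eps (n + 1) + (\<Sum>i<t. eps (n - Suc i + 1))"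
    by (subst sum.lessThan_Suc_shift) simp
  also have "(\<Sum>i<t. eps (n - Suc i + 1)) = ?S t"
    by (rule sum.cong) (use ge2.prems in \<open>auto simp: Suc_diff_Suc\<close>)
  also have "eps (n + 1) = eps n" using eps_sym[of "n + 1"] p_eq by simp
  finally have 5: "(\<Sum>i<Suc t. eps (n - i + 1)) = eps n + ?S t" .
  have 6: "eps n + (\<Sum>i<Suc t. eps (n - i - 1)) = ?S (Suc (Suc t))"
    by (subst sum.lessThan_Suc_shift[of _ "Suc t"]) (simp add: One_nat_def)
  have "om * eps (Suc (Suc t)) - of_nat 2 * ?S (Suc (Suc t)) =
    - (om * (del 2 * eps (Suc t) - eps (Suc (Suc t)) - eps t))
    + del 2 * (om * eps (Suc t) - of_nat 2 * ?S (Suc t))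
    - (om * eps t - of_nat 2 * ?S t)
    + of_nat 2 * (del 2 * ?S (Suc t) - (eps n + ?S t) - (\<Sum>i<Suc t. eps (n - i - 1)))"
    unfolding 6[symmetric] by (simp add: algebra_simps del: sum.lessThan_Suc)
  also have "del 2 * ?S (Suc t) - (eps n + ?S t) - (\<Sum>i<Suc t. eps (n - i - 1)) =
     (\<Sum>i<Suc t. del 2 * eps (n - i) - eps (n - i + 1) - eps (n - i - 1))"
    unfolding 5[symmetric] by (simp add: sum_distrib_left sum_subtractf del: sum.lessThan_Suc)
  also have "- (om * (del 2 * eps (Suc t) - eps (Suc (Suc t)) - eps t))
    + del 2 * (om * eps (Suc t) - of_nat 2 * ?S (Suc t)) - (om * eps t - of_nat 2 * ?S t)
    + of_nat 2 * (\<Sum>i<Suc t. del 2 * eps (n - i) - eps (n - i + 1) - eps (n - i - 1)) \<in> null"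
    by (intro null_diff null_add null_minus null_mult 1 2 3 4)
  finally show ?case .
qed

end

text \<open>Discrete boustrophedon transform iterated on the constant sequence \<open>1\<close>.\<close>

fun zigzag_sum :: "nat \<Rightarrow> nat \<Rightarrow> nat \<Rightarrow> real" where
  "zigzag_sum n 0 t = 1"
| "zigzag_sum n (Suc s) t = 2 * (\<Sum>i<t. zigzag_sum n s (n - i))"

context block_count
begin

text \<open>Each \<open>eps t\<close> in this range counts 1 + 1 - 1 = 1 block, which is the
  constant initial sequence; multiplication by \<open>om\<close> performs one round of
  summation.\<close>

lemma L_om_pow_eps: "1 \<le> t \<Longrightarrow> t \<le> n \<Longrightarrow> L (om ^ s * eps t) = zigzag_sum n s t"
proof (induction s arbitrary: t)
  case 0
  have "L (eps t) = D {#t#} + D {#p - t#} - D {#p#}"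
    by (simp add: eps_def L_add L_diff del_def)
  then show ?case using 0 p_eq by (simp add: D_single)
next
  case (Suc s)
  have "L (om ^ Suc s * eps t) = L (om ^ s * (of_nat 2 * (\<Sum>i<t. eps (n - i))))"
  proof (rule L_eq)
    have "om ^ Suc s * eps t - om ^ s * (of_nat 2 * (\<Sum>i<t. eps (n - i))) =
      om ^ s * (om * eps t - of_nat 2 * (\<Sum>i<t. eps (n - i)))" by (simp add: algebra_simps)
    also have "\<dots> \<in> null" by (intro null_mult om_mult_eps Suc.prems)
    finally show "om ^ Suc s * eps t - om ^ s * (of_nat 2 * (\<Sum>i<t. eps (n - i))) \<in> null" .
  qed
  also have "om ^ s * (of_nat 2 * (\<Sum>i<t. eps (n - i))) = of_nat 2 * (\<Sum>i<t. om ^ s * eps (n - i))"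
    by (simp only: mult.left_commute sum_distrib_left)
  also have "L \<dots> = 2 * (\<Sum>i<t. L (om ^ s * eps (n - i)))"
    unfolding L_of_nat_mult L_sum by simp
  also have "(\<Sum>i<t. L (om ^ s * eps (n - i))) = (\<Sum>i<t. zigzag_sum n s (n - i))"
    by (rule sum.cong) (use Suc in auto)
  finally show ?case by simp
qed

text \<open>One factor is written as \<open>eps n + del p\<close>. On \<open>del p\<close> the
  remaining factors act as the number \<open>p\<close>, which gives the main term p^d; the part
  \<open>eps n\<close> gives the zigzag term.\<close>

lemma L_om_pow: "L (om ^ Suc d) = real p ^ d + zigzag_sum n d n"
proof -
  have *: "om ^ s * del p - of_nat (p ^ s) * del p \<in> null" for s
  proof (induction s)
    case (Suc s)
    have "om ^ Suc s * del p - of_nat (p ^ Suc s) * del p =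
      om * (om ^ s * del p - of_nat (p ^ s) * del p) + of_nat (p ^ s) * (om * del p - of_nat p * del p)"
      by (simp add: algebra_simps)
    also have "\<dots> \<in> null" by (intro null_add null_mult Suc om_mult_del_p)
    finally show ?case .
  qed simp
  have "om ^ Suc d = om ^ d * eps n + om ^ d * del p"
    by (subst power_Suc2, subst (2) om_eq) (simp add: algebra_simps)
  then have "L (om ^ Suc d) = zigzag_sum n d n + L (of_nat (p ^ d) * del p)"
    using L_om_pow_eps[of n d] n_pos L_eq[OF *[of d]] by (simp add: L_add)
  also have "L (of_nat (p ^ d) * del p) = real p ^ d"
    unfolding L_of_nat_mult using p_pos by (simp add: del_def D_single)
  finally show ?thesis by simp
qed

section \<open>Powers of a sum of two classes\<close>

lemma pow_sum_del:
  "(del a + del b) ^ m = (\<Sum>c\<in>box (replicate m 2). tmon (mset (map (\<lambda>i. if i = 0 then a else b) c)))"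
proof (induction m)
  case 0
  have "box [] = {[]}" by auto
  then show ?case by (simp add: tmon_def)
next
  case (Suc m)
  let ?f = "\<lambda>i::nat. if i = 0 then a else b"
  have eq: "box (replicate (Suc m) 2) = (#) 0 ` box (replicate m 2) \<union> (#) 1 ` box (replicate m 2)"
  proof -
    have two: "{..<2::nat} = {0, 1}" by auto
    show ?thesis unfolding replicate_Suc box_Cons_image two by auto
  qed
  have "(\<Sum>c\<in>box (replicate (Suc m) 2). tmon (mset (map ?f c))) =
    (\<Sum>c\<in>box (replicate m 2). tmon (add_mset a (mset (map ?f c)))) +
    (\<Sum>c\<in>box (replicate m 2). tmon (add_mset b (mset (map ?f c))))"
    unfolding eq by (subst sum.union_disjoint) (auto simp: sum.reindex)
  also have "\<dots> = del a * (del a + del b) ^ m + del b * (del a + del b) ^ m"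
    unfolding Suc by (simp add: sum_distrib_left del_mult_tmon)
  finally show ?case by (simp add: algebra_simps)
qed

lemma L_pow_sum_del:
  "L ((del a + del b) ^ m) = (\<Sum>c\<in>box (replicate m 2). D (mset (map (\<lambda>i. if i = 0 then a else b) c)))"
  by (simp add: pow_sum_del L_sum)

lemma L_frobenius: "L ((del (p * a) + del (p * b)) ^ Suc d) = real p ^ d * L ((del a + del b) ^ Suc d)"
proof -
  have "D (mset (map (\<lambda>i. if i = 0 then p * a else p * b) c)) =
      real p ^ d * D (mset (map (\<lambda>i. if i = 0 then a else b) c))" if "c \<in> box (replicate (Suc d) 2)" for c :: "nat list"
  proof -
    have len: "length c = Suc d" using box_length[OF that] by simp
    have "mset (map (\<lambda>i. if i = 0 then p * a else p * b) c) =
        image_mset ((*) p) (mset (map (\<lambda>i. if i = 0 then a else b) c))"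
      by (induction c) auto
    moreover have "mset (map (\<lambda>i. if i = 0 then a else b) c) \<noteq> {#}" using len by auto
    ultimately show ?thesis using D_frobenius[of "mset (map (\<lambda>i. if i = 0 then a else b) c)"] len by simp
  qed
  then show ?thesis unfolding L_pow_sum_del sum_distrib_left by (rule sum.cong[OF refl])
qed

section \<open>Second-order differences and the step from q to p q\<close>

definition step :: "nat \<Rightarrow> tensors" where "step a = del (a + 1) - del a"

lemma L_step_step: "\<bar>L (step a * (step b * tmon M))\<bar> \<le> D M"
proof -
  have "L (step a * (step b * tmon M)) =
    D (add_mset (a + 1) (add_mset (b + 1) M)) - D (add_mset (a + 1) (add_mset b M))
        - D (add_mset a (add_mset (b + 1) M)) + D (add_mset a (add_mset b M))"
    unfolding step_def by (simp add: left_diff_distrib right_diff_distrib L_add L_diff del_mult_tmon)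
  then show ?thesis using D_second_difference[of a b M] by linarith
qed

lemma sum_step: "(\<Sum>s<m. step (a + s)) = del (a + m) - del a"
  by (induction m) (simp_all add: step_def flip: Suc_eq_plus1)

text \<open>For \<open>q = 2 * b + 1\<close>, the class of the two blocks belonging to
  \<open>p * q\<close>, namely those of sizes \<open>p * b + n\<close> and
  \<open>p * b + n + 1\<close>, minus the class obtained by stretching the two blocks for
  \<open>q\<close> by \<open>p\<close>.\<close>

definition eta :: "nat \<Rightarrow> tensors" where
  "eta b = del (p * b + n) + del (p * b + n + 1) - (del (p * b) + del (p * b + p))"

lemma L_eta_eta: "\<bar>L (eta b * (eta b * tmon M))\<bar> \<le> real (p ^ 2) * D M"
proof -
  \<comment> \<open>From \<open>p * b\<close> to \<open>p * b + n\<close> and from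
    \<open>p * b + n + 1\<close> to \<open>p * b + p\<close> there are \<open>n\<close> unit steps
    each; they enter with opposite signs. The square of \<open>eta\<close> therefore consists of (2
    n)^2 second differences.\<close>
  have "p * b + n + 1 + n = p * b + p" using p_eq by simp
  then have eta: "eta b = (\<Sum>s<n. step (p * b + s)) - (\<Sum>s<n. step (p * b + n + 1 + s))"
    unfolding sum_step eta_def by (simp only: algebra_simps)
  define u where "u s = (if s < n then step (p * b + s) else - step (p * b + s + 1))" for s
  have "{..<2 * n} = {..<n} \<union> (\<lambda>s. s + n) ` {..<n}"
    by (auto simp: image_iff) (metis add.commute le_add_diff_inverse less_diff_conv2 lessThan_iff mult_2 not_less)
  then have "(\<Sum>s<2 * n. u s) = (\<Sum>s<n. u s) + (\<Sum>s<n. u (s + n))"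
    by (simp, subst sum.union_disjoint) (auto simp: sum.reindex)
  also have "\<dots> = eta b"
    unfolding eta by (simp add: u_def sum_negf ac_simps)
  finally have eta': "eta b = (\<Sum>s<2 * n. u s)" ..
  have u: "\<bar>L (u s * (u t * tmon M))\<bar> \<le> D M" for s t
    using L_step_step by (auto simp: u_def L_minus)
  have "L (eta b * (eta b * tmon M)) = (\<Sum>s<2 * n. \<Sum>t<2 * n. L (u t * (u s * tmon M)))"
    unfolding eta' by (simp add: sum_distrib_left sum_distrib_right L_sum)
  also have "\<bar>\<dots>\<bar> \<le> (\<Sum>s<2 * n. \<Sum>t<2 * n. D M)"
    by (intro order_trans[OF sum_abs] sum_mono u)
  also have "\<dots> = real ((2 * n) ^ 2) * D M" by (simp add: power2_eq_square)
  also have "\<dots> \<le> real (p ^ 2) * D M"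
  proof (rule mult_right_mono)
    show "0 \<le> D M" using u[of 0 0] by linarith
    show "real ((2 * n) ^ 2) \<le> real (p ^ 2)" unfolding of_nat_le_iff by (rule power_mono) (auto simp: p_eq)
  qed
  finally show ?thesis .
qed

text \<open>Two factors \<open>eta\<close> are kept for the cancellation. Each of the other
  \<open>j\<close> is expanded into four single blocks of size at most \<open>p * b + p\<close>,
  hence the factor 4^j. The resulting products have \<open>k + 1\<close> factors, and the block
  count is at most the product of all sizes but one.\<close>

lemma L_eta_bound:
  assumes "size M + j = k + 1" "\<And>x. x \<in># M \<Longrightarrow> x \<le> p * b + p"
  shows "\<bar>L (eta b * (eta b * (eta b ^ j * tmon M)))\<bar> \<le> 4 ^ j * real (p ^ 2) * real (p * b + p) ^ k"
  using assms
proof (induction j arbitrary: M)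
  case 0
  then obtain a M' where M: "M = add_mset a M'" "size M' = k" by (cases M) auto
  have "prod_mset M' \<le> (p * b + p) ^ size M'"
    using "0.prems"(2) unfolding M(1)
    by (induction M') (auto intro: mult_le_mono)
  then have "D M \<le> real (p * b + p) ^ k"
    using D_le[of a M'] M by (metis (mono_tags) of_nat_le_iff of_nat_power order_trans)
  then have "real (p ^ 2) * D M \<le> real (p ^ 2) * real (p * b + p) ^ k" by (intro mult_left_mono) auto
  then show ?case using L_eta_eta[of b M] by simp
next
  case (Suc j)
  let ?B = "4 ^ j * real (p ^ 2) * real (p * b + p) ^ k"
  have *: "\<bar>L (eta b * (eta b * (eta b ^ j * tmon (add_mset x M))))\<bar> \<le> ?B" if "x \<le> p * b + p" for x
    by (rule Suc.IH) (use Suc.prems that in auto)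
  have "eta b * (eta b * (eta b ^ Suc j * tmon M)) = eta b * (eta b * (eta b ^ j * (eta b * tmon M)))"
    by (simp add: algebra_simps)
  also have "eta b * tmon M = tmon (add_mset (p * b + n) M) + tmon (add_mset (p * b + n + 1) M)
     - (tmon (add_mset (p * b) M) + tmon (add_mset (p * b + p) M))"
    unfolding eta_def by (simp only: left_diff_distrib distrib_right del_mult_tmon)
  finally have "L (eta b * (eta b * (eta b ^ Suc j * tmon M))) =
     L (eta b * (eta b * (eta b ^ j * tmon (add_mset (p * b + n) M))))
     + L (eta b * (eta b * (eta b ^ j * tmon (add_mset (p * b + n + 1) M))))
     - (L (eta b * (eta b * (eta b ^ j * tmon (add_mset (p * b) M))))
     + L (eta b * (eta b * (eta b ^ j * tmon (add_mset (p * b + p) M)))))"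
    by (simp only: distrib_left right_diff_distrib L_add L_diff)
  then have "\<bar>L (eta b * (eta b * (eta b ^ Suc j * tmon M)))\<bar> \<le> ?B + ?B + (?B + ?B)"
    using *[of "p * b + n"] *[of "p * b + n + 1"] *[of "p * b"] *[of "p * b + p"] p_eq by linarith
  also have "?B + ?B + (?B + ?B) = 4 ^ Suc j * real (p ^ 2) * real (p * b + p) ^ k" by simp
  finally show ?case .
qed

text \<open>The terms \<open>del (p * b)\<close> in the three expansions cancel, and
  \<open>kap b\<close> is left with exactly the combination \<open>eps n\<close>. Consequently
  blocks of size divisible by \<open>p\<close> annihilate \<open>eta\<close>.\<close>

lemma eta_eq: "eta b - kap b * eps n \<in> null"
proof -
  have "del (p * b + n) - (del (p * b) + del n * kap b) \<in> null"
    "del (p * b + (n + 1)) - (del (p * b) + del (n + 1) * kap b) \<in> null"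
    "del (p * b + p) - (del (p * b) + del p * kap b) \<in> null"
    by (rule del_block, use p_eq in simp)+
  then have "(del (p * b + n) - (del (p * b) + del n * kap b)) + (del (p * b + (n + 1)) - (del (p * b) + del (n + 1) * kap b))
    - (del (p * b + p) - (del (p * b) + del p * kap b)) \<in> null" (is "?x \<in> null")
    using null_diff null_add by presburger
  also have "?x = eta b - kap b * eps n"
  proof -
    have "p - n = n + 1" using p_eq by simp
    then show ?thesis unfolding eta_def eps_def by (simp add: algebra_simps)
  qed
  finally show ?thesis .
qed

lemma del_p_mult_eta: "del (p * c) * eta b \<in> null"
proof -
  have "del (p * c) * eta b = (eta b - kap b * eps n) * del (p * c) + kap b * (eps n * del (p * c))"
    by (simp add: algebra_simps)
  also have "\<dots> \<in> null" by (intro null_add null_mult eta_eq eps_mult_del_p) (simp add: p_eq)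
  finally show ?thesis .
qed

text \<open>The stretched part and the defect \<open>eta\<close> multiply to zero, so the power of
  their sum is the sum of their powers. The Frobenius rule evaluates the stretched part.\<close>

lemma L_recursion:
  "L ((del (p * b + n) + del (p * b + n + 1)) ^ Suc d) =
    real p ^ d * L ((del b + del (b + 1)) ^ Suc d) + L (eta b ^ Suc d)"
proof -
  define th where "th = del (p * b) + del (p * (b + 1))"
  have th: "del (p * b + n) + del (p * b + n + 1) = th + eta b"
    by (simp add: th_def eta_def algebra_simps)
  have 0: "th * eta b \<in> null"
    using null_add[OF del_p_mult_eta[of b b] del_p_mult_eta[of "b + 1" b]] by (simp add: th_def algebra_simps)
  have "(th + eta b) ^ Suc m - (th ^ Suc m + eta b ^ Suc m) \<in> null" for m
  proof (induction m)
    case (Suc m)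
    have "(th + eta b) ^ Suc (Suc m) - (th ^ Suc (Suc m) + eta b ^ Suc (Suc m)) =
      (th + eta b) * ((th + eta b) ^ Suc m - (th ^ Suc m + eta b ^ Suc m))
      + th * eta b * eta b ^ m + th * eta b * th ^ m"
      by (simp add: algebra_simps)
    also have "\<dots> \<in> null" by (intro null_add null_mult Suc 0)
    finally show ?case .
  qed simp
  from L_eq[OF this[of d]] show ?thesis
    unfolding th L_add using L_frobenius[of b "b + 1" d] by (simp add: th_def)
qed

definition quadric_count :: "nat \<Rightarrow> nat \<Rightarrow> real" where
  "quadric_count d q = L ((del (q div 2) + del (q div 2 + 1)) ^ Suc d)"

lemma quadric_count_p: "quadric_count d p = real p ^ d + zigzag_sum n d n"
  using L_om_pow[of d] p_eq by (simp add: quadric_count_def om_def)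

text \<open>Of the \<open>d + 1\<close> factors \<open>eta\<close> two provide the cancellation and
  \<open>d - 1\<close> are expanded, leaving \<open>d - 2\<close> powers of the size.\<close>

lemma quadric_count_step:
  assumes "d \<ge> 2" "odd q" "q > 1"
  shows "\<bar>quadric_count d (p * q) - real p ^ d * quadric_count d q\<bar> \<le> 4 ^ (d - 1) * real p ^ 2 * real (p * q) ^ (d - 2)"
proof -
  define b where "b = q div 2"
  have q: "q = 2 * b + 1" using assms(2) unfolding b_def by presburger
  have b: "b \<ge> 1" using assms(3) q by simp
  have "p * q = 2 * (p * b + n) + 1" using q p_eq by (simp add: algebra_simps)
  then have pq: "p * q div 2 = p * b + n" by simp
  have "quadric_count d (p * q) - real p ^ d * quadric_count d q = L (eta b ^ Suc d)"
    unfolding quadric_count_def pq b_def[symmetric] using L_recursion[of b d] by simp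
  also have "Suc d = Suc (Suc (d - 1))" using assms by simp
  also have "eta b ^ \<dots> = eta b * (eta b * (eta b ^ (d - 1) * tmon {#}))" by (simp add: tmon_def)
  also have "\<bar>L \<dots>\<bar> \<le> 4 ^ (d - 1) * real (p ^ 2) * real (p * b + p) ^ (d - 2)"
    by (rule L_eta_bound) (use assms in auto)
  also have "\<dots> \<le> 4 ^ (d - 1) * real (p ^ 2) * real (p * q) ^ (d - 2)"
  proof (intro mult_left_mono power_mono)
    have "p * b + p = p * (b + 1)" by (simp add: algebra_simps)
    also have "\<dots> \<le> p * q" unfolding q by (rule mult_le_mono2) (use b in simp)
    finally show "real (p * b + p) \<le> real (p * q)" unfolding of_nat_le_iff .
  qed auto
  finally show ?thesis by simp
qed

end

section \<open>Zigzag asymptotics\<close>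

definition sec_tan :: "real fps" where "sec_tan = inverse (fps_cos 1) + fps_tan 1"

text \<open>The coefficients of cos(u x) + (sec x + tan x) sin(u x). They solve the continuous
  boustrophedon equations: the derivative of the polynomial of index s + 1 at u is the polynomial of
  index s at 1 - u, with value 0 at 0, starting from the constant 1. At u = 1 the series becomes sec
  x + tan x.\<close>

definition zigzag_poly :: "nat \<Rightarrow> real \<Rightarrow> real" where
  "zigzag_poly s u = fps_nth (fps_cos u + sec_tan * fps_sin u) s"

lemma sec_tan_cos: "sec_tan * fps_cos 1 = 1 + fps_sin 1"
  and sec_tan_sin: "fps_cos 1 + sec_tan * fps_sin 1 = sec_tan"
proof -
  let ?C = "fps_cos (1::real)" and ?S = "fps_sin (1::real)"
  have C0: "fps_nth ?C 0 \<noteq> 0" by simp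
  then have inv: "inverse ?C * ?C = 1" by (rule inverse_mult_eq_1)
  have Z: "sec_tan = (1 + ?S) * inverse ?C"
    using C0 by (simp add: sec_tan_def fps_tan_def fps_divide_unit algebra_simps)
  show 1: "sec_tan * ?C = 1 + ?S" unfolding Z using inv by (simp add: mult.assoc)
  have "?C ^ 2 + ?S ^ 2 = 1" by (rule fps_sin_cos_sum_of_squares)
  then have "(1 + ?S) * (1 - ?S) = ?C * ?C" by (simp add: power2_eq_square algebra_simps)
  then have "sec_tan * (1 - ?S) = inverse ?C * ?C * ?C" unfolding Z by (simp add: mult_ac)
  then have "sec_tan * (1 - ?S) = ?C" by (simp add: inv)
  then show "?C + sec_tan * ?S = sec_tan" by (simp add: algebra_simps)
qed

lemma zigzag_poly_0 [simp]: "zigzag_poly 0 u = 1"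
  by (simp add: zigzag_poly_def)

lemma zigzag_poly_at_0: "s > 0 \<Longrightarrow> zigzag_poly s 0 = 0"
proof -
  have "fps_cos (0::real) = 1" "fps_sin (0::real) = 0" by (auto simp: fps_eq_iff fps_cos_def fps_sin_def odd_pos)
  then show "s > 0 \<Longrightarrow> zigzag_poly s 0 = 0" by (simp add: zigzag_poly_def)
qed

lemma zigzag_poly_at_1: "zigzag_poly s 1 = zigzag_number s / fact s"
  unfolding zigzag_poly_def sec_tan_sin by (simp add: zigzag_number_def sec_tan_def)

lemma zigzag_poly_reflect: "zigzag_poly s (1 - u) = fps_nth (sec_tan * fps_cos u - fps_sin u) s"
proof -
  have sm: "fps_sin (- u) = - fps_sin u" "fps_cos (- u) = fps_cos u"
    by (auto simp: fps_eq_iff fps_sin_def fps_cos_def)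
  have s: "fps_sin (1 - u) = fps_sin 1 * fps_cos u - fps_cos 1 * fps_sin u"
    and c: "fps_cos (1 - u) = fps_cos 1 * fps_cos u + fps_sin 1 * fps_sin u"
    using fps_cos_add[of 1 "- u"] fps_sin_add[of 1 "- u"] by (simp_all add: sm)
  have "fps_cos (1 - u) + sec_tan * fps_sin (1 - u) =
    fps_cos u * (fps_cos 1 + sec_tan * fps_sin 1) + fps_sin u * (fps_sin 1 - sec_tan * fps_cos 1)"
    unfolding s c by (simp add: algebra_simps)
  also have "\<dots> = sec_tan * fps_cos u - fps_sin u"
    unfolding sec_tan_cos sec_tan_sin by (simp add: algebra_simps)
  finally show ?thesis by (simp add: zigzag_poly_def)
qed

lemma fps_sin_cos_nth_deriv:
  "((\<lambda>u. fps_nth (fps_sin u) (Suc s)) has_real_derivative fps_nth (fps_cos u) s) (at u)"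
  "((\<lambda>u. fps_nth (fps_cos u) (Suc s)) has_real_derivative - fps_nth (fps_sin u) s) (at u)"
proof -
  have f: "fact (Suc s) = (1 + real s) * fact s" by simp
  have c: "((\<lambda>u. c * u ^ Suc s / fact (Suc s)) has_real_derivative c * u ^ s / fact s) (at u)" for c :: real
    by (rule derivative_eq_intros refl | simp)+
  show "((\<lambda>u. fps_nth (fps_sin u) (Suc s)) has_real_derivative fps_nth (fps_cos u) s) (at u)"
    using c[of "(-1) ^ (s div 2)"] by (auto simp: fps_sin_def fps_cos_def One_nat_def simp del: fact_Suc)
  show "((\<lambda>u. fps_nth (fps_cos u) (Suc s)) has_real_derivative - fps_nth (fps_sin u) s) (at u)"
  proof (cases "even s")
    case False
    then obtain k where k: "s = 2 * k + 1" by (rule oddE)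
    show ?thesis using c[of "(-1) ^ (k + 1)"] by (simp add: fps_sin_def fps_cos_def k One_nat_def del: fact_Suc)
  qed (simp add: fps_sin_def fps_cos_def)
qed

text \<open>Differentiation in u multiplies the series by x and turns it into (sec x + tan x) cos(u
  x) - sin(u x), which by the addition formulas is the same series at 1 - u.\<close>

lemma zigzag_poly_deriv:
  "(zigzag_poly (Suc s) has_real_derivative zigzag_poly s (1 - u)) (at u)"
proof -
  have eq: "zigzag_poly (Suc s) = (\<lambda>u. fps_nth (fps_cos u) (Suc s) +
      (\<Sum>i=0..s. fps_nth sec_tan i * fps_nth (fps_sin u) (Suc (s - i))))"
    by (rule ext) (simp add: zigzag_poly_def fps_mult_nth Suc_diff_le)
  have "(zigzag_poly (Suc s) has_real_derivative - fps_nth (fps_sin u) s +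
      (\<Sum>i=0..s. fps_nth sec_tan i * fps_nth (fps_cos u) (s - i))) (at u)"
    unfolding eq by (intro DERIV_add DERIV_sum DERIV_cmult fps_sin_cos_nth_deriv)
  then show ?thesis unfolding zigzag_poly_reflect by (simp add: fps_mult_nth algebra_simps)
qed

lemma zigzag_poly_deriv' [derivative_intros]:
  "(f has_real_derivative f') (at x) \<Longrightarrow>
    ((\<lambda>x. zigzag_poly (Suc s) (f x)) has_real_derivative zigzag_poly s (1 - f x) * f') (at x)"
  using DERIV_chain2[OF zigzag_poly_deriv] by blast

lemma zigzag_poly_cont: "isCont (zigzag_poly s) u"
proof (cases s)
  case 0
  then have "zigzag_poly s = (\<lambda>_. 1)" by (simp add: fun_eq_iff)
  then show ?thesis by simp
next
  case (Suc k)
  then show ?thesis using DERIV_isCont[OF zigzag_poly_deriv[of k u]] by simp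
qed

section \<open>The midpoint rule for the discrete transform\<close>

lemma zigzag_poly_bounded: "\<exists>M. \<forall>u\<in>{0..1}. \<bar>zigzag_poly s u\<bar> \<le> M"
proof -
  have "\<forall>x. 0 \<le> x \<and> x \<le> 1 \<longrightarrow> isCont (\<lambda>u. \<bar>zigzag_poly s u\<bar>) x"
    by (intro allI impI continuous_rabs zigzag_poly_cont)
  from isCont_bounded[OF _ this] show ?thesis by (simp add: Ball_def)
qed

lemma zigzag_poly_lipschitz: "\<exists>M\<ge>0. \<forall>a\<in>{0..1}. \<forall>b\<in>{0..1}. \<bar>zigzag_poly s a - zigzag_poly s b\<bar> \<le> M * \<bar>a - b\<bar>"
proof (cases s)
  case (Suc k)
  obtain M where M: "\<forall>u\<in>{0..1}. \<bar>zigzag_poly k u\<bar> \<le> M" using zigzag_poly_bounded by blast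
  have le: "\<bar>zigzag_poly s b - zigzag_poly s a\<bar> \<le> M * (b - a)" if "0 \<le> a" "a < b" "b \<le> 1" for a b
  proof -
    obtain z where z: "a < z" "z < b" "zigzag_poly s b - zigzag_poly s a = (b - a) * zigzag_poly k (1 - z)"
      using MVT2[OF \<open>a < b\<close>, of "zigzag_poly s" "\<lambda>z. zigzag_poly k (1 - z)"] zigzag_poly_deriv Suc by blast
    have "\<bar>zigzag_poly k (1 - z)\<bar> \<le> M" using M z that by simp
    then show ?thesis unfolding z(3) abs_mult using that by (simp add: mult.commute mult_left_mono)
  qed
  have "\<bar>zigzag_poly s a - zigzag_poly s b\<bar> \<le> M * \<bar>a - b\<bar>" if "a \<in> {0..1}" "b \<in> {0..1}" for a b
    using le[of a b] le[of b a] that by (cases a b rule: linorder_cases) (auto simp: abs_minus_commute)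
  moreover have "M \<ge> 0" using M by (smt (verit) atLeastAtMost_iff)
  ultimately show ?thesis by blast
qed auto

text \<open>As a function of the half-width the error vanishes at 0 and has derivative w(c + x) +
  w(c - x) - 2 w(c), which the Lipschitz bound on \<open>w'\<close> keeps below 2 M h^2. The
  exponent 3 leaves h^2 after summing over about 1 / h intervals.\<close>

lemma midpoint_error:
  fixes g w w' :: "real \<Rightarrow> real"
  assumes g: "\<And>x. (g has_real_derivative w x) (at x)" and w: "\<And>x. (w has_real_derivative w' x) (at x)"
    and lip: "\<And>a b. a \<in> {c - h..c + h} \<Longrightarrow> b \<in> {c - h..c + h} \<Longrightarrow> \<bar>w' a - w' b\<bar> \<le> M * \<bar>a - b\<bar>"
    and h: "h > 0" and M: "M \<ge> 0"
  shows "\<bar>g (c + h) - g (c - h) - 2 * h * w c\<bar> \<le> 2 * M * h ^ 3"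
proof -
  have 1: "\<bar>w (c + x) + w (c - x) - 2 * w c\<bar> \<le> 2 * M * h ^ 2" if x: "0 < x" "x < h" for x
  proof -
    have "c < c + x" "c - x < c" using x by auto
    obtain z where z: "c < z" "z < c + x" "w (c + x) - w c = (c + x - c) * w' z"
      using MVT2[OF \<open>c < c + x\<close>, of w w'] w by blast
    obtain z' where z': "c - x < z'" "z' < c" "w c - w (c - x) = (c - (c - x)) * w' z'"
      using MVT2[OF \<open>c - x < c\<close>, of w w'] w by blast
    have "w (c + x) + w (c - x) - 2 * w c = x * (w' z - w' z')" using z z' by (simp add: algebra_simps)
    then have "\<bar>w (c + x) + w (c - x) - 2 * w c\<bar> = x * \<bar>w' z - w' z'\<bar>" using x by (simp add: abs_mult)
    also have "\<dots> \<le> h * (M * (2 * h))"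
    proof (rule mult_mono)
      have "\<bar>w' z - w' z'\<bar> \<le> M * \<bar>z - z'\<bar>" by (rule lip) (use z z' x in auto)
      also have "\<dots> \<le> M * (2 * h)" by (rule mult_left_mono) (use z z' x M in auto)
      finally show "\<bar>w' z - w' z'\<bar> \<le> M * (2 * h)" .
    qed (use x in auto)
    finally show ?thesis by (simp add: power2_eq_square algebra_simps)
  qed
  let ?f = "\<lambda>x. g (c + x) - g (c - x) - 2 * x * w c"
  have "(?f has_real_derivative w (c + x) + w (c - x) - 2 * w c) (at x)" for x
    by (rule derivative_eq_intros DERIV_chain2[OF g] refl | simp)+
  then obtain z where z: "0 < z" "z < h" "?f h - ?f 0 = (h - 0) * (w (c + z) + w (c - z) - 2 * w c)"
    using MVT2[OF h, of ?f "\<lambda>x. w (c + x) + w (c - x) - 2 * w c"] by blast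
  then have "\<bar>?f h\<bar> = h * \<bar>w (c + z) + w (c - z) - 2 * w c\<bar>" using h by (simp add: abs_mult)
  also have "\<dots> \<le> h * (2 * M * h ^ 2)" using 1[OF z(1,2)] h by (intro mult_left_mono) auto
  finally show ?thesis by (simp add: power3_eq_cube power2_eq_square algebra_simps)
qed

lemma zigzag_poly_midpoint:
  "\<exists>M\<ge>0. \<forall>c h. h > 0 \<longrightarrow> c - h \<ge> 0 \<longrightarrow> c + h \<le> 1 \<longrightarrow>
     \<bar>zigzag_poly (Suc s) (c + h) - zigzag_poly (Suc s) (c - h) - 2 * h * zigzag_poly s (1 - c)\<bar> \<le> M * h ^ 3"
proof (cases s)
  case 0
  define w where "w = (\<lambda>u::real. zigzag_poly 0 (1 - u))"
  have w: "w = (\<lambda>u. 1)" by (auto simp: w_def)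
  have g: "(zigzag_poly (Suc s) has_real_derivative w x) (at x)" for x
    unfolding w_def 0 by (rule zigzag_poly_deriv)
  have w': "(w has_real_derivative 0) (at x)" for x unfolding w by simp
  have "\<bar>zigzag_poly (Suc s) (c + h) - zigzag_poly (Suc s) (c - h) - 2 * h * w c\<bar> \<le> 2 * 0 * h ^ 3"
    if "h > 0" for c h
    by (rule midpoint_error[OF g w']) (use that in auto)
  then show ?thesis unfolding w_def 0 by (intro exI[of _ 0]) auto
next
  case (Suc k)
  obtain M where M: "M \<ge> 0" "\<forall>a\<in>{0..1}. \<forall>b\<in>{0..1}. \<bar>zigzag_poly k a - zigzag_poly k b\<bar> \<le> M * \<bar>a - b\<bar>"
    using zigzag_poly_lipschitz by blast
  have "\<bar>zigzag_poly (Suc s) (c + h) - zigzag_poly (Suc s) (c - h) - 2 * h * zigzag_poly s (1 - c)\<bar> \<le> 2 * M * h ^ 3"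
    if h: "h > 0" and c: "c - h \<ge> 0" "c + h \<le> 1" for c h
  proof (rule midpoint_error[where w'="\<lambda>u. - zigzag_poly k u"])
    show "(zigzag_poly (Suc s) has_real_derivative zigzag_poly s (1 - x)) (at x)" for x
      by (rule zigzag_poly_deriv)
    show "((\<lambda>x. zigzag_poly s (1 - x)) has_real_derivative - zigzag_poly k x) (at x)" for x
      unfolding Suc by (rule derivative_eq_intros refl | simp)+
    show "\<bar>- zigzag_poly k a - - zigzag_poly k b\<bar> \<le> M * \<bar>a - b\<bar>"
      if "a \<in> {c - h..c + h}" "b \<in> {c - h..c + h}" for a b
    proof -
      have "\<bar>zigzag_poly k a - zigzag_poly k b\<bar> \<le> M * \<bar>a - b\<bar>" using M(2) that c by simp
      then show ?thesis by (simp add: abs_minus_commute)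
    qed
  qed (use h M in auto)
  then show ?thesis using M(1) by (intro exI[of _ "2 * M"]) auto
qed

text \<open>With q = 2 n + 1 and nodes 2 t / q, the midpoint (2 i + 1) / q of the i-th interval is
  reflected to 2 (n - i) / q, which is precisely the node of the summand
  \<open>zigzag_sum n s (n - i)\<close>. Each summation is therefore a midpoint rule; since 2 t is
  below q, the inherited constant does not grow and only \<open>M\<close> is added.\<close>

lemma zigzag_sum_approx:
  "\<exists>C\<ge>0. \<forall>n\<ge>1. \<forall>t\<le>n. \<bar>zigzag_sum n s t - real (2 * n + 1) ^ s * zigzag_poly s (2 * real t / real (2 * n + 1))\<bar>
    \<le> C * real (2 * n + 1) ^ s / real (2 * n + 1) ^ 2"
proof (induction s)
  case 0
  show ?case by (intro exI[of _ 0]) auto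
next
  case (Suc s)
  obtain C where C: "C \<ge> 0" "\<And>n t. n \<ge> 1 \<Longrightarrow> t \<le> n \<Longrightarrow>
      \<bar>zigzag_sum n s t - real (2 * n + 1) ^ s * zigzag_poly s (2 * real t / real (2 * n + 1))\<bar>
      \<le> C * real (2 * n + 1) ^ s / real (2 * n + 1) ^ 2" using Suc by blast
  obtain M where M: "M \<ge> 0" "\<And>c h. h > 0 \<Longrightarrow> c - h \<ge> 0 \<Longrightarrow> c + h \<le> 1 \<Longrightarrow>
     \<bar>zigzag_poly (Suc s) (c + h) - zigzag_poly (Suc s) (c - h) - 2 * h * zigzag_poly s (1 - c)\<bar> \<le> M * h ^ 3"
    using zigzag_poly_midpoint by blast
  have "\<bar>zigzag_sum n (Suc s) t - real (2 * n + 1) ^ Suc s * zigzag_poly (Suc s) (2 * real t / real (2 * n + 1))\<bar>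
    \<le> (C + M) * real (2 * n + 1) ^ Suc s / real (2 * n + 1) ^ 2" if n: "n \<ge> 1" and t: "t \<le> n" for n t
  proof -
    define q where "q = real (2 * n + 1)"
    have q: "q > 0" by (simp add: q_def)
    have mid: "\<bar>2 * zigzag_sum n s (n - i) - q ^ Suc s * (zigzag_poly (Suc s) (2 * real (Suc i) / q) - zigzag_poly (Suc s) (2 * real i / q))\<bar>
       \<le> 2 * (C * q ^ s / q ^ 2) + q ^ Suc s * (M * (1 / q) ^ 3)" if i: "i < t" for i
    proof -
      \<comment> \<open>The half-width is 1 / q, so \<open>?c\<close> plus and minus it are
        consecutive nodes.\<close>
      let ?c = "(2 * real i + 1) / q"
      have c1: "?c + 1 / q = 2 * real (Suc i) / q" and c2: "?c - 1 / q = 2 * real i / q"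
        by (simp_all add: add_divide_distrib diff_divide_distrib)
      have "real i + 1 \<le> real n" using i t by linarith
      then have c3: "1 - ?c = 2 * real (n - i) / q" and c4: "?c + 1 / q \<le> 1"
        using q i t by (auto simp: field_simps q_def of_nat_diff)
      have A: "\<bar>zigzag_poly (Suc s) (?c + 1 / q) - zigzag_poly (Suc s) (?c - 1 / q) - 2 * (1 / q) * zigzag_poly s (1 - ?c)\<bar>
          \<le> M * (1 / q) ^ 3"
        by (rule M(2)) (use q c4 c2 in auto)
      have B: "\<bar>zigzag_sum n s (n - i) - q ^ s * zigzag_poly s (2 * real (n - i) / q)\<bar> \<le> C * q ^ s / q ^ 2"
        using C(2)[OF n, of "n - i"] unfolding q_def by simp
      let ?P = "zigzag_poly (Suc s) (2 * real (Suc i) / q) - zigzag_poly (Suc s) (2 * real i / q)"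
      let ?W = "zigzag_poly s (2 * real (n - i) / q)"
      have A': "\<bar>?P - 2 * (1 / q) * ?W\<bar> \<le> M * (1 / q) ^ 3" using A unfolding c1 c2 c3 .
      have "2 * zigzag_sum n s (n - i) - q ^ Suc s * ?P =
        2 * (zigzag_sum n s (n - i) - q ^ s * ?W) - q ^ Suc s * (?P - 2 * (1 / q) * ?W)"
        using q by (simp add: algebra_simps)
      also have "\<bar>\<dots>\<bar> \<le> 2 * \<bar>zigzag_sum n s (n - i) - q ^ s * ?W\<bar> + q ^ Suc s * \<bar>?P - 2 * (1 / q) * ?W\<bar>"
        using q abs_triangle_ineq4[of "2 * (zigzag_sum n s (n - i) - q ^ s * ?W)" "q ^ Suc s * (?P - 2 * (1 / q) * ?W)"]
        by (simp only: abs_mult) (simp add: power_abs)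
      also have "\<dots> \<le> 2 * (C * q ^ s / q ^ 2) + q ^ Suc s * (M * (1 / q) ^ 3)"
        using A' B q by (intro add_mono mult_left_mono) auto
      finally show ?thesis .
    qed
    have tele: "zigzag_poly (Suc s) (2 * real t / q) =
      (\<Sum>i<t. zigzag_poly (Suc s) (2 * real (Suc i) / q) - zigzag_poly (Suc s) (2 * real i / q))"
      using sum_lessThan_telescope[of "\<lambda>i. zigzag_poly (Suc s) (2 * real i / q)" t]
      by (simp add: zigzag_poly_at_0)
    have eq: "zigzag_sum n (Suc s) t - q ^ Suc s * zigzag_poly (Suc s) (2 * real t / q) =
      (\<Sum>i<t. 2 * zigzag_sum n s (n - i) - q ^ Suc s * (zigzag_poly (Suc s) (2 * real (Suc i) / q) - zigzag_poly (Suc s) (2 * real i / q)))"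
      unfolding tele by (subst sum_subtractf) (simp only: zigzag_sum.simps sum_distrib_left)
    have "\<bar>zigzag_sum n (Suc s) t - q ^ Suc s * zigzag_poly (Suc s) (2 * real t / q)\<bar> \<le> (\<Sum>i<t. \<bar>2 * zigzag_sum n s (n - i) - q ^ Suc s * (zigzag_poly (Suc s) (2 * real (Suc i) / q) - zigzag_poly (Suc s) (2 * real i / q))\<bar>)"
      unfolding eq by (rule sum_abs)
    also have "\<dots> \<le> (\<Sum>i<t. 2 * (C * q ^ s / q ^ 2) + q ^ Suc s * (M * (1 / q) ^ 3))"
      by (rule sum_mono, rule mid) simp
    also have "\<dots> = 2 * real t * (C * q ^ s / q ^ 2) + real t * (q ^ Suc s * (M * (1 / q) ^ 3))"
    proof -
      have "(\<Sum>i<t. 2 * x + y) = 2 * real t * x + real t * y" for x y :: real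
        by (simp add: algebra_simps)
      then show ?thesis .
    qed
    also have "\<dots> \<le> q * (C * q ^ s / q ^ 2) + q * (q ^ Suc s * (M * (1 / q) ^ 3))"
      by (intro add_mono mult_right_mono) (use t q C M in \<open>auto simp: q_def\<close>)
    also have "\<dots> = (C + M) * q ^ Suc s / q ^ 2"
    proof -
      have 1: "q * (C * q ^ s / q ^ 2) = C * q ^ Suc s / q ^ 2" by simp
      have "q * (1 / q) ^ 3 = 1 / q ^ 2" using q by (simp add: power3_eq_cube power2_eq_square)
      then have "q * (q ^ Suc s * (M * (1 / q) ^ 3)) = q ^ Suc s * M * (1 / q ^ 2)"
        by (metis mult.assoc mult.commute)
      then show ?thesis unfolding 1 by (simp only: distrib_right add_divide_distrib) simp
    qed
    finally show ?thesis unfolding q_def .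
  qed
  then show ?case using C(1) M(1) by (intro exI[of _ "C + M"]) auto
qed

text \<open>The last node is 1 - 1 / q rather than 1. Replacing it by 1 costs only O(q^-2), since
  the derivative at 1 is \<open>zigzag_poly (d - 1) 0\<close>, which vanishes for
  \<open>d \<ge> 2\<close>.\<close>

lemma zigzag_sum_asymptotics:
  assumes "d \<ge> 2"
  shows "\<exists>C\<ge>0. \<forall>n\<ge>1. \<bar>zigzag_sum n d n / real (2 * n + 1) ^ d - zigzag_number d / fact d\<bar> \<le> C / real (2 * n + 1) ^ 2"
proof -
  obtain C where C: "C \<ge> 0" "\<And>n t. n \<ge> 1 \<Longrightarrow> t \<le> n \<Longrightarrow>
      \<bar>zigzag_sum n d t - real (2 * n + 1) ^ d * zigzag_poly d (2 * real t / real (2 * n + 1))\<bar>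
      \<le> C * real (2 * n + 1) ^ d / real (2 * n + 1) ^ 2" using zigzag_sum_approx[of d] by blast
  obtain k where k: "d = Suc k" "k \<ge> 1" using assms by (cases d) auto
  obtain M where M: "M \<ge> 0" "\<forall>a\<in>{0..1}. \<forall>b\<in>{0..1}. \<bar>zigzag_poly k a - zigzag_poly k b\<bar> \<le> M * \<bar>a - b\<bar>"
    using zigzag_poly_lipschitz by blast
  have "\<bar>zigzag_sum n d n / real (2 * n + 1) ^ d - zigzag_number d / fact d\<bar> \<le> (C + M) / real (2 * n + 1) ^ 2"
    if n: "n \<ge> 1" for n
  proof -
    define q where "q = real (2 * n + 1)"
    have q: "q > 0" "q \<ge> 1" by (simp_all add: q_def)
    have n2: "2 * real n / q = 1 - 1 / q" using q by (simp add: field_simps q_def)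
    have B: "\<bar>zigzag_sum n d n - q ^ d * zigzag_poly d (1 - 1 / q)\<bar> \<le> C * q ^ d / q ^ 2"
      using C(2)[OF n, of n] n2 unfolding q_def by simp
    have "zigzag_sum n d n / q ^ d - zigzag_poly d (1 - 1 / q) =
        (zigzag_sum n d n - q ^ d * zigzag_poly d (1 - 1 / q)) / q ^ d"
      using q by (simp add: field_simps)
    also have "\<bar>\<dots>\<bar> \<le> (C * q ^ d / q ^ 2) / q ^ d"
      using divide_right_mono[OF B, of "q ^ d"] q by (simp add: abs_divide)
    also have "\<dots> = C / q ^ 2" using q by simp
    finally have 1: "\<bar>zigzag_sum n d n / q ^ d - zigzag_poly d (1 - 1 / q)\<bar> \<le> C / q ^ 2" .
    have lt: "1 - 1 / q < 1" using q by simp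
    obtain z where z: "1 - 1 / q < z" "z < 1"
      "zigzag_poly d 1 - zigzag_poly d (1 - 1 / q) = (1 - (1 - 1 / q)) * zigzag_poly k (1 - z)"
      using MVT2[OF lt, of "zigzag_poly d" "\<lambda>z. zigzag_poly k (1 - z)"] zigzag_poly_deriv k(1) by blast
    have "1 / q \<le> 1" using q by simp
    then have "\<bar>zigzag_poly k (1 - z) - zigzag_poly k 0\<bar> \<le> M * \<bar>1 - z - 0\<bar>"
      using M(2)[rule_format, of "1 - z" 0] z(1,2) by auto
    also have "\<dots> \<le> M * (1 / q)" using z(1,2) M(1) by (intro mult_left_mono) auto
    finally have "\<bar>zigzag_poly k (1 - z)\<bar> \<le> M * (1 / q)" using k(2) by (simp add: zigzag_poly_at_0)
    then have "1 / q * \<bar>zigzag_poly k (1 - z)\<bar> \<le> 1 / q * (M * (1 / q))"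
      using q by (intro mult_left_mono) auto
    then have 2: "\<bar>zigzag_poly d 1 - zigzag_poly d (1 - 1 / q)\<bar> \<le> M / q ^ 2"
      unfolding z(3) using q by (simp add: abs_mult power2_eq_square)
    have "\<bar>zigzag_sum n d n / q ^ d - zigzag_poly d 1\<bar> \<le> C / q ^ 2 + M / q ^ 2"
      using 1 2 by linarith
    then show ?thesis unfolding zigzag_poly_at_1 q_def by (simp add: add_divide_distrib)
  qed
  then show ?thesis using C(1) M(1) by (intro exI[of _ "C + M"]) auto
qed

section \<open>Passage to the limit\<close>

lemma geometric_steps:
  fixes a :: "nat \<Rightarrow> real"
  assumes r: "0 \<le> r" "r \<le> 1 / 2" and K: "K \<ge> 0"
    and step: "\<And>e. e \<ge> 1 \<Longrightarrow> \<bar>a (e + 1) - a e\<bar> \<le> K * r ^ e"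
  shows "convergent a" "\<bar>lim a - a 1\<bar> \<le> 2 * K * r"
proof -
  let ?b = "\<lambda>e. a (Suc (Suc e)) - a (Suc e)"
  have b: "\<bar>?b e\<bar> \<le> K * r * r ^ e" for e using step[of "Suc e"] by (simp add: mult.assoc flip: Suc_eq_plus1)
  have g: "(\<lambda>e. K * r * r ^ e) sums (K * r * (1 / (1 - r)))"
    by (intro sums_mult geometric_sums) (use r in auto)
  have sb: "summable (\<lambda>e. \<bar>?b e\<bar>)"
    by (rule summable_comparison_test'[where g="\<lambda>e. K * r * r ^ e" and N=0]) (use g b in \<open>auto simp: sums_iff\<close>)
  have "(\<lambda>m. \<Sum>e<m. ?b e) \<longlonglongrightarrow> suminf ?b"
    using summable_rabs_cancel[OF sb] summable_LIMSEQ by blast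
  then have "(\<lambda>m. (\<Sum>e<m. ?b e) + a 1) \<longlonglongrightarrow> suminf ?b + a 1" by (intro tendsto_intros)
  moreover have "(\<Sum>e<m. ?b e) + a 1 = a (Suc m)" for m
    using sum_lessThan_telescope[of "\<lambda>e. a (Suc e)" m] by (simp add: One_nat_def)
  ultimately have "(\<lambda>m. a (Suc m)) \<longlonglongrightarrow> suminf ?b + a 1" by simp
  then have l: "a \<longlonglongrightarrow> suminf ?b + a 1" by (rule LIMSEQ_imp_Suc)
  then show "convergent a" by (auto simp: convergent_def)
  have "\<bar>suminf ?b\<bar> \<le> suminf (\<lambda>e. \<bar>?b e\<bar>)" by (rule summable_rabs[OF sb])
  also have "\<dots> \<le> suminf (\<lambda>e. K * r * r ^ e)" by (rule suminf_le[OF b sb]) (use g in \<open>simp add: sums_iff\<close>)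
  also have "\<dots> = K * r * (1 / (1 - r))" using g by (simp add: sums_iff)
  also have "\<dots> \<le> K * r * 2" by (rule mult_left_mono) (use r K in \<open>auto simp: field_simps\<close>)
  finally show "\<bar>lim a - a 1\<bar> \<le> 2 * K * r" using limI[OF l] by simp
qed

text \<open>With q = p^e, dividing the step estimate by (p q)^d leaves 4^(d-1) p^(-2 e), so the
  increments from e = 1 onwards are dominated by a geometric series of ratio p^-2. Its sum and the
  zigzag error at e = 1 give the two summands of the constant.\<close>

lemma block_count_limit:
  assumes "d \<ge> 2"
  shows "\<exists>C. \<forall>p n D. block_count p n D \<longrightarrow>
    \<bar>lim (\<lambda>e. block_count.quadric_count D d (p ^ e) / real (p ^ (e * d))) - (1 + zigzag_number d / fact d)\<bar>
      \<le> C / real p ^ 2"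
proof -
  obtain C where C: "C \<ge> 0" "\<And>n. n \<ge> 1 \<Longrightarrow>
    \<bar>zigzag_sum n d n / real (2 * n + 1) ^ d - zigzag_number d / fact d\<bar> \<le> C / real (2 * n + 1) ^ 2"
    using zigzag_sum_asymptotics[OF assms] by blast
  have "\<bar>lim (\<lambda>e. block_count.quadric_count D d (p ^ e) / real (p ^ (e * d))) - (1 + zigzag_number d / fact d)\<bar>
      \<le> (C + 2 * 4 ^ (d - 1)) / real p ^ 2" if "block_count p n D" for p n D
  proof -
    interpret block_count p n D by fact
    let ?a = "\<lambda>e. quadric_count d (p ^ e) / real (p ^ (e * d))"
    let ?r = "1 / real p ^ 2"
    have p3: "real p \<ge> 3" using p_gt_2 by linarith
    then have p9: "real p ^ 2 \<ge> 9" using power_mono[of 3 "real p" 2] by simp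
    have step: "\<bar>?a (e + 1) - ?a e\<bar> \<le> 4 ^ (d - 1) * ?r ^ e" if e: "e \<ge> 1" for e
    proof -
      let ?Q = "real (p * p ^ e)"
      have Q: "?Q > 0" using p3 by simp
      have odd: "odd (p ^ e)" using p_eq by simp
      have gt: "p ^ e > 1" using p_gt_2 e by (intro one_less_power) auto
      have "?a (e + 1) - ?a e = (quadric_count d (p * p ^ e) - real p ^ d * quadric_count d (p ^ e)) / ?Q ^ d"
      proof -
        have 1: "real (p ^ ((e + 1) * d)) = ?Q ^ d" "real (p ^ (e * d)) = real (p ^ e) ^ d"
          using power_mult[of p "e + 1" d] by (simp_all add: power_mult flip: Suc_eq_plus1)
        have 2: "?Q ^ d = real p ^ d * real (p ^ e) ^ d" by (simp add: power_mult_distrib)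
        have "?a e = real p ^ d * quadric_count d (p ^ e) / ?Q ^ d"
          unfolding 1 2 using p3 by simp
        then show ?thesis unfolding 1 by (simp add: diff_divide_distrib flip: Suc_eq_plus1)
      qed
      also have "\<bar>\<dots>\<bar> \<le> (4 ^ (d - 1) * real p ^ 2 * ?Q ^ (d - 2)) / ?Q ^ d"
        unfolding abs_divide using quadric_count_step[OF assms odd gt] Q by (simp add: divide_right_mono)
      also have "\<dots> = 4 ^ (d - 1) * real p ^ 2 / ?Q ^ 2"
      proof -
        have "?Q ^ d = ?Q ^ (d - 2) * ?Q ^ 2" using power_add[of ?Q "d - 2" 2] assms by (simp only: le_add_diff_inverse2)
        then show ?thesis using Q by simp
      qed
      also have "\<dots> = 4 ^ (d - 1) * ?r ^ e"
        using p3 by (simp add: power_mult_distrib power_divide power_commutes flip: power_mult)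
      finally show ?thesis .
    qed
    have r: "0 \<le> ?r" by simp
    have r': "?r \<le> 1 / 2" by (rule frac_le) (use p9 in auto)
    have 1: "\<bar>lim ?a - ?a 1\<bar> \<le> 2 * 4 ^ (d - 1) * ?r"
      by (rule geometric_steps(2)[OF r r' _ step]) auto
    have "?a 1 = 1 + zigzag_sum n d n / real p ^ d"
      using p3 by (simp add: quadric_count_p field_simps)
    then have "\<bar>?a 1 - (1 + zigzag_number d / fact d)\<bar> \<le> C / real p ^ 2"
      using C(2)[OF n_pos] unfolding p_eq by simp
    then show ?thesis using 1 by (simp add: add_divide_distrib)
  qed
  then show ?thesis by blast
qed

section \<open>Block counts from kernels over Z/p\<close>

context prime_values
begin

text \<open>The kernel of the nilpotent operator is a vector space over Z/p whose dimension is the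
  number of Jordan blocks; the logarithm recovers it from the order.\<close>

definition blocks :: "nat multiset \<Rightarrow> real" where
  "blocks M = log p (card (K 1 (sorted_list_of_multiset M)))"

lemma blocks_mset: "blocks (mset as) = log p (card (K 1 as))"
  unfolding blocks_def by (subst card_K_mset[of _ as]) auto

lemma log_p_mult: "0 < x \<Longrightarrow> 0 < y \<Longrightarrow> log p (real (x * y)) = log p x + log p y"
  using p_gt_1 by (simp add: log_mult)

lemma log_p_le: "0 < x \<Longrightarrow> x \<le> y \<Longrightarrow> log p (real x) \<le> log p (real y)"
  using p_gt_1 by (intro log_mono) auto

lemma log_p_pow: "log p (real (x ^ m)) = m * log p x" if "0 < x"
  using that p_gt_1 by (simp add: log_nat_power)

lemma blocks_Cons: "blocks (add_mset a (mset as)) = log p (card (K a as))"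
  using blocks_mset[of "a # as"] unfolding card_K_Cons by simp

lemma K_Nil: "m \<ge> 1 \<Longrightarrow> K m [] = F []"
proof -
  assume m: "m \<ge> 1"
  have "(shift_sum 1 ^^ m) f l = 0" if "f \<in> F []" for f :: "nat list \<Rightarrow> 'r" and l
  proof -
    have "shift_sum 1 f = (\<lambda>l. 0)"
    proof
      fix l show "shift_sum 1 f l = 0"
        using F_shift_sum[OF that, of 1] shift_sum.simps(1)[of 1 f] unfolding F_def by (cases "l = []") simp_all
    qed
    moreover have "(shift_sum 1 ^^ m) f = (shift_sum 1 ^^ (m - 1)) (shift_sum 1 f)"
      using m funpow_Suc_right[of "m - 1" "shift_sum 1 :: (nat list \<Rightarrow> 'r) \<Rightarrow> _"] by simp
    ultimately show ?thesis by (simp add: shift_sum_pow_zero)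
  qed
  then show "K m [] = F []" by (auto simp: K_def)
qed

lemma block_count_blocks:
  assumes "p > 2"
  shows "block_count p (p div 2) blocks"
proof
  have "odd p" by (rule prime_odd_nat[OF p assms])
  then show "p = 2 * (p div 2) + 1" by presburger
  show "p div 2 \<ge> 1" using assms by linarith
  show "blocks {#a#} = 1" if "a \<ge> 1" for a
    using blocks_Cons[of a "[]"] p_gt_1 by (simp add: K_Nil[OF that] card_F)
  show "blocks M = 0" if M: "0 \<in># M" for M
  proof -
    obtain as where as: "mset as = M - {#0#}" using ex_mset by blast
    then have "M = add_mset 0 (mset as)" using M by simp
    then show ?thesis using blocks_Cons[of 0 as] by (simp add: card_K_0)
  qed
  show "blocks (add_mset 1 M) = blocks M" for M
  proof -
    obtain as where as: "mset as = M" using ex_mset by blast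
    then show ?thesis using blocks_Cons[of 1 as] blocks_mset[of as] by simp
  qed
  show "blocks (add_mset 2 (add_mset m M)) = blocks (add_mset (m + 1) M) + blocks (add_mset (m - 1) M)"
    if m: "\<not> p dvd m" for m M
  proof -
    obtain as where as: "mset as = M" using ex_mset by blast
    have "blocks (add_mset 2 (add_mset m M)) = log p (card (K m (2 # as)))"
      using blocks_Cons[of m "2 # as"] as by (simp add: add_mset_commute)
    also have "\<dots> = log p (card (K (m + 1) as)) + log p (card (K (m - 1) as))"
      unfolding card_K_2_not_dvd[OF m] by (rule log_p_mult) (rule card_K_pos)+
    finally show ?thesis unfolding blocks_Cons[symmetric] as .
  qed
  show "blocks (add_mset 2 (add_mset m M)) = 2 * blocks (add_mset m M)" if m: "p dvd m" for m M
  proof -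
    obtain as where as: "mset as = M" using ex_mset by blast
    have "blocks (add_mset 2 (add_mset m M)) = log p (card (K m (2 # as)))"
      using blocks_Cons[of m "2 # as"] as by (simp add: add_mset_commute)
    also have "\<dots> = log p (card (K m as)) + log p (card (K m as))"
      unfolding card_K_2_dvd[OF m] by (rule log_p_mult) (rule card_K_pos)+
    finally show ?thesis unfolding blocks_Cons[symmetric] as by simp
  qed
  show "blocks (image_mset ((*) p) M) = real (p ^ (size M - 1)) * blocks M" if M: "M \<noteq> {#}" for M
  proof -
    obtain bs where bs: "mset bs = M" using ex_mset by blast
    then obtain a as where as: "mset (a # as) = M" using M by (cases bs) auto
    have "blocks (image_mset ((*) p) M) = log p (card (K 1 (p * a # map ((*) p) as)))"
      using blocks_mset[of "p * a # map ((*) p) as"] by (simp flip: as)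
    also have "\<dots> = real (p ^ length as) * log p (card (K 1 (a # as)))"
      unfolding card_K_frobenius by (rule log_p_pow) (rule card_K_pos)
    finally show ?thesis using blocks_mset[of "a # as"] as by (auto simp flip: as)
  qed
  have sd: "log p (card (K 1 (Suc a # b # cs))) + log p (card (K 1 (a # Suc b # cs)))
      \<le> log p (card (K 1 (Suc a # Suc b # cs))) + log p (card (K 1 (a # b # cs)))"
    "log p (card (K 1 (Suc a # Suc b # cs))) + log p (card (K 1 (a # b # cs)))
      \<le> log p (card (K 1 (Suc a # b # cs))) + log p (card (K 1 (a # Suc b # cs))) + log p (card (K 1 cs))" for a b cs
    using log_p_le[OF _ card_K_second_difference(1)[of a b cs]] log_p_le[OF _ card_K_second_difference(2)[of a b cs]]
    by (simp_all only: log_p_mult card_K_pos mult_pos_pos nat_0_less_mult_iff simp_thms)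
  have sd': "blocks (add_mset (a + 1) (add_mset b M)) + blocks (add_mset a (add_mset (b + 1) M))
      \<le> blocks (add_mset (a + 1) (add_mset (b + 1) M)) + blocks (add_mset a (add_mset b M))"
    "blocks (add_mset (a + 1) (add_mset (b + 1) M)) + blocks (add_mset a (add_mset b M))
      \<le> blocks (add_mset (a + 1) (add_mset b M)) + blocks (add_mset a (add_mset (b + 1) M)) + blocks M" for a b M
  proof -
    obtain cs where cs: "mset cs = M" using ex_mset by blast
    have b: "blocks (add_mset x (add_mset y M)) = log p (card (K 1 (x # y # cs)))" for x y
      using blocks_mset[of "x # y # cs"] cs by simp
    show "blocks (add_mset (a + 1) (add_mset b M)) + blocks (add_mset a (add_mset (b + 1) M))
      \<le> blocks (add_mset (a + 1) (add_mset (b + 1) M)) + blocks (add_mset a (add_mset b M))"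
      using sd(1)[of a b cs] unfolding b by (simp flip: Suc_eq_plus1)
    show "blocks (add_mset (a + 1) (add_mset (b + 1) M)) + blocks (add_mset a (add_mset b M))
      \<le> blocks (add_mset (a + 1) (add_mset b M)) + blocks (add_mset a (add_mset (b + 1) M)) + blocks M"
      using sd(2)[of a b cs] blocks_mset[of cs] cs unfolding b by (simp flip: Suc_eq_plus1)
  qed
  show "0 \<le> blocks (add_mset (a + 1) (add_mset (b + 1) M)) - blocks (add_mset (a + 1) (add_mset b M))
        - blocks (add_mset a (add_mset (b + 1) M)) + blocks (add_mset a (add_mset b M))" for a b M
    using sd'(1)[of a b M] by linarith
  show "blocks (add_mset (a + 1) (add_mset (b + 1) M)) - blocks (add_mset (a + 1) (add_mset b M))
        - blocks (add_mset a (add_mset (b + 1) M)) + blocks (add_mset a (add_mset b M)) \<le> blocks M" for a b M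
    using sd'(2)[of a b M] by linarith
  show "blocks (add_mset a M) \<le> real (prod_mset M)" for a M
  proof -
    obtain as where as: "mset as = M" using ex_mset by blast
    have "blocks (add_mset a M) \<le> log p (real (p ^ prod_list as))"
      using log_p_le[OF card_K_pos card_K_le[of a as]] blocks_mset[of "a # as"] as by simp
    also have "\<dots> = real (prod_list as)" using log_p_pow[OF p_gt_0, of "prod_list as"] p_gt_1 by simp
    also have "prod_list as = prod_mset M" using as by (metis prod_mset_prod_list)
    finally show ?thesis .
  qed
qed

text \<open>The algebra of the quadric, restricted to monomials with exponents below \<open>q\<close>: splitting the
  multi-indices by parity turns \<open>x\<^sub>i\<^sup>2\<close> into a variable of height \<open>(q + 1) div 2\<close> or \<open>q div 2\<close>.\<close>

lemma log_card_quadric: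
  assumes "p > 2" "odd q"
  shows "log p (card {f \<in> F (replicate (Suc d) q). \<forall>l. shift_sum 2 f l = 0}) =
    block_count.quadric_count blocks d q"
proof -
  interpret block_count p "p div 2" blocks by (rule block_count_blocks[OF assms(1)])
  let ?C = "box (replicate (Suc d) 2)"
  have rc: "residue_count 2 0 q = q div 2 + 1" "residue_count 2 1 q = q div 2"
    using assms(2) by (auto simp: residue_count_def elim: oddE)
  have "{f \<in> F (replicate (Suc d) q). \<forall>l. shift_sum 2 f l = 0} =
     {f \<in> F (replicate (Suc d) q). \<forall>l. (shift_sum 2 ^^ 1) f l = 0}" by (simp add: One_nat_def)
  also have "card \<dots> = (\<Prod>c\<in>?C. card (K 1 (map2 (residue_count 2) c (replicate (Suc d) q))))"
    by (subst card_residues) simp_all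
  also have "log p \<dots> = (\<Sum>c\<in>?C. log p (card (K 1 (map2 (residue_count 2) c (replicate (Suc d) q)))))"
  proof -
    have "log p (real (\<Prod>c\<in>S. card (K 1 (h c)))) = (\<Sum>c\<in>S. log p (card (K 1 (h c))))" if "finite S"
      for S :: "nat list set" and h
      using that
    proof (induction S)
      case (insert x S)
      have "(\<Prod>c\<in>S. card (K 1 (h c))) > 0" by (rule prod_pos) (rule card_K_pos)
      from log_p_mult[OF card_K_pos[of 1 "h x"] this] show ?case using insert by simp
    qed simp
    then show ?thesis by simp
  qed
  also have "\<dots> = (\<Sum>c\<in>?C. blocks (mset (map (\<lambda>i. if i = 0 then q div 2 + 1 else q div 2) c)))"
  proof (rule sum.cong)
    fix c assume "c \<in> ?C"
    then have "map2 (residue_count 2) c (replicate (Suc d) q) = map (\<lambda>i. if i = 0 then q div 2 + 1 else q div 2) c"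
    proof (induction "Suc d" arbitrary: c d)
      case (Suc d)
      then obtain i c' where c: "c = i # c'" "i < 2" "c' \<in> box (replicate d 2)" by (auto simp: box_Cons)
      have i: "i = 0 \<or> i = 1" using c(2) by linarith
      have "map2 (residue_count 2) c' (replicate d q) = map (\<lambda>i. if i = 0 then q div 2 + 1 else q div 2) c'"
      proof (cases d)
        case 0 then show ?thesis using c(3) by simp
      next
        case (Suc d') then show ?thesis using Suc.hyps(1)[of d' c'] c(3) by simp
      qed
      then show ?case using i rc by (auto simp: c(1))
    qed
    then show "log p (card (K 1 (map2 (residue_count 2) c (replicate (Suc d) q)))) =
      blocks (mset (map (\<lambda>i. if i = 0 then q div 2 + 1 else q div 2) c))" by (simp only: blocks_mset)
  qed simp
  also have "\<dots> = quadric_count d q"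
    unfolding quadric_count_def L_pow_sum_del[symmetric] by (simp add: add.commute)
  finally show ?thesis .
qed

text \<open>On one factor the shift sum is translation of the index, so the kernel of its
  \<open>a\<close>-th power consists of the functions supported below both \<open>a\<close> and
  \<open>b\<close>.\<close>

lemma blocks_pair: "blocks {#a, b#} = min a b"
proof -
  have pow: "(shift_sum 1 ^^ m) f [j] = f [j + m]" if "f \<in> F [b]" for f m j
  proof (induction m arbitrary: j)
    case (Suc m)
    have "(shift_sum 1 ^^ m) f \<in> F [b]" by (rule F_shift_sum_pow) (rule that)
    then show ?case using Suc[of "j + 1"] by (simp add: One_nat_def)
  qed simp
  have pow': "(shift_sum 1 ^^ m) f l = 0" if "f \<in> F [b]" "length l \<noteq> 1" for f m l
    using F_shift_sum_pow[OF that(1), of m 1] that(2) box_length[of l "[b]"] by (auto simp: F_def One_nat_def)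
  have "K a [b] = F [min a b]"
  proof (intro equalityI subsetI)
    fix f assume f: "f \<in> K a [b]"
    have "f [j] = 0" if "j \<ge> a" for j
      using f pow[of f a "j - a"] that by (simp add: K_def)
    moreover have "f [j] = 0" if "j \<ge> b" for j using f that by (simp add: K_def F_def)
    ultimately have "f [j] = 0" if "\<not> j < min a b" for j using that by (cases "a \<le> j") auto
    moreover have "f l = 0" if "\<forall>j. l \<noteq> [j]" for l using f that by (auto simp: K_def F_def box_Cons)
    ultimately have "f l = 0" if "l \<notin> box [min a b]" for l using that by (cases "\<exists>j. l = [j]") auto
    then show "f \<in> F [min a b]" using f by (simp add: K_def F_def)
  next
    fix f assume f: "f \<in> F [min a b]"
    then have fb: "f \<in> F [b]" by (auto simp: F_def box_Cons)
    have "f [j + a] = 0" for j using f by (simp add: F_def)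
    then have "(shift_sum 1 ^^ a) f l = 0" for l
      using pow[OF fb, of a "hd l"] pow'[OF fb, of l a] by (cases "length l = 1") (auto simp: length_Suc_conv One_nat_def)
    then show "f \<in> K a [b]" using fb by (simp add: K_def)
  qed
  then show ?thesis
    using blocks_Cons[of a "[b]"] log_p_pow[OF p_gt_0, of "min a b"] p_gt_1 by (simp add: card_F)
qed

text \<open>With blocks of sizes b and b + 1, where q = 2 b + 1, the square contributes b + 2 b + (b
  + 1) blocks. This exact value replaces the estimates, which start at dimension 2.\<close>

lemma quadric_count_dim_1:
  assumes "p > 2" "odd q"
  shows "block_count.quadric_count blocks 1 q = 2 * real q - 1"
proof -
  interpret block_count p "p div 2" blocks by (rule block_count_blocks[OF assms(1)])
  let ?b = "q div 2"
  have "(del ?b + del (?b + 1)) ^ Suc 1 = tmon {#?b, ?b#} + of_nat 2 * tmon {#?b, ?b + 1#} + tmon {#?b + 1, ?b + 1#}"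
    by (simp add: One_nat_def del_def algebra_simps tmon_mult add_mset_commute)
  then have "quadric_count 1 q = blocks {#?b, ?b#} + 2 * blocks {#?b, ?b + 1#} + blocks {#?b + 1, ?b + 1#}"
    unfolding quadric_count_def by (simp only: L_add L_of_nat_mult L_tmon)
  also have "\<dots> = 4 * real ?b + 1" by (simp add: blocks_pair)
  also have "4 * real ?b + 1 = 2 * real q - 1"
  proof -
    have "q = 2 * ?b + 1" using assms(2) by presburger
    then have "real q = 2 * real ?b + 1" by (metis of_nat_1 of_nat_add of_nat_mult of_nat_numeral)
    then show ?thesis by simp
  qed
  finally show ?thesis .
qed

end

section \<open>A model of \<open>\<int>/p\<close>\<close>

text \<open>Since no type can depend on \<open>p\<close>, \<open>\<int>/p\<close> is realised as a factor of the product of all \<open>\<int>/n\<close>.\<close>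

quotient_type residues_all = "nat \<Rightarrow> int" / "\<lambda>f g. \<forall>n. int n dvd f n - g n"
proof (rule equivpI)
  show "reflp (\<lambda>f g. \<forall>n. int n dvd f n - g n)" by (auto intro: reflpI)
  show "symp (\<lambda>f g. \<forall>n. int n dvd f n - g n)" by (auto intro!: sympI simp: dvd_diff_commute)
  show "transp (\<lambda>f g. \<forall>n. int n dvd f n - g n)"
  proof (rule transpI, rule allI)
    fix f g h :: "nat \<Rightarrow> int" and n
    assume "\<forall>n. int n dvd f n - g n" "\<forall>n. int n dvd g n - h n"
    then have "int n dvd (f n - g n) + (g n - h n)" by (intro dvd_add) auto
    then show "int n dvd f n - h n" by simp
  qed
qed

instantiation residues_all :: comm_ring_1
begin

lift_definition zero_residues_all :: residues_all is "\<lambda>n. 0" .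
lift_definition one_residues_all :: residues_all is "\<lambda>n. 1" .
lift_definition plus_residues_all :: "residues_all \<Rightarrow> residues_all \<Rightarrow> residues_all" is "\<lambda>f g n. f n + g n"
proof -
  fix f f' g g' :: "nat \<Rightarrow> int" and n
  assume "\<And>n. int n dvd f n - f' n" "\<And>n. int n dvd g n - g' n"
  then have "int n dvd (f n - f' n) + (g n - g' n)" by (intro dvd_add) auto
  then show "int n dvd f n + g n - (f' n + g' n)" by (simp add: algebra_simps)
qed
lift_definition minus_residues_all :: "residues_all \<Rightarrow> residues_all \<Rightarrow> residues_all" is "\<lambda>f g n. f n - g n"
proof -
  fix f f' g g' :: "nat \<Rightarrow> int" and n
  assume "\<And>n. int n dvd f n - f' n" "\<And>n. int n dvd g n - g' n"
  then have "int n dvd (f n - f' n) - (g n - g' n)" by (rule dvd_diff)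
  then show "int n dvd f n - g n - (f' n - g' n)" by (simp add: algebra_simps)
qed
lift_definition uminus_residues_all :: "residues_all \<Rightarrow> residues_all" is "\<lambda>f n. - f n"
proof -
  fix f f' :: "nat \<Rightarrow> int" and n
  assume "\<And>n. int n dvd f n - f' n"
  then have "int n dvd - (f n - f' n)" by (subst dvd_minus_iff) auto
  then show "int n dvd - f n - - f' n" by (simp add: algebra_simps)
qed
lift_definition times_residues_all :: "residues_all \<Rightarrow> residues_all \<Rightarrow> residues_all" is "\<lambda>f g n. f n * g n"
proof -
  fix f f' g g' :: "nat \<Rightarrow> int" and n
  assume "\<And>n. int n dvd f n - f' n" "\<And>n. int n dvd g n - g' n"
  then have "int n dvd (f n - f' n) * g n + f' n * (g n - g' n)" by (intro dvd_add dvd_mult dvd_mult2) auto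
  then show "int n dvd f n * g n - f' n * g' n" by (simp add: algebra_simps)
qed

instance
proof
  fix a b c :: residues_all
  show "a * b * c = a * (b * c)" by transfer (simp add: mult.assoc)
  show "a * b = b * a" by transfer (simp add: mult.commute)
  show "1 * a = a" by transfer simp
  show "a + b + c = a + (b + c)" by transfer (simp add: add.assoc)
  show "a + b = b + a" by transfer (simp add: add.commute)
  show "0 + a = a" by transfer simp
  show "- a + a = 0" by transfer simp
  show "a - b = a + - b" by transfer simp
  show "(a + b) * c = a * c + b * c" by transfer (simp add: algebra_simps)
  show "(0 :: residues_all) \<noteq> 1"
  proof (transfer, rule notI)
    assume "\<forall>n. int n dvd 0 - 1"
    then have "int 2 dvd 0 - 1" by blast
    then show False by simp
  qed
qed

end

text \<open>Supported at the coordinate \<open>p\<close> alone, so that its range is an additive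
  copy of Z/p inside a ring that is the same for all \<open>p\<close>.\<close>

lift_definition residue_at :: "nat \<Rightarrow> int \<Rightarrow> residues_all" is "\<lambda>p x n. if n = p then x else 0" .

lemma residue_at_eq_iff: "residue_at p x = residue_at p y \<longleftrightarrow> int p dvd x - y"
  by transfer auto

lemma residue_at_diff: "residue_at p x - residue_at p y = residue_at p (x - y)"
  by transfer simp

lemma residue_at_add: "residue_at p x + residue_at p y = residue_at p (x + y)"
  by transfer simp

lemma residue_at_0: "residue_at p 0 = 0"
  by transfer simp

lemma residue_at_mod: "residue_at p x = residue_at p (x mod int p)"
  by (simp add: residue_at_eq_iff)

lemma of_nat_mult_residue_at: "of_nat m * residue_at p x = residue_at p (int m * x)"
  by (induction m) (auto simp: algebra_simps residue_at_0 residue_at_add)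

lemma prime_values_residue_at:
  assumes "Factorial_Ring.prime p"
  shows "prime_values p (range (residue_at p))"
proof
  show "Factorial_Ring.prime p" by fact
  have p: "p > 0" using assms prime_gt_0_nat by blast
  have "range (residue_at p) = residue_at p ` {0..<int p}"
  proof (intro equalityI subsetI)
    fix z assume "z \<in> range (residue_at p)"
    then obtain x where "z = residue_at p (x mod int p)" using residue_at_mod by auto
    then show "z \<in> residue_at p ` {0..<int p}" using p by auto
  qed auto
  moreover have "inj_on (residue_at p) {0..<int p}"
  proof (rule inj_onI)
    fix x y assume xy: "x \<in> {0..<int p}" "y \<in> {0..<int p}" "residue_at p x = residue_at p y"
    then have "x mod int p = y mod int p" by (simp only: residue_at_eq_iff mod_eq_dvd_iff)
    moreover have "x mod int p = x" "y mod int p = y" using xy(1,2) by (simp_all add: mod_pos_pos_trivial)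
    ultimately show "x = y" by simp
  qed
  ultimately show "card (range (residue_at p)) = p" by (simp add: card_image)
  show "x - y \<in> range (residue_at p)" if "x \<in> range (residue_at p)" "y \<in> range (residue_at p)" for x y
    using that by (auto simp: residue_at_diff)
  show "of_nat p * x = 0" if "x \<in> range (residue_at p)" for x
    using that residue_at_eq_iff[of p _ 0] by (auto simp: of_nat_mult_residue_at residue_at_0)
qed

section \<open>Power series rings\<close>

lemma finite_submultisets [simp]: "finite {u. u \<subseteq># m}"
proof (induction m)
  case (add x m)
  have "u \<in> {u. u \<subseteq># m} \<union> add_mset x ` {u. u \<subseteq># m}" if "u \<subseteq># add_mset x m" for u
  proof (cases "x \<in># u")
    case True
    then obtain v where "u = add_mset x v" by (metis insert_DiffM)
    then show ?thesis using that by simp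
  next
    case False
    have "count u a \<le> count m a" for a
      using mset_subset_eq_count[OF that, of a] False by (cases "a = x") (auto simp: not_in_iff)
    then show ?thesis by (simp add: subseteq_mset_def)
  qed
  then have "{u. u \<subseteq># add_mset x m} \<subseteq> {u. u \<subseteq># m} \<union> add_mset x ` {u. u \<subseteq># m}" by blast
  then show ?case using add finite_subset by blast
qed simp

lemma mset_double_diff: "u \<subseteq># m \<Longrightarrow> m - (m - u) = u"
  by (simp add: multiset_eq_iff subseteq_mset_def)

lemma (in abelian_monoid) finsum_Sigma:
  assumes "finite I" "\<And>i. i \<in> I \<Longrightarrow> finite (J i)"
    and "\<And>i j. i \<in> I \<Longrightarrow> j \<in> J i \<Longrightarrow> f (i, j) \<in> carrier G"
  shows "finsum G f (Sigma I J) = (\<Oplus>i\<in>I. \<Oplus>j\<in>J i. f (i, j))"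
  using assms
proof (induction I)
  case (insert x I)
  have inj: "inj_on (Pair x) (J x)" by (auto simp: inj_on_def)
  have "Sigma (insert x I) J = Pair x ` J x \<union> Sigma I J" by auto
  also have "finsum G f \<dots> = finsum G f (Pair x ` J x) \<oplus> finsum G f (Sigma I J)"
    using insert by (intro finsum_Un_disjoint) auto
  also have "finsum G f (Pair x ` J x) = (\<Oplus>j\<in>J x. f (x, j))"
    using insert.prems by (intro finsum_reindex[OF _ inj]) auto
  also have "finsum G f (Sigma I J) = (\<Oplus>i\<in>I. \<Oplus>j\<in>J i. f (i, j))"
    using insert by blast
  also have "(\<Oplus>j\<in>J x. f (x, j)) \<oplus> (\<Oplus>i\<in>I. \<Oplus>j\<in>J i. f (i, j)) = (\<Oplus>i\<in>insert x I. \<Oplus>j\<in>J i. f (i, j))"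
    using insert by (intro finsum_insert[symmetric] finsum_closed Pi_I) auto
  finally show ?case .
qed simp

locale power_series = cring R for R :: "('a, 'b) ring_scheme" (structure) +
  fixes V :: "'c set"
begin

abbreviation S where "S \<equiv> power_series_ring R V"

definition monomials :: "'c multiset set" where "monomials = {m. set_mset m \<subseteq> V}"

lemma monomials_diff: "m \<in> monomials \<Longrightarrow> m - u \<in> monomials"
  by (auto simp: monomials_def dest: in_diffD)

lemma monomials_add: "m \<in> monomials \<Longrightarrow> u \<in> monomials \<Longrightarrow> m + u \<in> monomials"
  by (auto simp: monomials_def)

lemma monomials_empty [simp]: "{#} \<in> monomials" by (simp add: monomials_def)

lemma S_carrier: "f \<in> carrier S \<longleftrightarrow> (\<forall>m. f m \<in> carrier R) \<and> (\<forall>m. m \<notin> monomials \<longrightarrow> f m = \<zero>)"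
  by (auto simp: power_series_ring_def monomials_def)

lemma S_coeff [simp, intro]: "f \<in> carrier S \<Longrightarrow> f m \<in> carrier R"
  by (simp add: S_carrier)

lemma S_add: "(f \<oplus>\<^bsub>S\<^esub> g) m = f m \<oplus> g m"
  unfolding power_series_ring_def by (simp only: ring_record_simps monoid.simps ring.simps indexed_padd_def)

lemma S_zero: "\<zero>\<^bsub>S\<^esub> m = \<zero>"
  unfolding power_series_ring_def by (simp only: ring.simps indexed_const_def if_cancel)

lemma S_mult: "(f \<otimes>\<^bsub>S\<^esub> g) m = (\<Oplus>u\<in>{u. u \<subseteq># m}. f u \<otimes> g (m - u))"
  unfolding power_series_ring_def by (simp only: monoid.simps ring.simps)

definition mon :: "'a \<Rightarrow> 'c multiset \<Rightarrow> 'c multiset \<Rightarrow> 'a" where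
  "mon c \<mu> = (\<lambda>m. if m = \<mu> then c else \<zero>)"

lemma mon_closed [simp, intro]: "c \<in> carrier R \<Longrightarrow> \<mu> \<in> monomials \<Longrightarrow> mon c \<mu> \<in> carrier S"
  by (auto simp: S_carrier mon_def)

lemma S_one: "\<one>\<^bsub>S\<^esub> = mon \<one> {#}"
  unfolding power_series_ring_def mon_def by (simp only: monoid.simps indexed_const_def)

lemma S_mult_closed: "f \<in> carrier S \<Longrightarrow> g \<in> carrier S \<Longrightarrow> f \<otimes>\<^bsub>S\<^esub> g \<in> carrier S"
proof -
  assume f: "f \<in> carrier S" and g: "g \<in> carrier S"
  have "(f \<otimes>\<^bsub>S\<^esub> g) m = \<zero>" if m: "m \<notin> monomials" for m
  proof -
    have "f u \<otimes> g (m - u) = \<zero>" if "u \<subseteq># m" for u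
    proof (cases "u \<in> monomials")
      case True
      then have "m - u \<notin> monomials" using m monomials_add[of u "m - u"] that by auto
      then show ?thesis using f g by (simp add: S_carrier)
    next
      case False
      then show ?thesis using f g by (simp add: S_carrier)
    qed
    then show ?thesis unfolding S_mult by (intro add.finprod_one_eqI) auto
  qed
  moreover have "(f \<otimes>\<^bsub>S\<^esub> g) m \<in> carrier R" for m
    unfolding S_mult using f g by (intro finsum_closed) auto
  ultimately show "f \<otimes>\<^bsub>S\<^esub> g \<in> carrier S" by (simp add: S_carrier)
qed

lemma mon_mult:
  assumes "c \<in> carrier R" "g \<in> carrier S"
  shows "(mon c \<mu> \<otimes>\<^bsub>S\<^esub> g) m = (if \<mu> \<subseteq># m then c \<otimes> g (m - \<mu>) else \<zero>)"
proof (cases "\<mu> \<subseteq># m")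
  case True
  have "(mon c \<mu> \<otimes>\<^bsub>S\<^esub> g) m = (\<Oplus>u\<in>{u. u \<subseteq># m}. if \<mu> = u then c \<otimes> g (m - u) else \<zero>)"
    unfolding S_mult using assms by (intro finsum_cong') (auto simp: mon_def)
  also have "\<dots> = c \<otimes> g (m - \<mu>)"
    using True assms by (intro finsum_singleton) auto
  finally show ?thesis using True by simp
next
  case False
  have "(mon c \<mu> \<otimes>\<^bsub>S\<^esub> g) m = \<zero>"
    unfolding S_mult using assms False by (intro add.finprod_one_eqI) (auto simp: mon_def)
  then show ?thesis using False by simp
qed

lemma S_m_comm:
  assumes "f \<in> carrier S" "g \<in> carrier S"
  shows "f \<otimes>\<^bsub>S\<^esub> g = g \<otimes>\<^bsub>S\<^esub> f"
proof
  fix m :: "'c multiset"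
  have inj: "inj_on (\<lambda>u. m - u) {u. u \<subseteq># m}"
    by (intro inj_onI) (metis mem_Collect_eq subset_mset.add_diff_inverse subset_mset.diff_add add_left_imp_eq add_right_imp_eq)
  have "(f \<otimes>\<^bsub>S\<^esub> g) m = finsum R (\<lambda>u. f u \<otimes> g (m - u)) ((\<lambda>u. m - u) ` {u. u \<subseteq># m})"
  proof -
    have "(\<lambda>u. m - u) ` {u. u \<subseteq># m} = {u. u \<subseteq># m}"
    proof (intro equalityI subsetI)
      fix u assume "u \<in> {u. u \<subseteq># m}"
      then have "u = m - (m - u)" by (simp add: mset_double_diff)
      then show "u \<in> (\<lambda>u. m - u) ` {u. u \<subseteq># m}" by (intro image_eqI[of _ _ "m - u"]) auto
    qed auto
    then show ?thesis by (simp add: S_mult)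
  qed
  also have "\<dots> = (\<Oplus>u\<in>{u. u \<subseteq># m}. f (m - u) \<otimes> g (m - (m - u)))"
    using assms by (intro finsum_reindex inj) auto
  also have "\<dots> = (g \<otimes>\<^bsub>S\<^esub> f) m"
    unfolding S_mult using assms by (intro finsum_cong') (auto simp: mset_double_diff m_comm)
  finally show "(f \<otimes>\<^bsub>S\<^esub> g) m = (g \<otimes>\<^bsub>S\<^esub> f) m" .
qed

lemma S_m_assoc:
  assumes f: "f \<in> carrier S" and g: "g \<in> carrier S" and h: "h \<in> carrier S"
  shows "f \<otimes>\<^bsub>S\<^esub> g \<otimes>\<^bsub>S\<^esub> h = f \<otimes>\<^bsub>S\<^esub> (g \<otimes>\<^bsub>S\<^esub> h)"
proof
  fix m :: "'c multiset"
  let ?A = "Sigma {u. u \<subseteq># m} (\<lambda>u. {v. v \<subseteq># u})"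
  let ?B = "Sigma {v. v \<subseteq># m} (\<lambda>v. {w. w \<subseteq># m - v})"
  let ?F = "\<lambda>(u, v). f v \<otimes> g (u - v) \<otimes> h (m - u)"
  have "(f \<otimes>\<^bsub>S\<^esub> g \<otimes>\<^bsub>S\<^esub> h) m = (\<Oplus>u\<in>{u. u \<subseteq># m}. \<Oplus>v\<in>{v. v \<subseteq># u}. ?F (u, v))"
    unfolding S_mult using f g h
    by (intro finsum_cong') (auto simp: finsum_ldistr intro!: finsum_cong')
  also have "\<dots> = finsum R ?F ?A" using f g h by (intro finsum_Sigma[symmetric]) auto
  \<comment> \<open>The pairs v \<le> u \<le> m are parametrised by v and w = u - v, which turns one
    bracketing into the other.\<close>
  also have "?A = (\<lambda>(v, w). (v + w, v)) ` ?B"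
  proof (intro equalityI subsetI)
    fix x assume "x \<in> ?A"
    then obtain u v where x: "x = (u, v)" "u \<subseteq># m" "v \<subseteq># u" by blast
    then have "(v, u - v) \<in> ?B" "x = (\<lambda>(v, w). (v + w, v)) (v, u - v)"
      by (auto intro: subset_mset.order_trans) (simp add: subseteq_mset_def diff_le_mono)
    then show "x \<in> (\<lambda>(v, w). (v + w, v)) ` ?B" by blast
  next
    fix x assume "x \<in> (\<lambda>(v, w). (v + w, v)) ` ?B"
    then obtain v w where x: "x = (v + w, v)" "v \<subseteq># m" "w \<subseteq># m - v" by auto
    then have "v + w \<subseteq># m" by (metis add.commute subset_mset.le_diff_conv2)
    then show "x \<in> ?A" using x by auto
  qed
  also have "finsum R ?F \<dots> = finsum R (\<lambda>x. ?F ((\<lambda>(v, w). (v + w, v)) x)) ?B"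
    using f g h by (intro finsum_reindex) (auto simp: inj_on_def)
  also have "\<dots> = (\<Oplus>v\<in>{v. v \<subseteq># m}. \<Oplus>w\<in>{w. w \<subseteq># m - v}. f v \<otimes> g w \<otimes> h (m - (v + w)))"
    using f g h by (subst finsum_Sigma) auto
  also have "\<dots> = (f \<otimes>\<^bsub>S\<^esub> (g \<otimes>\<^bsub>S\<^esub> h)) m"
    unfolding S_mult using f g h
    by (intro finsum_cong') (auto simp: finsum_rdistr m_assoc intro!: finsum_cong')
  finally show "(f \<otimes>\<^bsub>S\<^esub> g \<otimes>\<^bsub>S\<^esub> h) m = (f \<otimes>\<^bsub>S\<^esub> (g \<otimes>\<^bsub>S\<^esub> h)) m" .
qed

lemma cring_S: "cring S"
proof (rule cringI)
  have closed: "f \<oplus>\<^bsub>S\<^esub> g \<in> carrier S" if "f \<in> carrier S" "g \<in> carrier S" for f g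
    using that by (simp add: S_carrier S_add)
  have zero: "\<zero>\<^bsub>S\<^esub> \<in> carrier S" by (simp add: S_carrier S_zero)
  show "abelian_group S"
  proof (rule abelian_groupI)
    fix f g h assume fgh: "f \<in> carrier S" "g \<in> carrier S" "h \<in> carrier S"
    show "f \<oplus>\<^bsub>S\<^esub> g \<oplus>\<^bsub>S\<^esub> h = f \<oplus>\<^bsub>S\<^esub> (g \<oplus>\<^bsub>S\<^esub> h)"
      using fgh by (intro ext) (simp add: S_add a_assoc)
    show "f \<oplus>\<^bsub>S\<^esub> g = g \<oplus>\<^bsub>S\<^esub> f" using fgh by (intro ext) (simp add: S_add a_comm)
  next
    fix f assume f: "f \<in> carrier S"
    show "\<zero>\<^bsub>S\<^esub> \<oplus>\<^bsub>S\<^esub> f = f" using f by (intro ext) (simp add: S_add S_zero)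
    show "\<exists>g\<in>carrier S. g \<oplus>\<^bsub>S\<^esub> f = \<zero>\<^bsub>S\<^esub>"
      using f by (intro bexI[of _ "\<lambda>m. \<ominus> f m"] ext) (auto simp: S_add S_zero l_neg S_carrier)
  qed (simp_all add: closed zero)
  have l_one: "\<one>\<^bsub>S\<^esub> \<otimes>\<^bsub>S\<^esub> f = f" if "f \<in> carrier S" for f
    using that unfolding S_one by (intro ext) (simp add: mon_mult)
  show "comm_monoid S"
    by (intro comm_monoidI S_mult_closed S_m_assoc S_m_comm l_one) (simp_all add: S_one)
  fix f g h assume fgh: "f \<in> carrier S" "g \<in> carrier S" "h \<in> carrier S"
  show "(f \<oplus>\<^bsub>S\<^esub> g) \<otimes>\<^bsub>S\<^esub> h = f \<otimes>\<^bsub>S\<^esub> h \<oplus>\<^bsub>S\<^esub> g \<otimes>\<^bsub>S\<^esub> h"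
  proof
    fix m
    have "((f \<oplus>\<^bsub>S\<^esub> g) \<otimes>\<^bsub>S\<^esub> h) m = (\<Oplus>u\<in>{u. u \<subseteq># m}. f u \<otimes> h (m - u) \<oplus> g u \<otimes> h (m - u))"
      unfolding S_mult using fgh by (intro finsum_cong') (auto simp: S_add l_distr)
    also have "\<dots> = (f \<otimes>\<^bsub>S\<^esub> h \<oplus>\<^bsub>S\<^esub> g \<otimes>\<^bsub>S\<^esub> h) m"
      unfolding S_add S_mult using fgh by (intro finsum_addf) auto
    finally show "((f \<oplus>\<^bsub>S\<^esub> g) \<otimes>\<^bsub>S\<^esub> h) m = (f \<otimes>\<^bsub>S\<^esub> h \<oplus>\<^bsub>S\<^esub> g \<otimes>\<^bsub>S\<^esub> h) m" .
  qed
qed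

sublocale S: cring S by (rule cring_S)

lemma S_minus: "f \<in> carrier S \<Longrightarrow> (\<ominus>\<^bsub>S\<^esub> f) m = \<ominus> f m"
proof -
  assume f: "f \<in> carrier S"
  have "(\<ominus>\<^bsub>S\<^esub> f) m \<oplus> f m = \<zero>" using fun_cong[OF S.l_neg[OF f], of m] by (simp add: S_add S_zero)
  then show ?thesis using f by (metis S.a_inv_closed S_coeff minus_equality)
qed

lemma S_diff: "f \<in> carrier S \<Longrightarrow> g \<in> carrier S \<Longrightarrow> (f \<ominus>\<^bsub>S\<^esub> g) m = f m \<ominus> g m"
  by (simp add: S.minus_eq S_add S_minus minus_eq)

lemma S_eq_zero_iff: "f \<in> carrier S \<Longrightarrow> f = \<zero>\<^bsub>S\<^esub> \<longleftrightarrow> (\<forall>m. f m = \<zero>)"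
  by (auto simp: fun_eq_iff S_zero)

lemma S_finsum:
  "(\<And>i. i \<in> I \<Longrightarrow> h i \<in> carrier S) \<Longrightarrow> (\<Oplus>\<^bsub>S\<^esub>i\<in>I. h i) m = (\<Oplus>i\<in>I. h i m)"
proof (induction I rule: infinite_finite_induct)
  case (insert x I)
  then have "(\<Oplus>\<^bsub>S\<^esub>i\<in>insert x I. h i) = h x \<oplus>\<^bsub>S\<^esub> (\<Oplus>\<^bsub>S\<^esub>i\<in>I. h i)"
    by (intro S.finsum_insert) auto
  moreover have "(\<Oplus>i\<in>insert x I. h i m) = h x m \<oplus> (\<Oplus>i\<in>I. h i m)"
    using insert by (intro finsum_insert) auto
  ultimately show ?case using insert by (simp add: S_add)
qed (simp_all add: S_zero finsum_infinite S.finsum_infinite)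

lemma mon_mult_mon:
  assumes "c \<in> carrier R" "c' \<in> carrier R" "\<mu>' \<in> monomials"
  shows "mon c \<mu> \<otimes>\<^bsub>S\<^esub> mon c' \<mu>' = mon (c \<otimes> c') (\<mu> + \<mu>')"
proof
  fix m :: "'c multiset"
  have "\<mu> \<subseteq># m \<Longrightarrow> (m - \<mu> = \<mu>') = (m = \<mu> + \<mu>')"
    by (metis add_diff_cancel_left' subset_mset.add_diff_inverse)
  then show "(mon c \<mu> \<otimes>\<^bsub>S\<^esub> mon c' \<mu>') m = mon (c \<otimes> c') (\<mu> + \<mu>') m"
    using assms by (auto simp: mon_mult) (auto simp: mon_def)
qed

lemma mon_pow: "\<mu> \<in> monomials \<Longrightarrow> mon \<one> \<mu> [^]\<^bsub>S\<^esub> (q::nat) = mon \<one> (repeat_mset q \<mu>)"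
proof (induction q)
  case 0
  then show ?case by (simp add: S_one)
next
  case (Suc q)
  have "mon \<one> \<mu> [^]\<^bsub>S\<^esub> Suc q = mon \<one> (repeat_mset q \<mu>) \<otimes>\<^bsub>S\<^esub> mon \<one> \<mu>"
    using Suc by simp
  then show ?case using Suc by (simp add: mon_mult_mon add.commute)
qed

lemma indexed_var_eq: "indexed_var i = mon \<one> {#i#}"
proof
  fix m :: "'c multiset"
  have "(i \<in># m \<and> m - {#i#} = {#}) = (m = {#i#})"
    by (auto dest: multi_member_split)
  then show "indexed_var i m = mon \<one> {#i#} m"
    by (auto simp: indexed_var_def indexed_pmult_def indexed_const_def mon_def)
qed

end

section \<open>The Frobenius map\<close>

lemma (in cring) add_pow_add:
  assumes "x \<in> carrier R"
  shows "[(m + n :: nat)] \<cdot> x = [m] \<cdot> x \<oplus> [n] \<cdot> x"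
  using add.nat_pow_mult[OF assms, of m n] by simp

lemma (in cring) binomial_theorem:
  assumes a: "a \<in> carrier R" and b: "b \<in> carrier R"
  shows "(a \<oplus> b) [^] (n::nat) = (\<Oplus>i\<in>{..n}. [(n choose i)] \<cdot> (a [^] i \<otimes> b [^] (n - i)))"
proof (induction n)
  case 0
  then show ?case by (simp add: add.nat_pow_eone)
next
  case (Suc n)
  let ?t = "\<lambda>c i j. [(c::nat)] \<cdot> (a [^] (i::nat) \<otimes> b [^] (j::nat))"
  have tc: "?t c i j \<in> carrier R" for c i j using a b by simp
  have aa: "a [^] i \<otimes> b [^] j \<otimes> a = a [^] Suc i \<otimes> b [^] j" for i j :: nat
    using a b by (simp add: m_ac)
  have bb: "a [^] i \<otimes> b [^] j \<otimes> b = a [^] i \<otimes> b [^] Suc j" for i j :: nat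
    using a b by (simp add: m_ac)
  have A: "(\<Oplus>i\<in>{..n}. ?t (n choose i) i (n - i)) \<otimes> a = (\<Oplus>i\<in>{..n}. ?t (n choose i) (Suc i) (n - i))"
  proof (subst finsum_ldistr)
    show "(\<Oplus>i\<in>{..n}. ?t (n choose i) i (n - i) \<otimes> a) = (\<Oplus>i\<in>{..n}. ?t (n choose i) (Suc i) (n - i))"
      using a b by (intro finsum_cong') (auto simp: add_pow_ldistr aa simp del: nat_pow_Suc)
  qed (use a b in auto)
  have B: "(\<Oplus>i\<in>{..n}. ?t (n choose i) i (n - i)) \<otimes> b = (\<Oplus>i\<in>{..n}. ?t (n choose i) i (Suc n - i))"
  proof (subst finsum_ldistr)
    show "(\<Oplus>i\<in>{..n}. ?t (n choose i) i (n - i) \<otimes> b) = (\<Oplus>i\<in>{..n}. ?t (n choose i) i (Suc n - i))"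
      using a b by (intro finsum_cong') (auto simp: add_pow_ldistr bb Suc_diff_le simp del: nat_pow_Suc)
  qed (use a b in auto)
  have C: "(\<Oplus>i\<in>{..n}. ?t (n choose i) i (Suc n - i)) =
     ?t 1 0 (Suc n) \<oplus> (\<Oplus>i\<in>{..n}. ?t (n choose Suc i) (Suc i) (n - i))"
  proof -
    have "(\<Oplus>i\<in>{..n}. ?t (n choose i) i (Suc n - i)) = (\<Oplus>i\<in>{..Suc n}. ?t (n choose i) i (Suc n - i))"
      using tc by (subst finsum_Suc) (auto simp: binomial_eq_0)
    also have "\<dots> = (\<Oplus>i\<in>{..n}. ?t (n choose Suc i) (Suc i) (Suc n - Suc i)) \<oplus> ?t (n choose 0) 0 (Suc n - 0)"
      using tc by (intro finsum_Suc2) auto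
    also have "\<dots> = ?t 1 0 (Suc n) \<oplus> (\<Oplus>i\<in>{..n}. ?t (n choose Suc i) (Suc i) (n - i))"
      using a b by (subst a_comm) (auto intro!: finsum_closed)
    finally show ?thesis .
  qed
  have D: "(\<Oplus>i\<in>{..Suc n}. ?t (Suc n choose i) i (Suc n - i)) =
     (\<Oplus>i\<in>{..n}. ?t (Suc n choose Suc i) (Suc i) (n - i)) \<oplus> ?t 1 0 (Suc n)"
    using tc by (subst finsum_Suc2) auto
  have E: "(\<Oplus>i\<in>{..n}. ?t (Suc n choose Suc i) (Suc i) (n - i)) =
    (\<Oplus>i\<in>{..n}. ?t (n choose i) (Suc i) (n - i)) \<oplus> (\<Oplus>i\<in>{..n}. ?t (n choose Suc i) (Suc i) (n - i))"
    using tc a b by (subst finsum_addf[symmetric]) (auto simp: add_pow_add intro!: finsum_cong')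
  have "(a \<oplus> b) [^] Suc n = (\<Oplus>i\<in>{..n}. ?t (n choose i) i (n - i)) \<otimes> (a \<oplus> b)"
    using Suc by simp
  also have "\<dots> = (\<Oplus>i\<in>{..n}. ?t (n choose i) i (n - i)) \<otimes> a \<oplus> (\<Oplus>i\<in>{..n}. ?t (n choose i) i (n - i)) \<otimes> b"
    using tc a b by (intro r_distr) (auto intro!: finsum_closed)
  also have "\<dots> = (\<Oplus>i\<in>{..Suc n}. ?t (Suc n choose i) i (Suc n - i))"
    unfolding A B C D E using tc a b by (simp add: a_ac finsum_closed Pi_def)
  finally show ?case .
qed

lemma (in cring) frobenius_add:
  assumes a: "a \<in> carrier R" and b: "b \<in> carrier R"
    and p: "Factorial_Ring.prime (p::nat)" and char: "[p] \<cdot> \<one> = \<zero>"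
  shows "(a \<oplus> b) [^] (p::nat) = a [^] p \<oplus> b [^] p"
proof -
  have p0: "p > 0" using p prime_gt_0_nat by blast
  have z: "[p] \<cdot> x = \<zero>" if "x \<in> carrier R" for x
    using add_pow_ldistr[of \<one> x p] char that by simp
  let ?t = "\<lambda>i. [(p choose i)] \<cdot> (a [^] i \<otimes> b [^] (p - i))"
  have t0: "?t i = \<zero>" if i: "0 < i" "i < p" for i
  proof -
    have "p dvd (p choose i)" using i p by (auto intro: dvd_choose_prime)
    then obtain c where "p choose i = p * c" by auto
    then have "?t i = [c] \<cdot> ([p] \<cdot> (a [^] i \<otimes> b [^] (p - i)))"
      using a b by (simp add: add.nat_pow_pow mult.commute)
    then show ?thesis using z a b by simp
  qed
  have "(a \<oplus> b) [^] p = (\<Oplus>i\<in>{..p}. ?t i)" by (rule binomial_theorem[OF a b])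
  also have "\<dots> = (\<Oplus>i\<in>{0, p}. ?t i)"
    using a b t0 by (intro add.finprod_mono_neutral_cong_right) auto
  also have "\<dots> = a [^] p \<oplus> b [^] p"
    using p0 a b by (simp add: add.nat_pow_eone a_comm)
  finally show ?thesis .
qed

lemma (in cring) frobenius_pow_add:
  assumes a: "a \<in> carrier R" and b: "b \<in> carrier R"
    and p: "Factorial_Ring.prime (p::nat)" and char: "[p] \<cdot> \<one> = \<zero>"
  shows "(a \<oplus> b) [^] (p ^ e) = a [^] (p ^ e) \<oplus> b [^] (p ^ e)"
proof (induction e)
  case 0
  then show ?case using a b nat_pow_eone by simp
next
  case (Suc e)
  have "x [^] (p ^ Suc e) = (x [^] (p ^ e)) [^] p" if "x \<in> carrier R" for x
    using nat_pow_pow[OF that, of "p ^ e" p] by (simp add: mult.commute)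
  then show ?case using Suc frobenius_add[OF _ _ p char, of "a [^] (p ^ e)" "b [^] (p ^ e)"] a b by simp
qed

lemma (in cring) frobenius_pow_finsum:
  assumes p: "Factorial_Ring.prime (p::nat)" and char: "[p] \<cdot> \<one> = \<zero>"
    and "finite I" "\<And>i. i \<in> I \<Longrightarrow> h i \<in> carrier R"
  shows "(\<Oplus>i\<in>I. h i) [^] (p ^ e) = (\<Oplus>i\<in>I. h i [^] (p ^ e))"
  using assms(3,4)
proof (induction I)
  case empty
  have "p ^ e > 0" using p prime_gt_0_nat by simp
  then show ?case by (simp add: nat_pow_zero)
next
  case (insert x I)
  then show ?case using frobenius_pow_add[OF _ _ p char, of "h x" "\<Oplus>i\<in>I. h i" e]
    by (simp add: finsum_insert Pi_def)
qed

section \<open>Initial monomials and lengths\<close>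

text \<open>Monomials are ordered by the integer obtained by substituting the \<open>i\<close>-th prime for \<open>x\<^sub>i\<close>. By
  unique factorisation this is a total order, and multiplicativity makes it a monomial order.\<close>

definition monomial_norm :: "nat multiset \<Rightarrow> nat" where
  "monomial_norm m = prod_mset (image_mset (enumerate {q. Factorial_Ring.prime q}) m)"

lemma prime_enumerate: "Factorial_Ring.prime (enumerate {q::nat. Factorial_Ring.prime q} i)"
  using enumerate_in_set[OF primes_infinite, of i] by simp

lemma monomial_norm_add: "monomial_norm (a + b) = monomial_norm a * monomial_norm b"
  by (simp add: monomial_norm_def)

lemma monomial_norm_ge: "2 ^ size m \<le> monomial_norm m"
proof (induction m)
  case (add x m)
  have "2 \<le> enumerate {q::nat. Factorial_Ring.prime q} x" using prime_enumerate prime_ge_2_nat by blast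
  then show ?case using add mult_le_mono by (fastforce simp: monomial_norm_def)
qed (simp add: monomial_norm_def)

lemma monomial_norm_pos: "monomial_norm m > 0"
  using monomial_norm_ge[of m] by (metis gr0I le_zero_eq power_eq_0_iff zero_neq_numeral)

lemma monomial_norm_inj: "monomial_norm a = monomial_norm b \<longleftrightarrow> a = b"
proof
  assume *: "monomial_norm a = monomial_norm b"
  have "prime_factorization (monomial_norm m) = image_mset (enumerate {q. Factorial_Ring.prime q}) m" for m
    unfolding monomial_norm_def by (rule prime_factorization_prod_mset_primes) (auto simp: prime_enumerate)
  then have "image_mset (enumerate {q. Factorial_Ring.prime q}) a = image_mset (enumerate {q::nat. Factorial_Ring.prime q}) b"
    using * by metis
  moreover have "inj (enumerate {q::nat. Factorial_Ring.prime q})"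
    using strict_mono_enumerate[OF primes_infinite] by (rule strict_mono_imp_inj_on)
  ultimately show "a = b" using multiset.inj_map injD by metis
qed simp

lemma monomial_norm_mono: "u \<subseteq># m \<Longrightarrow> monomial_norm u \<le> monomial_norm m"
  by (metis monomial_norm_add monomial_norm_pos mult_le_mono2 nat_mult_1_right subset_mset.add_diff_inverse Suc_leI One_nat_def)

lemma finite_monomial_norm_less: "finite {m. monomial_norm m < N}"
proof (rule finite_imageD)
  show "finite (monomial_norm ` {m. monomial_norm m < N})"
    by (rule finite_subset[of _ "{..<N}"]) auto
qed (auto simp: inj_on_def monomial_norm_inj)

text \<open>Every variable has norm at least 2, so a norm below 2^N forces the degree, and with it
  each of the \<open>d + 1\<close> exponents, below N.\<close>

lemma card_monomial_norm_less:
  "card {m. set_mset m \<subseteq> {..d} \<and> monomial_norm m < 2 ^ N} \<le> N ^ Suc d"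
proof -
  let ?h = "\<lambda>m. \<lambda>i\<in>{..d}. count m i"
  have "inj_on ?h {m. set_mset m \<subseteq> {..d} \<and> monomial_norm m < 2 ^ N}"
  proof (rule inj_onI)
    fix a b assume a: "a \<in> {m. set_mset m \<subseteq> {..d} \<and> monomial_norm m < 2 ^ N}"
      and b: "b \<in> {m. set_mset m \<subseteq> {..d} \<and> monomial_norm m < 2 ^ N}" and eq: "?h a = ?h b"
    have "count a i = count b i" for i
    proof (cases "i \<le> d")
      case True
      then show ?thesis using fun_cong[OF eq, of i] by simp
    next
      case False
      then have "i \<notin># a" "i \<notin># b" using a b by auto
      then show ?thesis by (simp add: not_in_iff)
    qed
    then show "a = b" by (rule multiset_eqI)
  qed
  moreover have "?h ` {m. set_mset m \<subseteq> {..d} \<and> monomial_norm m < 2 ^ N} \<subseteq> {..d} \<rightarrow>\<^sub>E {..<N}"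
  proof -
    have "count m i < N" if "monomial_norm m < 2 ^ N" for m and i :: nat
    proof -
      have "(2::nat) ^ size m < 2 ^ N" using monomial_norm_ge[of m] that by linarith
      then have "size m < N" by simp
      then show ?thesis using count_le_size[of m i] by linarith
    qed
    then show ?thesis by (intro image_subsetI) (simp add: restrict_PiE_iff)
  qed
  ultimately have "card {m. set_mset m \<subseteq> {..d} \<and> monomial_norm m < 2 ^ N} \<le> card ({..d} \<rightarrow>\<^sub>E {..<N})"
    by (intro card_inj_on_le) (auto intro: finite_PiE)
  also have "\<dots> = N ^ Suc d" by (simp add: card_PiE)
  finally show ?thesis .
qed

text \<open>Turns a decreasing filtration into an ascending chain. Starting at \<open>Z\<close>, the
  jumps are treated from the largest index down, and each contributes one new member at the
  top.\<close>

lemma strict_chain_of_jumps: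
  fixes I :: "nat \<Rightarrow> 'x set"
  assumes "finite T" and jump: "\<And>t. t \<in> T \<Longrightarrow> I (Suc t) \<subset> I t"
    and anti: "\<And>s t. s \<le> t \<Longrightarrow> I t \<subseteq> I s" and Z: "P Z" "\<And>t. Z \<subseteq> I t" and P: "\<And>t. P (I t)"
  shows "\<exists>C. strict_chain P (card T) C"
proof -
  have "\<exists>C. strict_chain P (card T) C \<and> (\<forall>t. (\<forall>x\<in>T. t \<le> x) \<longrightarrow> C (card T) \<subseteq> I t)"
    using assms(1) jump
  proof (induction T rule: finite_linorder_min_induct)
    case empty
    then show ?case using Z by (intro exI[of _ "\<lambda>_. Z"]) (auto simp: strict_chain_def)
  next
    case (insert b T)
    then obtain C where C: "strict_chain P (card T) C" "\<forall>t. (\<forall>x\<in>T. t \<le> x) \<longrightarrow> C (card T) \<subseteq> I t" by auto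
    have "b \<notin> T" using insert by auto
    then have card: "card (insert b T) = Suc (card T)" using insert by simp
    have "C (card T) \<subseteq> I (Suc b)" using C(2) insert.hyps(2) by (simp add: Suc_leI)
    then have lt: "C (card T) \<subset> I b" using insert.prems[of b] by blast
    let ?C = "\<lambda>i. if i \<le> card T then C i else I b"
    have "strict_chain P (Suc (card T)) ?C"
      unfolding strict_chain_def
    proof (intro conjI allI impI)
      fix i assume "i < Suc (card T)"
      then consider "i < card T" | "i = card T" by linarith
      then show "?C i \<subset> ?C (Suc i)" using C(1) lt by cases (auto simp: strict_chain_def)
    qed (use C(1) P in \<open>auto simp: strict_chain_def\<close>)
    moreover have "?C (Suc (card T)) \<subseteq> I t" if "\<forall>x\<in>insert b T. t \<le> x" for t
      using that anti[of t b] by simp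
    ultimately show ?case unfolding card by blast
  qed
  then show ?thesis by blast
qed

section \<open>Initial monomials of power series\<close>

locale quadric_series = field R for R :: "('a, 'b) ring_scheme" (structure) +
  fixes d :: nat
begin

sublocale power_series R "{..d}" by unfold_locales

abbreviation nm where "nm \<equiv> monomial_norm"

text \<open>The smallest monomial present, as befits power series; it is arbitrary for the zero
  series.\<close>

definition lead :: "(nat multiset \<Rightarrow> 'a) \<Rightarrow> nat multiset" where
  "lead f = (ARG_MIN nm m. f m \<noteq> \<zero>)"

lemma lead:
  assumes "f m \<noteq> \<zero>"
  shows "f (lead f) \<noteq> \<zero>" "nm (lead f) \<le> nm m"
  unfolding lead_def by (rule arg_min_natI[where P="\<lambda>m. f m \<noteq> \<zero>"], fact)
    (rule arg_min_nat_le[where P="\<lambda>m. f m \<noteq> \<zero>"], fact)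

lemma lead_nonzero: "f \<in> carrier S \<Longrightarrow> f \<noteq> \<zero>\<^bsub>S\<^esub> \<Longrightarrow> f (lead f) \<noteq> \<zero>"
  using lead(1) S_eq_zero_iff by blast

lemma below_lead: "nm m < nm (lead f) \<Longrightarrow> f m = \<zero>"
  using lead(2)[of f m] by (meson leD)

lemma leadI: "f \<mu> \<noteq> \<zero> \<Longrightarrow> (\<And>m. nm m < nm \<mu> \<Longrightarrow> f m = \<zero>) \<Longrightarrow> lead f = \<mu>"
  using lead[of f \<mu>] monomial_norm_inj[of "lead f" \<mu>] by (metis le_neq_implies_less)

lemma lead_in_monomials: "f \<in> carrier S \<Longrightarrow> f \<noteq> \<zero>\<^bsub>S\<^esub> \<Longrightarrow> lead f \<in> monomials"
  using lead_nonzero[of f] by (auto simp: S_carrier)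

text \<open>Norms multiply. In any other splitting of a monomial of norm at most that of
  \<open>\<mu> + \<nu>\<close>, one of the two parts lies below its bound and contributes a zero
  coefficient.\<close>

lemma mult_coeff:
  assumes f: "f \<in> carrier S" and g: "g \<in> carrier S"
    and f0: "\<And>m. nm m < nm \<mu> \<Longrightarrow> f m = \<zero>" and g0: "\<And>m. nm m < nm \<nu> \<Longrightarrow> g m = \<zero>"
  shows "(f \<otimes>\<^bsub>S\<^esub> g) (\<mu> + \<nu>) = f \<mu> \<otimes> g \<nu>" "nm m < nm (\<mu> + \<nu>) \<Longrightarrow> (f \<otimes>\<^bsub>S\<^esub> g) m = \<zero>"
proof -
  have z: "f u \<otimes> g (m - u) = \<zero>" if u: "u \<subseteq># m" and m: "nm m < nm (\<mu> + \<nu>) \<or> nm m = nm (\<mu> + \<nu>) \<and> u \<noteq> \<mu>" for u m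
  proof (rule ccontr)
    assume "f u \<otimes> g (m - u) \<noteq> \<zero>"
    then have "f u \<noteq> \<zero>" "g (m - u) \<noteq> \<zero>" using f g by auto
    then have le: "nm \<mu> \<le> nm u" "nm \<nu> \<le> nm (m - u)" using f0 g0 by (meson not_le)+
    have "nm m = nm u * nm (m - u)" using u by (metis monomial_norm_add subset_mset.add_diff_inverse)
    moreover have "nm \<mu> * nm \<nu> \<le> nm u * nm (m - u)" using le by (rule mult_le_mono)
    ultimately have eq: "nm \<mu> * nm \<nu> = nm u * nm (m - u)" and ne: "u \<noteq> \<mu>"
      using m by (auto simp: monomial_norm_add)
    then have "nm \<mu> < nm u" using le monomial_norm_inj by (metis le_neq_implies_less)
    then have "nm \<mu> * nm \<nu> < nm u * nm \<nu>" using monomial_norm_pos by simp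
    also have "\<dots> \<le> nm u * nm (m - u)" using le by simp
    finally show False using eq by simp
  qed
  have "(f \<otimes>\<^bsub>S\<^esub> g) (\<mu> + \<nu>) = (\<Oplus>u\<in>{u. u \<subseteq># \<mu> + \<nu>}. if \<mu> = u then f u \<otimes> g (\<mu> + \<nu> - u) else \<zero>)"
    unfolding S_mult using f g z[of _ "\<mu> + \<nu>"] by (intro finsum_cong') auto
  also have "\<dots> = f \<mu> \<otimes> g (\<mu> + \<nu> - \<mu>)" using f g by (intro finsum_singleton) auto
  finally show "(f \<otimes>\<^bsub>S\<^esub> g) (\<mu> + \<nu>) = f \<mu> \<otimes> g \<nu>" by simp
  show "(f \<otimes>\<^bsub>S\<^esub> g) m = \<zero>" if "nm m < nm (\<mu> + \<nu>)"
    unfolding S_mult using z[of _ m] that by (intro add.finprod_one_eqI) auto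
qed

lemma lead_mult:
  assumes "f \<in> carrier S" "g \<in> carrier S" "f \<noteq> \<zero>\<^bsub>S\<^esub>" "g \<noteq> \<zero>\<^bsub>S\<^esub>"
  shows "lead (f \<otimes>\<^bsub>S\<^esub> g) = lead f + lead g" "f \<otimes>\<^bsub>S\<^esub> g \<noteq> \<zero>\<^bsub>S\<^esub>"
    "(f \<otimes>\<^bsub>S\<^esub> g) (lead f + lead g) = f (lead f) \<otimes> g (lead g)"
proof -
  show c: "(f \<otimes>\<^bsub>S\<^esub> g) (lead f + lead g) = f (lead f) \<otimes> g (lead g)"
    by (rule mult_coeff(1)) (use assms below_lead in auto)
  have nz: "(f \<otimes>\<^bsub>S\<^esub> g) (lead f + lead g) \<noteq> \<zero>"
    unfolding c using lead_nonzero assms S_coeff integral by blast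
  then show "f \<otimes>\<^bsub>S\<^esub> g \<noteq> \<zero>\<^bsub>S\<^esub>" by (auto simp: S_zero)
  show "lead (f \<otimes>\<^bsub>S\<^esub> g) = lead f + lead g" 
    by (rule leadI, rule nz, rule mult_coeff(2)[OF assms(1,2)]) (use below_lead in auto)
qed

lemma domain_S: "domain S"
proof (rule domainI)
  show "\<one>\<^bsub>S\<^esub> \<noteq> \<zero>\<^bsub>S\<^esub>"
  proof
    assume "\<one>\<^bsub>S\<^esub> = \<zero>\<^bsub>S\<^esub>"
    from fun_cong[OF this, of "{#}"] show False by (simp add: S_one S_zero mon_def)
  qed
  show "f = \<zero>\<^bsub>S\<^esub> \<or> g = \<zero>\<^bsub>S\<^esub>" if "f \<otimes>\<^bsub>S\<^esub> g = \<zero>\<^bsub>S\<^esub>" "f \<in> carrier S" "g \<in> carrier S" for f g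
    using lead_mult(2) that by blast
qed (rule S.is_cring)

definition outside :: "nat multiset set \<Rightarrow> (nat multiset \<Rightarrow> 'a) set" where
  "outside B = {f \<in> carrier S. \<forall>m\<in>B. f m = \<zero>}"

text \<open>Initial monomials relative to \<open>B\<close>: only coefficients in \<open>B\<close>
  are inspected, which amounts to working modulo \<open>outside B\<close>.\<close>

definition initials :: "nat multiset set \<Rightarrow> (nat multiset \<Rightarrow> 'a) set \<Rightarrow> nat multiset set" where
  "initials B I = {\<mu>\<in>B. \<exists>u\<in>I. u \<mu> \<noteq> \<zero> \<and> (\<forall>m\<in>B. nm m < nm \<mu> \<longrightarrow> u m = \<zero>)}"

lemma initials_mono: "I \<subseteq> I' \<Longrightarrow> initials B I \<subseteq> initials B I'"
  by (auto simp: initials_def)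

text \<open>If the initial monomials agreed, any \<open>u\<close> in the larger ideal could be
  reduced by multiples of elements of the smaller one. Each reduction removes the initial term of
  \<open>u\<close> and shrinks the set of monomials of \<open>B\<close> of norm at least that of the
  initial one, until \<open>u\<close> lies in \<open>outside B\<close>.\<close>

lemma initials_strict:
  assumes "ideal I S" "ideal I' S" "I \<subset> I'" "outside B \<subseteq> I" "finite B"
  shows "initials B I \<subset> initials B I'"
proof -
  interpret I: ideal I S by fact
  interpret I': ideal I' S by fact
  have "u \<in> I" if "u \<in> I'" and sub: "initials B I' \<subseteq> initials B I" for u
    using \<open>u \<in> I'\<close>
  proof (induction "card {\<mu>\<in>B. \<exists>m\<in>B. u m \<noteq> \<zero> \<and> nm m \<le> nm \<mu>}" arbitrary: u rule: less_induct)
    case less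
    have u: "u \<in> carrier S" using less.prems I'.a_subset by blast
    show ?case
    proof (cases "\<forall>m\<in>B. u m = \<zero>")
      case True
      then show ?thesis using assms(4) u by (auto simp: outside_def)
    next
      case False
      then obtain m0 where m0: "m0 \<in> B \<and> u m0 \<noteq> \<zero>" by blast
      define \<mu> where "\<mu> = (ARG_MIN nm m. m \<in> B \<and> u m \<noteq> \<zero>)"
      have \<mu>: "\<mu> \<in> B" "u \<mu> \<noteq> \<zero>" and min: "m \<in> B \<Longrightarrow> u m \<noteq> \<zero> \<Longrightarrow> nm \<mu> \<le> nm m" for m
        using arg_min_natI[of "\<lambda>m. m \<in> B \<and> u m \<noteq> \<zero>", OF m0, of nm]
          arg_min_nat_le[of "\<lambda>m. m \<in> B \<and> u m \<noteq> \<zero>" m nm] unfolding \<mu>_def by auto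
      then have "\<mu> \<in> initials B I'" using less.prems unfolding initials_def by (auto simp: not_less[symmetric])
      then obtain w where w: "w \<in> I" "w \<mu> \<noteq> \<zero>" "\<forall>m\<in>B. nm m < nm \<mu> \<longrightarrow> w m = \<zero>"
        using sub by (auto simp: initials_def)
      have wS: "w \<in> carrier S" using w I.a_subset by blast
      define c where "c = u \<mu> \<otimes> inv (w \<mu>)"
      have wU: "w \<mu> \<in> Units R" using w(2) wS by (simp add: field_Units)
      then have cc: "c \<in> carrier R" "c \<otimes> w \<mu> = u \<mu>"
        using u wS by (auto simp: c_def m_assoc)
      define v where "v = mon c {#} \<otimes>\<^bsub>S\<^esub> w"
      have vI: "v \<in> I" unfolding v_def using w(1) cc by (intro I.I_l_closed) auto
      have vm: "v m = c \<otimes> w m" for m unfolding v_def using cc wS by (simp add: mon_mult)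
      have vS: "v \<in> carrier S" using vI I.a_subset by blast
      let ?u = "u \<ominus>\<^bsub>S\<^esub> v"
      have uI': "?u \<in> I'" using less.prems vI assms(3) by (auto simp: S.minus_eq intro!: I'.a_closed I'.a_inv_closed)
      have um: "?u m = u m \<ominus> c \<otimes> w m" for m using u vS by (simp add: S_diff vm)
      have "?u \<mu> = \<zero>" using u cc by (simp add: um)
      moreover have "?u m = \<zero>" if "m \<in> B" "nm m < nm \<mu>" for m
      proof -
        have "u m = \<zero>" using min[of m] that by auto
        then show ?thesis using w(3) that cc by (simp add: um minus_eq)
      qed
      ultimately have gt: "nm \<mu> < nm m" if "m \<in> B" "?u m \<noteq> \<zero>" for m
        using that monomial_norm_inj by (metis linorder_neqE_nat)
      have "{\<mu>\<in>B. \<exists>m\<in>B. ?u m \<noteq> \<zero> \<and> nm m \<le> nm \<mu>} \<subset> {\<mu>\<in>B. \<exists>m\<in>B. u m \<noteq> \<zero> \<and> nm m \<le> nm \<mu>}"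
      proof (rule psubsetI)
        show "{\<mu>\<in>B. \<exists>m\<in>B. ?u m \<noteq> \<zero> \<and> nm m \<le> nm \<mu>} \<subseteq> {\<mu>\<in>B. \<exists>m\<in>B. u m \<noteq> \<zero> \<and> nm m \<le> nm \<mu>}"
        proof
          fix x assume "x \<in> {\<mu>\<in>B. \<exists>m\<in>B. ?u m \<noteq> \<zero> \<and> nm m \<le> nm \<mu>}"
          then obtain m where "x \<in> B" "m \<in> B" "?u m \<noteq> \<zero>" "nm m \<le> nm x" by blast
          then have "x \<in> B" "nm \<mu> \<le> nm x" using gt[of m] by auto
          then show "x \<in> {\<mu>\<in>B. \<exists>m\<in>B. u m \<noteq> \<zero> \<and> nm m \<le> nm \<mu>}" using \<mu> by blast
        qed
        have "\<mu> \<in> {\<mu>\<in>B. \<exists>m\<in>B. u m \<noteq> \<zero> \<and> nm m \<le> nm \<mu>}" using \<mu> by blast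
        moreover have "\<mu> \<notin> {\<mu>\<in>B. \<exists>m\<in>B. ?u m \<noteq> \<zero> \<and> nm m \<le> nm \<mu>}" using gt by (auto simp: not_le[symmetric])
        ultimately show "{\<mu>\<in>B. \<exists>m\<in>B. ?u m \<noteq> \<zero> \<and> nm m \<le> nm \<mu>} \<noteq> {\<mu>\<in>B. \<exists>m\<in>B. u m \<noteq> \<zero> \<and> nm m \<le> nm \<mu>}"
          by blast
      qed
      then have "card {\<mu>\<in>B. \<exists>m\<in>B. ?u m \<noteq> \<zero> \<and> nm m \<le> nm \<mu>} < card {\<mu>\<in>B. \<exists>m\<in>B. u m \<noteq> \<zero> \<and> nm m \<le> nm \<mu>}"
        by (rule psubset_card_mono[rotated]) (simp add: assms(5))
      then have "?u \<in> I" using uI' by (rule less.hyps)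
      then have "?u \<oplus>\<^bsub>S\<^esub> v \<in> I" using vI by (rule I.a_closed)
      also have "?u \<oplus>\<^bsub>S\<^esub> v = u"
        using u vS by (simp add: S.minus_eq S.a_assoc S.l_neg)
      finally show ?thesis .
    qed
  qed
  then have "\<not> initials B I' \<subseteq> initials B I" using assms(3) by blast
  then show ?thesis using initials_mono[of I I' B] assms(3) by blast
qed

text \<open>Each strict inclusion of ideals adds at least one initial monomial, and all of them lie
  in \<open>B\<close>.\<close>

lemma chain_length_le:
  assumes "strict_chain (\<lambda>I. ideal I S \<and> outside B \<subseteq> I) n C" "finite B"
  shows "n \<le> card B - card (initials B (C 0))"
proof -
  have fin: "finite (initials B (C i))" for i using assms(2) by (simp add: initials_def)
  have "i \<le> n \<Longrightarrow> card (initials B (C 0)) + i \<le> card (initials B (C i))" for i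
  proof (induction i)
    case (Suc i)
    have "initials B (C i) \<subset> initials B (C (Suc i))"
      using assms Suc.prems by (intro initials_strict) (auto simp: strict_chain_def)
    then have "card (initials B (C i)) < card (initials B (C (Suc i)))" using fin psubset_card_mono by blast
    then show ?case using Suc by simp
  qed simp
  from this[of n] have "card (initials B (C 0)) + n \<le> card (initials B (C n))" by simp
  also have "\<dots> \<le> card B" by (rule card_mono) (use assms(2) in \<open>auto simp: initials_def\<close>)
  finally show ?thesis by simp
qed

text \<open>Supplies the lower bound for the length that matches
  \<open>chain_length_le\<close>.\<close>

lemma exists_chain:
  assumes J: "ideal J S" and "outside B \<subseteq> J" "finite B" "B \<subseteq> monomials"
  shows "\<exists>C. strict_chain (\<lambda>I. ideal I S \<and> J \<subseteq> I) (card B - card (initials B J)) C"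
proof -
  interpret J: ideal J S by fact
  have JS: "J \<subseteq> carrier S" by (rule J.a_subset)
  \<comment> \<open>\<open>filt t\<close> is \<open>J\<close> plus the series that vanish below norm
    \<open>t\<close>. At the norm of a non-initial \<open>\<mu>\<close> in \<open>B\<close> it
    drops, because the monomial \<open>\<mu>\<close> itself leaves it there.\<close>
  define filt where "filt t = {g \<in> carrier S. \<exists>u\<in>J. \<forall>m. nm m < t \<longrightarrow> g m = u m}" for t
  have ideal: "ideal (filt t) S" for t
  proof (rule idealI)
    show "ring S" by (rule S.ring_axioms)
    show "subgroup (filt t) (add_monoid S)"
    proof (rule S.add.subgroupI)
      show "filt t \<subseteq> carrier S" by (auto simp: filt_def)
      show "filt t \<noteq> {}" using J.zero_closed S.zero_closed unfolding filt_def by blast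
      fix f assume "f \<in> filt t"
      then obtain u where u: "f \<in> carrier S" "u \<in> J" "\<forall>m. nm m < t \<longrightarrow> f m = u m" by (auto simp: filt_def)
      then have "u \<in> carrier S" using JS by blast
      then show "\<ominus>\<^bsub>S\<^esub> f \<in> filt t" unfolding filt_def using u
        by (auto simp: S_minus intro!: bexI[of _ "\<ominus>\<^bsub>S\<^esub> u"] J.a_inv_closed)
      fix g assume "g \<in> filt t"
      then obtain v where v: "g \<in> carrier S" "v \<in> J" "\<forall>m. nm m < t \<longrightarrow> g m = v m" by (auto simp: filt_def)
      show "f \<oplus>\<^bsub>S\<^esub> g \<in> filt t" unfolding filt_def using u v
        by (auto simp: S_add intro!: bexI[of _ "u \<oplus>\<^bsub>S\<^esub> v"] J.a_closed)
    qed
    fix g h assume "g \<in> filt t" and h: "h \<in> carrier S"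
    then obtain u where u: "g \<in> carrier S" "u \<in> J" "\<forall>m. nm m < t \<longrightarrow> g m = u m" by (auto simp: filt_def)
    have uS: "u \<in> carrier S" using u(2) JS by blast
    have "(h \<otimes>\<^bsub>S\<^esub> g) m = (h \<otimes>\<^bsub>S\<^esub> u) m" if "nm m < t" for m
    proof -
      have "g (m - v) = u (m - v)" for v
        using u(3) monomial_norm_mono[of "m - v" m] that by (meson diff_subset_eq_self order.strict_trans1)
      then show ?thesis by (simp add: S_mult)
    qed
    then show *: "h \<otimes>\<^bsub>S\<^esub> g \<in> filt t" unfolding filt_def using u h uS
      by (auto intro!: bexI[of _ "h \<otimes>\<^bsub>S\<^esub> u"] J.I_l_closed)
    show "g \<otimes>\<^bsub>S\<^esub> h \<in> filt t" using * S.m_comm[OF u(1) h] by simp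
  qed
  have Jf: "J \<subseteq> filt t" for t using JS by (auto simp: filt_def)
  have anti: "filt t \<subseteq> filt s" if "s \<le> t" for s t using that by (fastforce simp: filt_def)
  have jump: "filt (Suc t) \<subset> filt t" if t: "t \<in> nm ` (B - initials B J)" for t
  proof -
    obtain \<mu> where \<mu>: "\<mu> \<in> B" "\<mu> \<notin> initials B J" "t = nm \<mu>" using t by blast
    have \<mu>M: "\<mu> \<in> monomials" using \<mu> assms(4) by blast
    have "mon \<one> \<mu> \<in> filt t" unfolding filt_def \<mu>(3) using \<mu>M J.zero_closed
      by (auto simp: S_zero intro!: bexI[of _ "\<zero>\<^bsub>S\<^esub>"]) (auto simp: mon_def)
    moreover have "mon \<one> \<mu> \<notin> filt (Suc t)"
    proof
      assume "mon \<one> \<mu> \<in> filt (Suc t)"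
      then obtain u where u: "u \<in> J" "\<And>m. nm m < Suc (nm \<mu>) \<Longrightarrow> mon \<one> \<mu> m = u m" by (auto simp: filt_def \<mu>(3))
      have "u \<mu> = \<one>" using u(2)[of \<mu>] by (simp add: mon_def)
      moreover have "u m = \<zero>" if "nm m < nm \<mu>" for m using u(2)[of m] that by (auto simp: mon_def split: if_splits)
      ultimately have "\<mu> \<in> initials B J"
        using u(1) \<mu>(1) by (auto simp: initials_def intro!: bexI[of _ u])
      then show False using \<mu>(2) by blast
    qed
    ultimately show ?thesis using anti[of t "Suc t"] by auto
  qed
  have "card (nm ` (B - initials B J)) = card (B - initials B J)"
    by (rule card_image) (auto simp: inj_on_def monomial_norm_inj)
  also have "\<dots> = card B - card (initials B J)"
    using assms(3) by (intro card_Diff_subset) (auto simp: initials_def)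
  finally have card: "card (nm ` (B - initials B J)) = card B - card (initials B J)" .
  show ?thesis unfolding card[symmetric]
    by (rule strict_chain_of_jumps[where I=filt and Z=J]) (use assms(3) jump anti J Jf ideal in auto)
qed

end

section \<open>Multiplication by the sum of squares on multi-indices\<close>

fun raise_sum :: "(nat list \<Rightarrow> 'r::comm_ring_1) \<Rightarrow> nat list \<Rightarrow> 'r" where
  "raise_sum f [] = 0"
| "raise_sum f (j # l) = (if 2 \<le> j then f ((j - 2) # l) else 0) + raise_sum (\<lambda>l. f (j # l)) l"

lemma raise_sum_eq: "raise_sum f l = (\<Sum>i<length l. if 2 \<le> l ! i then f (l[i := l ! i - 2]) else 0)"
proof (induction l arbitrary: f)
  case (Cons j l)
  show ?case
    unfolding length_Cons by (subst sum.lessThan_Suc_shift) (simp add: Cons cong: if_cong)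
qed simp

lemma raise_sum_diff: "raise_sum (\<lambda>l. f l - g l) l = raise_sum f l - raise_sum g l"
  by (induction f l arbitrary: g rule: raise_sum.induct) auto

text \<open>The self-duality of k[x]/(x^a) on exponents. It exchanges multiplication by the sum of
  squares with its transpose \<open>shift_sum 2\<close>, so that the two kernels have the same
  order.\<close>

definition reflect :: "nat list \<Rightarrow> nat list \<Rightarrow> nat list" where
  "reflect as l = map2 (\<lambda>a x. a - 1 - x) as l"

lemma reflect_box: "l \<in> box as \<Longrightarrow> reflect as l \<in> box as" "l \<in> box as \<Longrightarrow> reflect as (reflect as l) = l"
  by (induction as arbitrary: l) (auto simp: reflect_def box_Cons)

context prime_values
begin

definition reflected :: "nat list \<Rightarrow> (nat list \<Rightarrow> 'r) \<Rightarrow> nat list \<Rightarrow> 'r" where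
  "reflected as f l = (if l \<in> box as then f (reflect as l) else 0)"

lemma reflected_F: "f \<in> F as \<Longrightarrow> reflected as f \<in> F as"
  by (auto simp: F_def reflected_def)

lemma reflected_reflected: "f \<in> F as \<Longrightarrow> reflected as (reflected as f) = f"
  by (auto simp: F_def reflected_def reflect_box fun_eq_iff)

lemma shift_sum_reflected:
  "l \<in> box as \<Longrightarrow> shift_sum 2 (reflected as f) l = raise_sum f (reflect as l)"
proof (induction as arbitrary: l f)
  case Nil
  then show ?case by (simp add: reflect_def)
next
  case (Cons a as)
  then obtain j l' where l: "l = j # l'" "j < a" "l' \<in> box as" by (auto simp: box_Cons)
  have "(\<lambda>l. reflected (a # as) f (j # l)) = reflected as (\<lambda>l. f ((a - 1 - j) # l))"
    using l(2) by (auto simp: reflected_def reflect_def fun_eq_iff)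
  moreover have "reflected (a # as) f ((j + 2) # l') =
      (if 2 \<le> a - 1 - j then f ((a - 1 - j - 2) # reflect as l') else 0)"
    using l by (auto simp: reflected_def reflect_def One_nat_def diff_diff_eq)
  ultimately show ?case
    using Cons.IH[OF l(3), of "\<lambda>l. f ((a - 1 - j) # l)"] unfolding l(1)
    by (simp add: reflect_def)
qed

definition raised :: "nat list \<Rightarrow> (nat list \<Rightarrow> 'r) \<Rightarrow> nat list \<Rightarrow> 'r" where
  "raised as f l = (if l \<in> box as then raise_sum f l else 0)"

lemma card_raised_kernel:
  "card {f \<in> F as. raised as f = 0} = card {f \<in> F as. \<forall>l. shift_sum 2 f l = 0}"
proof -
  have "bij_betw (reflected as) {f \<in> F as. raised as f = 0} {f \<in> F as. \<forall>l. shift_sum 2 f l = 0}"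
  proof (rule bij_betwI[where g="reflected as"])
    show "reflected as \<in> {f \<in> F as. raised as f = 0} \<rightarrow> {f \<in> F as. \<forall>l. shift_sum 2 f l = 0}"
    proof
      fix f assume f: "f \<in> {f \<in> F as. raised as f = 0}"
      have "shift_sum 2 (reflected as f) l = 0" for l
      proof (cases "l \<in> box as")
        case True
        have "raised as f (reflect as l) = 0" using f by simp
        then show ?thesis using True by (simp add: shift_sum_reflected raised_def reflect_box)
      next
        case False
        have "shift_sum 2 (reflected as f) \<in> F as" using f by (intro F_shift_sum reflected_F) simp
        then show ?thesis using False by (simp add: F_def)
      qed
      then show "reflected as f \<in> {f \<in> F as. \<forall>l. shift_sum 2 f l = 0}" using f reflected_F by simp
    qed
    show "reflected as \<in> {f \<in> F as. \<forall>l. shift_sum 2 f l = 0} \<rightarrow> {f \<in> F as. raised as f = 0}"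
    proof
      fix f assume f: "f \<in> {f \<in> F as. \<forall>l. shift_sum 2 f l = 0}"
      have "raised as (reflected as f) l = 0" for l
      proof (cases "l \<in> box as")
        case True
        have "raise_sum (reflected as f) l = shift_sum 2 (reflected as (reflected as f)) (reflect as l)"
          using True by (simp add: shift_sum_reflected reflect_box)
        then show ?thesis using f True by (simp add: reflected_reflected raised_def)
      qed (simp add: raised_def)
      then show "reflected as f \<in> {f \<in> F as. raised as f = 0}"
        using f reflected_F by (auto simp: fun_eq_iff)
    qed
  qed (auto simp: reflected_reflected)
  then show ?thesis by (rule bij_betw_same_card)
qed

definition leads :: "('i \<Rightarrow> nat) \<Rightarrow> 'i set \<Rightarrow> ('i \<Rightarrow> 'r) set \<Rightarrow> 'i set" where
  "leads w B G = {l\<in>B. \<exists>g\<in>G. g l \<noteq> 0 \<and> (\<forall>l'\<in>B. w l' < w l \<longrightarrow> g l' = 0)}"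

lemma subgroup_trivial:
  assumes "H \<subseteq> A" "\<And>x y. x \<in> H \<Longrightarrow> y \<in> H \<Longrightarrow> x - y \<in> H" "H \<noteq> {}"
  shows "H = {0} \<or> H = A"
proof (cases "H = {0}")
  case False
  have H0: "0 \<in> H" using assms(2,3) by (metis diff_self ex_in_conv)
  then obtain x where x: "x \<in> H" "x \<noteq> 0" using False by blast
  have neg: "- y \<in> H" if "y \<in> H" for y using assms(2)[OF H0 that] by simp
  have mult: "of_nat k * x \<in> H" for k
  proof (induction k)
    case (Suc k)
    then have "of_nat k * x - (- x) \<in> H" using assms(2) neg x(1) by blast
    then show ?case by (simp add: algebra_simps)
  qed (simp add: H0)
  have "inj_on (\<lambda>k. of_nat k * x) {..<p}"
  proof (rule linorder_inj_onI)
    fix i j assume ij: "i < j" "i \<in> {..<p}" "j \<in> {..<p}"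
    show "of_nat i * x \<noteq> of_nat j * x"
    proof
      assume eq: "of_nat i * x = of_nat j * x"
      have "\<not> p dvd j - i" using ij by (auto dest: dvd_imp_le)
      then obtain m where m: "\<And>x. x \<in> A \<Longrightarrow> of_nat (j - i) * (of_nat m * x) = x" using inverse_mod by blast
      have "of_nat (j - i) * x = 0" using eq ij(1) by (simp add: of_nat_diff left_diff_distrib)
      then have "of_nat (j - i) * (of_nat m * x) = 0" by (simp add: mult.left_commute)
      then show False using m[of x] x assms(1) by auto
    qed
  qed auto
  then have "p = card ((\<lambda>k. of_nat k * x) ` {..<p})" by (simp add: card_image)
  also have "\<dots> \<le> card H" by (rule card_mono) (use mult finite_subset[OF assms(1) finite_A] in auto)
  finally have "H = A" using card_A assms(1) card_seteq finite_A by metis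
  then show ?thesis ..
qed simp

text \<open>Evaluation at the index of least weight is additive, and its image, a subgroup of a
  group of prime order, is trivial or all of \<open>A\<close>. It is nontrivial exactly if that
  index is a lead; the kernel has the remaining leads.\<close>

lemma card_leads:
  assumes "finite B" "inj_on w B" "finite G" "0 \<in> G" "\<And>g h. g \<in> G \<Longrightarrow> h \<in> G \<Longrightarrow> g - h \<in> G"
    "\<And>g l. g \<in> G \<Longrightarrow> g l \<in> A" "\<And>g l. g \<in> G \<Longrightarrow> l \<notin> B \<Longrightarrow> g l = 0"
  shows "card G = p ^ card (leads w B G)"
  using assms
proof (induction "card B" arbitrary: B G)
  case 0
  then have "B = {}" by simp
  then have "g = 0" if "g \<in> G" for g using "0.prems"(7)[OF that] by auto
  then have "G = {0}" using "0.prems"(4) by blast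
  then show ?case using \<open>B = {}\<close> by (simp add: leads_def)
next
  case (Suc n)
  then have "B \<noteq> {}" by auto
  then obtain \<mu> where \<mu>: "\<mu> \<in> B" "\<And>l. l \<in> B \<Longrightarrow> w \<mu> \<le> w l"
    using Suc.prems(1) by (metis arg_min_if_finite(1) arg_min_least)
  have lt: "w \<mu> < w l" if "l \<in> B - {\<mu>}" for l
    using \<mu> that Suc.prems(2) by (metis DiffE inj_on_eq_iff insertI1 le_neq_implies_less)
  let ?G = "{g \<in> G. g \<mu> = 0}"
  have IH: "card ?G = p ^ card (leads w (B - {\<mu>}) ?G)"
  proof (rule Suc.hyps(1))
    show "n = card (B - {\<mu>})" using Suc.hyps(2) \<mu>(1) by simp
    show "inj_on w (B - {\<mu>})" using Suc.prems(2) by (rule inj_on_subset) auto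
    show "g l = 0" if "g \<in> ?G" "l \<notin> B - {\<mu>}" for g l using that Suc.prems(7)[of g l] by (cases "l = \<mu>") auto
  qed (use Suc.prems in auto)
  have "card G = card ?G * card ((\<lambda>g. g \<mu>) ` G)"
    using Suc.prems by (intro card_additive_image) auto
  moreover have "card ((\<lambda>g. g \<mu>) ` G) = (if \<mu> \<in> leads w B G then p else 1)"
  proof -
    have "(\<lambda>g. g \<mu>) ` G = {0} \<or> (\<lambda>g. g \<mu>) ` G = A"
    proof (rule subgroup_trivial)
      fix x y assume "x \<in> (\<lambda>g. g \<mu>) ` G" "y \<in> (\<lambda>g. g \<mu>) ` G"
      then obtain g h where "g \<in> G" "h \<in> G" "x = g \<mu>" "y = h \<mu>" by blast
      then show "x - y \<in> (\<lambda>g. g \<mu>) ` G" using Suc.prems(5) by (intro image_eqI[of _ _ "g - h"]) auto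
    qed (use Suc.prems in auto)
    moreover have "\<mu> \<in> leads w B G \<longleftrightarrow> (\<exists>g\<in>G. g \<mu> \<noteq> 0)"
      using \<mu> by (auto simp: leads_def not_less[symmetric])
    moreover have "A \<noteq> {0}" using card_A p_gt_1 by auto
    ultimately show ?thesis using card_A by auto
  qed
  moreover have "leads w B G - {\<mu>} = leads w (B - {\<mu>}) ?G"
    unfolding leads_def using \<mu>(1) lt by auto
  then have "card (leads w B G) = card (leads w (B - {\<mu>}) ?G) + (if \<mu> \<in> leads w B G then 1 else 0)"
  proof -
    assume eq: "leads w B G - {\<mu>} = leads w (B - {\<mu>}) ?G"
    have "finite (leads w B G)" using Suc.prems(1) by (simp add: leads_def)
    then show ?thesis unfolding eq[symmetric] using card_Suc_Diff1[of "leads w B G" \<mu>] by auto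
  qed
  ultimately show ?case using IH by (simp add: power_add)
qed

text \<open>Rank and nullity for multiplication by the sum of squares: the image has p^(number of
  leads) elements, hence the kernel has p^(number of non-leads), and the order of the kernel is
  known from the block count.\<close>

lemma quadric_count_eq_card:
  assumes "p > 2" "odd q" "inj_on w (box (replicate (Suc d) q))"
  shows "real (card (box (replicate (Suc d) q)) -
      card (leads w (box (replicate (Suc d) q)) (raised (replicate (Suc d) q) ` F (replicate (Suc d) q)))) =
    block_count.quadric_count blocks d q"
proof -
  let ?as = "replicate (Suc d) q"
  let ?G = "raised ?as ` F ?as"
  let ?B = "box ?as"
  have diff: "raised as f - raised as g = raised as (\<lambda>l. f l - g l)" for as f g
    by (auto simp: raised_def raise_sum_diff fun_eq_iff)
  have rA: "raise_sum f l \<in> A" if "\<And>l. f l \<in> A" for f l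
    using that by (induction f l rule: raise_sum.induct) (auto simp: A_add)
  have "card ?G = p ^ card (leads w ?B ?G)"
  proof (rule card_leads)
    show "0 \<in> ?G" using F_zero[of ?as] diff[of ?as "\<lambda>l. 0" "\<lambda>l. 0"] by (intro image_eqI[of _ _ "\<lambda>l. 0"]) auto
    show "g - h \<in> ?G" if "g \<in> ?G" "h \<in> ?G" for g h
      using that F_diff by (auto simp: diff)
    show "g l \<in> A" if "g \<in> ?G" for g l using that rA by (auto simp: raised_def F_def)
    show "g l = 0" if "g \<in> ?G" "l \<notin> ?B" for g l using that by (auto simp: raised_def)
  qed (use assms in auto)
  moreover have "card (F ?as) = card {f \<in> F ?as. raised ?as f = 0} * card ?G"
    by (rule card_additive_image) (use F_diff diff in \<open>auto simp: fun_diff_def\<close>)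
  ultimately have eq: "p ^ card ?B = card {f \<in> F ?as. raised ?as f = 0} * p ^ card (leads w ?B ?G)"
    by (simp only: card_F card_box)
  have le: "card (leads w ?B ?G) \<le> card ?B" by (rule card_mono) (auto simp: leads_def)
  then have "p ^ card ?B = p ^ (card ?B - card (leads w ?B ?G)) * p ^ card (leads w ?B ?G)"
    by (simp flip: power_add)
  then have "card {f \<in> F ?as. raised ?as f = 0} = p ^ (card ?B - card (leads w ?B ?G))"
    using eq p_gt_0 by simp
  then have "log p (card {f \<in> F ?as. \<forall>l. shift_sum 2 f l = 0}) = real (card ?B - card (leads w ?B ?G))"
    unfolding card_raised_kernel using p_gt_1 log_p_pow[OF p_gt_0, of "card ?B - card (leads w ?B ?G)"] by simp
  then show ?thesis using log_card_quadric[OF assms(1,2), of d] by simp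
qed

end

section \<open>Additive maps between the field and Z/p\<close>

locale char_p_series = quadric_series R d + prime_values p A
  for R :: "('a, 'b) ring_scheme" (structure) and d p and A :: "'r::comm_ring_1 set" +
  assumes char: "[p] \<cdot> \<one> = \<zero>"
begin

lemma p_add_pow: "x \<in> carrier R \<Longrightarrow> [p] \<cdot> x = \<zero>"
  using add_pow_ldistr[of \<one> x p] char by simp

lemma add_pow_dvd: "x \<in> carrier R \<Longrightarrow> p dvd k \<Longrightarrow> [k] \<cdot> x = \<zero>"
proof -
  assume x: "x \<in> carrier R" and "p dvd k"
  then obtain c where "k = p * c" by auto
  then show ?thesis using x add.nat_pow_pow[OF x, of p c] by (simp add: p_add_pow mult.commute)
qed

lemma add_pow_cong:
  assumes x: "x \<in> carrier R" and "k mod p = k' mod p"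
  shows "[k] \<cdot> x = [k'] \<cdot> x"
proof -
  have "[k] \<cdot> x = [(k mod p)] \<cdot> x" for k
  proof -
    have "[(p * (k div p) + k mod p)] \<cdot> x = [(p * (k div p))] \<cdot> x \<oplus> [(k mod p)] \<cdot> x"
      by (rule add_pow_add[OF x])
    then show ?thesis using x add_pow_dvd[OF x, of "p * (k div p)"] by simp
  qed
  then show ?thesis using assms by metis
qed

lemma mod_inverse_nat:
  assumes "\<not> p dvd k"
  obtains k' where "(k * k') mod p = 1"
proof -
  have "coprime k p" using prime_imp_coprime[OF p assms] by (simp add: coprime_commute)
  then obtain k' where "[k * k' = 1] (mod p)" using cong_solve_coprime_nat[of k p] by (auto simp: One_nat_def)
  then have "(k * k') mod p = 1" using p_gt_1 by (simp add: cong_def)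
  then show ?thesis using that by blast
qed

text \<open>A maximal additive subgroup avoiding \<open>y\<close> is a complement of the line spanned by \<open>y\<close>.\<close>

lemma additive_functional:
  assumes y: "y \<in> carrier R" "y \<noteq> \<zero>"
  shows "\<exists>\<tau>. (\<forall>a\<in>carrier R. \<forall>b\<in>carrier R. \<tau> (a \<oplus> b) = \<tau> a + \<tau> b) \<and> (\<forall>a. \<tau> a \<in> A) \<and> \<tau> \<zero> = 0 \<and> \<tau> y \<noteq> 0"
proof -
  define sub where "sub H \<longleftrightarrow> H \<subseteq> carrier R \<and> \<zero> \<in> H \<and> (\<forall>a\<in>H. \<forall>b\<in>H. a \<ominus> b \<in> H)" for H
  define \<H> where "\<H> = {H. sub H \<and> y \<notin> H}"
  have "{\<zero>} \<in> \<H>" using y by (auto simp: \<H>_def sub_def minus_eq)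
  then have "\<H> \<noteq> {}" by blast
  moreover have "\<Union>\<C> \<in> \<H>" if ne: "\<C> \<noteq> {}" and ch: "subset.chain \<H> \<C>" for \<C>
  proof -
    have C: "sub H" "y \<notin> H" if "H \<in> \<C>" for H using ch that by (auto simp: subset_chain_def \<H>_def)
    have "a \<ominus> b \<in> \<Union>\<C>" if ab: "a \<in> \<Union>\<C>" "b \<in> \<Union>\<C>" for a b
    proof -
      obtain H1 H2 where H: "a \<in> H1" "b \<in> H2" "H1 \<in> \<C>" "H2 \<in> \<C>" using ab by blast
      then have "H1 \<subseteq> H2 \<or> H2 \<subseteq> H1" using ch by (auto simp: subset_chain_def)
      then obtain H where "H \<in> \<C>" "a \<in> H" "b \<in> H" using H by blast
      then show ?thesis using C(1)[of H] by (auto simp: sub_def)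
    qed
    then have "sub (\<Union>\<C>)" using C(1) ne unfolding sub_def by blast
    then show ?thesis using C(2) by (auto simp: \<H>_def)
  qed
  ultimately obtain H where H: "H \<in> \<H>" "\<And>H'. H' \<in> \<H> \<Longrightarrow> H \<subseteq> H' \<Longrightarrow> H' = H"
    using subset_Zorn_nonempty[of \<H>] by blast
  have Hc: "H \<subseteq> carrier R" and H0: "\<zero> \<in> H" and Hd: "\<And>a b. a \<in> H \<Longrightarrow> b \<in> H \<Longrightarrow> a \<ominus> b \<in> H" and yH: "y \<notin> H"
    using H(1) by (auto simp: \<H>_def sub_def)
  have Hm: "\<ominus> a \<in> H" if "a \<in> H" for a using Hd[OF H0 that] Hc that by (auto simp: minus_eq)
  have Ha: "a \<oplus> b \<in> H" if "a \<in> H" "b \<in> H" for a b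
    using Hd[OF that(1) Hm[OF that(2)]] Hc that by (auto simp: minus_eq)
  have Hp: "[(k::nat)] \<cdot> a \<in> H" if "a \<in> H" for a k
    by (induction k) (use that Ha H0 in auto)
  \<comment> \<open>If \<open>w\<close> is not in \<open>H\<close>, adjoining it must capture
    \<open>y\<close> by maximality. Then y = h + k w with \<open>k\<close> prime to
    \<open>p\<close>, and inverting \<open>k\<close> modulo \<open>p\<close> expresses
    \<open>w\<close> through \<open>y\<close> modulo \<open>H\<close>.\<close>
  have ex: "\<exists>k::nat. w \<ominus> [k] \<cdot> y \<in> H" if w: "w \<in> carrier R" for w
  proof (cases "w \<in> H")
    case True
    then show ?thesis using w by (intro exI[of _ 0]) (simp add: minus_eq)
  next
    case False
    let ?H = "{h \<oplus> [(k::nat)] \<cdot> w | h k. h \<in> H}"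
    have "sub ?H"
      unfolding sub_def
    proof (intro conjI ballI)
      show "?H \<subseteq> carrier R" using Hc w by auto
      show "\<zero> \<in> ?H" using H0 w by (auto intro!: exI[of _ \<zero>] exI[of _ "0::nat"])
      fix a b assume "a \<in> ?H" "b \<in> ?H"
      then obtain h k h' k' where a: "a = h \<oplus> [(k::nat)] \<cdot> w" "h \<in> H" and b: "b = h' \<oplus> [(k'::nat)] \<cdot> w" "h' \<in> H"
        by blast
      have hc: "h \<in> carrier R" "h' \<in> carrier R" using a b Hc by auto
      \<comment> \<open>Multiples are taken by natural numbers, so minus \<open>k'\<close> is
        represented by \<open>(p - 1) * k'\<close>.\<close>
      have "[(k + (p - 1) * k')] \<cdot> w \<oplus> [k'] \<cdot> w = [(k + p * k')] \<cdot> w"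
      proof -
        have eq: "k + (p - 1) * k' + k' = k + p * k'" using p_gt_0 by (cases p) auto
        show ?thesis using add_pow_add[OF w, of "k + (p - 1) * k'" k'] unfolding eq by (rule sym)
      qed
      also have "\<dots> = [k] \<cdot> w" by (rule add_pow_cong[OF w]) simp
      finally have kk: "[k] \<cdot> w = [(k + (p - 1) * k')] \<cdot> w \<oplus> [k'] \<cdot> w" ..
      have "a \<ominus> b = (h \<ominus> h') \<oplus> [(k + (p - 1) * k')] \<cdot> w"
        unfolding a(1) b(1) kk using hc w by (simp add: minus_eq minus_add a_ac r_neg1 r_neg2, (simp add: r_neg a_ac)?)
      then show "a \<ominus> b \<in> ?H" using Hd[OF a(2) b(2)] by blast
    qed
    moreover have "H \<subseteq> ?H"
    proof
      fix h assume "h \<in> H"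
      then show "h \<in> ?H" using Hc w by (auto intro!: exI[of _ h] exI[of _ "0::nat"])
    qed
    moreover have "w \<in> ?H" using H0 w by (auto intro!: exI[of _ \<zero>] exI[of _ "1::nat"])
    ultimately have "y \<in> ?H" using H(2)[of ?H] False by (auto simp: \<H>_def)
    then obtain h k where hk: "y = h \<oplus> [(k::nat)] \<cdot> w" "h \<in> H" by blast
    have hc: "h \<in> carrier R" using hk Hc by auto
    have "\<not> p dvd k" using hk yH add_pow_dvd[OF w, of k] hc by auto
    then obtain k' where k': "(k * k') mod p = 1" by (rule mod_inverse_nat)
    have "[k'] \<cdot> y = [k'] \<cdot> h \<oplus> [k'] \<cdot> ([k] \<cdot> w)"
      unfolding hk(1) using hc w by (intro add.nat_pow_distrib) auto
    also have "[k'] \<cdot> ([k] \<cdot> w) = [(k * k')] \<cdot> w" using w by (rule add.nat_pow_pow)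
    also have "\<dots> = [(1::nat)] \<cdot> w" by (rule add_pow_cong[OF w]) (use k' p_gt_1 in simp)
    also have "\<dots> = w" using w by simp
    finally have "w \<ominus> [k'] \<cdot> y = \<ominus> ([k'] \<cdot> h)"
      using hc w by (simp add: minus_eq minus_add a_ac r_neg1 r_neg2, (simp add: r_neg a_ac)?)
    then show ?thesis using Hm[OF Hp[OF hk(2)]] by metis
  qed
  \<comment> \<open>The multiple is unique modulo \<open>p\<close>: a multiple of \<open>y\<close>
    in \<open>H\<close> with a factor prime to \<open>p\<close> would bring \<open>y\<close> itself
    into \<open>H\<close>.\<close>
  have cong: "i mod p = j mod p" if ij: "[i] \<cdot> y \<ominus> [j] \<cdot> y \<in> H" for i j :: nat
  proof -
    let ?t = "i + (p - 1) * j"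
    have "[?t] \<cdot> y \<oplus> [j] \<cdot> y = [(i + p * j)] \<cdot> y"
    proof -
      have eq: "?t + j = i + p * j" using p_gt_0 by (cases p) auto
      show ?thesis using add_pow_add[OF y(1), of ?t j] unfolding eq by (rule sym)
    qed
    also have "\<dots> = [i] \<cdot> y" by (rule add_pow_cong[OF y(1)]) simp
    finally have t: "[i] \<cdot> y = [?t] \<cdot> y \<oplus> [j] \<cdot> y" ..
    have "[i] \<cdot> y \<ominus> [j] \<cdot> y = [?t] \<cdot> y"
      unfolding t using y(1) by (simp add: minus_eq a_assoc r_neg)
    then have tH: "[?t] \<cdot> y \<in> H" using ij by simp
    have "p dvd ?t"
    proof (rule ccontr)
      assume "\<not> p dvd ?t"
      then obtain k' where k': "(?t * k') mod p = 1" by (rule mod_inverse_nat)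
      have "[k'] \<cdot> ([?t] \<cdot> y) = [(?t * k')] \<cdot> y" using y(1) by (rule add.nat_pow_pow)
      also have "\<dots> = [(1::nat)] \<cdot> y" by (rule add_pow_cong[OF y(1)]) (use k' p_gt_1 in simp)
      also have "\<dots> = y" using y(1) by simp
      finally show False using Hp[OF tH, of k'] yH by simp
    qed
    then have "(?t + j) mod p = j mod p" by (metis add.commute dvd_eq_mod_eq_0 mod_add_right_eq add.right_neutral)
    moreover have "?t + j = i + p * j" using p_gt_0 by (cases p) auto
    ultimately show ?thesis by simp
  qed
  obtain e where e: "e \<in> A" "e \<noteq> 0"
  proof -
    have "A \<noteq> {0}" using card_A p_gt_1 by auto
    then show ?thesis using A_zero that by blast
  qed
  have e_cong: "of_nat i * e = of_nat j * e" if "i mod p = j mod p" for i j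
  proof -
    have "of_nat i * e = of_nat (i mod p) * e" for i
    proof -
      have "of_nat (p * (i div p) + i mod p) * e = of_nat (p * (i div p)) * e + of_nat (i mod p) * e"
        by (simp only: of_nat_add distrib_right)
      then show ?thesis using p_dvd_mult[OF e(1), of "p * (i div p)"] by simp
    qed
    then show ?thesis using that by metis
  qed
  define \<kappa> where "\<kappa> w = (SOME k::nat. w \<ominus> [k] \<cdot> y \<in> H)" for w
  have \<kappa>: "w \<ominus> [(\<kappa> w)] \<cdot> y \<in> H" if "w \<in> carrier R" for w
    unfolding \<kappa>_def using someI_ex[OF ex[OF that]] .
  have \<kappa>_eq: "\<kappa> w mod p = k mod p" if "w \<in> carrier R" "w \<ominus> [k] \<cdot> y \<in> H" for w k
  proof (rule cong)
    have "(w \<ominus> [k] \<cdot> y) \<ominus> (w \<ominus> [(\<kappa> w)] \<cdot> y) = [(\<kappa> w)] \<cdot> y \<ominus> [k] \<cdot> y"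
      using that(1) y(1) by (simp add: minus_eq minus_add a_ac r_neg1 r_neg2)
    then show "[(\<kappa> w)] \<cdot> y \<ominus> [k] \<cdot> y \<in> H" using Hd[OF that(2) \<kappa>[OF that(1)]] by simp
  qed
  let ?\<tau> = "\<lambda>w. of_nat (\<kappa> w) * e"
  have "?\<tau> (a \<oplus> b) = ?\<tau> a + ?\<tau> b" if ab: "a \<in> carrier R" "b \<in> carrier R" for a b
  proof -
    have "(a \<ominus> [(\<kappa> a)] \<cdot> y) \<oplus> (b \<ominus> [(\<kappa> b)] \<cdot> y) = (a \<oplus> b) \<ominus> [(\<kappa> a + \<kappa> b)] \<cdot> y"
      using ab y(1) by (simp add: add_pow_add minus_eq minus_add a_ac)
    then have "(a \<oplus> b) \<ominus> [(\<kappa> a + \<kappa> b)] \<cdot> y \<in> H" using Ha[OF \<kappa>[OF ab(1)] \<kappa>[OF ab(2)]] by simp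
    then have "\<kappa> (a \<oplus> b) mod p = (\<kappa> a + \<kappa> b) mod p" using \<kappa>_eq ab by simp
    from e_cong[OF this] show ?thesis by (simp add: distrib_right)
  qed
  moreover have "?\<tau> w \<in> A" for w using A_of_nat_mult[OF e(1)] .
  moreover have "?\<tau> \<zero> = 0"
  proof -
    have "\<zero> \<ominus> [(0::nat)] \<cdot> y \<in> H" using H0 by (simp add: minus_eq)
    then have "\<kappa> \<zero> mod p = 0 mod p" by (intro \<kappa>_eq) auto
    from e_cong[OF this] show ?thesis by simp
  qed
  moreover have "?\<tau> y \<noteq> 0"
  proof -
    have "y \<ominus> [(1::nat)] \<cdot> y \<in> H" using H0 y(1) by (simp add: minus_eq r_neg)
    then have "\<kappa> y mod p = 1 mod p" by (rule \<kappa>_eq[OF y(1)])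
    from e_cong[OF this] show ?thesis using e(2) by simp
  qed
  ultimately show ?thesis by (intro exI[of _ ?\<tau>]) auto
qed

text \<open>A nonzero \<open>y\<close> generates \<open>A\<close>, and both \<open>y\<close> and the
  unit of the field have additive order \<open>p\<close>; sending one to the other is well defined
  and injective on multiples.\<close>

lemma additive_embedding:
  assumes y: "y \<in> A" "y \<noteq> 0"
  shows "\<exists>\<iota>. (\<forall>a\<in>A. \<forall>b\<in>A. \<iota> (a + b) = \<iota> a \<oplus> \<iota> b) \<and> (\<forall>a. \<iota> a \<in> carrier R) \<and> \<iota> 0 = \<zero> \<and> \<iota> y \<noteq> \<zero>"
proof -
  have cong: "i mod p = j mod p" if "of_nat i * y = of_nat j * y" for i j
  proof -
    have *: "p dvd j - i" if "i \<le> j" "of_nat i * y = of_nat j * y" for i j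
    proof (rule ccontr)
      assume "\<not> p dvd j - i"
      then obtain m where m: "\<And>x. x \<in> A \<Longrightarrow> of_nat (j - i) * (of_nat m * x) = x" using inverse_mod by blast
      have "of_nat (j - i) * y = 0" using that by (simp add: of_nat_diff left_diff_distrib)
      then have "of_nat (j - i) * (of_nat m * y) = 0" by (simp add: mult.left_commute)
      then show False using m[of y] y by auto
    qed
    show ?thesis
    proof (cases "i \<le> j")
      case True
      then show ?thesis using *[OF True that] by (metis mod_eq_dvd_iff_nat)
    next
      case False
      then show ?thesis using *[of j i] that by (metis mod_eq_dvd_iff_nat nat_le_linear)
    qed
  qed
  have "range (\<lambda>k. of_nat k * y) = {0} \<or> range (\<lambda>k. of_nat k * y) = A"
  proof (rule subgroup_trivial)
    show "range (\<lambda>k. of_nat k * y) \<subseteq> A" using A_of_nat_mult[OF y(1)] by auto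
    fix x z assume "x \<in> range (\<lambda>k. of_nat k * y)" "z \<in> range (\<lambda>k. of_nat k * y)"
    then obtain i j where x: "x = of_nat i * y" "z = of_nat j * y" by blast
    have "of_nat (i + (p - 1) * j) * y + z = of_nat i * y + of_nat (p * j) * y"
      using p_gt_0 by (cases p) (simp_all add: x algebra_simps)
    then have "x - z = of_nat (i + (p - 1) * j) * y"
      using p_dvd_mult[OF y(1), of "p * j"] by (simp add: x algebra_simps)
    then show "x - z \<in> range (\<lambda>k. of_nat k * y)" by blast
  qed auto
  moreover have "y \<in> range (\<lambda>k. of_nat k * y)" by (rule range_eqI[of _ _ 1]) simp
  ultimately have gen: "\<exists>k. x = of_nat k * y" if "x \<in> A" for x using that y(2) by auto
  define \<kappa> where "\<kappa> x = (SOME k. x = of_nat k * y)" for x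
  have \<kappa>: "of_nat (\<kappa> x) * y = x" if "x \<in> A" for x
    unfolding \<kappa>_def using someI_ex[OF gen[OF that]] by simp
  let ?\<iota> = "\<lambda>x. [(\<kappa> x)] \<cdot> \<one>"
  have "?\<iota> (a + b) = ?\<iota> a \<oplus> ?\<iota> b" if "a \<in> A" "b \<in> A" for a b
  proof -
    have "of_nat (\<kappa> (a + b)) * y = of_nat (\<kappa> a + \<kappa> b) * y" using \<kappa> that A_add by (simp add: distrib_right)
    then have "\<kappa> (a + b) mod p = (\<kappa> a + \<kappa> b) mod p" by (rule cong)
    from add_pow_cong[OF one_closed this] show ?thesis by (simp only: add_pow_add[OF one_closed])
  qed
  moreover have "?\<iota> 0 = \<zero>"
  proof -
    have "of_nat (\<kappa> 0) * y = of_nat 0 * y" using \<kappa>[of 0] by simp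
    then have "\<kappa> 0 mod p = 0 mod p" by (rule cong)
    then show ?thesis using add_pow_cong[OF one_closed, of "\<kappa> 0" 0] by simp
  qed
  moreover have "?\<iota> y \<noteq> \<zero>"
  proof -
    have "of_nat (\<kappa> y) * y = of_nat 1 * y" using \<kappa>[of y] y by simp
    then have "\<kappa> y mod p = 1 mod p" by (rule cong)
    then show ?thesis using add_pow_cong[OF one_closed, of "\<kappa> y" 1] by simp
  qed
  ultimately show ?thesis by (intro exI[of _ ?\<iota>]) auto
qed

end

section \<open>Multi-indices and monomials\<close>

lemma box_replicate: "l \<in> box (replicate n q) \<longleftrightarrow> length l = n \<and> (\<forall>i<n. l ! i < q)"
  by (auto simp: box_def list_all2_conv_all_nth)

definition mon_of :: "nat list \<Rightarrow> nat multiset" where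
  "mon_of l = (\<Sum>i<length l. replicate_mset (l ! i) i)"

lemma count_mon_of: "count (mon_of l) i = (if i < length l then l ! i else 0)"
proof -
  have "count (mon_of l) i = (\<Sum>j<length l. if j = i then l ! j else 0)"
    unfolding mon_of_def count_sum by (rule sum.cong) auto
  then show ?thesis by simp
qed

declare replicate_Suc [simp del]

context quadric_series
begin

definition exps :: "nat multiset \<Rightarrow> nat list" where "exps m = map (count m) [0..<Suc d]"

definition boxm :: "nat \<Rightarrow> nat multiset set" where "boxm q = {m \<in> monomials. \<forall>i. count m i < q}"

lemma exps_nth: "i \<le> d \<Longrightarrow> exps m ! i = count m i" and length_exps [simp]: "length (exps m) = Suc d"
  unfolding exps_def by (simp_all del: upt_Suc)

lemma mon_of_exps: "m \<in> monomials \<Longrightarrow> mon_of (exps m) = m"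
  by (rule multiset_eqI) (auto simp: count_mon_of exps_nth less_Suc_eq_le monomials_def not_in_iff subset_iff)

lemma exps_mon_of: "length l = Suc d \<Longrightarrow> exps (mon_of l) = l"
  by (rule nth_equalityI) (auto simp: exps_nth count_mon_of)

lemma mon_of_monomials: "length l = Suc d \<Longrightarrow> mon_of l \<in> monomials"
proof -
  assume l: "length l = Suc d"
  have "i \<le> d" if "i \<in># mon_of l" for i
  proof -
    have "count (mon_of l) i \<noteq> 0" using that by simp
    then show ?thesis using l by (simp add: count_mon_of split: if_splits)
  qed
  then show ?thesis by (auto simp: monomials_def)
qed

lemma exps_box: "m \<in> boxm q \<Longrightarrow> exps m \<in> box (replicate (Suc d) q)"
  by (auto simp: box_replicate boxm_def exps_nth less_Suc_eq_le)

lemma mon_of_box: "l \<in> box (replicate (Suc d) q) \<Longrightarrow> q > 0 \<Longrightarrow> mon_of l \<in> boxm q"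
  using mon_of_monomials[of l] by (auto simp: box_replicate boxm_def count_mon_of)

lemma bij_exps: "q > 0 \<Longrightarrow> bij_betw exps (boxm q) (box (replicate (Suc d) q))"
  by (rule bij_betwI[where g=mon_of])
    (use mon_of_box in \<open>auto simp: exps_box mon_of_exps exps_mon_of dest: box_length\<close>,
      simp add: boxm_def mon_of_exps)

lemma finite_boxm: "q > 0 \<Longrightarrow> finite (boxm q)"
  using bij_betw_finite[OF bij_exps] by simp

lemma boxm_sub: "m \<in> boxm q \<Longrightarrow> m - u \<in> boxm q"
  unfolding boxm_def by (auto simp: monomials_diff less_imp_diff_less)

section \<open>The ideal of the form and the q-th powers of the variables\<close>

abbreviation form where "form \<equiv> diagonal_quadric_form R d"

lemma form_eq: "form = (\<Oplus>\<^bsub>S\<^esub>i\<in>{..d}. mon \<one> {#i, i#})"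
proof -
  have "indexed_var i [^]\<^bsub>S\<^esub> (2::nat) = mon \<one> {#i, i#}" if "i \<in> {..d}" for i
    unfolding indexed_var_eq using that by (subst mon_pow) (auto simp: monomials_def numeral_2_eq_2)
  then show ?thesis unfolding diagonal_quadric_form_def
    by (intro S.finsum_cong') (auto simp: monomials_def)
qed

lemma form_closed [simp, intro]: "form \<in> carrier S"
  unfolding form_eq by (intro S.finsum_closed) (auto simp: monomials_def)

lemma form_mult:
  assumes h: "h \<in> carrier S"
  shows "(form \<otimes>\<^bsub>S\<^esub> h) m = (\<Oplus>i\<in>{..d}. if {#i, i#} \<subseteq># m then h (m - {#i, i#}) else \<zero>)"
proof -
  have c: "mon \<one> {#i, i#} \<in> carrier S" if "i \<in> {..d}" for i using that by (auto simp: monomials_def)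
  have eq: "form \<otimes>\<^bsub>S\<^esub> h = (\<Oplus>\<^bsub>S\<^esub>i\<in>{..d}. mon \<one> {#i, i#} \<otimes>\<^bsub>S\<^esub> h)"
    unfolding form_eq using c h by (intro S.finsum_ldistr) auto
  have "(form \<otimes>\<^bsub>S\<^esub> h) m = (\<Oplus>i\<in>{..d}. (mon \<one> {#i, i#} \<otimes>\<^bsub>S\<^esub> h) m)"
    unfolding eq using c h by (intro S_finsum) auto
  also have "\<dots> = (\<Oplus>i\<in>{..d}. if {#i, i#} \<subseteq># m then h (m - {#i, i#}) else \<zero>)"
    using h by (intro finsum_cong') (auto simp: mon_mult)
  finally show ?thesis .
qed

text \<open>For \<open>q > 0\<close> this is the ideal generated by the form and the powers x_i^q,
  described through the coefficients in the box, which is what the comparison with multi-indices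
  uses.\<close>

definition quad_ideal :: "nat \<Rightarrow> (nat multiset \<Rightarrow> 'a) set" where
  "quad_ideal q = {u \<in> carrier S. \<exists>h\<in>carrier S. \<forall>m\<in>boxm q. u m = (form \<otimes>\<^bsub>S\<^esub> h) m}"

lemma ideal_quad_ideal: "ideal (quad_ideal q) S"
proof (rule idealI)
  show "ring S" by (rule S.ring_axioms)
  show "subgroup (quad_ideal q) (add_monoid S)"
  proof (rule S.add.subgroupI)
    show "quad_ideal q \<subseteq> carrier S" by (auto simp: quad_ideal_def)
    have "\<zero>\<^bsub>S\<^esub> \<in> quad_ideal q" unfolding quad_ideal_def
      by (auto intro!: bexI[of _ "\<zero>\<^bsub>S\<^esub>"])
    then show "quad_ideal q \<noteq> {}" by blast
    fix f assume "f \<in> quad_ideal q"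
    then obtain h where f: "f \<in> carrier S" "h \<in> carrier S" "\<forall>m\<in>boxm q. f m = (form \<otimes>\<^bsub>S\<^esub> h) m"
      by (auto simp: quad_ideal_def)
    have "form \<otimes>\<^bsub>S\<^esub> (\<ominus>\<^bsub>S\<^esub> h) = \<ominus>\<^bsub>S\<^esub> (form \<otimes>\<^bsub>S\<^esub> h)" using f by (intro S.r_minus) auto
    then show "\<ominus>\<^bsub>S\<^esub> f \<in> quad_ideal q" unfolding quad_ideal_def using f
      by (auto simp: S_minus intro!: bexI[of _ "\<ominus>\<^bsub>S\<^esub> h"])
    fix g assume "g \<in> quad_ideal q"
    then obtain h' where g: "g \<in> carrier S" "h' \<in> carrier S" "\<forall>m\<in>boxm q. g m = (form \<otimes>\<^bsub>S\<^esub> h') m"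
      by (auto simp: quad_ideal_def)
    have "form \<otimes>\<^bsub>S\<^esub> (h \<oplus>\<^bsub>S\<^esub> h') = form \<otimes>\<^bsub>S\<^esub> h \<oplus>\<^bsub>S\<^esub> form \<otimes>\<^bsub>S\<^esub> h'" using f g by (intro S.r_distr) auto
    then show "f \<oplus>\<^bsub>S\<^esub> g \<in> quad_ideal q" unfolding quad_ideal_def using f g
      by (auto simp: S_add intro!: bexI[of _ "h \<oplus>\<^bsub>S\<^esub> h'"])
  qed
  fix f g assume "f \<in> quad_ideal q" and g: "g \<in> carrier S"
  then obtain h where f: "f \<in> carrier S" "h \<in> carrier S" "\<And>m. m \<in> boxm q \<Longrightarrow> f m = (form \<otimes>\<^bsub>S\<^esub> h) m"
    by (auto simp: quad_ideal_def)
  \<comment> \<open>The box contains every divisor of its monomials, so agreement of coefficients on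
    the box survives multiplication.\<close>
  have "(g \<otimes>\<^bsub>S\<^esub> f) m = (form \<otimes>\<^bsub>S\<^esub> (g \<otimes>\<^bsub>S\<^esub> h)) m" if m: "m \<in> boxm q" for m
  proof -
    have "(g \<otimes>\<^bsub>S\<^esub> f) m = (g \<otimes>\<^bsub>S\<^esub> (form \<otimes>\<^bsub>S\<^esub> h)) m"
      unfolding S_mult[of g] using f g boxm_sub[OF m] by (intro finsum_cong') auto
    also have "g \<otimes>\<^bsub>S\<^esub> (form \<otimes>\<^bsub>S\<^esub> h) = form \<otimes>\<^bsub>S\<^esub> (g \<otimes>\<^bsub>S\<^esub> h)"
      using f g by (intro S.m_lcomm) auto
    finally show ?thesis .
  qed
  then show *: "g \<otimes>\<^bsub>S\<^esub> f \<in> quad_ideal q" unfolding quad_ideal_def using f g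
    by (auto intro!: bexI[of _ "g \<otimes>\<^bsub>S\<^esub> h"])
  show "f \<otimes>\<^bsub>S\<^esub> g \<in> quad_ideal q" using * S.m_comm[OF f(1) g] by simp
qed

lemma outside_quad_ideal: "outside (boxm q) \<subseteq> quad_ideal q"
proof
  fix u assume "u \<in> outside (boxm q)"
  then have "u \<in> carrier S" "\<forall>m\<in>boxm q. u m = (form \<otimes>\<^bsub>S\<^esub> \<zero>\<^bsub>S\<^esub>) m"
    by (auto simp: outside_def S_zero)
  then show "u \<in> quad_ideal q" unfolding quad_ideal_def by blast
qed

lemma form_in_quad_ideal: "form \<in> quad_ideal q"
  unfolding quad_ideal_def by (auto intro!: bexI[of _ "\<one>\<^bsub>S\<^esub>"])

definition xpow :: "nat \<Rightarrow> nat \<Rightarrow> nat multiset \<Rightarrow> 'a" where "xpow i q = mon \<one> (replicate_mset q i)"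

lemma xpow_closed [simp, intro]: "i \<le> d \<Longrightarrow> xpow i q \<in> carrier S"
  unfolding xpow_def by (rule mon_closed) (auto simp: monomials_def)

lemma xpow_pow: "i \<le> d \<Longrightarrow> xpow i 1 [^]\<^bsub>S\<^esub> q = xpow i q"
  unfolding xpow_def by (subst mon_pow) (auto simp: monomials_def multiset_eq_iff One_nat_def)

text \<open>Each monomial outside the box is attributed to its first variable with a large exponent.\<close>

lemma outside_decomp:
  assumes g: "g \<in> outside (boxm q)" and q: "q > 0"
  shows "\<exists>G. (\<forall>i\<le>d. G i \<in> carrier S) \<and> g = (\<Oplus>\<^bsub>S\<^esub>i\<in>{..d}. xpow i q \<otimes>\<^bsub>S\<^esub> G i)"
proof -
  have gS: "g \<in> carrier S" and g0: "\<And>m. m \<in> boxm q \<Longrightarrow> g m = \<zero>" using g by (auto simp: outside_def)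
  define fst_big where "fst_big m = (LEAST i. q \<le> count m i)" for m :: "nat multiset"
  define G where "G i m = (if m \<in> monomials \<and> fst_big (m + replicate_mset q i) = i then g (m + replicate_mset q i) else \<zero>)" for i m
  have GS: "G i \<in> carrier S" for i using gS by (auto simp: G_def S_carrier)
  have "g m = (\<Oplus>\<^bsub>S\<^esub>i\<in>{..d}. xpow i q \<otimes>\<^bsub>S\<^esub> G i) m" for m
  proof -
    have sub: "replicate_mset q i \<subseteq># m \<longleftrightarrow> q \<le> count m i" for i by (simp add: count_le_replicate_mset_subset_eq)
    have "(\<Oplus>\<^bsub>S\<^esub>i\<in>{..d}. xpow i q \<otimes>\<^bsub>S\<^esub> G i) m = (\<Oplus>i\<in>{..d}. (xpow i q \<otimes>\<^bsub>S\<^esub> G i) m)"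
      using GS by (intro S_finsum) auto
    also have "\<dots> = (\<Oplus>i\<in>{..d}. if q \<le> count m i \<and> m \<in> monomials \<and> fst_big m = i then g m else \<zero>)"
    proof (intro finsum_cong')
      fix i assume i: "i \<in> {..d}"
      then have ri: "replicate_mset q i \<in> monomials" by (auto simp: monomials_def)
      have "m - replicate_mset q i \<in> monomials \<longleftrightarrow> m \<in> monomials" if "replicate_mset q i \<subseteq># m"
        using that ri by (metis monomials_add monomials_diff subset_mset.diff_add)
      then show "(xpow i q \<otimes>\<^bsub>S\<^esub> G i) m = (if q \<le> count m i \<and> m \<in> monomials \<and> fst_big m = i then g m else \<zero>)"
        using GS[of i] gS unfolding xpow_def by (auto simp: mon_mult sub[symmetric] G_def)
    qed (use gS in auto)
    also have "\<dots> = g m"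
    proof (cases "m \<in> monomials \<and> (\<exists>i. q \<le> count m i)")
      case True
      then have big: "q \<le> count m (fst_big m)" unfolding fst_big_def by (metis LeastI)
      then have "fst_big m \<in># m" using q by (metis count_eq_zero_iff not_le)
      then have le: "fst_big m \<le> d" using True by (auto simp: monomials_def)
      have "(\<Oplus>i\<in>{..d}. if q \<le> count m i \<and> m \<in> monomials \<and> fst_big m = i then g m else \<zero>) =
        (\<Oplus>i\<in>{..d}. if fst_big m = i then g m else \<zero>)"
        using gS big True by (intro finsum_cong') auto
      also have "\<dots> = g m" using le gS by (intro finsum_singleton) auto
      finally show ?thesis .
    next
      case False
      then have "g m = \<zero>" using g0 gS by (auto simp: boxm_def S_carrier not_le)
      moreover have "(\<Oplus>i\<in>{..d}. if q \<le> count m i \<and> m \<in> monomials \<and> fst_big m = i then g m else \<zero>) = \<zero>"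
        using False by (intro add.finprod_one_eqI) auto
      ultimately show ?thesis by simp
    qed
    finally show ?thesis by simp
  qed
  then show ?thesis using GS by blast
qed

lemma quad_ideal_least:
  assumes I: "ideal I S" and form: "form \<in> I" and x: "\<And>i. i \<le> d \<Longrightarrow> xpow i q \<in> I" and q: "q > 0"
  shows "quad_ideal q \<subseteq> I"
proof
  interpret I: ideal I S by fact
  fix u assume "u \<in> quad_ideal q"
  then obtain h where u: "u \<in> carrier S" "h \<in> carrier S" "\<And>m. m \<in> boxm q \<Longrightarrow> u m = (form \<otimes>\<^bsub>S\<^esub> h) m"
    by (auto simp: quad_ideal_def)
  let ?g = "u \<ominus>\<^bsub>S\<^esub> form \<otimes>\<^bsub>S\<^esub> h"
  have "?g \<in> outside (boxm q)" unfolding outside_def using u by (auto simp: S_diff minus_eq r_neg)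
  then obtain G where G: "\<forall>i\<le>d. G i \<in> carrier S" "?g = (\<Oplus>\<^bsub>S\<^esub>i\<in>{..d}. xpow i q \<otimes>\<^bsub>S\<^esub> G i)"
    using outside_decomp q by blast
  have "(\<Oplus>\<^bsub>S\<^esub>i\<in>J. xpow i q \<otimes>\<^bsub>S\<^esub> G i) \<in> I" if "J \<subseteq> {..d}" for J
    using finite_subset[OF that finite_atMost] that
  proof (induction J)
    case (insert i J)
    have "xpow i q \<otimes>\<^bsub>S\<^esub> G i \<in> I" using x[of i] G(1) insert.prems by (intro I.I_r_closed) auto
    moreover have "(\<Oplus>\<^bsub>S\<^esub>i\<in>insert i J. xpow i q \<otimes>\<^bsub>S\<^esub> G i) = xpow i q \<otimes>\<^bsub>S\<^esub> G i \<oplus>\<^bsub>S\<^esub> (\<Oplus>\<^bsub>S\<^esub>i\<in>J. xpow i q \<otimes>\<^bsub>S\<^esub> G i)"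
      using insert G(1) by (intro S.finsum_insert) auto
    ultimately show ?case using insert by (simp add: I.a_closed)
  qed (simp add: I.zero_closed)
  then have "?g \<in> I" using G(2) by simp
  then have "?g \<oplus>\<^bsub>S\<^esub> form \<otimes>\<^bsub>S\<^esub> h \<in> I" using form u(2) by (intro I.a_closed I.I_r_closed)
  also have "?g \<oplus>\<^bsub>S\<^esub> form \<otimes>\<^bsub>S\<^esub> h = u" using u by (simp add: S.minus_eq S.a_assoc S.l_neg)
  finally show "u \<in> I" .
qed

end

section \<open>Frobenius powers and transport of initial monomials\<close>

context char_p_series
begin

lemma char_S: "[p] \<cdot>\<^bsub>S\<^esub> \<one>\<^bsub>S\<^esub> = \<zero>\<^bsub>S\<^esub>"
proof
  fix m :: "nat multiset"
  have "([k] \<cdot>\<^bsub>S\<^esub> \<one>\<^bsub>S\<^esub>) m = [k] \<cdot> (\<one>\<^bsub>S\<^esub> m)" for k :: nat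
    by (induction k) (simp_all add: S_zero S_add)
  then show "([p] \<cdot>\<^bsub>S\<^esub> \<one>\<^bsub>S\<^esub>) m = \<zero>\<^bsub>S\<^esub> m"
    using p_add_pow[of "\<one>\<^bsub>S\<^esub> m"] by (simp add: S_zero S_coeff)
qed

text \<open>A series without constant term is a combination of the variables. In characteristic
  \<open>p\<close> its power to the exponent p^e is then a combination of the same powers of the
  variables.\<close>

lemma frobenius_in_quad_ideal:
  assumes g: "g \<in> carrier S" "g {#} = \<zero>"
  shows "g [^]\<^bsub>S\<^esub> (p ^ e) \<in> quad_ideal (p ^ e)"
proof -
  have q: "p ^ e > 0" using p_gt_0 by simp
  \<comment> \<open>The box of side 1 contains at most the empty monomial, so the decomposition
    outside a box yields the combination of the variables.\<close>
  have "boxm 1 \<subseteq> {{#}}" unfolding boxm_def by (auto simp: multiset_eq_iff One_nat_def)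
  then have "g \<in> outside (boxm 1)" using g by (auto simp: outside_def)
  then obtain G where G: "\<forall>i\<le>d. G i \<in> carrier S" "g = (\<Oplus>\<^bsub>S\<^esub>i\<in>{..d}. xpow i 1 \<otimes>\<^bsub>S\<^esub> G i)"
    using outside_decomp[of g 1] by auto
  have "g [^]\<^bsub>S\<^esub> (p ^ e) = (\<Oplus>\<^bsub>S\<^esub>i\<in>{..d}. (xpow i 1 \<otimes>\<^bsub>S\<^esub> G i) [^]\<^bsub>S\<^esub> (p ^ e))"
    unfolding G(2) using G(1) by (intro S.frobenius_pow_finsum p char_S) auto
  also have "\<dots> = (\<Oplus>\<^bsub>S\<^esub>i\<in>{..d}. xpow i (p ^ e) \<otimes>\<^bsub>S\<^esub> G i [^]\<^bsub>S\<^esub> (p ^ e))"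
    using G(1) by (intro S.finsum_cong') (auto simp: S.nat_pow_distrib xpow_pow)
  finally have eq: "g [^]\<^bsub>S\<^esub> (p ^ e) = (\<Oplus>\<^bsub>S\<^esub>i\<in>{..d}. xpow i (p ^ e) \<otimes>\<^bsub>S\<^esub> G i [^]\<^bsub>S\<^esub> (p ^ e))" .
  have "(g [^]\<^bsub>S\<^esub> (p ^ e)) m = \<zero>" if m: "m \<in> boxm (p ^ e)" for m
  proof -
    have "(g [^]\<^bsub>S\<^esub> (p ^ e)) m = (\<Oplus>i\<in>{..d}. (xpow i (p ^ e) \<otimes>\<^bsub>S\<^esub> G i [^]\<^bsub>S\<^esub> (p ^ e)) m)"
      unfolding eq using G(1) by (intro S_finsum) auto
    also have "\<dots> = \<zero>"
    proof (intro add.finprod_one_eqI)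
      fix i assume "i \<in> {..d}"
      moreover have "\<not> replicate_mset (p ^ e) i \<subseteq># m"
        using m by (auto simp: boxm_def not_le simp flip: count_le_replicate_mset_subset_eq)
      ultimately show "(xpow i (p ^ e) \<otimes>\<^bsub>S\<^esub> G i [^]\<^bsub>S\<^esub> (p ^ e)) m = \<zero>"
        unfolding xpow_def using G(1) by (subst mon_mult) auto
    qed
    finally show ?thesis .
  qed
  then have "g [^]\<^bsub>S\<^esub> (p ^ e) \<in> outside (boxm (p ^ e))" using g by (auto simp: outside_def)
  then show ?thesis using outside_quad_ideal by blast
qed

lemma sub_replicate2: "{#i, i#} \<subseteq># m \<longleftrightarrow> 2 \<le> count m i"
  using count_le_replicate_mset_subset_eq[of 2 m i] by (simp add: numeral_2_eq_2)

lemma mon_of_lower: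
  assumes "i < length l" "2 \<le> l ! i"
  shows "mon_of (l[i := l ! i - 2]) = mon_of l - {#i, i#}"
  by (rule multiset_eqI) (use assms in \<open>auto simp: count_mon_of nth_list_update One_nat_def\<close>)

lemma lower_box: "l \<in> box (replicate n q) \<Longrightarrow> l[i := l ! i - 2] \<in> box (replicate n q)"
  by (cases "i < length l") (auto simp: box_replicate nth_list_update less_imp_diff_less)

text \<open>The squares in the form have coefficient 1, so multiplying by it merely adds
  coefficients of \<open>h\<close>. An additive map therefore commutes with it.\<close>

lemma raise_sum_transfer:
  assumes \<tau>: "\<forall>a\<in>carrier R. \<forall>b\<in>carrier R. \<tau> (a \<oplus> b) = \<tau> a + \<tau> b" "\<tau> \<zero> = 0"
    and h: "h \<in> carrier S" and l: "l \<in> box (replicate (Suc d) q)"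
    and f: "\<And>l. l \<in> box (replicate (Suc d) q) \<Longrightarrow> f l = \<tau> (h (mon_of l))"
  shows "raise_sum f l = \<tau> ((form \<otimes>\<^bsub>S\<^esub> h) (mon_of l))"
proof -
  have fin: "\<tau> (\<Oplus>i\<in>I. c i) = (\<Sum>i\<in>I. \<tau> (c i))" if "finite I" "\<And>i. i \<in> I \<Longrightarrow> c i \<in> carrier R" for I :: "nat set" and c
    using that
  proof (induction I)
    case (insert i I)
    then show ?case using \<tau>(1) by (simp add: finsum_insert Pi_def)
  qed (simp add: \<tau>)
  have len: "length l = Suc d" using box_length[OF l] by simp
  have "\<tau> ((form \<otimes>\<^bsub>S\<^esub> h) (mon_of l)) =
    (\<Sum>i\<in>{..d}. \<tau> (if {#i, i#} \<subseteq># mon_of l then h (mon_of l - {#i, i#}) else \<zero>))"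
    unfolding form_mult[OF h] by (rule fin) (use h in auto)
  also have "\<dots> = (\<Sum>i\<in>{..d}. if 2 \<le> l ! i then f (l[i := l ! i - 2]) else 0)"
  proof (rule sum.cong)
    fix i assume i: "i \<in> {..d}"
    then have "{#i, i#} \<subseteq># mon_of l \<longleftrightarrow> 2 \<le> l ! i" unfolding sub_replicate2 by (simp add: count_mon_of len)
    moreover have "f (l[i := l ! i - 2]) = \<tau> (h (mon_of l - {#i, i#}))" if "2 \<le> l ! i"
      using f[OF lower_box[OF l, of i]] mon_of_lower[of i l] that i len by simp
    ultimately show "\<tau> (if {#i, i#} \<subseteq># mon_of l then h (mon_of l - {#i, i#}) else \<zero>) =
        (if 2 \<le> l ! i then f (l[i := l ! i - 2]) else 0)" using \<tau>(2) by simp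
  qed simp
  also have "\<dots> = raise_sum f l" unfolding raise_sum_eq len lessThan_Suc_atMost ..
  finally show ?thesis ..
qed

lemma raise_sum_transfer':
  assumes \<iota>: "\<forall>a\<in>A. \<forall>b\<in>A. \<iota> (a + b) = \<iota> a \<oplus> \<iota> b" "\<iota> 0 = \<zero>" "\<forall>a. \<iota> a \<in> carrier R"
    and h: "h \<in> carrier S" and l: "l \<in> box (replicate (Suc d) q)"
    and f: "\<And>l. f l \<in> A" "\<And>l. l \<in> box (replicate (Suc d) q) \<Longrightarrow> h (mon_of l) = \<iota> (f l)"
  shows "(form \<otimes>\<^bsub>S\<^esub> h) (mon_of l) = \<iota> (raise_sum f l)"
proof -
  have sumA: "(\<Sum>i\<in>I. c i) \<in> A" if "finite I" "\<And>i. i \<in> I \<Longrightarrow> c i \<in> A" for I :: "nat set" and c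
    using that by (induction I) (auto simp: A_add)
  have fin: "\<iota> (\<Sum>i\<in>I. c i) = (\<Oplus>i\<in>I. \<iota> (c i))" if "finite I" "\<And>i. i \<in> I \<Longrightarrow> c i \<in> A" for I :: "nat set" and c
    using that
  proof (induction I)
    case (insert i I)
    then show ?case using \<iota>(1,3) sumA[of I c] by (simp add: finsum_insert Pi_def)
  qed (simp add: \<iota>)
  have len: "length l = Suc d" using box_length[OF l] by simp
  have "\<iota> (raise_sum f l) = (\<Oplus>i\<in>{..d}. \<iota> (if 2 \<le> l ! i then f (l[i := l ! i - 2]) else 0))"
    unfolding raise_sum_eq len lessThan_Suc_atMost by (rule fin) (use f(1) in auto)
  also have "\<dots> = (\<Oplus>i\<in>{..d}. if {#i, i#} \<subseteq># mon_of l then h (mon_of l - {#i, i#}) else \<zero>)"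
  proof (rule finsum_cong')
    fix i assume i: "i \<in> {..d}"
    then have "{#i, i#} \<subseteq># mon_of l \<longleftrightarrow> 2 \<le> l ! i" unfolding sub_replicate2 by (simp add: count_mon_of len)
    moreover have "\<iota> (f (l[i := l ! i - 2])) = h (mon_of l - {#i, i#})" if "2 \<le> l ! i"
      using f(2)[OF lower_box[OF l, of i]] mon_of_lower[of i l] that i len by simp
    ultimately show "\<iota> (if 2 \<le> l ! i then f (l[i := l ! i - 2]) else 0) =
        (if {#i, i#} \<subseteq># mon_of l then h (mon_of l - {#i, i#}) else \<zero>)" using \<iota>(2) by simp
  qed (use h in auto)
  finally show ?thesis unfolding form_mult[OF h] ..
qed

text \<open>Vanishing of the lower coefficients passes through any additive map, while the initial
  coefficient must not be lost. The map is therefore chosen for the element at hand, so as to be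
  nonzero on its initial coefficient.\<close>

lemma leads_eq_initials:
  assumes q: "q > 0"
  shows "leads (\<lambda>l. nm (mon_of l)) (box (replicate (Suc d) q))
      (raised (replicate (Suc d) q) ` F (replicate (Suc d) q)) = exps ` initials (boxm q) (quad_ideal q)"
    (is "leads ?w ?B (?r ` F ?as) = _")
proof (intro equalityI subsetI)
  fix l assume "l \<in> leads ?w ?B (?r ` F ?as)"
  then obtain f where l: "l \<in> ?B" and f: "f \<in> F ?as" "?r f l \<noteq> 0"
    and low: "\<And>l'. l' \<in> ?B \<Longrightarrow> ?w l' < ?w l \<Longrightarrow> ?r f l' = 0"
    by (auto simp: leads_def)
  have fA: "f l \<in> A" for l using f(1) by (simp add: F_def)
  have rA: "raise_sum f l \<in> A" if "\<And>l. f l \<in> A" for f l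
    using that by (induction f l rule: raise_sum.induct) (auto simp: A_add)
  obtain \<iota> where \<iota>: "\<forall>a\<in>A. \<forall>b\<in>A. \<iota> (a + b) = \<iota> a \<oplus> \<iota> b" "\<forall>a. \<iota> a \<in> carrier R" "\<iota> 0 = \<zero>" "\<iota> (?r f l) \<noteq> \<zero>"
    using additive_embedding[of "?r f l"] f(2) l rA[OF fA] by (auto simp: raised_def)
  define h where "h m = (if m \<in> monomials then \<iota> (f (exps m)) else \<zero>)" for m
  have hS: "h \<in> carrier S" using \<iota>(2) by (auto simp: h_def S_carrier)
  have hf: "h (mon_of l) = \<iota> (f l)" if "l \<in> ?B" for l
    using box_length[OF that] by (simp add: h_def mon_of_monomials exps_mon_of)
  have eq: "(form \<otimes>\<^bsub>S\<^esub> h) (mon_of l') = \<iota> (?r f l')" if "l' \<in> ?B" for l'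
    using raise_sum_transfer'[OF \<iota>(1,3,2) hS that fA hf] that by (simp add: raised_def)
  have "mon_of l \<in> initials (boxm q) (quad_ideal q)"
    unfolding initials_def
  proof (intro CollectI conjI bexI[of _ "form \<otimes>\<^bsub>S\<^esub> h"] ballI impI)
    show "mon_of l \<in> boxm q" using mon_of_box[OF l q] .
    show "(form \<otimes>\<^bsub>S\<^esub> h) (mon_of l) \<noteq> \<zero>" using eq[OF l] \<iota>(4) by simp
    show "form \<otimes>\<^bsub>S\<^esub> h \<in> quad_ideal q" unfolding quad_ideal_def using hS by blast
    fix m assume m: "m \<in> boxm q" "nm m < nm (mon_of l)"
    have mm: "mon_of (exps m) = m" using m by (simp add: mon_of_exps boxm_def)
    then have "?r f (exps m) = 0" using low[of "exps m"] m exps_box[OF m(1)] by simp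
    then show "(form \<otimes>\<^bsub>S\<^esub> h) m = \<zero>" using eq[OF exps_box[OF m(1)]] mm \<iota>(3) by simp
  qed
  moreover have "exps (mon_of l) = l" using box_length[OF l] by (simp add: exps_mon_of)
  ultimately show "l \<in> exps ` initials (boxm q) (quad_ideal q)" by force
next
  fix l assume "l \<in> exps ` initials (boxm q) (quad_ideal q)"
  then obtain \<mu> u where l: "l = exps \<mu>" "\<mu> \<in> boxm q" and u: "u \<in> quad_ideal q" "u \<mu> \<noteq> \<zero>"
    and low: "\<And>m. m \<in> boxm q \<Longrightarrow> nm m < nm \<mu> \<Longrightarrow> u m = \<zero>"
    by (auto simp: initials_def)
  then obtain h where uS: "u \<in> carrier S" and h: "h \<in> carrier S" "\<And>m. m \<in> boxm q \<Longrightarrow> u m = (form \<otimes>\<^bsub>S\<^esub> h) m"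
    by (auto simp: quad_ideal_def)
  obtain \<tau> where \<tau>: "\<forall>a\<in>carrier R. \<forall>b\<in>carrier R. \<tau> (a \<oplus> b) = \<tau> a + \<tau> b" "\<forall>a. \<tau> a \<in> A" "\<tau> \<zero> = 0" "\<tau> (u \<mu>) \<noteq> 0"
    using additive_functional[of "u \<mu>"] u(2) uS by auto
  define f where "f l = (if l \<in> ?B then \<tau> (h (mon_of l)) else 0)" for l
  have fF: "f \<in> F ?as" using \<tau>(2) by (auto simp: f_def F_def)
  have eq: "?r f l' = \<tau> (u (mon_of l'))" if "l' \<in> ?B" for l'
    using raise_sum_transfer[OF \<tau>(1,3) h(1) that, of f] h(2)[OF mon_of_box[OF that q]] that
    by (simp add: f_def raised_def)
  have lB: "l \<in> ?B" using exps_box l by simp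
  have ml: "mon_of l = \<mu>" using l by (simp add: mon_of_exps boxm_def)
  show "l \<in> leads ?w ?B (?r ` F ?as)"
    unfolding leads_def
  proof (intro CollectI conjI bexI[of _ "?r f"] ballI impI)
    show "?r f l \<noteq> 0" using eq[OF lB] \<tau>(4) ml by simp
    show "?r f l' = 0" if "l' \<in> ?B" "?w l' < ?w l" for l'
      using eq[OF that(1)] low[OF mon_of_box[OF that(1) q]] that(2) ml \<tau>(3) by simp
  qed (use lB fF in auto)
qed

lemma quad_ideal_count:
  assumes "p > 2" "odd q"
  shows "real (card (boxm q) - card (initials (boxm q) (quad_ideal q))) = block_count.quadric_count blocks d q"
proof -
  have q: "q > 0" using assms by (intro gr0I) auto
  note bij = bij_exps[OF q]
  have "inj_on (\<lambda>l. nm (mon_of l)) (box (replicate (Suc d) q))"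
    by (rule inj_onI) (metis monomial_norm_inj exps_mon_of box_length length_replicate)
  from quadric_count_eq_card[OF assms this] show ?thesis
    unfolding leads_eq_initials[OF q] bij_betw_same_card[OF bij, symmetric]
    using card_image[OF inj_on_subset[OF bij_betw_imp_inj_on[OF bij]], of "initials (boxm q) (quad_ideal q)"]
    by (auto simp: initials_def)
qed

end

section \<open>Dickson's lemma\<close>

text \<open>A nonincreasing sequence of naturals is constant from the place where it attains its
  minimum, so either kind of monotone subsequence yields a nondecreasing one.\<close>

lemma mono_subseq_nat:
  fixes s :: "nat \<Rightarrow> nat"
  shows "\<exists>r :: nat \<Rightarrow> nat. strict_mono r \<and> mono (\<lambda>n. s (r n))"
proof -
  obtain r :: "nat \<Rightarrow> nat" where r: "strict_mono r" "monoseq (\<lambda>n. s (r n))" using seq_monosub by blast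
  show ?thesis
  proof (cases "mono (\<lambda>n. s (r n))")
    case False
    then have dec: "decseq (\<lambda>n. s (r n))" using r(2) by (auto simp: monoseq_iff incseq_def mono_def)
    obtain k where k: "\<And>n. s (r k) \<le> s (r n)"
      using ex_has_least_nat[of "\<lambda>_. True" 0 "\<lambda>n. s (r n)"] by auto
    have "s (r (k + n)) = s (r k)" for n
      using k[of "k + n"] decseqD[OF dec, of k "k + n"] by simp
    then have "mono (\<lambda>n. s (r (k + n)))" by (simp add: mono_def)
    moreover have "strict_mono (\<lambda>n. r (k + n))" using r(1) by (auto simp: strict_mono_def)
    ultimately show ?thesis by blast
  qed (use r in blast)
qed

lemma mono_subseq_counts:
  fixes f :: "nat \<Rightarrow> 'x multiset"
  assumes "finite V"
  shows "\<exists>r :: nat \<Rightarrow> nat. strict_mono r \<and> (\<forall>i\<in>V. mono (\<lambda>n. count (f (r n)) i))"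
  using assms
proof (induction V)
  case empty
  then show ?case by (intro exI[of _ id]) (auto simp: strict_mono_def)
next
  case (insert x V)
  then obtain r :: "nat \<Rightarrow> nat" where r: "strict_mono r" "\<forall>i\<in>V. mono (\<lambda>n. count (f (r n)) i)" by blast
  obtain r' :: "nat \<Rightarrow> nat" where r': "strict_mono r'" "mono (\<lambda>n. count (f (r (r' n))) x)"
    using mono_subseq_nat[of "\<lambda>n. count (f (r n)) x"] by blast
  have "mono (\<lambda>n. count (f (r (r' n))) i)" if "i \<in> V" for i
    using r(2) r'(1) that by (simp add: mono_def strict_mono_less_eq)
  moreover have "strict_mono (\<lambda>n. r (r' n))" using r(1) r'(1) by (simp add: strict_mono_def)
  ultimately show ?case using r'(2) by (intro exI[of _ "\<lambda>n. r (r' n)"]) auto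
qed

text \<open>The minimal elements under divisibility serve. Infinitely many of them would contain a
  sequence with all exponents nondecreasing, and hence two distinct comparable minimal
  elements.\<close>

lemma dickson:
  fixes L :: "'x multiset set"
  assumes "finite V" "\<And>m. m \<in> L \<Longrightarrow> set_mset m \<subseteq> V"
  shows "\<exists>L0\<subseteq>L. finite L0 \<and> (\<forall>m\<in>L. \<exists>m0\<in>L0. m0 \<subseteq># m)"
proof -
  define L0 where "L0 = {m\<in>L. \<forall>m'\<in>L. m' \<subseteq># m \<longrightarrow> m' = m}"
  have "\<exists>m0\<in>L0. m0 \<subseteq># m" if "m \<in> L" for m
    using that
  proof (induction "size m" arbitrary: m rule: less_induct)
    case less
    show ?case
    proof (cases "m \<in> L0")
      case False
      then obtain m' where m': "m' \<in> L" "m' \<subseteq># m" "m' \<noteq> m" using less.prems by (auto simp: L0_def)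
      then have "size m' < size m" by (simp add: mset_subset_size subset_mset.le_neq_trans)
      then show ?thesis using less.hyps[of m'] m' subset_mset.order_trans by blast
    qed auto
  qed
  moreover have "finite L0"
  proof (rule ccontr)
    assume "infinite L0"
    then obtain f :: "nat \<Rightarrow> 'x multiset" where f: "inj f" "range f \<subseteq> L0"
      using infinite_countable_subset by blast
    obtain r :: "nat \<Rightarrow> nat" where r: "strict_mono r" "\<forall>i\<in>V. mono (\<lambda>n. count (f (r n)) i)"
      using mono_subseq_counts[OF assms(1)] by blast
    have L: "f n \<in> L" for n using f(2) by (auto simp: L0_def)
    have "count (f (r 0)) i \<le> count (f (r 1)) i" for i
    proof (cases "i \<in> V")
      case True
      then show ?thesis using r(2) by (auto simp: mono_def)
    next
      case False
      then have "i \<notin># f (r 0)" using assms(2)[OF L] by blast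
      then show ?thesis by (simp add: not_in_iff)
    qed
    then have "f (r 0) \<subseteq># f (r 1)" by (simp add: subseteq_mset_def)
    then have "f (r 0) = f (r 1)" using f(2) L by (auto simp: L0_def)
    then have "r 0 = r 1" using f(1) by (simp add: inj_eq)
    then show False using r(1) strict_mono_eq by fastforce
  qed
  ultimately show ?thesis by (intro exI[of _ L0]) (auto simp: L0_def)
qed

section \<open>Avoiding a multiplicative set\<close>

context cring
begin

text \<open>For ideals \<open>I\<close> and \<open>J\<close>, the ideal x I + J.\<close>

definition comb where
  "comb x I J = {v \<in> carrier R. \<exists>a\<in>I. v \<ominus> x \<otimes> a \<in> J}"

lemma ideal_comb:
  assumes I: "ideal I R" and J: "ideal J R" and x: "x \<in> carrier R"
  shows "ideal (comb x I J) R" (is "ideal ?H R")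
proof -
  have H: "?H = {v \<in> carrier R. \<exists>a\<in>I. v \<ominus> x \<otimes> a \<in> J}" by (rule comb_def)
  interpret I: ideal I R by fact
  interpret J: ideal J R by fact
  have IS: "a \<in> carrier R" if "a \<in> I" for a using that I.a_subset by blast
  have mult: "h \<otimes> v \<in> ?H" if v: "v \<in> ?H" and h: "h \<in> carrier R" for v h
  proof -
    obtain a where a: "v \<in> carrier R" "a \<in> I" "v \<ominus> x \<otimes> a \<in> J" using v unfolding H by blast
    have "h \<otimes> v \<ominus> x \<otimes> (h \<otimes> a) = h \<otimes> (v \<ominus> x \<otimes> a)"
      using a h x IS[OF a(2)] by (simp add: minus_eq r_distr r_minus m_lcomm)
    then show ?thesis using a h J.I_l_closed[OF a(3) h] I.I_l_closed[OF a(2) h] by (auto simp: H intro!: bexI[of _ "h \<otimes> a"])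
  qed
  show ?thesis
  proof (rule idealI)
    show "subgroup ?H (add_monoid R)"
    proof (rule add.subgroupI)
      have "\<zero> \<in> ?H" using x I.zero_closed J.zero_closed by (auto simp: H minus_eq intro!: bexI[of _ "\<zero>"])
      then show "?H \<noteq> {}" by blast
      fix v assume "v \<in> ?H"
      then obtain a where a: "v \<in> carrier R" "a \<in> I" "v \<ominus> x \<otimes> a \<in> J" unfolding H by blast
      have "\<ominus> v \<ominus> x \<otimes> (\<ominus> a) = \<ominus> (v \<ominus> x \<otimes> a)"
        using a x IS[OF a(2)] by (simp add: minus_eq r_minus minus_add)
      then show "\<ominus> v \<in> ?H" using a J.a_inv_closed[OF a(3)] I.a_inv_closed[OF a(2)] by (auto simp: H intro!: bexI[of _ "\<ominus> a"])
      fix w assume "w \<in> ?H"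
      then obtain b where b: "w \<in> carrier R" "b \<in> I" "w \<ominus> x \<otimes> b \<in> J" unfolding H by blast
      have "(v \<oplus> w) \<ominus> x \<otimes> (a \<oplus> b) = (v \<ominus> x \<otimes> a) \<oplus> (w \<ominus> x \<otimes> b)"
        using a b x IS[OF a(2)] IS[OF b(2)] by (simp add: minus_eq r_distr minus_add a_ac)
      then show "v \<oplus> w \<in> ?H"
        using a b J.a_closed[OF a(3) b(3)] I.a_closed[OF a(2) b(2)] by (auto simp: H intro!: bexI[of _ "a \<oplus> b"])
    qed (auto simp: H)
    show "h \<otimes> v \<in> ?H" if "v \<in> ?H" "h \<in> carrier R" for v h using mult that by blast
    show "v \<otimes> h \<in> ?H" if "v \<in> ?H" "h \<in> carrier R" for v h
      using mult[OF that] that m_comm[of v h] by (simp add: H)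
  qed (rule ring_axioms)
qed

text \<open>Krull's argument: an ideal maximal among those that contain \<open>I\<close> and avoid
  \<open>T\<close> is prime.\<close>

lemma exists_prime_disjoint:
  assumes I: "ideal I R" and T1: "\<one> \<in> T"
    and T: "\<And>s t. s \<in> T \<Longrightarrow> t \<in> T \<Longrightarrow> s \<otimes> t \<in> T" and IT: "I \<inter> T = {}"
  shows "\<exists>P. primeideal P R \<and> I \<subseteq> P \<and> P \<inter> T = {}"
proof -
  define \<A> where "\<A> = {J. ideal J R \<and> I \<subseteq> J \<and> J \<inter> T = {}}"
  have "\<exists>M\<in>\<A>. \<forall>Z\<in>\<A>. M \<subseteq> Z \<longrightarrow> Z = M"
  proof (rule subset_Zorn_nonempty)
    show "\<A> \<noteq> {}" using I IT by (auto simp: \<A>_def)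
    fix \<C> assume \<C>: "\<C> \<noteq> {}" "subset.chain \<A> \<C>"
    then have "subset.chain {J. ideal J R} \<C>" by (auto simp: subset_chain_def \<A>_def)
    then have "ideal (\<Union>\<C>) R" using chain_Union_is_ideal[of \<C>] \<C>(1) by simp
    moreover obtain J where "J \<in> \<C>" using \<C>(1) by blast
    then have "I \<subseteq> \<Union>\<C>" using \<C>(2) by (auto simp: subset_chain_def \<A>_def)
    moreover have "\<Union>\<C> \<inter> T = {}"
      using \<C>(2) by (auto simp: subset_chain_def \<A>_def)
    ultimately show "\<Union>\<C> \<in> \<A>" by (simp add: \<A>_def)
  qed
  then obtain M where MA: "M \<in> \<A>" and mx: "\<forall>Z\<in>\<A>. M \<subseteq> Z \<longrightarrow> Z = M" by (elim bexE)
  have M: "ideal M R" "I \<subseteq> M" "M \<inter> T = {}" using MA by (simp_all add: \<A>_def)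
  have max: "Z = M" if "ideal Z R" "I \<subseteq> Z" "Z \<inter> T = {}" "M \<subseteq> Z" for Z
    using mx that by (simp add: \<A>_def)
  interpret M: ideal M R by fact
  have meet: "\<exists>t\<in>T. \<exists>r\<in>carrier R. t \<in> carrier R \<and> t \<ominus> a \<otimes> r \<in> M" if a: "a \<in> carrier R" "a \<notin> M" for a
  proof -
    let ?J = "comb a (carrier R) M"
    have J: "ideal ?J R" using a by (intro ideal_comb oneideal M.ideal_axioms)
    have MJ: "M \<subseteq> ?J"
    proof
      fix v assume v: "v \<in> M"
      then have "v \<in> carrier R" using M.a_subset by blast
      then show "v \<in> ?J" using v a unfolding comb_def by (auto simp: minus_eq intro!: bexI[of _ "\<zero>"])
    qed
    have "a \<in> ?J" using a M.zero_closed unfolding comb_def by (auto simp: minus_eq r_neg intro!: bexI[of _ "\<one>"])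
    then have "?J \<inter> T \<noteq> {}" using max[OF J] M(2) MJ a(2) by blast
    then show ?thesis unfolding comb_def by blast
  qed
  have "primeideal M R"
  proof (rule primeidealI[OF M(1) is_cring])
    show "carrier R \<noteq> M" using M(3) T1 one_closed by blast
    fix a b assume ab: "a \<in> carrier R" "b \<in> carrier R" "a \<otimes> b \<in> M"
    show "a \<in> M \<or> b \<in> M"
    proof (rule ccontr)
      assume n: "\<not> (a \<in> M \<or> b \<in> M)"
      obtain s r where s: "s \<in> T" "r \<in> carrier R" "s \<in> carrier R" "s \<ominus> a \<otimes> r \<in> M"
        using meet ab n by blast
      obtain t q where t: "t \<in> T" "q \<in> carrier R" "t \<in> carrier R" "t \<ominus> b \<otimes> q \<in> M"
        using meet ab n by blast
      \<comment> \<open>With s congruent to a r and t to b q modulo \<open>M\<close>, the product s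
        t is written so that every summand has a factor in \<open>M\<close>; as it also lies in
        \<open>T\<close>, this is absurd.\<close>
      have e: "s \<otimes> t = t \<otimes> (s \<ominus> a \<otimes> r) \<oplus> (a \<otimes> r) \<otimes> (t \<ominus> b \<otimes> q) \<oplus> (r \<otimes> q) \<otimes> (a \<otimes> b)"
        using s(2,3) t(2,3) ab(1,2)
        by (simp add: minus_eq r_distr r_minus m_ac a_assoc r_neg1 r_neg2 l_neg)
      have "s \<otimes> t \<in> M" unfolding e
        using M.I_l_closed[OF s(4) t(3)] M.I_l_closed[OF t(4), of "a \<otimes> r"]
          M.I_l_closed[OF ab(3), of "r \<otimes> q"] s(2) t(2) ab(1) by (intro M.a_closed) auto
      then show False using T[OF s(1) t(1)] M(3) by blast
    qed
  qed
  then show ?thesis using M(2,3) by blast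
qed

end

section \<open>Division and the Artin--Rees lemma\<close>

context quadric_series
begin

lemma coeff_mult_below:
  assumes g: "g \<in> carrier S" and "\<nu> \<subseteq># m" "nm m < nm \<nu> * nm (lead g)"
  shows "g (m - \<nu>) = \<zero>"
proof -
  have "nm m = nm \<nu> * nm (m - \<nu>)" using assms(2) by (metis monomial_norm_add subset_mset.add_diff_inverse)
  then have "nm (m - \<nu>) < nm (lead g)" using assms(3) by simp
  then show ?thesis by (rule below_lead)
qed

text \<open>Division by a standard basis: the term of norm \<open>t\<close> is removed at stage \<open>t\<close>, so the quotients
  converge coefficientwise.\<close>

lemma division:
  assumes Y: "ideal Y S" and \<Gamma>: "finite \<Gamma>" "\<Gamma> \<subseteq> Y"
    and std: "\<And>u. u \<in> Y \<Longrightarrow> u \<noteq> \<zero>\<^bsub>S\<^esub> \<Longrightarrow> \<exists>g\<in>\<Gamma>. g \<noteq> \<zero>\<^bsub>S\<^esub> \<and> lead g \<subseteq># lead u"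
    and u: "u \<in> Y" and uN: "\<And>m. nm m < N \<Longrightarrow> u m = \<zero>"
  shows "\<exists>h. (\<forall>g\<in>\<Gamma>. h g \<in> carrier S \<and> (\<forall>m. nm m * nm (lead g) < N \<longrightarrow> h g m = \<zero>)) \<and>
    u = (\<Oplus>\<^bsub>S\<^esub>g\<in>\<Gamma>. h g \<otimes>\<^bsub>S\<^esub> g)"
proof -
  interpret Y: ideal Y S by fact
  have YS: "x \<in> carrier S" if "x \<in> Y" for x using that Y.a_subset by blast
  have \<Gamma>S: "g \<in> carrier S" if "g \<in> \<Gamma>" for g using that \<Gamma>(2) YS by blast
  \<comment> \<open>Every leading monomial of \<open>Y\<close> is charged to one chosen divisor.
    \<open>\<Delta> U t g\<close> is the quotient term by which \<open>g\<close> cancels the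
    coefficient of norm \<open>t\<close> in \<open>U\<close>, and the remainder after
    \<open>t\<close> stages is the later \<open>U t\<close>.\<close>
  define sel where "sel \<mu> = (SOME g. g \<in> \<Gamma> \<and> g \<noteq> \<zero>\<^bsub>S\<^esub> \<and> lead g \<subseteq># \<mu>)" for \<mu>
  define \<Delta> where "\<Delta> U t g = (\<lambda>\<nu>. if \<nu> \<in> monomials \<and> nm (\<nu> + lead g) = t \<and> sel (\<nu> + lead g) = g \<and> g \<noteq> \<zero>\<^bsub>S\<^esub>
     then U (\<nu> + lead g) \<otimes> inv (g (lead g)) else \<zero>)" for U t g
  define U where "U = rec_nat u (\<lambda>t U. U \<ominus>\<^bsub>S\<^esub> (\<Oplus>\<^bsub>S\<^esub>g\<in>\<Gamma>. \<Delta> U t g \<otimes>\<^bsub>S\<^esub> g))"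
  have U0: "U 0 = u" and USuc: "U (Suc t) = U t \<ominus>\<^bsub>S\<^esub> (\<Oplus>\<^bsub>S\<^esub>g\<in>\<Gamma>. \<Delta> (U t) t g \<otimes>\<^bsub>S\<^esub> g)" for t
    by (simp_all add: U_def)
  have unit: "g (lead g) \<in> Units R" if "g \<in> \<Gamma>" "g \<noteq> \<zero>\<^bsub>S\<^esub>" for g
    using lead_nonzero[OF \<Gamma>S that(2)] that \<Gamma>S by (simp add: field_Units)
  have \<Delta>S: "\<Delta> V t g \<in> carrier S" if "V \<in> carrier S" "g \<in> \<Gamma>" for V t g
    using that unit by (auto simp: \<Delta>_def S_carrier)
  have sumY: "(\<Oplus>\<^bsub>S\<^esub>g\<in>G. h g \<otimes>\<^bsub>S\<^esub> g) \<in> Y" if "G \<subseteq> \<Gamma>" "\<And>g. g \<in> \<Gamma> \<Longrightarrow> h g \<in> carrier S" for G h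
    using finite_subset[OF that(1) \<Gamma>(1)] that
  proof (induction G)
    case (insert g G)
    have "h g \<otimes>\<^bsub>S\<^esub> g \<in> Y" using insert.prems \<Gamma>(2) by (intro Y.I_l_closed) auto
    moreover have "(\<Oplus>\<^bsub>S\<^esub>g\<in>insert g G. h g \<otimes>\<^bsub>S\<^esub> g) = h g \<otimes>\<^bsub>S\<^esub> g \<oplus>\<^bsub>S\<^esub> (\<Oplus>\<^bsub>S\<^esub>g\<in>G. h g \<otimes>\<^bsub>S\<^esub> g)"
      using insert \<Gamma>S by (intro S.finsum_insert) auto
    ultimately show ?case using insert by (simp add: Y.a_closed)
  qed (simp add: Y.zero_closed)
  have UY: "U t \<in> Y" for t
  proof (induction t)
    case (Suc t)
    have "(\<Oplus>\<^bsub>S\<^esub>g\<in>\<Gamma>. \<Delta> (U t) t g \<otimes>\<^bsub>S\<^esub> g) \<in> Y" using \<Delta>S[OF YS[OF Suc]] by (intro sumY) auto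
    then show ?case unfolding USuc S.minus_eq using Suc by (intro Y.a_closed Y.a_inv_closed)
  qed (simp add: U0 u)
  have US: "U t \<in> carrier S" for t using YS[OF UY] .
  have \<Delta>low: "(\<Delta> (U t) t g \<otimes>\<^bsub>S\<^esub> g) m = \<zero>" if m: "nm m < t" and g: "g \<in> \<Gamma>" for t g m
  proof -
    have "\<Delta> (U t) t g \<nu> \<otimes> g (m - \<nu>) = \<zero>" if \<nu>: "\<nu> \<subseteq># m" for \<nu>
    proof (cases "nm (\<nu> + lead g) = t")
      case True
      then have "g (m - \<nu>) = \<zero>" using m by (intro coeff_mult_below[OF \<Gamma>S[OF g] \<nu>]) (simp add: monomial_norm_add)
      then show ?thesis using \<Delta>S[OF US g] by simp
    next
      case False
      then show ?thesis using \<Gamma>S[OF g] by (simp add: \<Delta>_def)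
    qed
    then show ?thesis unfolding S_mult by (intro add.finprod_one_eqI) auto
  qed
  have \<Delta>at: "(\<Delta> (U (nm m)) (nm m) g \<otimes>\<^bsub>S\<^esub> g) m = (if sel m = g then U (nm m) m else \<zero>)"
    if g: "g \<in> \<Gamma>" and m: "U (nm m) m \<noteq> \<zero> \<Longrightarrow> sel m \<noteq> \<zero>\<^bsub>S\<^esub> \<and> lead (sel m) \<subseteq># m" for g m
  proof -
    let ?t = "nm m"
    let ?D = "\<Delta> (U ?t) ?t g"
    have eq: "?D \<nu> \<otimes> g (m - \<nu>) = \<zero>" if \<nu>: "\<nu> \<subseteq># m" "m \<noteq> \<nu> + lead g" for \<nu>
    proof (cases "nm (\<nu> + lead g) = ?t")
      case True
      then show ?thesis using \<nu>(2) monomial_norm_inj by metis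
    next
      case False
      then show ?thesis using \<Gamma>S[OF g] by (simp add: \<Delta>_def)
    qed
    show ?thesis
    proof (cases "lead g \<subseteq># m \<and> sel m = g \<and> g \<noteq> \<zero>\<^bsub>S\<^esub> \<and> m \<in> monomials")
      case True
      then have m': "m - lead g + lead g = m" by (simp add: subset_mset.diff_add)
      have ne: "m \<noteq> \<nu> + lead g" if "m - lead g \<noteq> \<nu>" for \<nu> using that by auto
      have "(?D \<otimes>\<^bsub>S\<^esub> g) m = (\<Oplus>\<nu>\<in>{\<nu>. \<nu> \<subseteq># m}. if m - lead g = \<nu> then ?D \<nu> \<otimes> g (m - \<nu>) else \<zero>)"
        unfolding S_mult using \<Delta>S[OF US g] \<Gamma>S[OF g] eq ne by (intro finsum_cong') auto
      also have "\<dots> = ?D (m - lead g) \<otimes> g (m - (m - lead g))"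
        using \<Delta>S[OF US g] \<Gamma>S[OF g] by (intro finsum_singleton) auto
      also have "\<dots> = U ?t m \<otimes> inv (g (lead g)) \<otimes> g (lead g)"
        using True m' by (simp add: \<Delta>_def mset_double_diff monomials_diff)
      also have "\<dots> = U ?t m" using unit[OF g] True S_coeff[OF US, of ?t m] S_coeff[OF \<Gamma>S[OF g]] by (simp add: m_assoc Units_inv_closed)
      finally show ?thesis using True by simp
    next
      case False
      have "?D \<nu> = \<zero>" if "m = \<nu> + lead g" for \<nu>
        using False that US[of ?t] unit[OF g] by (auto simp: \<Delta>_def S_carrier)
      then have "?D \<nu> \<otimes> g (m - \<nu>) = \<zero>" if "\<nu> \<subseteq># m" for \<nu>
        using eq[OF that] \<Gamma>S[OF g] by (cases "m = \<nu> + lead g") auto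
      then have "(?D \<otimes>\<^bsub>S\<^esub> g) m = \<zero>" unfolding S_mult by (intro add.finprod_one_eqI) auto
      moreover have "(if sel m = g then U ?t m else \<zero>) = \<zero>"
        using False m US[of ?t] by (auto simp: S_carrier)
      ultimately show ?thesis by simp
    qed
  qed
  have sumc: "(\<Oplus>\<^bsub>S\<^esub>g\<in>\<Gamma>. h g \<otimes>\<^bsub>S\<^esub> g) m = (\<Oplus>g\<in>\<Gamma>. (h g \<otimes>\<^bsub>S\<^esub> g) m)"
    if "\<And>g. g \<in> \<Gamma> \<Longrightarrow> h g \<in> carrier S" for h m
    using that \<Gamma>S by (intro S_finsum) auto
  have Ulow: "nm m < t \<Longrightarrow> U t m = \<zero>" for t m
  proof (induction t arbitrary: m)
    case (Suc t)
    have D: "\<Delta> (U t) t g \<in> carrier S" if "g \<in> \<Gamma>" for g using \<Delta>S[OF US that] .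
    have Um: "U (Suc t) m = U t m \<ominus> (\<Oplus>g\<in>\<Gamma>. (\<Delta> (U t) t g \<otimes>\<^bsub>S\<^esub> g) m)"
      unfolding USuc using S_diff[OF US] sumc[of "\<Delta> (U t) t", OF D] D \<Gamma>S by (simp add: S.finsum_closed Pi_def)
    show ?case
    proof (cases "nm m < t")
      case True
      then have "(\<Oplus>g\<in>\<Gamma>. (\<Delta> (U t) t g \<otimes>\<^bsub>S\<^esub> g) m) = \<zero>"
        by (intro add.finprod_one_eqI) (rule \<Delta>low)
      then show ?thesis using Suc.IH[OF True] Um by (simp add: minus_eq)
    next
      case False
      then have t: "t = nm m" using Suc.prems by simp
      have sel: "sel m \<in> \<Gamma> \<and> sel m \<noteq> \<zero>\<^bsub>S\<^esub> \<and> lead (sel m) \<subseteq># m" if "U t m \<noteq> \<zero>"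
      proof -
        have "lead (U t) = m" using that Suc.IH t by (intro leadI) auto
        moreover have "U t \<noteq> \<zero>\<^bsub>S\<^esub>" using that by (auto simp: S_zero)
        ultimately have "\<exists>g. g \<in> \<Gamma> \<and> g \<noteq> \<zero>\<^bsub>S\<^esub> \<and> lead g \<subseteq># m" using std[OF UY[of t]] by auto
        then show ?thesis unfolding sel_def by (rule someI_ex)
      qed
      have "(\<Oplus>g\<in>\<Gamma>. (\<Delta> (U t) t g \<otimes>\<^bsub>S\<^esub> g) m) = (\<Oplus>g\<in>\<Gamma>. if sel m = g then U t m else \<zero>)"
        using US sel unfolding t by (intro finsum_cong') (auto simp: \<Delta>at)
      also have "\<dots> = U t m"
      proof (cases "U t m = \<zero>")
        case True
        then show ?thesis by (intro trans[OF add.finprod_one_eqI]) auto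
      next
        case False
        then show ?thesis using sel US \<Gamma>(1) by (intro finsum_singleton) auto
      qed
      finally show ?thesis unfolding Um using US by (simp add: minus_eq r_neg)
    qed
  qed simp
  \<comment> \<open>The coefficient of a quotient at \<open>\<nu>\<close> is settled at the single
    stage given by the norm of \<open>\<nu> + lead g\<close>, so the limit is formed without
    convergence arguments; \<open>T t\<close> collects the stages before \<open>t\<close>.\<close>
  define h where "h g = (\<lambda>\<nu>. \<Delta> (U (nm (\<nu> + lead g))) (nm (\<nu> + lead g)) g \<nu>)" for g
  have hS: "h g \<in> carrier S" if "g \<in> \<Gamma>" for g
    using \<Delta>S[OF US that] unfolding h_def S_carrier by blast
  define T where "T t g = (\<lambda>\<nu>. if nm (\<nu> + lead g) < t then h g \<nu> else \<zero>)" for t g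
  have TS: "T t g \<in> carrier S" if "g \<in> \<Gamma>" for t g
    using hS[OF that] by (auto simp: T_def S_carrier)
  have TSuc: "T (Suc t) g = T t g \<oplus>\<^bsub>S\<^esub> \<Delta> (U t) t g" if "g \<in> \<Gamma>" for t g
  proof
    fix \<nu>
    have "\<Delta> (U t) t g \<nu> = \<zero>" if "nm (\<nu> + lead g) \<noteq> t" using that by (simp add: \<Delta>_def)
    then show "T (Suc t) g \<nu> = (T t g \<oplus>\<^bsub>S\<^esub> \<Delta> (U t) t g) \<nu>"
      using hS[OF \<open>g \<in> \<Gamma>\<close>] \<Delta>S[OF US \<open>g \<in> \<Gamma>\<close>]
      by (cases "nm (\<nu> + lead g) = t") (auto simp: T_def S_add h_def less_Suc_eq)
  qed
  have inv: "u = U t \<oplus>\<^bsub>S\<^esub> (\<Oplus>\<^bsub>S\<^esub>g\<in>\<Gamma>. T t g \<otimes>\<^bsub>S\<^esub> g)" for t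
  proof (induction t)
    case 0
    have "(\<Oplus>\<^bsub>S\<^esub>g\<in>\<Gamma>. T 0 g \<otimes>\<^bsub>S\<^esub> g) = \<zero>\<^bsub>S\<^esub>"
    proof (intro S.add.finprod_one_eqI)
      fix g assume g: "g \<in> \<Gamma>"
      have "T 0 g = \<zero>\<^bsub>S\<^esub>" by (auto simp: T_def S_zero fun_eq_iff)
      then show "T 0 g \<otimes>\<^bsub>S\<^esub> g = \<zero>\<^bsub>S\<^esub>" using \<Gamma>S[OF g] by simp
    qed
    then show ?case using US[of 0] by (simp add: U0)
  next
    case (Suc t)
    have D: "\<Delta> (U t) t g \<in> carrier S" if "g \<in> \<Gamma>" for g using \<Delta>S[OF US that] .
    have "(\<Oplus>\<^bsub>S\<^esub>g\<in>\<Gamma>. T (Suc t) g \<otimes>\<^bsub>S\<^esub> g) = (\<Oplus>\<^bsub>S\<^esub>g\<in>\<Gamma>. T t g \<otimes>\<^bsub>S\<^esub> g \<oplus>\<^bsub>S\<^esub> \<Delta> (U t) t g \<otimes>\<^bsub>S\<^esub> g)"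
      using TS D \<Gamma>S by (intro S.finsum_cong') (auto simp: TSuc S.l_distr)
    also have "\<dots> = (\<Oplus>\<^bsub>S\<^esub>g\<in>\<Gamma>. T t g \<otimes>\<^bsub>S\<^esub> g) \<oplus>\<^bsub>S\<^esub> (\<Oplus>\<^bsub>S\<^esub>g\<in>\<Gamma>. \<Delta> (U t) t g \<otimes>\<^bsub>S\<^esub> g)"
      using TS D \<Gamma>S by (intro S.finsum_addf) auto
    finally have e: "(\<Oplus>\<^bsub>S\<^esub>g\<in>\<Gamma>. T (Suc t) g \<otimes>\<^bsub>S\<^esub> g) =
      (\<Oplus>\<^bsub>S\<^esub>g\<in>\<Gamma>. T t g \<otimes>\<^bsub>S\<^esub> g) \<oplus>\<^bsub>S\<^esub> (\<Oplus>\<^bsub>S\<^esub>g\<in>\<Gamma>. \<Delta> (U t) t g \<otimes>\<^bsub>S\<^esub> g)" .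
    have c: "(\<Oplus>\<^bsub>S\<^esub>g\<in>\<Gamma>. T t g \<otimes>\<^bsub>S\<^esub> g) \<in> carrier S" "(\<Oplus>\<^bsub>S\<^esub>g\<in>\<Gamma>. \<Delta> (U t) t g \<otimes>\<^bsub>S\<^esub> g) \<in> carrier S"
      using TS D \<Gamma>S by (auto intro!: S.finsum_closed)
    have "x = (x \<ominus>\<^bsub>S\<^esub> z) \<oplus>\<^bsub>S\<^esub> z" if "x \<in> carrier S" "z \<in> carrier S" for x z
      using that by (simp add: S.minus_eq S.a_assoc S.l_neg)
    then have "U t = U (Suc t) \<oplus>\<^bsub>S\<^esub> (\<Oplus>\<^bsub>S\<^esub>g\<in>\<Gamma>. \<Delta> (U t) t g \<otimes>\<^bsub>S\<^esub> g)"
      unfolding USuc using US c(2) by blast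
    then have "u = U (Suc t) \<oplus>\<^bsub>S\<^esub> (\<Oplus>\<^bsub>S\<^esub>g\<in>\<Gamma>. \<Delta> (U t) t g \<otimes>\<^bsub>S\<^esub> g) \<oplus>\<^bsub>S\<^esub> (\<Oplus>\<^bsub>S\<^esub>g\<in>\<Gamma>. T t g \<otimes>\<^bsub>S\<^esub> g)"
      using Suc by simp
    then show ?case unfolding e using US[of "Suc t"] c by (simp add: S.a_ac)
  qed
  have "u = (\<Oplus>\<^bsub>S\<^esub>g\<in>\<Gamma>. h g \<otimes>\<^bsub>S\<^esub> g)"
  proof
    fix m
    let ?t = "Suc (nm m)"
    have "u m = (\<Oplus>g\<in>\<Gamma>. (T ?t g \<otimes>\<^bsub>S\<^esub> g) m)"
    proof -
      have "u m = U ?t m \<oplus> (\<Oplus>\<^bsub>S\<^esub>g\<in>\<Gamma>. T ?t g \<otimes>\<^bsub>S\<^esub> g) m"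
        by (subst inv[of ?t]) (simp add: S_add)
      then show ?thesis using Ulow[of m ?t] sumc[of "T ?t", OF TS] TS \<Gamma>S
        by (simp add: finsum_closed Pi_def)
    qed
    also have "\<dots> = (\<Oplus>g\<in>\<Gamma>. (h g \<otimes>\<^bsub>S\<^esub> g) m)"
    proof (intro finsum_cong')
      fix g assume g: "g \<in> \<Gamma>"
      have "T ?t g \<nu> \<otimes> g (m - \<nu>) = h g \<nu> \<otimes> g (m - \<nu>)" if \<nu>: "\<nu> \<subseteq># m" for \<nu>
      proof (cases "nm (\<nu> + lead g) < ?t")
        case False
        then have "g (m - \<nu>) = \<zero>" by (intro coeff_mult_below[OF \<Gamma>S[OF g] \<nu>]) (simp add: monomial_norm_add)
        then show ?thesis using hS[OF g] TS[OF g] by simp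
      qed (simp add: T_def)
      then show "(T ?t g \<otimes>\<^bsub>S\<^esub> g) m = (h g \<otimes>\<^bsub>S\<^esub> g) m"
        unfolding S_mult using hS[OF g] \<Gamma>S[OF g] by (intro finsum_cong') auto
    qed (use hS \<Gamma>S in auto)
    also have "\<dots> = (\<Oplus>\<^bsub>S\<^esub>g\<in>\<Gamma>. h g \<otimes>\<^bsub>S\<^esub> g) m" using sumc[of h, OF hS] by simp
    finally show "u m = (\<Oplus>\<^bsub>S\<^esub>g\<in>\<Gamma>. h g \<otimes>\<^bsub>S\<^esub> g) m" .
  qed
  moreover have "h g m = \<zero>" if g: "g \<in> \<Gamma>" and m: "nm m * nm (lead g) < N" for g m
  proof -
    \<comment> \<open>The remainders keep vanishing below \<open>N\<close>, so the quotients inherit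
      an order bound, up to the norm of the lead. This is the quantitative part that the Artin-Rees
      lemma exploits.\<close>
    have UN: "nm x < N \<Longrightarrow> U t x = \<zero>" for t x
    proof (induction t arbitrary: x)
      case (Suc t)
      have D: "\<Delta> (U t) t g \<in> carrier S" if "g \<in> \<Gamma>" for g using \<Delta>S[OF US that] .
      have "(\<Delta> (U t) t g \<otimes>\<^bsub>S\<^esub> g) x = \<zero>" if g: "g \<in> \<Gamma>" for g
      proof -
        have "\<Delta> (U t) t g \<nu> \<otimes> g (x - \<nu>) = \<zero>" if \<nu>: "\<nu> \<subseteq># x" for \<nu>
        proof (cases "nm (\<nu> + lead g) < N")
          case True
          then have "\<Delta> (U t) t g \<nu> = \<zero>"
            using Suc.IH unit[OF g] by (auto simp: \<Delta>_def)
          then show ?thesis using \<Gamma>S[OF g] by simp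
        next
          case False
          then have "g (x - \<nu>) = \<zero>" using Suc.prems
            by (intro coeff_mult_below[OF \<Gamma>S[OF g] \<nu>]) (simp add: monomial_norm_add)
          then show ?thesis using D[OF g] by simp
        qed
        then show ?thesis unfolding S_mult by (intro add.finprod_one_eqI) auto
      qed
      then have "(\<Oplus>g\<in>\<Gamma>. (\<Delta> (U t) t g \<otimes>\<^bsub>S\<^esub> g) x) = \<zero>" by (intro add.finprod_one_eqI)
      moreover have "U (Suc t) x = U t x \<ominus> (\<Oplus>g\<in>\<Gamma>. (\<Delta> (U t) t g \<otimes>\<^bsub>S\<^esub> g) x)"
        unfolding USuc using S_diff[OF US] sumc[of "\<Delta> (U t) t", OF D] D \<Gamma>S by (simp add: S.finsum_closed Pi_def)
      ultimately show ?case using Suc.IH[OF Suc.prems] by (simp add: minus_eq)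
    qed (simp add: U0 uN)
    have "U (nm (m + lead g)) (m + lead g) = \<zero>" by (rule UN) (use m in \<open>simp add: monomial_norm_add\<close>)
    then show ?thesis using unit[OF g] by (auto simp: h_def \<Delta>_def)
  qed
  ultimately show ?thesis using hS by (intro exI[of _ h]) auto
qed

text \<open>The initial monomial of such a series is empty and divides everything, so division of 1
  by it leaves no remainder.\<close>

lemma unit_of_constant_coeff:
  assumes g: "g \<in> carrier S" and g0: "g {#} \<noteq> \<zero>"
  shows "\<exists>h\<in>carrier S. h \<otimes>\<^bsub>S\<^esub> g = \<one>\<^bsub>S\<^esub>"
proof -
  have lead: "lead g = {#}" by (rule leadI, rule g0) (use monomial_norm_mono[of "{#}"] in \<open>auto simp: not_less[symmetric]\<close>)
  have "g \<noteq> \<zero>\<^bsub>S\<^esub>" using g0 by (auto simp: S_zero)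
  then obtain h where "h g \<in> carrier S" "\<one>\<^bsub>S\<^esub> = (\<Oplus>\<^bsub>S\<^esub>g\<in>{g}. h g \<otimes>\<^bsub>S\<^esub> g)"
    using division[OF S.oneideal, of "{g}" "\<one>\<^bsub>S\<^esub>" 0] g lead by auto
  then show ?thesis using g by (intro bexI[of _ "h g"]) (auto simp: S.finsum_insert)
qed

text \<open>Plays the role of the powers of the maximal ideal. With thresholds 2^N, dividing by a
  leading monomial of norm at most 2^c costs \<open>c\<close> in the index.\<close>

definition filtN :: "nat \<Rightarrow> (nat multiset \<Rightarrow> 'a) set" where
  "filtN N = {f \<in> carrier S. \<forall>m. nm m < 2 ^ N \<longrightarrow> f m = \<zero>}"

lemma filtN_anti: "M \<le> N \<Longrightarrow> filtN N \<subseteq> filtN M"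
proof -
  assume "M \<le> N"
  then have "(2::nat) ^ M \<le> 2 ^ N" by simp
  then show ?thesis unfolding filtN_def using less_le_trans by blast
qed

lemma filtN_mult:
  assumes h: "h \<in> carrier S" and f: "f \<in> filtN N"
  shows "h \<otimes>\<^bsub>S\<^esub> f \<in> filtN N"
proof -
  have fS: "f \<in> carrier S" using f by (simp add: filtN_def)
  have "(h \<otimes>\<^bsub>S\<^esub> f) m = \<zero>" if "nm m < 2 ^ N" for m
  proof -
    have "f (m - u) = \<zero>" for u
      using f monomial_norm_mono[of "m - u" m] that unfolding filtN_def
      by (metis (mono_tags, lifting) diff_subset_eq_self mem_Collect_eq order.strict_trans1)
    then show ?thesis unfolding S_mult using h by (intro add.finprod_one_eqI) auto
  qed
  then show ?thesis using h fS by (simp add: filtN_def)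
qed

lemma filtN_ideal: "ideal (filtN N) S"
proof (rule idealI)
  show "subgroup (filtN N) (add_monoid S)"
    by (rule S.add.subgroupI) (auto simp: filtN_def S_add S_minus S_zero intro!: exI[of _ "\<zero>\<^bsub>S\<^esub>"])
  show "x \<otimes>\<^bsub>S\<^esub> a \<in> filtN N" if "a \<in> filtN N" "x \<in> carrier S" for a x using filtN_mult that by blast
  then show "a \<otimes>\<^bsub>S\<^esub> x \<in> filtN N" if "a \<in> filtN N" "x \<in> carrier S" for a x
    using that S.m_comm[of a x] by (simp add: filtN_def)
qed (rule S.ring_axioms)

text \<open>An element of the ideal y S + P is divided by a finite standard basis, with quotients of
  controlled order. Each basis element is congruent modulo \<open>P\<close> to some y b, and
  collecting the quotients times these b gives \<open>w\<close>.\<close>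

lemma artin_rees:
  assumes P: "ideal P S" and y: "y \<in> carrier S"
  shows "\<exists>c. \<forall>N. \<forall>u\<in>filtN N. (\<exists>a\<in>carrier S. u \<ominus>\<^bsub>S\<^esub> y \<otimes>\<^bsub>S\<^esub> a \<in> P) \<longrightarrow>
    (\<exists>w\<in>filtN (N - c). u \<ominus>\<^bsub>S\<^esub> y \<otimes>\<^bsub>S\<^esub> w \<in> P)"
proof -
  define Y where "Y = S.comb y (carrier S) P"
  have Y: "ideal Y S" unfolding Y_def by (rule S.ideal_comb[OF S.oneideal P y])
  interpret P: ideal P S by fact
  have YS: "v \<in> carrier S" if "v \<in> Y" for v using that by (simp add: Y_def S.comb_def)
  let ?L = "lead ` {u \<in> Y. u \<noteq> \<zero>\<^bsub>S\<^esub>}"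
  have "set_mset m \<subseteq> {..d}" if "m \<in> ?L" for m
    using that lead_in_monomials YS by (auto simp: monomials_def)
  then obtain L0 where L0: "L0 \<subseteq> ?L" "finite L0" "\<forall>m\<in>?L. \<exists>m0\<in>L0. m0 \<subseteq># m"
    using dickson[of "{..d}" ?L] by auto
  obtain \<Gamma> where \<Gamma>: "\<Gamma> \<subseteq> {u \<in> Y. u \<noteq> \<zero>\<^bsub>S\<^esub>}" "finite \<Gamma>" "L0 = lead ` \<Gamma>"
    using finite_subset_image[OF L0(2,1)] by blast
  have std: "\<exists>g\<in>\<Gamma>. g \<noteq> \<zero>\<^bsub>S\<^esub> \<and> lead g \<subseteq># lead u" if "u \<in> Y" "u \<noteq> \<zero>\<^bsub>S\<^esub>" for u
    using L0(3) \<Gamma> that by fastforce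
  have "\<forall>g\<in>\<Gamma>. \<exists>a\<in>carrier S. g \<ominus>\<^bsub>S\<^esub> y \<otimes>\<^bsub>S\<^esub> a \<in> P" using \<Gamma>(1) by (auto simp: Y_def S.comb_def)
  then obtain b where b: "\<And>g. g \<in> \<Gamma> \<Longrightarrow> b g \<in> carrier S" "\<And>g. g \<in> \<Gamma> \<Longrightarrow> g \<ominus>\<^bsub>S\<^esub> y \<otimes>\<^bsub>S\<^esub> b g \<in> P"
    by metis
  \<comment> \<open>\<open>c\<close> bounds the leading norms of the basis, and so the loss of order
    in the quotients, independently of \<open>N\<close>.\<close>
  obtain c where c: "\<And>g. g \<in> \<Gamma> \<Longrightarrow> nm (lead g) \<le> 2 ^ c"
  proof -
    have "nm (lead g) \<le> 2 ^ (\<Sum>g\<in>\<Gamma>. nm (lead g))" if "g \<in> \<Gamma>" for g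
    proof -
      have "nm (lead g) \<le> (\<Sum>g\<in>\<Gamma>. nm (lead g))" using \<Gamma>(2) that by (intro member_le_sum) auto
      then show ?thesis by (meson less_exp less_imp_le order_trans)
    qed
    then show ?thesis using that by blast
  qed
  have "\<exists>w\<in>filtN (N - c). u \<ominus>\<^bsub>S\<^esub> y \<otimes>\<^bsub>S\<^esub> w \<in> P" if u: "u \<in> filtN N" "u \<in> Y" for u N
  proof -
    have "\<Gamma> \<subseteq> Y" using \<Gamma>(1) by blast
    moreover have "\<And>m. nm m < 2 ^ N \<Longrightarrow> u m = \<zero>" using u(1) by (simp add: filtN_def)
    ultimately obtain h where h: "\<And>g. g \<in> \<Gamma> \<Longrightarrow> h g \<in> carrier S"
      "\<And>g m. g \<in> \<Gamma> \<Longrightarrow> nm m * nm (lead g) < 2 ^ N \<Longrightarrow> h g m = \<zero>" "u = (\<Oplus>\<^bsub>S\<^esub>g\<in>\<Gamma>. h g \<otimes>\<^bsub>S\<^esub> g)"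
      using division[OF Y \<Gamma>(2) _ std u(2), of "2 ^ N"] by blast
    have hf: "h g \<in> filtN (N - c)" if g: "g \<in> \<Gamma>" for g
    proof -
      have "h g m = \<zero>" if m: "nm m < 2 ^ (N - c)" for m
      proof (cases "c \<le> N")
        case True
        have "nm m * nm (lead g) < 2 ^ (N - c) * 2 ^ c"
          using m c[OF g] monomial_norm_pos[of m] monomial_norm_pos[of "lead g"] by (intro mult_less_le_imp_less) auto
        also have "(2::nat) ^ (N - c) * 2 ^ c = 2 ^ N" using True by (simp flip: power_add)
        finally show ?thesis using h(2)[OF g] by blast
      next
        \<comment> \<open>Here \<open>N - c = 0\<close>, and no monomial has norm below 1.\<close>
        case False
        then show ?thesis using m monomial_norm_pos[of m] by simp
      qed
      then show ?thesis using h(1)[OF g] by (simp add: filtN_def)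
    qed
    let ?w = "\<Oplus>\<^bsub>S\<^esub>g\<in>\<Gamma>. h g \<otimes>\<^bsub>S\<^esub> b g"
    interpret Fi: ideal "filtN (N - c)" S by (rule filtN_ideal)
    have "G \<subseteq> \<Gamma> \<Longrightarrow> (\<Oplus>\<^bsub>S\<^esub>g\<in>G. h g \<otimes>\<^bsub>S\<^esub> b g) \<in> filtN (N - c) \<and>
       (\<Oplus>\<^bsub>S\<^esub>g\<in>G. h g \<otimes>\<^bsub>S\<^esub> g) \<ominus>\<^bsub>S\<^esub> y \<otimes>\<^bsub>S\<^esub> (\<Oplus>\<^bsub>S\<^esub>g\<in>G. h g \<otimes>\<^bsub>S\<^esub> b g) \<in> P" if "finite G" for G
      using that
    proof (induction G)
      case empty
      then show ?case using y Fi.zero_closed P.zero_closed by (simp add: S.minus_eq)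
    next
      case (insert g G)
      have g: "g \<in> \<Gamma>" "g \<in> carrier S" and GS: "\<And>g. g \<in> G \<Longrightarrow> g \<in> \<Gamma> \<and> g \<in> carrier S"
        using insert.prems \<Gamma>(1) YS by auto
      have e1: "(\<Oplus>\<^bsub>S\<^esub>g\<in>insert g G. h g \<otimes>\<^bsub>S\<^esub> b g) = h g \<otimes>\<^bsub>S\<^esub> b g \<oplus>\<^bsub>S\<^esub> (\<Oplus>\<^bsub>S\<^esub>g\<in>G. h g \<otimes>\<^bsub>S\<^esub> b g)"
        using insert.hyps h b g GS by (intro S.finsum_insert) auto
      have e2: "(\<Oplus>\<^bsub>S\<^esub>g\<in>insert g G. h g \<otimes>\<^bsub>S\<^esub> g) = h g \<otimes>\<^bsub>S\<^esub> g \<oplus>\<^bsub>S\<^esub> (\<Oplus>\<^bsub>S\<^esub>g\<in>G. h g \<otimes>\<^bsub>S\<^esub> g)"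
        using insert.hyps h g GS by (intro S.finsum_insert) auto
      have IH: "(\<Oplus>\<^bsub>S\<^esub>g\<in>G. h g \<otimes>\<^bsub>S\<^esub> b g) \<in> filtN (N - c)"
         "(\<Oplus>\<^bsub>S\<^esub>g\<in>G. h g \<otimes>\<^bsub>S\<^esub> g) \<ominus>\<^bsub>S\<^esub> y \<otimes>\<^bsub>S\<^esub> (\<Oplus>\<^bsub>S\<^esub>g\<in>G. h g \<otimes>\<^bsub>S\<^esub> b g) \<in> P"
        using insert by auto
      have cl: "(\<Oplus>\<^bsub>S\<^esub>g\<in>G. h g \<otimes>\<^bsub>S\<^esub> b g) \<in> carrier S" "(\<Oplus>\<^bsub>S\<^esub>g\<in>G. h g \<otimes>\<^bsub>S\<^esub> g) \<in> carrier S"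
        using h b GS by (auto intro!: S.finsum_closed)
      have "h g \<otimes>\<^bsub>S\<^esub> b g \<in> filtN (N - c)" using hf[OF g(1)] b(1)[OF g(1)] by (rule Fi.I_r_closed)
      moreover have "(h g \<otimes>\<^bsub>S\<^esub> g \<oplus>\<^bsub>S\<^esub> Y1) \<ominus>\<^bsub>S\<^esub> y \<otimes>\<^bsub>S\<^esub> (h g \<otimes>\<^bsub>S\<^esub> b g \<oplus>\<^bsub>S\<^esub> Y2) =
         h g \<otimes>\<^bsub>S\<^esub> (g \<ominus>\<^bsub>S\<^esub> y \<otimes>\<^bsub>S\<^esub> b g) \<oplus>\<^bsub>S\<^esub> (Y1 \<ominus>\<^bsub>S\<^esub> y \<otimes>\<^bsub>S\<^esub> Y2)" if "Y1 \<in> carrier S" "Y2 \<in> carrier S" for Y1 Y2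
        using that h(1)[OF g(1)] b(1)[OF g(1)] g(2) y
        by (simp add: S.minus_eq S.r_distr S.r_minus S.minus_add S.m_lcomm S.a_ac)
      moreover have "h g \<otimes>\<^bsub>S\<^esub> (g \<ominus>\<^bsub>S\<^esub> y \<otimes>\<^bsub>S\<^esub> b g) \<in> P"
        using b(2)[OF g(1)] h(1)[OF g(1)] by (rule P.I_l_closed)
      ultimately show ?case unfolding e1 e2 using IH cl by (auto intro!: Fi.a_closed P.a_closed)
    qed
    from this[OF \<Gamma>(2)] show ?thesis unfolding h(3) by blast
  qed
  then show ?thesis unfolding Y_def S.comb_def using filtN_def by (intro exI[of _ c]) auto
qed

end

section \<open>The dimension of the power series ring\<close>

lemma strict_chain_append:
  assumes D: "strict_chain P l D" and C: "strict_chain P n C" and "D l \<subseteq> C 0"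
  shows "strict_chain P (l + n) (\<lambda>i. if i < l then D i else C (i - l))"
proof -
  have "D i \<subset> C (Suc i - l)" if "i < l" "\<not> Suc i < l" for i
  proof -
    have "Suc i = l" using that by simp
    then show ?thesis using D that(1) assms(3) unfolding strict_chain_def by auto
  qed
  moreover have "C (i - l) \<subset> C (Suc i - l)" if "\<not> i < l" "i < l + n" for i
    using C that by (simp add: strict_chain_def Suc_diff_le)
  ultimately show ?thesis using D C by (auto simp: strict_chain_def)
qed

context quadric_series
begin

definition thicken where
  "thicken P M = {v \<in> carrier S. \<exists>a\<in>P. v \<ominus>\<^bsub>S\<^esub> a \<in> filtN M}"

lemma ideal_thicken: "ideal P S \<Longrightarrow> ideal (thicken P M) S"
proof -
  assume P: "ideal P S"
  have "a \<in> carrier S" if "a \<in> P" for a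
    using that additive_subgroup.a_subset[OF ideal.axioms(1)[OF P]] by blast
  then have "thicken P M = S.comb \<one>\<^bsub>S\<^esub> P (filtN M)" unfolding thicken_def S.comb_def by auto
  then show ?thesis using S.ideal_comb[OF P filtN_ideal] by simp
qed

lemma thicken_supset:
  assumes "ideal P S"
  shows "P \<subseteq> thicken P M" "filtN M \<subseteq> thicken P M"
proof -
  interpret P: ideal P S by fact
  interpret Fi: ideal "filtN M" S by (rule filtN_ideal)
  show "P \<subseteq> thicken P M"
  proof
    fix v assume v: "v \<in> P"
    then have "v \<in> carrier S" using P.a_subset by blast
    then show "v \<in> thicken P M" using v Fi.zero_closed
      unfolding thicken_def by (auto simp: S.r_neg S.minus_eq intro!: bexI[of _ v])
  qed
  show "filtN M \<subseteq> thicken P M"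
  proof
    fix v assume v: "v \<in> filtN M"
    then have "v \<in> carrier S" using Fi.a_subset by blast
    then show "v \<in> thicken P M" using v P.zero_closed
      unfolding thicken_def by (auto simp: S.minus_eq intro!: bexI[of _ "\<zero>\<^bsub>S\<^esub>"])
  qed
qed

text \<open>By Artin-Rees the part of y z lying deep in the filtration is y w modulo
  \<open>P\<close> with \<open>w\<close> almost as deep. As \<open>P\<close> is prime and avoids
  \<open>y\<close>, z and w agree modulo \<open>P\<close>, so each cancellation of \<open>y\<close>
  costs at most \<open>c\<close>.\<close>

lemma colon_thicken:
  assumes P: "primeideal P S" and y: "y \<in> carrier S" "y \<notin> P"
  shows "\<exists>c. \<forall>i M. \<forall>z\<in>carrier S. y [^]\<^bsub>S\<^esub> (i::nat) \<otimes>\<^bsub>S\<^esub> z \<in> thicken P M \<longrightarrow> z \<in> thicken P (M - c * i)"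
proof -
  interpret P: primeideal P S by fact
  obtain c where c: "\<And>N u a. u \<in> filtN N \<Longrightarrow> a \<in> carrier S \<Longrightarrow> u \<ominus>\<^bsub>S\<^esub> y \<otimes>\<^bsub>S\<^esub> a \<in> P \<Longrightarrow>
    \<exists>w\<in>filtN (N - c). u \<ominus>\<^bsub>S\<^esub> y \<otimes>\<^bsub>S\<^esub> w \<in> P"
    using artin_rees[OF P.is_ideal y(1)] by blast
  have step: "z \<in> thicken P (M - c)" if z: "z \<in> carrier S" and yz: "y \<otimes>\<^bsub>S\<^esub> z \<in> thicken P M" for z M
  proof -
    obtain p where p: "p \<in> P" "y \<otimes>\<^bsub>S\<^esub> z \<ominus>\<^bsub>S\<^esub> p \<in> filtN M" using yz by (auto simp: thicken_def)
    have pS: "p \<in> carrier S" using p(1) P.a_subset by blast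
    let ?u = "y \<otimes>\<^bsub>S\<^esub> z \<ominus>\<^bsub>S\<^esub> p"
    have "?u \<ominus>\<^bsub>S\<^esub> y \<otimes>\<^bsub>S\<^esub> z = \<ominus>\<^bsub>S\<^esub> p"
      using y z pS by (simp add: S.minus_eq S.a_ac S.r_neg2 S.r_neg1 S.r_neg)
    then have "?u \<ominus>\<^bsub>S\<^esub> y \<otimes>\<^bsub>S\<^esub> z \<in> P" using p(1) by (simp add: P.a_inv_closed)
    then obtain w where w: "w \<in> filtN (M - c)" "?u \<ominus>\<^bsub>S\<^esub> y \<otimes>\<^bsub>S\<^esub> w \<in> P" using c[OF p(2) z] by blast
    have wS: "w \<in> carrier S" using w(1) by (simp add: filtN_def)
    have "y \<otimes>\<^bsub>S\<^esub> (z \<ominus>\<^bsub>S\<^esub> w) = p \<oplus>\<^bsub>S\<^esub> (?u \<ominus>\<^bsub>S\<^esub> y \<otimes>\<^bsub>S\<^esub> w)"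
      using y z pS wS by (simp add: S.minus_eq S.r_distr S.r_minus S.a_ac S.r_neg1 S.r_neg2)
    then have "y \<otimes>\<^bsub>S\<^esub> (z \<ominus>\<^bsub>S\<^esub> w) \<in> P" using p(1) w(2) P.a_closed by simp
    then have zw: "z \<ominus>\<^bsub>S\<^esub> w \<in> P" using P.I_prime[of y "z \<ominus>\<^bsub>S\<^esub> w"] y z wS by auto
    have "z \<ominus>\<^bsub>S\<^esub> (z \<ominus>\<^bsub>S\<^esub> w) = w" using z wS
      by (simp add: S.minus_eq S.minus_add S.r_neg2)
    then show ?thesis using zw w(1) z unfolding thicken_def by (auto intro!: bexI[of _ "z \<ominus>\<^bsub>S\<^esub> w"])
  qed
  have "z \<in> thicken P (M - c * i)" if "z \<in> carrier S" "y [^]\<^bsub>S\<^esub> i \<otimes>\<^bsub>S\<^esub> z \<in> thicken P M" for i :: nat and M z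
    using that
  proof (induction i arbitrary: z M)
    case (Suc i)
    have "y [^]\<^bsub>S\<^esub> i \<otimes>\<^bsub>S\<^esub> (y \<otimes>\<^bsub>S\<^esub> z) \<in> thicken P M" using Suc.prems y by (simp add: S.m_assoc)
    then have "y \<otimes>\<^bsub>S\<^esub> z \<in> thicken P (M - c * i)" using Suc.prems(1) y by (intro Suc.IH) auto
    then have "z \<in> thicken P (M - c * i - c)" using step Suc.prems(1) by blast
    then show ?case by (simp add: diff_diff_add add.commute)
  qed simp
  then show ?thesis by blast
qed

text \<open>Below \<open>r\<close> successive primes the quotient by \<open>filtN (c N)\<close> has length at least \<open>N\<^sup>r\<close>: multiplication
  by the powers \<open>y\<^sup>i\<close>, \<open>i < N\<close>, of an element \<open>y\<close> of the next prime gives \<open>N\<close> copies of a chain for that prime.\<close>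

definition long_chains :: "nat \<Rightarrow> (nat multiset \<Rightarrow> 'a) set \<Rightarrow> bool" where
  "long_chains r P \<longleftrightarrow> (\<exists>c. \<forall>N\<ge>1. \<exists>C. strict_chain (\<lambda>I. ideal I S \<and> P \<subseteq> I \<and> filtN (c * N) \<subseteq> I) (N ^ r) C)"

lemma proper_ideal_constant_coeff:
  assumes J: "ideal J S" "J \<noteq> carrier S" and f: "f \<in> J"
  shows "f {#} = \<zero>"
proof (rule ccontr)
  interpret J: ideal J S by fact
  assume "f {#} \<noteq> \<zero>"
  moreover have fS: "f \<in> carrier S" using f J.a_subset by blast
  ultimately obtain h where h: "h \<in> carrier S" "h \<otimes>\<^bsub>S\<^esub> f = \<one>\<^bsub>S\<^esub>" using unit_of_constant_coeff by blast
  then have "\<one>\<^bsub>S\<^esub> \<in> J" using J.I_l_closed[OF f h(1)] by simp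
  then show False using J.one_imp_carrier J(2) by simp
qed

lemma long_chains_0:
  assumes P: "primeideal P S"
  shows "long_chains 0 P"
proof -
  interpret P: primeideal P S by fact
  have "\<exists>C. strict_chain (\<lambda>I. ideal I S \<and> P \<subseteq> I \<and> filtN (1 * N) \<subseteq> I) (N ^ 0) C" if N: "N \<ge> 1" for N :: nat
  proof -
    have "\<one>\<^bsub>S\<^esub> \<notin> thicken P N"
    proof
      assume "\<one>\<^bsub>S\<^esub> \<in> thicken P N"
      then obtain p where p: "p \<in> P" "\<one>\<^bsub>S\<^esub> \<ominus>\<^bsub>S\<^esub> p \<in> filtN N" by (auto simp: thicken_def)
      have pS: "p \<in> carrier S" using p(1) P.a_subset by blast
      have "(2::nat) ^ 1 \<le> 2 ^ N" using N by (intro power_increasing) auto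
      then have "nm {#} < 2 ^ N" by (simp add: monomial_norm_def)
      then have "(\<one>\<^bsub>S\<^esub> \<ominus>\<^bsub>S\<^esub> p) {#} = \<zero>" using p(2) by (simp add: filtN_def)
      then have "\<one> = \<zero>" using S_diff[OF S.one_closed pS, of "{#}"] proper_ideal_constant_coeff[OF P.is_ideal P.I_notcarr[symmetric] p(1)]
        by (simp add: S_one mon_def minus_eq)
      then show False by simp
    qed
    then have "thicken P N \<subset> carrier S"
      using S.one_closed by (auto simp: thicken_def)
    then have "strict_chain (\<lambda>I. ideal I S \<and> P \<subseteq> I \<and> filtN (1 * N) \<subseteq> I) 1 (\<lambda>i. if i = 0 then thicken P N else carrier S)"
      using ideal_thicken[OF P.is_ideal] thicken_supset[OF P.is_ideal] S.oneideal P.a_subset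
        additive_subgroup.a_subset[OF ideal.axioms(1)[OF filtN_ideal]]
      by (auto simp: strict_chain_def)
    then show ?thesis by auto
  qed
  then show ?thesis unfolding long_chains_def by blast
qed

lemma long_chains_Suc:
  assumes P: "primeideal P S" and Q: "primeideal Q S" and PQ: "P \<subset> Q" and lc: "long_chains r Q"
  shows "long_chains (Suc r) P"
proof -
  interpret P: primeideal P S by fact
  interpret Q: primeideal Q S by fact
  obtain y where y: "y \<in> Q" "y \<notin> P" using PQ by blast
  then have yS: "y \<in> carrier S" using Q.a_subset by blast
  obtain c' where c': "\<And>i M z. z \<in> carrier S \<Longrightarrow> y [^]\<^bsub>S\<^esub> (i::nat) \<otimes>\<^bsub>S\<^esub> z \<in> thicken P M \<Longrightarrow> z \<in> thicken P (M - c' * i)"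
    using colon_thicken[OF P yS y(2)] by blast
  obtain c where c: "\<And>N::nat. N \<ge> 1 \<Longrightarrow> \<exists>C. strict_chain (\<lambda>I. ideal I S \<and> Q \<subseteq> I \<and> filtN (c * N) \<subseteq> I) (N ^ r) C"
    using lc unfolding long_chains_def by blast
  have "\<exists>D. strict_chain (\<lambda>I. ideal I S \<and> P \<subseteq> I \<and> filtN ((c + c') * N) \<subseteq> I) (N ^ Suc r) D"
    if N: "N \<ge> 1" for N :: nat
  proof -
    obtain C where C: "strict_chain (\<lambda>I. ideal I S \<and> Q \<subseteq> I \<and> filtN (c * N) \<subseteq> I) (N ^ r) C" using c[OF N] by blast
    \<comment> \<open>The chain above \<open>Q\<close> needs depth \<open>c * N\<close>, and
      cancelling a power of \<open>y\<close> with exponent below \<open>N\<close> costs at most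
      \<open>c' * N\<close>.\<close>
    define M where "M = (c + c') * N"
    define J where "J = thicken P M"
    define \<phi> where "\<phi> i I = S.comb (y [^]\<^bsub>S\<^esub> (i::nat)) I J" for i I
    interpret J: ideal J S unfolding J_def by (rule ideal_thicken[OF P.is_ideal])
    have \<phi>_ideal: "ideal (\<phi> i I) S" if "ideal I S" for i I
      unfolding \<phi>_def using that J.ideal_axioms yS by (intro S.ideal_comb) auto
    have \<phi>_sup: "P \<subseteq> \<phi> i I \<and> filtN M \<subseteq> \<phi> i I" if "ideal I S" for i I
    proof -
      interpret I: ideal I S by fact
      have "J \<subseteq> \<phi> i I"
      proof
        fix v assume v: "v \<in> J"
        then have "v \<in> carrier S" using J.a_subset by blast
        then show "v \<in> \<phi> i I" using v I.zero_closed yS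
          unfolding \<phi>_def S.comb_def by (auto simp: S.minus_eq intro!: bexI[of _ "\<zero>\<^bsub>S\<^esub>"])
      qed
      then show ?thesis using thicken_supset[OF P.is_ideal, of M] by (auto simp: J_def)
    qed
    \<comment> \<open>\<open>\<phi> i I\<close> is y^i I + J. Were y^i a in it with \<open>a\<close>
      outside \<open>I\<close>, cancelling y^i would place \<open>a\<close> in \<open>I\<close> up
      to terms of \<open>P\<close> and of \<open>filtN (c * N)\<close>, both contained in
      \<open>I\<close>.\<close>
    have \<phi>_strict: "\<phi> i I \<subset> \<phi> i I'" if i: "i < N" and I: "ideal I S" "Q \<subseteq> I" "filtN (c * N) \<subseteq> I"
      and I': "ideal I' S" "I \<subset> I'" for i I I'
    proof -
      interpret I: ideal I S by fact
      interpret I': ideal I' S by fact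
      obtain a where a: "a \<in> I'" "a \<notin> I" using I'(2) by blast
      have aS: "a \<in> carrier S" using a(1) I'.a_subset by blast
      have "y [^]\<^bsub>S\<^esub> i \<otimes>\<^bsub>S\<^esub> a \<in> \<phi> i I'" using a(1) aS yS J.zero_closed
        unfolding \<phi>_def S.comb_def by (auto simp: S.minus_eq S.r_neg intro!: bexI[of _ a])
      moreover have "y [^]\<^bsub>S\<^esub> i \<otimes>\<^bsub>S\<^esub> a \<notin> \<phi> i I"
      proof
        assume "y [^]\<^bsub>S\<^esub> i \<otimes>\<^bsub>S\<^esub> a \<in> \<phi> i I"
        then obtain b where b: "b \<in> I" "y [^]\<^bsub>S\<^esub> i \<otimes>\<^bsub>S\<^esub> a \<ominus>\<^bsub>S\<^esub> y [^]\<^bsub>S\<^esub> i \<otimes>\<^bsub>S\<^esub> b \<in> J" by (auto simp: \<phi>_def S.comb_def)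
        have bS: "b \<in> carrier S" using b(1) I.a_subset by blast
        have "y [^]\<^bsub>S\<^esub> i \<otimes>\<^bsub>S\<^esub> a \<ominus>\<^bsub>S\<^esub> y [^]\<^bsub>S\<^esub> i \<otimes>\<^bsub>S\<^esub> b = y [^]\<^bsub>S\<^esub> i \<otimes>\<^bsub>S\<^esub> (a \<ominus>\<^bsub>S\<^esub> b)"
          using yS aS bS by (simp add: S.minus_eq S.r_distr S.r_minus)
        then have "a \<ominus>\<^bsub>S\<^esub> b \<in> thicken P (M - c' * i)" using b(2) aS bS by (intro c') (auto simp: J_def)
        then obtain p where p: "p \<in> P" "a \<ominus>\<^bsub>S\<^esub> b \<ominus>\<^bsub>S\<^esub> p \<in> filtN (M - c' * i)" by (auto simp: thicken_def)
        have pS: "p \<in> carrier S" using p(1) P.a_subset by blast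
        have "c' * i \<le> c' * N" using i by simp
        moreover have "M = c * N + c' * N" by (simp add: M_def add_mult_distrib)
        ultimately have "c * N \<le> M - c' * i" by linarith
        then have "a \<ominus>\<^bsub>S\<^esub> b \<ominus>\<^bsub>S\<^esub> p \<in> I" using filtN_anti p(2) I(3) by blast
        moreover have "p \<in> I" using p(1) PQ I(2) by blast
        ultimately have "(a \<ominus>\<^bsub>S\<^esub> b \<ominus>\<^bsub>S\<^esub> p) \<oplus>\<^bsub>S\<^esub> p \<oplus>\<^bsub>S\<^esub> b \<in> I" using b(1) I.a_closed by simp
        moreover have "(a \<ominus>\<^bsub>S\<^esub> b \<ominus>\<^bsub>S\<^esub> p) \<oplus>\<^bsub>S\<^esub> p \<oplus>\<^bsub>S\<^esub> b = a"
          using aS bS pS by (simp add: S.minus_eq S.a_assoc S.l_neg)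
        ultimately show False using a(2) by simp
      qed
      moreover have "\<phi> i I \<subseteq> \<phi> i I'" using I'(2) by (auto simp: \<phi>_def S.comb_def)
      ultimately show ?thesis by blast
    qed
    \<comment> \<open>As \<open>y\<close> lies in \<open>Q\<close>, which \<open>I\<close> contains,
      y^(i+1) Z is contained in y^i I; the blocks for consecutive exponents can be stacked.\<close>
    have \<phi>_next: "\<phi> (Suc i) Z \<subseteq> \<phi> i I" if Z: "ideal Z S" and I: "ideal I S" "Q \<subseteq> I" for i Z I
    proof
      interpret Z: ideal Z S by fact
      interpret I: ideal I S by fact
      fix v assume "v \<in> \<phi> (Suc i) Z"
      then obtain a where a: "v \<in> carrier S" "a \<in> Z" "v \<ominus>\<^bsub>S\<^esub> y [^]\<^bsub>S\<^esub> Suc i \<otimes>\<^bsub>S\<^esub> a \<in> J" by (auto simp: \<phi>_def S.comb_def)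
      have aS: "a \<in> carrier S" using a(2) Z.a_subset by blast
      have "y \<otimes>\<^bsub>S\<^esub> a \<in> I" using y(1) I(2) aS by (intro I.I_r_closed) auto
      moreover have "y [^]\<^bsub>S\<^esub> Suc i \<otimes>\<^bsub>S\<^esub> a = y [^]\<^bsub>S\<^esub> i \<otimes>\<^bsub>S\<^esub> (y \<otimes>\<^bsub>S\<^esub> a)" using aS yS by (simp add: S.m_assoc)
      ultimately show "v \<in> \<phi> i I" using a(1,3) unfolding \<phi>_def S.comb_def by (auto intro!: bexI[of _ "y \<otimes>\<^bsub>S\<^esub> a"])
    qed
    let ?P = "\<lambda>I. ideal I S \<and> P \<subseteq> I \<and> filtN M \<subseteq> I"
    have CI: "ideal (C j) S \<and> Q \<subseteq> C j \<and> filtN (c * N) \<subseteq> C j" if "j \<le> N ^ r" for j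
      using C that by (simp add: strict_chain_def)
    have blk: "strict_chain ?P (N ^ r) (\<lambda>j. \<phi> t (C j))" if "t < N" for t
      unfolding strict_chain_def
    proof (intro conjI allI impI)
      fix j assume "j < N ^ r"
      then show "\<phi> t (C j) \<subset> \<phi> t (C (Suc j))"
        using that CI[of j] CI[of "Suc j"] C by (intro \<phi>_strict) (auto simp: strict_chain_def)
    qed (use CI \<phi>_ideal \<phi>_sup in auto)
    \<comment> \<open>The block for exponent \<open>t\<close> goes below those for smaller
      exponents; the second conjunct reserves the room for it.\<close>
    have "\<exists>D. strict_chain ?P (t * N ^ r) D \<and> (\<forall>Z. ideal Z S \<longrightarrow> \<phi> t Z \<subseteq> D 0)" if "t \<le> N" for t
      using that
    proof (induction t)
      case 0
      have "strict_chain ?P 0 (\<lambda>_. carrier S)"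
        using S.oneideal P.a_subset additive_subgroup.a_subset[OF ideal.axioms(1)[OF filtN_ideal]]
        by (auto simp: strict_chain_def)
      moreover have "\<phi> 0 Z \<subseteq> carrier S" for Z by (auto simp: \<phi>_def S.comb_def)
      ultimately show ?case by (intro exI[of _ "\<lambda>_. carrier S"]) auto
    next
      case (Suc t)
      then obtain D where D: "strict_chain ?P (t * N ^ r) D" "\<And>Z. ideal Z S \<Longrightarrow> \<phi> t Z \<subseteq> D 0" by auto
      let ?D = "\<lambda>i. if i < N ^ r then \<phi> t (C i) else D (i - N ^ r)"
      have "strict_chain ?P (N ^ r + t * N ^ r) ?D"
        using strict_chain_append[OF blk D(1)] D(2) CI[of "N ^ r"] Suc.prems by auto
      moreover have "\<phi> (Suc t) Z \<subseteq> ?D 0" if "ideal Z S" for Z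
        using \<phi>_next[OF that, of "C 0" t] CI[of 0] N by auto
      ultimately show ?case by (intro exI[of _ ?D]) simp
    qed
    from this[of N] show ?thesis unfolding M_def by (auto simp: mult.commute)
  qed
  then show ?thesis unfolding long_chains_def by blast
qed

text \<open>A chain of \<open>n\<close> strict inclusions of primes forces colength at least N^n in
  depth c N, whereas only (c N)^(d+1) monomials are available. Letting N grow bounds
  \<open>n\<close>.\<close>

lemma prime_chain_length_le:
  assumes C: "strict_chain (\<lambda>P. primeideal P S) n C"
  shows "n \<le> Suc d"
proof -
  have "long_chains r (C (n - r))" if "r \<le> n" for r
    using that
  proof (induction r)
    case 0
    then show ?case using C by (intro long_chains_0) (auto simp: strict_chain_def)
  next
    case (Suc r)
    have eq: "Suc (n - Suc r) = n - r" using Suc.prems by simp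
    have "C (n - Suc r) \<subset> C (Suc (n - Suc r))" using C Suc.prems by (auto simp: strict_chain_def)
    then show ?case using C Suc eq by (intro long_chains_Suc[of _ "C (n - r)"]) (auto simp: strict_chain_def)
  qed
  from this[of n] obtain c where c: "\<And>N::nat. N \<ge> 1 \<Longrightarrow>
      \<exists>D. strict_chain (\<lambda>I. ideal I S \<and> C 0 \<subseteq> I \<and> filtN (c * N) \<subseteq> I) (N ^ n) D"
    unfolding long_chains_def by auto
  have bound: "N ^ n \<le> (c * N) ^ Suc d" if N: "N \<ge> 1" for N :: nat
  proof -
    obtain D where D: "strict_chain (\<lambda>I. ideal I S \<and> C 0 \<subseteq> I \<and> filtN (c * N) \<subseteq> I) (N ^ n) D"
      using c[OF N] by blast
    let ?B = "{m. set_mset m \<subseteq> {..d} \<and> nm m < 2 ^ (c * N)}"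
    have fin: "finite ?B" by (rule finite_subset[OF _ finite_monomial_norm_less]) auto
    have "outside ?B \<subseteq> filtN (c * N)"
      unfolding outside_def filtN_def S_carrier monomials_def by blast
    then have "strict_chain (\<lambda>I. ideal I S \<and> outside ?B \<subseteq> I) (N ^ n) D"
      using D unfolding strict_chain_def by blast
    from chain_length_le[OF this fin] have "N ^ n \<le> card ?B" by simp
    also have "\<dots> \<le> (c * N) ^ Suc d" by (rule card_monomial_norm_less)
    finally show ?thesis .
  qed
  show ?thesis
  proof (rule ccontr)
    assume n: "\<not> n \<le> Suc d"
    \<comment> \<open>For \<open>n\<close> at least d + 2 the comparison would give N \<le> c^(d+1),
      which this choice violates.\<close>
    let ?N = "Suc (c ^ Suc d)"
    have "?N ^ Suc (Suc d) \<le> ?N ^ n" using n by (intro power_increasing) auto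
    also have "\<dots> \<le> (c * ?N) ^ Suc d" by (rule bound) simp
    also have "\<dots> = c ^ Suc d * ?N ^ Suc d" by (rule power_mult_distrib)
    finally have "?N * ?N ^ Suc d \<le> c ^ Suc d * ?N ^ Suc d" by (simp only: power_Suc)
    then show False by (simp only: mult_le_cancel2) simp
  qed
qed

end

section \<open>A chain of primes containing the quadratic form\<close>

context quadric_series
begin

text \<open>The iterated boundary monoids of Coquand and Lombardi: a prime disjoint from \<open>boundary j\<close> is the
  bottom of a chain of \<open>j\<close> strict inclusions of primes.\<close>

primrec boundary :: "nat \<Rightarrow> (nat multiset \<Rightarrow> 'a) set" where
  "boundary 0 = {\<one>\<^bsub>S\<^esub>}"
| "boundary (Suc j) = {xpow (d - j) m \<otimes>\<^bsub>S\<^esub> (s \<oplus>\<^bsub>S\<^esub> xpow (d - j) 1 \<otimes>\<^bsub>S\<^esub> a) |m s a. s \<in> boundary j \<and> a \<in> carrier S}"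

lemma boundary_closed: "s \<in> boundary j \<Longrightarrow> s \<in> carrier S"
  by (induction j arbitrary: s) auto

lemma xpow_0: "xpow i 0 = \<one>\<^bsub>S\<^esub>" by (simp add: xpow_def S_one)

lemma xpow_add: "i \<le> d \<Longrightarrow> xpow i m \<otimes>\<^bsub>S\<^esub> xpow i n = xpow i (m + n)"
  using multiset_eqI[of "replicate_mset m i + replicate_mset n i" "replicate_mset (m + n) i"]
  unfolding xpow_def by (subst mon_mult_mon) (auto simp: monomials_def)

lemma boundary_one: "\<one>\<^bsub>S\<^esub> \<in> boundary j"
proof (induction j)
  case (Suc j)
  have "\<one>\<^bsub>S\<^esub> = xpow (d - j) 0 \<otimes>\<^bsub>S\<^esub> (\<one>\<^bsub>S\<^esub> \<oplus>\<^bsub>S\<^esub> xpow (d - j) 1 \<otimes>\<^bsub>S\<^esub> \<zero>\<^bsub>S\<^esub>)" by (simp add: xpow_0)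
  then show ?case using Suc unfolding boundary.simps by blast
qed simp

lemma xpow_boundary: "xpow (d - j) 1 \<in> boundary (Suc j)"
proof -
  have "xpow (d - j) 1 = xpow (d - j) 1 \<otimes>\<^bsub>S\<^esub> (\<one>\<^bsub>S\<^esub> \<oplus>\<^bsub>S\<^esub> xpow (d - j) 1 \<otimes>\<^bsub>S\<^esub> \<zero>\<^bsub>S\<^esub>)" by simp
  then show ?thesis using boundary_one[of j] unfolding boundary.simps by blast
qed

lemma boundary_incl:
  assumes "s \<in> boundary j" "a \<in> carrier S"
  shows "s \<oplus>\<^bsub>S\<^esub> xpow (d - j) 1 \<otimes>\<^bsub>S\<^esub> a \<in> boundary (Suc j)"
proof -
  have "s \<oplus>\<^bsub>S\<^esub> xpow (d - j) 1 \<otimes>\<^bsub>S\<^esub> a = xpow (d - j) 0 \<otimes>\<^bsub>S\<^esub> (s \<oplus>\<^bsub>S\<^esub> xpow (d - j) 1 \<otimes>\<^bsub>S\<^esub> a)"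
    using assms boundary_closed by (simp add: xpow_0)
  then show ?thesis using assms unfolding boundary.simps by blast
qed

lemma boundary_mult: "s \<in> boundary j \<Longrightarrow> t \<in> boundary j \<Longrightarrow> s \<otimes>\<^bsub>S\<^esub> t \<in> boundary j"
proof (induction j arbitrary: s t)
  case (Suc j)
  let ?x = "xpow (d - j)"
  obtain m s' a where s: "s = ?x m \<otimes>\<^bsub>S\<^esub> (s' \<oplus>\<^bsub>S\<^esub> ?x 1 \<otimes>\<^bsub>S\<^esub> a)" "s' \<in> boundary j" "a \<in> carrier S"
    using Suc.prems(1) by auto
  obtain n t' b where t: "t = ?x n \<otimes>\<^bsub>S\<^esub> (t' \<oplus>\<^bsub>S\<^esub> ?x 1 \<otimes>\<^bsub>S\<^esub> b)" "t' \<in> boundary j" "b \<in> carrier S"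
    using Suc.prems(2) by auto
  have c: "s' \<in> carrier S" "t' \<in> carrier S" "?x k \<in> carrier S" for k
    using s(2) t(2) boundary_closed by auto
  let ?a = "s' \<otimes>\<^bsub>S\<^esub> b \<oplus>\<^bsub>S\<^esub> a \<otimes>\<^bsub>S\<^esub> t' \<oplus>\<^bsub>S\<^esub> ?x 1 \<otimes>\<^bsub>S\<^esub> (a \<otimes>\<^bsub>S\<^esub> b)"
  have "s \<otimes>\<^bsub>S\<^esub> t = (?x m \<otimes>\<^bsub>S\<^esub> ?x n) \<otimes>\<^bsub>S\<^esub> ((s' \<otimes>\<^bsub>S\<^esub> t') \<oplus>\<^bsub>S\<^esub> ?x 1 \<otimes>\<^bsub>S\<^esub> ?a)"
    unfolding s(1) t(1) using c(1,2) c(3)[of m] c(3)[of n] c(3)[of 1] s(3) t(3)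
    by (simp add: S.r_distr S.l_distr S.m_ac S.a_ac)
  also have "?x m \<otimes>\<^bsub>S\<^esub> ?x n = ?x (m + n)" by (rule xpow_add) simp
  finally have eq: "s \<otimes>\<^bsub>S\<^esub> t = ?x (m + n) \<otimes>\<^bsub>S\<^esub> ((s' \<otimes>\<^bsub>S\<^esub> t') \<oplus>\<^bsub>S\<^esub> ?x 1 \<otimes>\<^bsub>S\<^esub> ?a)" .
  have "?a \<in> carrier S" using c(1,2) c(3)[of 1] s(3) t(3) by simp
  then show ?case unfolding boundary.simps using eq Suc.IH[OF s(2) t(2)]
    by (intro CollectI exI[of _ "m + n"] exI[of _ "s' \<otimes>\<^bsub>S\<^esub> t'"] exI[of _ ?a]) simp
qed simp

lemma xpow_mult_coeff:
  "g \<in> carrier S \<Longrightarrow> (xpow i k \<otimes>\<^bsub>S\<^esub> g) m = (if k \<le> count m i then g (m - replicate_mset k i) else \<zero>)"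
  unfolding xpow_def by (simp add: mon_mult flip: count_le_replicate_mset_subset_eq)

text \<open>The monomial \<open>\<mu>\<close> records the exponents \<open>m\<close> of the nested
  description of \<open>E\<close>. At each level a term either comes from \<open>s\<close>, where
  induction applies, or contains one more of the current variable, whose weight dominates the rest
  of \<open>\<mu>\<close> in the later variables. Hence \<open>\<mu>\<close> has least weight for
  every weight growing fast enough, and the weight may be chosen after \<open>\<mu>\<close>.\<close>

lemma boundary_weight:
  assumes "E \<in> boundary k" "k \<le> d"
  shows "\<exists>\<mu>. set_mset \<mu> \<subseteq> {d - k<..d} \<and> E \<mu> = \<one> \<and>
    (\<forall>w :: nat \<Rightarrow> nat. (\<forall>j\<in>{d - k<..d}. (\<Sum>l\<in>#filter_mset (\<lambda>l. j < l) \<mu>. w l) \<le> w j) \<longrightarrow>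
      (\<forall>\<nu>. E \<nu> \<noteq> \<zero> \<longrightarrow> (\<Sum>l\<in>#\<mu>. w l) \<le> (\<Sum>l\<in>#\<nu>. w l)))"
  using assms
proof (induction k arbitrary: E)
  case 0
  then show ?case by (intro exI[of _ "{#}"]) (auto simp: S_one mon_def)
next
  case (Suc k)
  let ?x = "d - k"
  obtain m s a where E: "E = xpow ?x m \<otimes>\<^bsub>S\<^esub> (s \<oplus>\<^bsub>S\<^esub> xpow ?x 1 \<otimes>\<^bsub>S\<^esub> a)" and s: "s \<in> boundary k" and a: "a \<in> carrier S"
    using Suc.prems(1) by auto
  obtain \<mu> where \<mu>: "set_mset \<mu> \<subseteq> {?x<..d}" "s \<mu> = \<one>"
    and wt: "\<And>(w :: nat \<Rightarrow> nat) \<nu>. (\<And>j. j \<in> {?x<..d} \<Longrightarrow> (\<Sum>l\<in>#filter_mset (\<lambda>l. j < l) \<mu>. w l) \<le> w j) \<Longrightarrow>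
      s \<nu> \<noteq> \<zero> \<Longrightarrow> (\<Sum>l\<in>#\<mu>. w l) \<le> (\<Sum>l\<in>#\<nu>. w l)"
    using Suc.IH[OF s] Suc.prems(2) by (metis Suc_leD)
  have sS: "s \<in> carrier S" using boundary_closed[OF s] .
  have x1: "?x = Suc (d - Suc k)" using Suc.prems(2) by simp
  have Ec: "E \<nu> = (if m \<le> count \<nu> ?x then s (\<nu> - replicate_mset m ?x) \<oplus>
      (if 1 \<le> count (\<nu> - replicate_mset m ?x) ?x then a (\<nu> - replicate_mset m ?x - {#?x#}) else \<zero>) else \<zero>)" for \<nu>
    unfolding E using sS a by (simp add: xpow_mult_coeff S_add replicate_Suc One_nat_def)
  let ?\<mu> = "replicate_mset m ?x + \<mu>"
  have nx: "?x \<notin># \<mu>" using \<mu>(1) by auto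
  have "E ?\<mu> = \<one>" unfolding Ec using nx \<mu>(2) by (simp add: not_in_iff)
  moreover have "set_mset ?\<mu> \<subseteq> {d - Suc k<..d}" using \<mu>(1) x1 by auto
  moreover have "(\<Sum>l\<in>#?\<mu>. w l) \<le> (\<Sum>l\<in>#\<nu>. w l)"
    if w: "\<And>j. j \<in> {d - Suc k<..d} \<Longrightarrow> (\<Sum>l\<in>#filter_mset (\<lambda>l. j < l) ?\<mu>. w l) \<le> w j" and \<nu>: "E \<nu> \<noteq> \<zero>" for w :: "nat \<Rightarrow> nat" and \<nu>
  proof -
    let ?\<nu> = "\<nu> - replicate_mset m ?x"
    have m: "m \<le> count \<nu> ?x" using \<nu> unfolding Ec by (auto split: if_splits)
    then have \<nu>eq: "\<nu> = replicate_mset m ?x + ?\<nu>"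
      by (simp flip: count_le_replicate_mset_subset_eq add: subset_mset.add_diff_inverse)
    have filt: "filter_mset (\<lambda>l. j < l) ?\<mu> = filter_mset (\<lambda>l. j < l) \<mu>" if "?x \<le> j" for j
      using that by (simp add: filter_mset_eq_conv multiset_eq_iff)
    have wx: "(\<Sum>l\<in>#filter_mset (\<lambda>l. j < l) \<mu>. w l) \<le> w j" if "j \<in> {?x..d}" for j
      using w[of j] filt[of j] that x1 by auto
    have "(\<Sum>l\<in>#\<mu>. w l) \<le> (\<Sum>l\<in>#?\<nu>. w l)"
    proof (cases "s ?\<nu> = \<zero>")
      case False
      then show ?thesis using wx by (intro wt) auto
    next
      case True
      then have "1 \<le> count ?\<nu> ?x" using \<nu> m unfolding Ec by (auto split: if_splits)
      then have "?x \<in># ?\<nu>" by (simp add: count_greater_zero_iff[symmetric] del: count_greater_zero_iff)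
      then obtain B where B: "?\<nu> = add_mset ?x B" by (metis multi_member_split)
      have "w ?x \<le> (\<Sum>l\<in>#?\<nu>. w l)" unfolding B by simp
      moreover have "filter_mset (\<lambda>l. ?x < l) \<mu> = \<mu>" using \<mu>(1) by (auto simp: filter_mset_eq_conv)
      ultimately show ?thesis using wx[of ?x] by simp
    qed
    then show ?thesis by (subst \<nu>eq) simp
  qed
  ultimately show ?case by (intro exI[of _ ?\<mu>] conjI allI impI) auto
qed

text \<open>The weight makes x_0 the lightest variable, so the form times the lightest term of
  \<open>h\<close> yields a term through x_0^2 of weight two more. But \<open>\<mu>\<close> avoids
  x_0 and must come from a square of a heavier variable, which makes it strictly heavier than this
  term, against its minimality.\<close>

lemma form_not_in_boundary:
  assumes h: "h \<in> carrier S"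
  shows "form \<otimes>\<^bsub>S\<^esub> h \<notin> boundary d"
proof
  let ?E = "form \<otimes>\<^bsub>S\<^esub> h"
  assume "?E \<in> boundary d"
  then obtain \<mu> where \<mu>: "set_mset \<mu> \<subseteq> {0<..d}" "?E \<mu> = \<one>"
    and wt: "\<And>(w :: nat \<Rightarrow> nat) \<nu>. (\<And>j. j \<in> {0<..d} \<Longrightarrow> (\<Sum>l\<in>#filter_mset (\<lambda>l. j < l) \<mu>. w l) \<le> w j) \<Longrightarrow>
      ?E \<nu> \<noteq> \<zero> \<Longrightarrow> (\<Sum>l\<in>#\<mu>. w l) \<le> (\<Sum>l\<in>#\<nu>. w l)"
    using boundary_weight[of ?E d] by auto
  \<comment> \<open>The powers of \<open>size \<mu> + 1\<close> let one variable outweigh all later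
    variables in \<open>\<mu>\<close>; the factor 2 makes x_0 strictly lighter than the
    others.\<close>
  define w where "w l = (if l = 0 then 1 else 2 * (size \<mu> + 1) ^ (d - l))" for l
  let ?W = "\<lambda>\<nu>. \<Sum>l\<in>#\<nu>. w l"
  have w2: "2 \<le> w l" if "l > 0" for l using that by (simp add: w_def)
  have "(\<Sum>l\<in>#filter_mset (\<lambda>l. j < l) \<mu>. w l) \<le> w j" if j: "j \<in> {0<..d}" for j
  proof (cases "j = d")
    case True
    then have f: "filter_mset (\<lambda>l. j < l) \<mu> = {#}" using \<mu>(1) by (auto simp: multiset_eq_iff count_eq_zero_iff)
    show ?thesis unfolding f by simp
  next
    case False
    let ?c = "2 * (size \<mu> + 1) ^ (d - Suc j)"
    have "w l \<le> ?c" if "l \<in># filter_mset (\<lambda>l. j < l) \<mu>" for l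
    proof -
      have "(size \<mu> + 1) ^ (d - l) \<le> (size \<mu> + 1) ^ (d - Suc j)" using that by (intro power_increasing) auto
      then show ?thesis using that by (simp add: w_def)
    qed
    then have "(\<Sum>l\<in>#filter_mset (\<lambda>l. j < l) \<mu>. w l) \<le> (\<Sum>l\<in>#filter_mset (\<lambda>l. j < l) \<mu>. ?c)"
      by (rule sum_mset_mono)
    also have "\<dots> = size (filter_mset (\<lambda>l. j < l) \<mu>) * ?c" by simp
    also have "\<dots> \<le> (size \<mu> + 1) * ?c" by (intro mult_right_mono trans_le_add1[OF size_filter_mset_lesseq]) simp
    also have "\<dots> = 2 * (size \<mu> + 1) ^ Suc (d - Suc j)" by simp
    also have "Suc (d - Suc j) = d - j" using False j by auto
    finally show ?thesis using j by (simp add: w_def)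
  qed
  note wt' = wt[of w, OF this]
  have hit: "\<exists>i\<in>{..d}. {#i, i#} \<subseteq># \<nu> \<and> h (\<nu> - {#i, i#}) \<noteq> \<zero>" if "?E \<nu> \<noteq> \<zero>" for \<nu>
  proof (rule ccontr)
    assume "\<not> ?thesis"
    then have "?E \<nu> = \<zero>" unfolding form_mult[OF h] by (intro add.finprod_one_eqI) auto
    then show False using that by simp
  qed
  obtain i where i: "i \<le> d" "{#i, i#} \<subseteq># \<mu>" "h (\<mu> - {#i, i#}) \<noteq> \<zero>"
    using hit[of \<mu>] \<mu>(2) by auto
  then have "i \<in># \<mu>" by (meson mset_subset_eqD union_single_eq_member)
  then have i0: "i > 0" using \<mu>(1) by auto
  obtain \<nu> where \<nu>: "h \<nu> \<noteq> \<zero>" "\<And>\<nu>'. h \<nu>' \<noteq> \<zero> \<Longrightarrow> ?W \<nu> \<le> ?W \<nu>'"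
    using ex_has_least_nat[of "\<lambda>\<nu>. h \<nu> \<noteq> \<zero>" "\<mu> - {#i, i#}" ?W] i(3) by blast
  have split: "?W m = ?W (m - {#j, j#}) + 2 * w j" if "{#j, j#} \<subseteq># m" for m j
  proof -
    have "m = (m - {#j, j#}) + {#j, j#}" using subset_mset.diff_add[OF that] by simp
    then have "?W m = ?W ((m - {#j, j#}) + {#j, j#})" by simp
    then show ?thesis by simp
  qed
  \<comment> \<open>No cancellation occurs: another index \<open>j\<close> would require a term of
    \<open>h\<close> lighter than the lightest one, by 2 w(j) - 2.\<close>
  have "?E (\<nu> + {#0, 0#}) = (\<Oplus>j\<in>{..d}. if 0 = j then h \<nu> else \<zero>)"
    unfolding form_mult[OF h]
  proof (rule finsum_cong')
    fix j assume j: "j \<in> {..d}"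
    show "(if {#j, j#} \<subseteq># \<nu> + {#0, 0#} then h (\<nu> + {#0, 0#} - {#j, j#}) else \<zero>) = (if 0 = j then h \<nu> else \<zero>)"
    proof (cases "j = 0")
      case False
      have "h (\<nu> + {#0, 0#} - {#j, j#}) = \<zero>" if "{#j, j#} \<subseteq># \<nu> + {#0, 0#}"
      proof (rule ccontr)
        assume "h (\<nu> + {#0, 0#} - {#j, j#}) \<noteq> \<zero>"
        then have "?W \<nu> \<le> ?W (\<nu> + {#0, 0#} - {#j, j#})" by (rule \<nu>(2))
        moreover have "?W (\<nu> + {#0, 0#}) = ?W \<nu> + 2" by (simp add: w_def)
        ultimately show False using split[OF that] w2[of j] False by simp
      qed
      then show ?thesis using False by simp
    qed simp
  qed (use h in auto)
  also have "\<dots> = h \<nu>" using h by (subst finsum_singleton) auto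
  finally have "?E (\<nu> + {#0, 0#}) \<noteq> \<zero>" using \<nu>(1) by simp
  from wt'[OF _ this] have "?W \<mu> \<le> ?W \<nu> + 2" by (simp add: w_def)
  moreover have "?W \<nu> \<le> ?W (\<mu> - {#i, i#})" by (rule \<nu>(2)[OF i(3)])
  ultimately show False using split[OF i(2)] w2[OF i0] by simp
qed

text \<open>The k-th prime avoids \<open>boundary (d - k)\<close>, which contains x_(k+1). Adjoining
  that variable strictly enlarges the prime, and the enlarged ideal still avoids the next smaller
  boundary monoid, so a prime above it continues the chain. The form enters at the bottom.\<close>

lemma exists_prime_chain:
  "\<exists>C. strict_chain (\<lambda>P. primeideal P S) d C \<and> form \<in> C 0"
proof -
  have "\<exists>C. strict_chain (\<lambda>P. primeideal P S) k C \<and> form \<in> C 0 \<and> C k \<inter> boundary (d - k) = {}" if "k \<le> d" for k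
    using that
  proof (induction k)
    case 0
    let ?I = "PIdl\<^bsub>S\<^esub> form"
    have "?I \<inter> boundary d = {}"
      using form_not_in_boundary S.m_comm[OF form_closed] by (auto simp: cgenideal_def)
    then obtain P where P: "primeideal P S" "?I \<subseteq> P" "P \<inter> boundary d = {}"
      using S.exists_prime_disjoint[OF S.cgenideal_ideal[OF form_closed] boundary_one[of d] boundary_mult] by blast
    then show ?case using S.cgenideal_self[OF form_closed]
      by (intro exI[of _ "\<lambda>_. P"]) (auto simp: strict_chain_def)
  next
    case (Suc k)
    then obtain C where C: "strict_chain (\<lambda>P. primeideal P S) k C" "form \<in> C 0" "C k \<inter> boundary (d - k) = {}" by auto
    define j where "j = d - Suc k"
    have dk: "d - k = Suc j" using Suc.prems by (simp add: j_def)
    interpret Ck: primeideal "C k" S using C(1) by (simp add: strict_chain_def)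
    let ?x = "xpow (d - j) 1" let ?I = "S.comb ?x (carrier S) (C k)"
    have x: "?x \<in> carrier S" by auto
    have I: "ideal ?I S" by (intro S.ideal_comb S.oneideal Ck.is_ideal x)
    have "t \<notin> boundary j" if "t \<in> ?I" for t
    proof
      assume t: "t \<in> boundary j"
      obtain a where a: "a \<in> carrier S" "t \<ominus>\<^bsub>S\<^esub> ?x \<otimes>\<^bsub>S\<^esub> a \<in> C k" using that \<open>t \<in> ?I\<close> by (auto simp: S.comb_def)
      have "t \<oplus>\<^bsub>S\<^esub> ?x \<otimes>\<^bsub>S\<^esub> (\<ominus>\<^bsub>S\<^esub> a) \<in> boundary (Suc j)" using t a by (intro boundary_incl) auto
      moreover have "t \<oplus>\<^bsub>S\<^esub> ?x \<otimes>\<^bsub>S\<^esub> (\<ominus>\<^bsub>S\<^esub> a) = t \<ominus>\<^bsub>S\<^esub> ?x \<otimes>\<^bsub>S\<^esub> a" using x a(1) by (simp add: S.r_minus S.minus_eq)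
      ultimately show False using a(2) C(3) dk by auto
    qed
    then have "?I \<inter> boundary j = {}" by blast
    then obtain P where P: "primeideal P S" "?I \<subseteq> P" "P \<inter> boundary j = {}"
      using S.exists_prime_disjoint[OF I boundary_one[of j] boundary_mult] by blast
    have "C k \<subseteq> ?I"
    proof
      fix v assume v: "v \<in> C k"
      then have "v \<in> carrier S" using Ck.a_subset by blast
      then show "v \<in> ?I" using v x unfolding S.comb_def by (auto simp: S.minus_eq intro!: bexI[of _ "\<zero>\<^bsub>S\<^esub>"])
    qed
    moreover have "?x \<in> ?I" using x Ck.zero_closed unfolding S.comb_def
      by (auto simp: S.minus_eq S.r_neg intro!: bexI[of _ "\<one>\<^bsub>S\<^esub>"])
    moreover have "?x \<notin> C k" using xpow_boundary[of j] C(3) dk by auto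
    ultimately have CP: "C k \<subset> P" using P(2) by blast
    let ?C = "\<lambda>i. if i \<le> k then C i else P"
    have "strict_chain (\<lambda>P. primeideal P S) (Suc k) ?C"
      using C(1) P(1) CP by (auto simp: strict_chain_def le_Suc_eq less_Suc_eq)
    then show ?case using C(2) P(3) by (intro exI[of _ ?C]) (auto simp: j_def)
  qed
  from this[of d] show ?thesis by blast
qed

end

section \<open>Ideals of quotient rings\<close>

definition preimage_ideal :: "('a, 'b) ring_scheme \<Rightarrow> 'a set \<Rightarrow> 'a set set \<Rightarrow> 'a set" where
  "preimage_ideal R I K = {r \<in> carrier R. I +>\<^bsub>R\<^esub> r \<in> K}"

lemma carrier_Quot: "carrier (R Quot I) = (+>\<^bsub>R\<^esub>) I ` carrier R"
  by (auto simp: FactRing_def A_RCOSETS_def')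

lemma (in cring) preimage_ideal_ideal:
  assumes I: "ideal I R" and K: "ideal K (R Quot I)"
  shows "ideal (preimage_ideal R I K) R" "I \<subseteq> preimage_ideal R I K" "(+>) I ` preimage_ideal R I K = K"
proof -
  interpret I: ideal I R by fact
  interpret K: ideal K "R Quot I" by fact
  interpret h: ring_hom_ring R "R Quot I" "(+>) I" by (rule I.rcos_ring_hom_ring)
  show "ideal (preimage_ideal R I K) R" unfolding preimage_ideal_def by (rule h.ideal_vimage[OF K])
  show "I \<subseteq> preimage_ideal R I K"
  proof
    fix r assume r: "r \<in> I"
    have "I +> r = I" by (rule a_coset_join2[OF I.a_Hcarr[OF r] I.a_subgroup r])
    moreover have "\<zero>\<^bsub>R Quot I\<^esub> = I" by (simp only: FactRing_def ring.simps)
    then have "I \<in> K" using additive_subgroup.zero_closed[OF ideal.axioms(1)[OF K]] by (simp only:)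
    ultimately have "I +> r \<in> K" by (simp only:)
    then show "r \<in> preimage_ideal R I K" using I.a_Hcarr[OF r] unfolding preimage_ideal_def by blast
  qed
  show "(+>) I ` preimage_ideal R I K = K"
    using K.a_subset by (auto simp: preimage_ideal_def carrier_Quot)
qed

lemma (in cring) preimage_image_ideal:
  assumes I: "ideal I R" and J: "ideal J R" "I \<subseteq> J"
  shows "ideal ((+>) I ` J) (R Quot I)" "preimage_ideal R I ((+>) I ` J) = J"
proof -
  interpret I: ideal I R by fact
  interpret J: ideal J R by fact
  show "ideal ((+>) I ` J) (R Quot I)" by (rule ring_ideal_imp_quot_ideal[OF I J(1)])
  have "r \<in> J" if "r \<in> carrier R" "j \<in> J" "I +> r = I +> j" for r j
  proof -
    have "r \<in> I +> j" using I.a_rcos_self[OF that(1)] that(3) by simp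
    then obtain i where "i \<in> I" "r = i \<oplus> j" by (auto simp: a_r_coset_def')
    then show ?thesis using that(2) J(2) J.a_closed by blast
  qed
  then show "preimage_ideal R I ((+>) I ` J) = J"
    using J.a_subset by (auto simp: preimage_ideal_def)
qed

text \<open>The correspondence of ideals, with a side condition that is instantiated by primality
  and by containment of a fixed ideal.\<close>

lemma (in cring) quotient_chain_iff:
  assumes I: "ideal I R" and QQ: "\<And>K. ideal K (R Quot I) \<Longrightarrow> Q K \<longleftrightarrow> Q' (preimage_ideal R I K)"
  shows "(\<exists>C. strict_chain (\<lambda>K. ideal K (R Quot I) \<and> Q K) n C) \<longleftrightarrow>
    (\<exists>C. strict_chain (\<lambda>J. ideal J R \<and> I \<subseteq> J \<and> Q' J) n C)"
proof
  assume "\<exists>C. strict_chain (\<lambda>K. ideal K (R Quot I) \<and> Q K) n C"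
  then obtain C where C: "\<And>i. i \<le> n \<Longrightarrow> ideal (C i) (R Quot I) \<and> Q (C i)" "\<And>i. i < n \<Longrightarrow> C i \<subset> C (Suc i)"
    by (auto simp: strict_chain_def)
  have e: "(+>) I ` preimage_ideal R I (C j) = C j" if "j \<le> n" for j
    using preimage_ideal_ideal(3)[OF I] C(1)[OF that] by blast
  have "preimage_ideal R I (C i) \<subset> preimage_ideal R I (C (Suc i))" if i: "i < n" for i
  proof -
    have "preimage_ideal R I (C i) \<subseteq> preimage_ideal R I (C (Suc i))"
      using C(2)[OF i] by (auto simp: preimage_ideal_def)
    moreover have "preimage_ideal R I (C i) \<noteq> preimage_ideal R I (C (Suc i))"
    proof
      assume "preimage_ideal R I (C i) = preimage_ideal R I (C (Suc i))"
      then have "(+>) I ` preimage_ideal R I (C i) = (+>) I ` preimage_ideal R I (C (Suc i))" by (rule arg_cong)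
      then show False using e[of i] e[of "Suc i"] C(2)[OF i] i by simp
    qed
    ultimately show ?thesis by (rule psubsetI)
  qed
  moreover have "Q' (preimage_ideal R I (C i))" if "i \<le> n" for i using C(1)[OF that] QQ by blast
  ultimately have "strict_chain (\<lambda>J. ideal J R \<and> I \<subseteq> J \<and> Q' J) n (\<lambda>i. preimage_ideal R I (C i))"
    using C(1) preimage_ideal_ideal(1,2)[OF I] by (auto simp: strict_chain_def)
  then show "\<exists>C. strict_chain (\<lambda>J. ideal J R \<and> I \<subseteq> J \<and> Q' J) n C" by blast
next
  assume "\<exists>C. strict_chain (\<lambda>J. ideal J R \<and> I \<subseteq> J \<and> Q' J) n C"
  then obtain C where C: "\<And>i. i \<le> n \<Longrightarrow> ideal (C i) R \<and> I \<subseteq> C i \<and> Q' (C i)" "\<And>i. i < n \<Longrightarrow> C i \<subset> C (Suc i)"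
    by (auto simp: strict_chain_def)
  have e: "preimage_ideal R I ((+>) I ` C j) = C j" if "j \<le> n" for j
    using preimage_image_ideal(2)[OF I] C(1)[OF that] by blast
  have "(+>) I ` C i \<subset> (+>) I ` C (Suc i)" if i: "i < n" for i
  proof -
    have "(+>) I ` C i \<noteq> (+>) I ` C (Suc i)"
    proof
      assume "(+>) I ` C i = (+>) I ` C (Suc i)"
      then have "preimage_ideal R I ((+>) I ` C i) = preimage_ideal R I ((+>) I ` C (Suc i))" by (rule arg_cong)
      then show False using e[of i] e[of "Suc i"] C(2)[OF i] i by simp
    qed
    moreover have "(+>) I ` C i \<subseteq> (+>) I ` C (Suc i)" using C(2)[OF i] by blast
    ultimately show ?thesis by blast
  qed
  then have "strict_chain (\<lambda>K. ideal K (R Quot I) \<and> Q K) n (\<lambda>i. (+>) I ` C i)"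
    using C(1) preimage_image_ideal[OF I] QQ by (auto simp: strict_chain_def)
  then show "\<exists>C. strict_chain (\<lambda>K. ideal K (R Quot I) \<and> Q K) n C" by blast
qed

lemma (in cring) primeideal_quot_iff:
  assumes I: "ideal I R" and K: "ideal K (R Quot I)"
  shows "primeideal K (R Quot I) \<longleftrightarrow> primeideal (preimage_ideal R I K) R"
proof
  interpret I: ideal I R by fact
  interpret h: ring_hom_ring R "R Quot I" "(+>) I" by (rule I.rcos_ring_hom_ring)
  show "primeideal K (R Quot I) \<Longrightarrow> primeideal (preimage_ideal R I K) R"
    unfolding preimage_ideal_def by (rule h.primeideal_vimage[OF is_cring])
  assume P: "primeideal (preimage_ideal R I K) R"
  show "primeideal K (R Quot I)"
  proof (rule primeidealI[OF K I.quotient_is_cring[OF is_cring]])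
    have "preimage_ideal R I K \<noteq> carrier R" using primeideal.I_notcarr[OF P] by simp
    then show "carrier (R Quot I) \<noteq> K" by (auto simp: preimage_ideal_def)
    fix a b assume ab: "a \<in> carrier (R Quot I)" "b \<in> carrier (R Quot I)" "a \<otimes>\<^bsub>R Quot I\<^esub> b \<in> K"
    obtain r s where rs: "r \<in> carrier R" "a = I +> r" "s \<in> carrier R" "b = I +> s"
      using ab(1,2) by (auto simp: carrier_Quot)
    then have "I +> (r \<otimes> s) \<in> K" using ab(3) by simp
    then have "r \<otimes> s \<in> preimage_ideal R I K" using rs by (simp add: preimage_ideal_def)
    then show "a \<in> K \<or> b \<in> K" using primeideal.I_prime[OF P rs(1,3)] rs by (auto simp: preimage_ideal_def)
  qed
qed

lemma krull_dim_quot: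
  assumes "cring R" "ideal I R"
  shows "krull_dim (R Quot I) = (SUP n \<in> {n. \<exists>C. strict_chain (\<lambda>P. primeideal P R \<and> I \<subseteq> P) n C}. enat n)"
proof -
  interpret cring R by fact
  have "(\<exists>C. strict_chain (\<lambda>P. primeideal P (R Quot I)) n C) \<longleftrightarrow> (\<exists>C. strict_chain (\<lambda>P. primeideal P R \<and> I \<subseteq> P) n C)" for n
  proof -
    have e1: "(\<lambda>P. primeideal P (R Quot I)) = (\<lambda>P. ideal P (R Quot I) \<and> primeideal P (R Quot I))"
      using primeideal.axioms(1) by auto
    have e2: "(\<lambda>P. primeideal P R \<and> I \<subseteq> P) = (\<lambda>P. ideal P R \<and> I \<subseteq> P \<and> primeideal P R)"
      using primeideal.axioms(1) by auto
    show ?thesis unfolding e1 e2 using quotient_chain_iff[OF assms(2), where Q = "\<lambda>P. primeideal P (R Quot I)" and Q' = "\<lambda>P. primeideal P R"]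
        primeideal_quot_iff[OF assms(2)] by blast
  qed
  then show ?thesis by (simp add: krull_dim_def)
qed

lemma submodule_quotient_module_iff:
  assumes "cring R" "ideal I R"
  shows "submodule N R (quotient_module R I) \<longleftrightarrow> ideal N (R Quot I)"
proof -
  interpret cring R by fact
  interpret I: ideal I R by fact
  interpret Q: cring "R Quot I" by (rule I.quotient_is_cring) (rule is_cring)
  have am: "subgroup N (add_monoid (quotient_module R I)) \<longleftrightarrow> subgroup N (add_monoid (R Quot I))"
    by (simp add: quotient_module_def subgroup_def m_inv_def)
  show ?thesis
  proof
    assume N: "submodule N R (quotient_module R I)"
    then have sm: "(I +>\<^bsub>R\<^esub> r) \<otimes>\<^bsub>R Quot I\<^esub> x \<in> N" if "r \<in> carrier R" "x \<in> N" for r x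
      using submodule.smult_closed[OF N that] by (simp add: quotient_module_def)
    have sg: "subgroup N (add_monoid (R Quot I))" using N submodule.axioms(1) am by blast
    have "x \<otimes>\<^bsub>R Quot I\<^esub> a \<in> N" if "a \<in> N" "x \<in> carrier (R Quot I)" for a x
      using sm that by (auto simp: carrier_Quot)
    moreover have "a \<in> carrier (R Quot I)" if "a \<in> N" for a using subgroup.mem_carrier[OF sg that] by simp
    moreover from calculation have "a \<otimes>\<^bsub>R Quot I\<^esub> x \<in> N" if "a \<in> N" "x \<in> carrier (R Quot I)" for a x
      using Q.m_comm[of a x] that by simp
    ultimately show "ideal N (R Quot I)" using sg by (intro idealI Q.ring_axioms)
  next
    assume N: "ideal N (R Quot I)"
    then have "subgroup N (add_monoid (R Quot I))" by (intro additive_subgroup.a_subgroup ideal.axioms(1))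
    then have "subgroup N (add_monoid (quotient_module R I))" using am by blast
    moreover have "r \<odot>\<^bsub>quotient_module R I\<^esub> x \<in> N" if "r \<in> carrier R" "x \<in> N" for r x
      using ideal.I_l_closed[OF N that(2), of "I +>\<^bsub>R\<^esub> r"] that(1) by (simp add: quotient_module_def carrier_Quot)
    ultimately show "submodule N R (quotient_module R I)" by (intro submodule.intro submodule_axioms.intro)
  qed
qed

lemma module_length_quot:
  assumes "cring R" "ideal I R"
  shows "module_length R (quotient_module R I) =
    (SUP n \<in> {n. \<exists>C. strict_chain (\<lambda>J. ideal J R \<and> I \<subseteq> J) n C}. enat n)"
  using cring.quotient_chain_iff[OF assms, of "\<lambda>_. True" "\<lambda>_. True"]
  by (simp add: module_length_def submodule_quotient_module_iff[OF assms])

lemma SUP_enat_eqI: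
  assumes "n \<in> A" "\<And>m. m \<in> A \<Longrightarrow> m \<le> n"
  shows "(SUP m\<in>A. enat m) = enat n"
  using assms by (intro antisym SUP_least SUP_upper) auto

lemma (in ring) ring_char_eq_prime_iff:
  assumes p: "Factorial_Ring.prime p" and "\<one> \<noteq> \<zero>"
  shows "ring_char R = p \<longleftrightarrow> [p] \<cdot> \<one> = \<zero>"
proof -
  have ord: "[n] \<cdot> \<one> = \<zero> \<longleftrightarrow> ring_char R dvd n" for n :: nat
    using group.pow_eq_id[OF a_group, of \<one> n] by (simp add: ring_char_def add_pow_def)
  have "ring_char R \<noteq> 1" using ord[of 1] assms(2) by (auto simp: One_nat_def)
  then have "ring_char R = p \<longleftrightarrow> ring_char R dvd p" using p by (auto simp: prime_nat_iff)
  then show ?thesis using ord by simp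
qed

section \<open>The diagonal quadric\<close>

context quadric_series
begin

abbreviation quadric where "quadric \<equiv> diagonal_quadric_ring R d"
abbreviation form_ideal where "form_ideal \<equiv> Idl\<^bsub>S\<^esub> {form}"

lemma quadric_eq: "quadric = S Quot form_ideal"
  by (rule diagonal_quadric_ring_def)

lemma form_ideal: "ideal form_ideal S" by (rule S.genideal_ideal) simp

lemma form_ideal_subset_iff: "ideal J S \<Longrightarrow> form_ideal \<subseteq> J \<longleftrightarrow> form \<in> J"
  using S.genideal_minimal[of J "{form}"] S.genideal_self'[OF form_closed] by blast

lemma cring_quadric: "cring quadric"
  unfolding quadric_eq by (rule ideal.quotient_is_cring[OF form_ideal S.is_cring])

lemma form_coeff: "form m = (\<Oplus>i\<in>{..d}. if {#i, i#} \<subseteq># m then \<one>\<^bsub>S\<^esub> (m - {#i, i#}) else \<zero>)"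
  using form_mult[OF S.one_closed, of m] by simp

lemma form_nonzero: "form \<noteq> \<zero>\<^bsub>S\<^esub>"
proof -
  have "form {#0, 0#} = (\<Oplus>i\<in>{..d}. if 0 = i then \<one> else \<zero>)"
    unfolding form_coeff by (intro finsum_cong') (auto simp: S_one mon_def)
  also have "\<dots> = \<one>" by (subst finsum_singleton) auto
  finally show ?thesis by (metis S_zero one_not_zero)
qed

lemma filtN_1: "f \<in> filtN 1 \<longleftrightarrow> f \<in> carrier S \<and> f {#} = \<zero>"
proof -
  have "nm m < 2 \<longleftrightarrow> m = {#}" for m
  proof
    assume m: "nm m < 2"
    show "m = {#}"
    proof (rule ccontr)
      assume "m \<noteq> {#}"
      then have "(2::nat) ^ 1 \<le> 2 ^ size m" by (intro power_increasing) (auto simp: Suc_le_eq One_nat_def nonempty_has_size[symmetric])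
      then show False using m monomial_norm_ge[of m] by simp
    qed
  qed (simp add: monomial_norm_def)
  then show ?thesis by (auto simp: filtN_def)
qed

lemma one_not_filtN_1: "\<one>\<^bsub>S\<^esub> \<notin> filtN 1"
  by (simp add: filtN_1 S_one mon_def)

lemma form_in_filtN_1: "form \<in> filtN 1"
proof -
  have "form {#} = \<zero>" unfolding form_coeff by (intro add.finprod_one_eqI) auto
  then show ?thesis by (simp add: filtN_1)
qed

lemma proper_ideal_subset: "ideal J S \<Longrightarrow> J \<noteq> carrier S \<Longrightarrow> J \<subseteq> filtN 1"
  using proper_ideal_constant_coeff additive_subgroup.a_subset[OF ideal.axioms(1)] by (fastforce simp: filtN_1)

text \<open>For the upper bound a chain of primes containing the form is extended downwards by the
  zero ideal, which is prime and does not contain the form; this lowers the bound for the power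
  series ring by one.\<close>

lemma krull_dim_quadric: "krull_dim quadric = enat d"
  unfolding quadric_eq krull_dim_quot[OF S.is_cring form_ideal]
proof (rule SUP_enat_eqI)
  obtain C where C: "strict_chain (\<lambda>P. primeideal P S) d C" "form \<in> C 0" using exists_prime_chain by blast
  have "C 0 \<subseteq> C i" if "i \<le> d" for i
    using that
  proof (induction i)
    case (Suc i)
    then have "C i \<subset> C (Suc i)" using C(1) by (auto simp: strict_chain_def)
    then show ?case using Suc by auto
  qed simp
  then have "primeideal (C i) S \<and> form_ideal \<subseteq> C i" if "i \<le> d" for i
    using C that form_ideal_subset_iff[of "C i"] primeideal.axioms(1)[of "C i" S] by (auto simp: strict_chain_def)
  then show "d \<in> {n. \<exists>C. strict_chain (\<lambda>P. primeideal P S \<and> form_ideal \<subseteq> P) n C}"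
    using C(1) by (auto simp: strict_chain_def)
next
  fix n assume "n \<in> {n. \<exists>C. strict_chain (\<lambda>P. primeideal P S \<and> form_ideal \<subseteq> P) n C}"
  then obtain C where C: "strict_chain (\<lambda>P. primeideal P S \<and> form_ideal \<subseteq> P) n C" by blast
  then have P0: "primeideal (C 0) S" "form \<in> C 0"
    using S.genideal_self'[OF form_closed] by (auto simp: strict_chain_def)
  have "\<zero>\<^bsub>S\<^esub> \<in> C 0" using additive_subgroup.zero_closed ideal.axioms(1) primeideal.axioms(1) P0(1) by blast
  then have "{\<zero>\<^bsub>S\<^esub>} \<subset> C 0" using P0(2) form_nonzero by blast
  then have "strict_chain (\<lambda>P. primeideal P S) 1 (\<lambda>i. if i = 0 then {\<zero>\<^bsub>S\<^esub>} else C 0)"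
    using domain.zeroprimeideal[OF domain_S] P0(1) by (auto simp: strict_chain_def)
  moreover have "strict_chain (\<lambda>P. primeideal P S) n C" using C by (auto simp: strict_chain_def)
  ultimately have "1 + n \<le> Suc d" by (intro prime_chain_length_le[OF strict_chain_append]) auto
  then show "n \<le> d" by simp
qed

section \<open>The maximal ideal and its Frobenius powers\<close>

definition quadric_max :: "(nat multiset \<Rightarrow> 'a) set set" where
  "quadric_max = (+>\<^bsub>S\<^esub>) form_ideal ` filtN 1"

lemma form_ideal_filtN_1: "form_ideal \<subseteq> filtN 1"
  using form_ideal_subset_iff[OF filtN_ideal] form_in_filtN_1 by simp

lemma ideal_quadric_max: "ideal quadric_max quadric"
  unfolding quadric_max_def quadric_eq
  by (rule S.preimage_image_ideal[OF form_ideal filtN_ideal form_ideal_filtN_1])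

lemma preimage_quadric_max: "preimage_ideal S form_ideal quadric_max = filtN 1"
  unfolding quadric_max_def by (rule S.preimage_image_ideal[OF form_ideal filtN_ideal form_ideal_filtN_1])

lemma one_not_quadric_max: "\<one>\<^bsub>quadric\<^esub> \<notin> quadric_max"
proof
  assume "\<one>\<^bsub>quadric\<^esub> \<in> quadric_max"
  moreover have "\<one>\<^bsub>quadric\<^esub> = form_ideal +>\<^bsub>S\<^esub> \<one>\<^bsub>S\<^esub>" unfolding quadric_eq by (simp only: FactRing_def monoid.simps)
  ultimately have "\<one>\<^bsub>S\<^esub> \<in> preimage_ideal S form_ideal quadric_max" by (simp add: preimage_ideal_def)
  then show False using preimage_quadric_max one_not_filtN_1 by simp
qed

lemma proper_ideal_quadric:
  assumes K: "ideal K quadric" "K \<noteq> carrier quadric"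
  shows "K \<subseteq> quadric_max"
proof -
  note KQ = K[unfolded quadric_eq]
  have im: "(+>\<^bsub>S\<^esub>) form_ideal ` preimage_ideal S form_ideal K = K"
    by (rule S.preimage_ideal_ideal(3)[OF form_ideal KQ(1)])
  have "preimage_ideal S form_ideal K \<noteq> carrier S"
  proof
    assume "preimage_ideal S form_ideal K = carrier S"
    then have "K = carrier (S Quot form_ideal)" using im by (simp add: carrier_Quot)
    then show False using KQ(2) by simp
  qed
  then have "preimage_ideal S form_ideal K \<subseteq> filtN 1"
    by (intro proper_ideal_subset S.preimage_ideal_ideal(1)[OF form_ideal KQ(1)])
  then show ?thesis using im unfolding quadric_max_def by blast
qed

lemma the_max_ideal_quadric: "the_max_ideal quadric = quadric_max"
proof -
  interpret Q: cring quadric by (rule cring_quadric)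
  interpret m: ideal quadric_max quadric by (rule ideal_quadric_max)
  have "maximalideal quadric_max quadric"
  proof (rule maximalidealI[OF ideal_quadric_max])
    show "carrier quadric \<noteq> quadric_max" using one_not_quadric_max Q.one_closed by blast
    show "J = quadric_max \<or> J = carrier quadric" if "ideal J quadric" "quadric_max \<subseteq> J" for J
      using proper_ideal_quadric[of J] that by blast
  qed
  moreover have "K = quadric_max" if "maximalideal K quadric" for K
  proof -
    interpret K: maximalideal K quadric by fact
    have "K \<subseteq> quadric_max" using K.I_notcarr by (intro proper_ideal_quadric K.is_ideal) simp
    then have "quadric_max = K \<or> quadric_max = carrier quadric"
      using m.a_subset by (intro K.I_maximal m.is_ideal) auto
    then show ?thesis using one_not_quadric_max Q.one_closed by blast
  qed
  ultimately show ?thesis unfolding the_max_ideal_def by (intro the_equality)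
qed

end

context char_p_series
begin

text \<open>Powers of non-units lie in \<open>quad_ideal\<close> by additivity of the Frobenius map.
  Conversely, the preimage contains the form and the powers of the variables, and
  \<open>quad_ideal\<close> is the least such ideal.\<close>

lemma frobenius_power_quadric:
  "ideal (frobenius_power quadric quadric_max (p ^ e)) quadric"
  "preimage_ideal S form_ideal (frobenius_power quadric quadric_max (p ^ e)) = quad_ideal (p ^ e)"
proof -
  let ?q = "p ^ e" and ?F = "frobenius_power quadric quadric_max (p ^ e)" and ?\<phi> = "(+>\<^bsub>S\<^esub>) form_ideal"
  interpret Q: cring quadric by (rule cring_quadric)
  interpret h: ring_hom_ring S quadric ?\<phi>
    unfolding quadric_eq by (rule ideal.rcos_ring_hom_ring[OF form_ideal])
  have q: "?q > 0" using p_gt_0 by simp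
  have pow: "?\<phi> (f [^]\<^bsub>S\<^esub> ?q) = (?\<phi> f) [^]\<^bsub>quadric\<^esub> ?q" if "f \<in> carrier S" for f
    by (rule h.hom_nat_pow[OF that])
  have sub: "(\<lambda>a. a [^]\<^bsub>quadric\<^esub> ?q) ` quadric_max \<subseteq> carrier quadric"
    using additive_subgroup.a_subset[OF ideal.axioms(1)[OF ideal_quadric_max]] by blast
  show F: "ideal ?F quadric" unfolding frobenius_power_def by (rule Q.genideal_ideal[OF sub])
  have F': "ideal ?F (S Quot form_ideal)" using F by (simp only: quadric_eq)
  have fq: "form_ideal \<subseteq> quad_ideal ?q" using form_ideal_subset_iff[OF ideal_quad_ideal] form_in_quad_ideal by simp
  show "preimage_ideal S form_ideal ?F = quad_ideal ?q"
  proof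
    have "?F \<subseteq> ?\<phi> ` quad_ideal ?q"
      unfolding frobenius_power_def
    proof (rule Q.genideal_minimal)
      show "ideal (?\<phi> ` quad_ideal ?q) quadric"
        unfolding quadric_eq by (rule S.preimage_image_ideal(1)[OF form_ideal ideal_quad_ideal fq])
      show "(\<lambda>a. a [^]\<^bsub>quadric\<^esub> ?q) ` quadric_max \<subseteq> ?\<phi> ` quad_ideal ?q"
      proof
        fix b assume "b \<in> (\<lambda>a. a [^]\<^bsub>quadric\<^esub> ?q) ` quadric_max"
        then obtain g where g: "g \<in> filtN 1" "b = (?\<phi> g) [^]\<^bsub>quadric\<^esub> ?q" by (auto simp: quadric_max_def)
        then have "g \<in> carrier S" "g {#} = \<zero>" by (simp_all add: filtN_1)
        then have "b = ?\<phi> (g [^]\<^bsub>S\<^esub> ?q)" "g [^]\<^bsub>S\<^esub> ?q \<in> quad_ideal ?q"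
          using g(2) pow frobenius_in_quad_ideal by auto
        then show "b \<in> ?\<phi> ` quad_ideal ?q" by blast
      qed
    qed
    then have "preimage_ideal S form_ideal ?F \<subseteq> preimage_ideal S form_ideal (?\<phi> ` quad_ideal ?q)"
      by (auto simp: preimage_ideal_def)
    then show "preimage_ideal S form_ideal ?F \<subseteq> quad_ideal ?q"
      by (simp only: S.preimage_image_ideal(2)[OF form_ideal ideal_quad_ideal fq])
    show "quad_ideal ?q \<subseteq> preimage_ideal S form_ideal ?F"
    proof (rule quad_ideal_least[OF _ _ _ q])
      show "ideal (preimage_ideal S form_ideal ?F) S" by (rule S.preimage_ideal_ideal(1)[OF form_ideal F'])
      show "form \<in> preimage_ideal S form_ideal ?F"
        using S.preimage_ideal_ideal(2)[OF form_ideal F'] S.genideal_self'[OF form_closed] by blast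
      fix i assume i: "i \<le> d"
      have "xpow i 1 {#} = \<zero>" by (simp add: xpow_def mon_def One_nat_def replicate_Suc)
      then have "?\<phi> (xpow i 1) \<in> quadric_max" using i by (auto simp: quadric_max_def filtN_1)
      then have "(?\<phi> (xpow i 1)) [^]\<^bsub>quadric\<^esub> ?q \<in> ?F"
        unfolding frobenius_power_def using Q.genideal_self[OF sub] by blast
      then have "?\<phi> (xpow i ?q) \<in> ?F" using pow[of "xpow i 1"] xpow_pow[OF i, of ?q] i by simp
      then show "xpow i ?q \<in> preimage_ideal S form_ideal ?F" using i by (simp add: preimage_ideal_def)
    qed
  qed
qed

lemma length_quadric:
  "module_length quadric (quotient_module quadric (frobenius_power quadric quadric_max (p ^ e))) =
    enat (card (boxm (p ^ e)) - card (initials (boxm (p ^ e)) (quad_ideal (p ^ e))))"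
proof -
  let ?q = "p ^ e" and ?F = "frobenius_power quadric quadric_max (p ^ e)"
  have q: "?q > 0" using p_gt_0 by simp
  have F': "ideal ?F (S Quot form_ideal)" using frobenius_power_quadric(1) by (simp only: quadric_eq)
  have fq: "form_ideal \<subseteq> quad_ideal ?q" using form_ideal_subset_iff[OF ideal_quad_ideal] form_in_quad_ideal by simp
  have sub: "?F \<subseteq> K \<longleftrightarrow> quad_ideal ?q \<subseteq> preimage_ideal S form_ideal K" if "ideal K (S Quot form_ideal)" for K
  proof
    assume "?F \<subseteq> K"
    then have "preimage_ideal S form_ideal ?F \<subseteq> preimage_ideal S form_ideal K" by (auto simp: preimage_ideal_def)
    then show "quad_ideal ?q \<subseteq> preimage_ideal S form_ideal K" by (simp only: frobenius_power_quadric(2))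
  next
    assume "quad_ideal ?q \<subseteq> preimage_ideal S form_ideal K"
    then have "preimage_ideal S form_ideal ?F \<subseteq> preimage_ideal S form_ideal K" by (simp only: frobenius_power_quadric(2))
    then have "(+>\<^bsub>S\<^esub>) form_ideal ` preimage_ideal S form_ideal ?F \<subseteq> (+>\<^bsub>S\<^esub>) form_ideal ` preimage_ideal S form_ideal K"
      by (rule image_mono)
    then show "?F \<subseteq> K" by (simp only: S.preimage_ideal_ideal(3)[OF form_ideal F'] S.preimage_ideal_ideal(3)[OF form_ideal that])
  qed
  have "(\<exists>C. strict_chain (\<lambda>K. ideal K quadric \<and> ?F \<subseteq> K) n C) \<longleftrightarrow>
      (\<exists>C. strict_chain (\<lambda>J. ideal J S \<and> form_ideal \<subseteq> J \<and> quad_ideal ?q \<subseteq> J) n C)" for n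
    unfolding quadric_eq
    using S.quotient_chain_iff[OF form_ideal, where Q = "\<lambda>K. ?F \<subseteq> K" and Q' = "\<lambda>J. quad_ideal ?q \<subseteq> J" and n = n] sub
    by (simp only: quadric_eq)
  moreover have "(\<lambda>J. ideal J S \<and> form_ideal \<subseteq> J \<and> quad_ideal ?q \<subseteq> J) = (\<lambda>J. ideal J S \<and> quad_ideal ?q \<subseteq> J)"
    using fq by blast
  ultimately have "module_length quadric (quotient_module quadric ?F) =
      (SUP n \<in> {n. \<exists>C. strict_chain (\<lambda>J. ideal J S \<and> quad_ideal ?q \<subseteq> J) n C}. enat n)"
    unfolding module_length_quot[OF cring_quadric frobenius_power_quadric(1)] by simp
  also have "\<dots> = enat (card (boxm ?q) - card (initials (boxm ?q) (quad_ideal ?q)))"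
  proof (rule SUP_enat_eqI)
    have "boxm ?q \<subseteq> monomials" by (auto simp: boxm_def)
    from exists_chain[OF ideal_quad_ideal outside_quad_ideal finite_boxm[OF q] this]
    show "card (boxm ?q) - card (initials (boxm ?q) (quad_ideal ?q)) \<in>
      {n. \<exists>C. strict_chain (\<lambda>J. ideal J S \<and> quad_ideal ?q \<subseteq> J) n C}" by blast
    fix n assume "n \<in> {n. \<exists>C. strict_chain (\<lambda>J. ideal J S \<and> quad_ideal ?q \<subseteq> J) n C}"
    then obtain C where C: "strict_chain (\<lambda>J. ideal J S \<and> quad_ideal ?q \<subseteq> J) n C" by blast
    then have "strict_chain (\<lambda>J. ideal J S \<and> outside (boxm ?q) \<subseteq> J) n C"
      using outside_quad_ideal unfolding strict_chain_def by blast
    from chain_length_le[OF this finite_boxm[OF q]]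
    have "n \<le> card (boxm ?q) - card (initials (boxm ?q) (C 0))" .
    moreover have "initials (boxm ?q) (quad_ideal ?q) \<subseteq> initials (boxm ?q) (C 0)"
      using C by (intro initials_mono) (auto simp: strict_chain_def)
    then have "card (initials (boxm ?q) (quad_ideal ?q)) \<le> card (initials (boxm ?q) (C 0))"
      using finite_boxm[OF q] by (intro card_mono) (auto simp: initials_def)
    ultimately show "n \<le> card (boxm ?q) - card (initials (boxm ?q) (quad_ideal ?q))" by simp
  qed
  finally show ?thesis .
qed

lemma ring_char_quadric: "ring_char quadric = p"
proof -
  interpret Q: cring quadric by (rule cring_quadric)
  interpret h: ring_hom_ring S quadric "(+>\<^bsub>S\<^esub>) form_ideal"
    unfolding quadric_eq by (rule ideal.rcos_ring_hom_ring[OF form_ideal])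
  have "\<zero>\<^bsub>quadric\<^esub> \<in> quadric_max" using additive_subgroup.zero_closed ideal.axioms(1) ideal_quadric_max by blast
  then have ne: "\<one>\<^bsub>quadric\<^esub> \<noteq> \<zero>\<^bsub>quadric\<^esub>" using one_not_quadric_max by metis
  have "form_ideal +>\<^bsub>S\<^esub> ([p] \<cdot>\<^bsub>S\<^esub> \<one>\<^bsub>S\<^esub>) = [p] \<cdot>\<^bsub>quadric\<^esub> (form_ideal +>\<^bsub>S\<^esub> \<one>\<^bsub>S\<^esub>)"
    unfolding add_pow_def by (rule group_hom.hom_nat_pow[OF h.a_group_hom]) simp
  then have "[p] \<cdot>\<^bsub>quadric\<^esub> \<one>\<^bsub>quadric\<^esub> = \<zero>\<^bsub>quadric\<^esub>" unfolding char_S by simp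
  then show ?thesis using Q.ring_char_eq_prime_iff[OF p ne] by simp
qed

text \<open>The right-hand side no longer refers to the field, so the multiplicity depends only on
  \<open>p\<close> and \<open>d\<close>.\<close>

lemma hilbert_kunz_quadric:
  assumes "p > 2"
  shows "hilbert_kunz_multiplicity quadric =
    lim (\<lambda>e. block_count.quadric_count blocks d (p ^ e) / real (p ^ (e * d)))"
proof -
  have "odd (p ^ e)" for e using prime_odd_nat[OF p] assms by simp
  from quad_ideal_count[OF assms this] show ?thesis
    unfolding hilbert_kunz_multiplicity_def ring_char_quadric the_max_ideal_quadric krull_dim_quadric length_quadric
    by simp
qed

end

section \<open>Fields of characteristic p and the estimate\<close>

lemma char_p_series_field:
  assumes "field k" "ring_char k = p" "Factorial_Ring.prime p"
  shows "char_p_series k p (range (residue_at p))"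
proof -
  interpret field k by fact
  interpret prime_values p "range (residue_at p)" by (rule prime_values_residue_at) fact
  show ?thesis using assms ring_char_eq_prime_iff[OF assms(3)] by unfold_locales simp
qed

text \<open>A field of characteristic \<open>p\<close> on the type \<open>nat\<close>, at which an
  estimate for the fields on \<open>nat\<close> can be evaluated.\<close>

definition prime_field :: "nat \<Rightarrow> nat ring" where
  "prime_field p = \<lparr>carrier = {..<p}, monoid.mult = (\<lambda>a b. a * b mod p), one = 1, ring.zero = 0, add = (\<lambda>a b. (a + b) mod p)\<rparr>"

lemma field_prime_field:
  assumes "Factorial_Ring.prime p"
  shows "field (prime_field p)" "ring_char (prime_field p) = p"
proof -
  interpret F: residues_prime p "residue_ring (int p)" by unfold_locales (use assms in auto)
  have p: "p > 1" using assms prime_gt_1_nat by blast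
  have "nat \<in> ring_iso (residue_ring (int p)) (prime_field p)"
  proof (rule ring_iso_memI)
    show "bij_betw nat (carrier (residue_ring (int p))) (carrier (prime_field p))"
      by (rule bij_betwI[where g = int]) (auto simp: residue_ring_def prime_field_def)
  qed (auto simp: residue_ring_def prime_field_def nat_mult_distrib nat_mod_distrib nat_add_distrib One_nat_def)
  from F.ring_iso_imp_img_field[OF this] show f: "field (prime_field p)"
    by (simp add: prime_field_def residue_ring_def)
  interpret field "prime_field p" by (rule f)
  have ops: "\<zero>\<^bsub>prime_field p\<^esub> = 0" "\<one>\<^bsub>prime_field p\<^esub> = 1" "x \<oplus>\<^bsub>prime_field p\<^esub> y = (x + y) mod p" for x y
    by (simp_all add: prime_field_def)
  have "[n] \<cdot>\<^bsub>prime_field p\<^esub> \<one>\<^bsub>prime_field p\<^esub> = n mod p" for n :: nat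
  proof (induction n)
    case (Suc n)
    then show ?case unfolding add.nat_pow_Suc by (simp add: ops mod_Suc_eq flip: Suc_eq_plus1)
  qed (simp add: ops)
  then show "ring_char (prime_field p) = p"
    using ring_char_eq_prime_iff[OF assms one_not_zero] by (simp add: ops)
qed

lemma zigzag_number_1: "zigzag_number 1 = 1"
proof -
  have "fps_nth (sec_tan * fps_cos 1) 1 = fps_nth (1 + fps_sin 1) 1" by (simp only: sec_tan_cos)
  then have "fps_nth sec_tan 1 = 1" by (simp add: fps_mult_nth fps_cos_def fps_sin_def One_nat_def)
  then show ?thesis by (simp add: zigzag_number_def sec_tan_def)
qed

theorem corollary3p14:
  fixes d :: nat
  assumes "d \<ge> 1"
  shows "(\<exists>C. quadric_estimate TYPE(nat) d C) \<and>
         (\<forall>C. quadric_estimate TYPE(nat) d C \<longrightarrow> quadric_estimate TYPE('a) d C)"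
proof -
  \<comment> \<open>The common multiplicity of all quadrics of dimension \<open>d\<close> in
    characteristic \<open>p\<close>, whatever the type of the field.\<close>
  define val where "val p = lim (\<lambda>e. block_count.quadric_count (prime_values.blocks p (range (residue_at p))) d (p ^ e) / real (p ^ (e * d)))" for p
  have hk: "hilbert_kunz_multiplicity (diagonal_quadric_ring k d) = val p"
    if "Factorial_Ring.prime p" "p > 2" "field k" "ring_char k = p" for k :: "'a ring" and p
    unfolding val_def by (rule char_p_series.hilbert_kunz_quadric[OF char_p_series_field]) (use that in auto)
  have hk': "hilbert_kunz_multiplicity (diagonal_quadric_ring k d) = val p"
    if "Factorial_Ring.prime p" "p > 2" "field k" "ring_char k = p" for k :: "nat ring" and p
    unfolding val_def by (rule char_p_series.hilbert_kunz_quadric[OF char_p_series_field]) (use that in auto)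
  let ?E = "\<lambda>C p. \<bar>val p - (1 + zigzag_number d / fact d)\<bar> \<le> C / real p ^ 2"
  have "\<exists>C. \<forall>p. Factorial_Ring.prime p \<and> p > 2 \<longrightarrow> ?E C p"
  proof (cases "d = 1")
    \<comment> \<open>The multiplicity equals 2 = 1 + 1 / 1! exactly, so the constant 0
      works.\<close>
    case True
    have "val p = 2" if pr: "Factorial_Ring.prime p" "p > 2" for p
    proof -
      interpret prime_values p "range (residue_at p)" by (rule prime_values_residue_at[OF pr(1)])
      have "block_count.quadric_count blocks d (p ^ e) / real (p ^ (e * d)) = 2 - (1 / real p) ^ e" for e
      proof -
        have "odd (p ^ e)" using prime_odd_nat[OF pr(1)] pr(2) by simp
        then have "block_count.quadric_count blocks 1 (p ^ e) = 2 * real (p ^ e) - 1"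
          by (rule quadric_count_dim_1[OF pr(2)])
        then show ?thesis using pr(2) True by (simp add: field_simps)
      qed
      moreover have "(\<lambda>e. 2 - (1 / real p) ^ e) \<longlonglongrightarrow> 2 - 0"
        using pr(2) by (intro tendsto_intros LIMSEQ_power_zero) auto
      ultimately show ?thesis unfolding val_def using limI by simp
    qed
    then show ?thesis using True by (intro exI[of _ 0]) (simp add: zigzag_number_1)
  next
    case False
    then have "d \<ge> 2" using assms by linarith
    from block_count_limit[OF this] obtain C where C: "\<And>p n D. block_count p n D \<Longrightarrow>
      \<bar>lim (\<lambda>e. block_count.quadric_count D d (p ^ e) / real (p ^ (e * d))) - (1 + zigzag_number d / fact d)\<bar>
        \<le> C / real p ^ 2" by blast
    have "?E C p" if p: "Factorial_Ring.prime p" "p > 2" for p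
      unfolding val_def by (rule C[OF prime_values.block_count_blocks[OF prime_values_residue_at[OF p(1)] p(2)]])
    then show ?thesis by blast
  qed
  then have "\<exists>C. quadric_estimate TYPE(nat) d C" 
  proof (elim exE)
    fix C assume C: "\<forall>p. Factorial_Ring.prime p \<and> p > 2 \<longrightarrow> ?E C p"
    have "quadric_estimate TYPE(nat) d C"
      unfolding quadric_estimate_def
    proof (intro allI impI)
      fix p :: nat and k :: "nat ring"
      assume "Factorial_Ring.prime p \<and> p > 2" "field k \<and> ring_char k = p"
      then show "\<bar>hilbert_kunz_multiplicity (diagonal_quadric_ring k d) - (1 + zigzag_number d / fact d)\<bar> \<le> C / real p ^ 2"
        using C hk'[of p k] by simp
    qed
    then show ?thesis ..
  qed
  moreover have "quadric_estimate TYPE('a) d C" if C: "quadric_estimate TYPE(nat) d C" for C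
    unfolding quadric_estimate_def
  proof (intro allI impI)
    fix p :: nat and k :: "'a ring"
    assume p: "Factorial_Ring.prime p \<and> p > 2" and k: "field k \<and> ring_char k = p"
    \<comment> \<open>The assumed estimate, applied to the prime field on \<open>nat\<close>, is
      already a statement about \<open>val p\<close>, and this is the multiplicity over
      \<open>k\<close> too.\<close>
    have "?E C p"
      using C p field_prime_field[of p] hk'[of p "prime_field p"] unfolding quadric_estimate_def by metis
    then show "\<bar>hilbert_kunz_multiplicity (diagonal_quadric_ring k d) - (1 + zigzag_number d / fact d)\<bar> \<le> C / real p ^ 2"
      using hk[of p k] p k by simp
  qed
  ultimately show ?thesis by blast
qed

end
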